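(* Let $\overrightarrow{\Xi}^{(0)}$ be a unit-intensity renewal process on $\mathbb{R}$ whose inter-renewal distribution has finite variance, and let $(\overrightarrow{\Xi}^{(t)})_{t\ge 0}$ be the clustering dynamics started from $\overrightarrow{\Xi}^{(0)}$ (each point moves halfway towards its left or right neighbor, chosen uniformly at random and independently; co-located points merge; space is rescaled by $\frac34$). Then there is a point process $\overrightarrow{\Xi}^{(\infty)}$, whose law does not depend on $\overrightarrow{\Xi}^{(0)}$, such that $$\overrightarrow{\Xi}^{(t)}\to\overrightarrow{\Xi}^{(\infty)}\quad\text{in finite-dimensional distributions as } t\to\infty .$$ Moreover, if $\Theta$ denotes the Palm shift, then $\Theta\overrightarrow{\Xi}^{(t)}\Rightarrow\Theta\overrightarrow{\Xi}^{(\infty)}$ (weak convergence). Finally, the gap distribution of $\overrightarrow{\Xi}^{(\infty)}$, i.e. the law of $\overrightarrow{\Xi}^{(\infty)}_{1}-\overrightarrow{\Xi}^{(\infty)}_{0}$, has an exponentially decaying tail.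
   Context: A point process on $\mathbb{R}$ is a (possibly random) countable collection of points, viewed as a non-decreasing element $\Xi=(\Xi_i)_{i\in\mathbb{Z}}$ of $\mathbb{R}^{\mathbb{Z}}$. It is simple if almost surely no location carries more than one point. A simple point process is renewal if the gaps between successive points are i.i.d. It is stationary if the distributions of the number of points in any two sets of equal finite Lebesgue measure are equal; its intensity is $\lim_{t\to\pm\infty}\mathbb{E}N(t)/t$, where $N(t)$ is the number of points in $(0,t]$. The Palm-shifted process $\Theta\Xi$ is obtained by shifting all points of $\Xi$ so that the $0$-indexed point is at the origin. Dynamics: the initial process $\overrightarrow{\Xi}^{(0)}$ is a unit-intensity stationary point process on $\mathbb{R}$ (not required to have a point at the origin). Given $\overrightarrow{\Xi}^{(t)}$, each point moves halfway towards one of its two neighbors (left or right), chosen uniformly at random and independently of the other points' movements. If two points move to the same location they merge into one point; the result $\hat\Xi^{(t+1)}$ is a simple stationary point process of intensity $\frac34$. Then $\overrightarrow{\Xi}^{(t+1)}:=\frac34\times\hat\Xi^{(t+1)}$, where $c\times\Xi:=(c\,\Xi_i)_{i\in\mathbb{Z}}$, so that $\overrightarrow{\Xi}^{(t+1)}$ has unit intensity. Points are indexed by $\mathbb{Z}$ in increasing order, and the gaps $\overrightarrow{\Xi}^{(t)}_{i+1}-\overrightarrow{\Xi}^{(t)}_i$, $i\in\mathbb{Z}$, are identically distributed (generally not independent). An exponentially decaying tail of a nonnegative random variable $Z$ means that there are constants $C,c>0$ with $\mathbb{P}(Z>x)\le Ce^{-cx}$ for all $x\ge 0$. *)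

theory Defs
  imports "HOL-Probability.Probability"
begin

text \<open>
  A point process is represented by its law, a probability measure on the Borel sets of the
  product space \<open>\<real>\<^sup>\<int>\<close>, i.e. on the type \<open>int \<Rightarrow> real\<close>. No particular choice of the point
  carrying index \<open>0\<close> is imposed; everything below depends on the collection of points only.
\<close>

definition point_process :: "(int \<Rightarrow> real) measure \<Rightarrow> bool" where
  "point_process P \<longleftrightarrow> prob_space P \<and> sets P = sets borel \<and> (AE x in P. mono x)"

definition simple_process :: "(int \<Rightarrow> real) measure \<Rightarrow> bool" where
  "simple_process P \<longleftrightarrow> point_process P \<and> (AE x in P. inj x)"

definition num_points :: "(int \<Rightarrow> real) \<Rightarrow> real set \<Rightarrow> ennreal" where
  "num_points x B = emeasure (count_space UNIV) {i. x i \<in> B}"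

text \<open>The vector \<open>(N(B 0), \<dots>, N(B (k - 1)))\<close>, padded with zeros.\<close>

definition counts :: "nat \<Rightarrow> (nat \<Rightarrow> real set) \<Rightarrow> (int \<Rightarrow> real) \<Rightarrow> (nat \<Rightarrow> ennreal)" where
  "counts k B x = (\<lambda>j. if j < k then num_points x (B j) else 0)"

text \<open>
  Stationarity is invariance of the joint laws of the counts under translation. (Asking for
  equally distributed counts on \<^emph>\<open>arbitrary\<close> Borel sets of equal measure would leave only mixed
  Poisson processes.)
\<close>

definition stationary :: "(int \<Rightarrow> real) measure \<Rightarrow> bool" where
  "stationary P \<longleftrightarrow>
     (\<forall>s k B. (\<forall>j<k. B j \<in> sets borel) \<longrightarrow>
        distr P borel (counts k (\<lambda>j. (\<lambda>u. u + s) ` B j)) = distr P borel (counts k B))"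

text \<open>For \<open>t < 0\<close>, \<open>N(t)\<close> is minus the number of points in \<open>(t, 0]\<close>.\<close>

definition has_intensity :: "(int \<Rightarrow> real) measure \<Rightarrow> ennreal \<Rightarrow> bool" where
  "has_intensity P c \<longleftrightarrow>
     ((\<lambda>t. (\<integral>\<^sup>+x. num_points x {0<..t} \<partial>P) / ennreal t) \<longlongrightarrow> c) at_top \<and>
     ((\<lambda>t. (\<integral>\<^sup>+x. num_points x {t<..0} \<partial>P) / ennreal (- t)) \<longlongrightarrow> c) at_bot"

definition recenter :: "(int \<Rightarrow> real) \<Rightarrow> (int \<Rightarrow> real)" where
  "recenter x = (\<lambda>j. x j - x 0)"

text \<open>
  The law of the Palm-shifted process: the point with index \<open>0\<close>, which is moved to the origin, is
  a typical point of the process, i.e. it is chosen according to the Campbell measure of the points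
  in \<open>(0, 1]\<close>. This is the choice of index for which the gaps are identically distributed. If
  instead the indices of a stationary process were fixed by \<open>x 0 \<le> 0 < x 1\<close>, then the gap
  \<open>x 1 - x 0\<close> would be size-biased, and the gaps of a stationary renewal process would not be
  identically distributed.
\<close>

definition palm :: "(int \<Rightarrow> real) measure \<Rightarrow> (int \<Rightarrow> real) measure" where
  "palm P = distr
     (uniform_measure (P \<Otimes>\<^sub>M count_space (UNIV :: int set)) {(x, i). x i \<in> {0<..1}})
     borel (\<lambda>(x, i). recenter (\<lambda>j. x (i + j)))"

definition gap :: "int \<Rightarrow> (int \<Rightarrow> real) \<Rightarrow> real" where
  "gap i x = x (i + 1) - x i"

definition gap_law :: "(int \<Rightarrow> real) measure \<Rightarrow> real measure" where
  "gap_law P = distr (palm P) borel (gap 0)"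

definition renewal :: "(int \<Rightarrow> real) measure \<Rightarrow> bool" where
  "renewal P \<longleftrightarrow> simple_process P \<and> prob_space (palm P) \<and>
     prob_space.indep_vars (palm P) (\<lambda>_. borel) gap UNIV \<and>
     (\<forall>i. distr (palm P) borel (gap i) = gap_law P)"

text \<open>Point \<open>i\<close> moves to the right if \<open>r i\<close>, and to the left otherwise.\<close>

definition move :: "(int \<Rightarrow> real) \<Rightarrow> (int \<Rightarrow> bool) \<Rightarrow> (int \<Rightarrow> real)" where
  "move x r i = (if r i then (x i + x (i + 1)) / 2 else (x i + x (i - 1)) / 2)"

text \<open>
  The increasing enumeration of a set of points. The last two conditions only make it unique; which
  point gets index \<open>0\<close> affects neither the dynamics in law nor the notions above.
\<close>

definition enum_points :: "real set \<Rightarrow> (int \<Rightarrow> real)" where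
  "enum_points S = (THE y. strict_mono y \<and> range y = S \<and> y 0 \<le> 0 \<and> 0 < y 1)"

text \<open>Co-located points merge because only the set of the new positions is retained.\<close>

primrec clustering :: "(int \<Rightarrow> real) \<Rightarrow> (nat \<Rightarrow> int \<Rightarrow> bool) \<Rightarrow> nat \<Rightarrow> (int \<Rightarrow> real)" where
  "clustering x r 0 = x"
| "clustering x r (Suc t) =
     enum_points ((\<lambda>u. 3 / 4 * u) ` range (move (clustering x r t) (r t)))"

definition coins :: "(nat \<Rightarrow> int \<Rightarrow> bool) measure" where
  "coins = (\<Pi>\<^sub>M t\<in>UNIV. \<Pi>\<^sub>M i\<in>UNIV. measure_pmf (bernoulli_pmf (1 / 2)))"

text \<open>The law of the process at time \<open>t\<close> of the dynamics started from a process with law \<open>P\<close>.\<close>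

definition clustering_law :: "(int \<Rightarrow> real) measure \<Rightarrow> nat \<Rightarrow> (int \<Rightarrow> real) measure" where
  "clustering_law P t = distr (P \<Otimes>\<^sub>M coins) borel (\<lambda>(x, r). clustering x r t)"

definition weakly_converges :: "(nat \<Rightarrow> 'b::topological_space measure) \<Rightarrow> 'b measure \<Rightarrow> bool" where
  "weakly_converges P Q \<longleftrightarrow>
     (\<forall>f :: 'b \<Rightarrow> real. continuous_on UNIV f \<longrightarrow> bounded (range f) \<longrightarrow>
        (\<lambda>t. \<integral>x. f x \<partial>P t) \<longlonglongrightarrow> (\<integral>x. f x \<partial>Q))"

text \<open>
  Convergence in finite-dimensional distributions of point processes: joint convergence in law of
  the counts on finitely many bounded continuity sets of the limit.
\<close>

definition fdd_converges ::
  "(nat \<Rightarrow> (int \<Rightarrow> real) measure) \<Rightarrow> (int \<Rightarrow> real) measure \<Rightarrow> bool" where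
  "fdd_converges P Q \<longleftrightarrow>
     (\<forall>k B. (\<forall>j<k. B j \<in> sets borel \<and> bounded (B j) \<and>
                   (AE x in Q. num_points x (frontier (B j)) = 0)) \<longrightarrow>
        weakly_converges (\<lambda>t. distr (P t) borel (counts k B)) (distr Q borel (counts k B)))"

definition exp_tail :: "real measure \<Rightarrow> bool" where
  "exp_tail D \<longleftrightarrow> (\<exists>C>0. \<exists>c>0. \<forall>x\<ge>0. measure D {x<..} \<le> C * exp (- c * x))"

end

theory Submission
  imports Defs
begin

text \<open>
  The intensity-one stationary process and its Palm version determine each other: the stationary
  process is the Palm version seen from a position spread over the cell to the right of the point at
  the origin. This relation, \<open>inverts\<close>, has uniqueness and invariance properties that all follow from the
  mass transport principle, \<open>mass_transport\<close>. The key observation is that a clustering step preserves it,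
  \<open>inverts_step\<close>. After a step, the points sit at the midpoints of the edges between neighbouring points
  that at least one end moves into; such an edge is called occupied and has probability \<open>3 / 4\<close>. On the Palm
  side the step is the map \<open>coarsen\<close>, driven by coins conditioned on edge \<open>0\<close> being occupied. For
  given coins this map is linear in the configuration. A new gap is \<open>3 / 4\<close> times the sum of half of each
  of the two old gaps at consecutive occupied edges and of the old gap that is skipped between them,
  if there is one.

  The laws of the iterates of independent random maps do not depend on the order of composition, so
  the order can be reversed, \<open>nn_integral_palm_step_iter\<close>. A weighted sum of gaps at time \<open>t\<close> is then pulled
  back by the outermost map to a weighted sum of gaps at time \<open>t - 1\<close> with new random weights, \<open>pullback\<close>.
  Weights that lie between \<open>0\<close> and \<open>1\<close> keep this property, and the total weight is multiplied by \<open>4 / 3\<close> in the mean.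
  Variances are bounded by a multiple of the total weight, so one step multiplies the bound by
  \<open>(3 / 4)\<^sup>2 * 4 / 3 = 3 / 4\<close>, see \<open>iterated_bound\<close>. Consequently the iterates started from the integer lattice
  converge almost surely and in mean, and a start from any Palm law with uncorrelated gaps of finite
  variance, moved by the same coins, has the same limit, \<open>start_points_limit\<close>. This proves
  the weak convergence of the Palm versions and that the limit does not depend on the initial law.

  The same recursion holds for exponential moments. The number of skipped edges is an additive functional of
  a two-state Markov chain with a sub-Gaussian Laplace transform, \<open>palm_exp_bound\<close>. Hence one step costs a term
  quadratic in the exponent, and since the exponent shrinks by \<open>3 / 4\<close> per step, the costs are summable,
  \<open>lattice_exp_bound\<close>. This gives an exponential moment of the limiting gap.

  The limit of the Palm laws is again invariant under a change of the typical point and has mean gap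
  one. Its inversion is the limiting stationary law. Almost sure convergence of the points and convergence in mean
  of the length of the cell at the origin carry over to the joint laws of the counts through the
  inversion formula, \<open>clustering_fdd_convergence\<close>.
\<close>

section \<open>Measurable enumeration of point sets\<close>

definition enumerates :: "(int \<Rightarrow> real) \<Rightarrow> real set \<Rightarrow> bool" where
  "enumerates y S \<longleftrightarrow> strict_mono y \<and> range y = S \<and> y 0 \<le> 0 \<and> 0 < y 1"

text \<open>
  Index \<open>i\<close> carries the \<open>k\<close>-th point of the increasing enumeration normalised by \<open>y 0 \<le> 0 < y 1\<close>:
  positive ranks count the distinct points in \<open>(0, z i]\<close>, the other ranks those in \<open>(z i, 0]\<close>. The cardinality
  is stated through a list of indices because only quantifiers over countable types then occur, which
  makes the relation measurable in \<open>z\<close> without any assumption on \<open>z\<close>.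
\<close>

definition has_rank :: "(int \<Rightarrow> real) \<Rightarrow> int \<Rightarrow> int \<Rightarrow> bool" where
  "has_rank z k i \<longleftrightarrow> (\<exists>l. int (length l) = \<bar>k\<bar> \<and>
     (\<forall>a<length l. \<forall>b<length l. a \<noteq> b \<longrightarrow> z (l ! a) \<noteq> z (l ! b)) \<and>
     (\<forall>j. (if 0 < k then 0 < z j \<and> z j \<le> z i else z i < z j \<and> z j \<le> 0) \<longleftrightarrow>
        (\<exists>a<length l. z j = z (l ! a)))) \<and> (0 < k \<longleftrightarrow> 0 < z i)"

text \<open>
  Defined for every sequence, hence measurable on the whole space, and equal to the increasing
  enumeration of the range whenever that exists.
\<close>

definition candidate :: "(int \<Rightarrow> real) \<Rightarrow> int \<Rightarrow> real" where
  "candidate z k = z (from_nat (LEAST n. has_rank z k (from_nat n)))"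

lemma has_rank_iff_card:
  "has_rank z k i \<longleftrightarrow>
     (let A = (if 0 < k then range z \<inter> {0<..z i} else range z \<inter> {z i<..0})
      in finite A \<and> int (card A) = \<bar>k\<bar> \<and> (0 < k \<longleftrightarrow> 0 < z i))"
proof -
  define A where "A = (if 0 < k then range z \<inter> {0<..z i} else range z \<inter> {z i<..0})"
  have memA: "z j \<in> A \<longleftrightarrow> (if 0 < k then 0 < z j \<and> z j \<le> z i else z i < z j \<and> z j \<le> 0)" for j
    by (auto simp: A_def)
  have sub: "A \<subseteq> range z" by (auto simp: A_def)
  have "(\<exists>l. int (length l) = \<bar>k\<bar> \<and>
     (\<forall>a<length l. \<forall>b<length l. a \<noteq> b \<longrightarrow> z (l ! a) \<noteq> z (l ! b)) \<and>
     (\<forall>j. z j \<in> A \<longleftrightarrow> (\<exists>a<length l. z j = z (l ! a)))) \<longleftrightarrow> finite A \<and> int (card A) = \<bar>k\<bar>"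
    (is "?L \<longleftrightarrow> ?R")
  proof
    assume ?L
    then obtain l where l: "int (length l) = \<bar>k\<bar>"
      "\<forall>a<length l. \<forall>b<length l. a \<noteq> b \<longrightarrow> z (l ! a) \<noteq> z (l ! b)"
      "\<And>j. z j \<in> A \<longleftrightarrow> (\<exists>a<length l. z j = z (l ! a))" by auto
    have "distinct (map z l)" using l(2) by (auto simp: distinct_conv_nth)
    moreover have "set (map z l) = A"
      using l(3) sub by (force simp: in_set_conv_nth image_iff)
    ultimately show ?R using l(1) distinct_card[of "map z l"] by auto
  next
    assume R: ?R
    then obtain m where m: "set m = A" "distinct m" using finite_distinct_list by blast
    define l where "l = map (inv z) m"
    have zl: "map z l = m"
      using m(1) sub by (auto simp: l_def map_idI f_inv_into_f subset_iff intro!: map_idI)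
    have len: "length l = length m" by (simp add: l_def)
    have nth: "z (l ! a) = m ! a" if "a < length l" for a
      using zl that by (metis nth_map)
    show ?L
    proof (intro exI[of _ l] conjI allI impI)
      show "int (length l) = \<bar>k\<bar>" using R m distinct_card[of m] len by simp
      show "z (l ! a) \<noteq> z (l ! b)" if "a < length l" "b < length l" "a \<noteq> b" for a b
        using that m(2) nth len by (simp add: nth_eq_iff_index_eq)
      show "z j \<in> A \<longleftrightarrow> (\<exists>a<length l. z j = z (l ! a))" for j
        unfolding m(1)[symmetric] in_set_conv_nth len[symmetric] using nth by metis
    qed
  qed
  then show ?thesis
    unfolding has_rank_def memA[symmetric] A_def[symmetric] Let_def by blast
qed

lemma enumerates_has_rank:
  assumes y: "enumerates y (range z)" and k': "z i = y k'"
  shows "has_rank z k i \<longleftrightarrow> k = k'"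
proof -
  have sm: "\<And>a b. y a < y b \<longleftrightarrow> a < b" "\<And>a b. y a \<le> y b \<longleftrightarrow> a \<le> b"
    using y by (auto simp: enumerates_def strict_mono_less strict_mono_less_eq)
  have inj: "inj y" using y by (auto simp: enumerates_def strict_mono_imp_inj_on)
  have y01: "y 0 \<le> 0" "0 < y 1" and r: "range z = range y" using y by (auto simp: enumerates_def)
  have pos: "0 < y a \<longleftrightarrow> 0 < a" for a
    using sm(2)[of 1 a] sm(2)[of a 0] y01 by (smt (verit))
  have npos: "y a \<le> 0 \<longleftrightarrow> a \<le> 0" for a using pos[of a] by linarith
  have A1: "range z \<inter> {0<..z i} = y ` {1..k'}"
    unfolding r k' by (fastforce simp: sm pos)
  have A2: "range z \<inter> {z i<..0} = y ` {k'<..0}"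
    unfolding r k' by (fastforce simp: sm npos)
  have c: "card (y ` B) = card B" for B
    using inj by (simp add: card_image inj_on_subset)
  show ?thesis
    unfolding has_rank_iff_card Let_def A1 A2 using pos[of k'] by (auto simp: c k')
qed

lemma enumerates_candidate:
  assumes y: "enumerates y (range z)" shows "candidate z = y"
proof
  fix k
  have "y k \<in> range z" using y by (auto simp: enumerates_def)
  then obtain i where "z i = y k" by auto
  then have "has_rank z k i" using enumerates_has_rank[OF y] by blast
  then have "has_rank z k (from_nat (to_nat i))" by simp
  then have h: "has_rank z k (from_nat (LEAST n. has_rank z k (from_nat n)))" by (rule LeastI)
  define i' :: int where "i' = from_nat (LEAST n. has_rank z k (from_nat n))"
  have "z i' \<in> range y" using y by (auto simp: enumerates_def)
  then obtain k' where k': "z i' = y k'" by auto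
  with h have "k = k'" using enumerates_has_rank[OF y k'] unfolding i'_def by blast
  then show "candidate z k = y k" using k' by (simp add: candidate_def i'_def)
qed

lemma enum_points_eq:
  assumes "enumerates y S" shows "enum_points S = y"
proof -
  have S: "S = range y" using assms by (simp add: enumerates_def)
  have "y' = y" if "enumerates y' S" for y'
  proof -
    have "candidate y = y'" using that unfolding S by (rule enumerates_candidate)
    moreover have "candidate y = y" using assms unfolding S by (rule enumerates_candidate)
    ultimately show ?thesis by (rule trans[OF sym])
  qed
  then show ?thesis
    unfolding enum_points_def enumerates_def[symmetric] by (intro the_equality assms)
qed

text \<open>
  If no enumeration exists, the description operator in \<open>enum_points\<close> is applied to an empty
  predicate; its value is then some fixed sequence, so this case is harmless for measurability.
\<close>

lemma enum_points_candidate: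
  "enum_points (range z) =
     (if enumerates (candidate z) (range z) then candidate z else (THE y. False))"
proof (cases "\<exists>y. enumerates y (range z)")
  case True
  then obtain y where y: "enumerates y (range z)" by blast
  show ?thesis unfolding enumerates_candidate[OF y] enum_points_eq[OF y] using y by simp
next
  case False
  then have "(\<lambda>y :: int \<Rightarrow> real. strict_mono y \<and> range y = range z \<and> y 0 \<le> 0 \<and> 0 < y 1) = (\<lambda>y. False)"
    unfolding enumerates_def by (intro ext) blast
  then show ?thesis using False by (simp add: enum_points_def)
qed

lemma measurable_coordinate [measurable (raw)]:
  fixes f :: "'a \<Rightarrow> int \<Rightarrow> real"
  shows "f \<in> borel_measurable M \<Longrightarrow> (\<lambda>w. f w i) \<in> borel_measurable M"
  by (rule measurable_product_then_coordinatewise)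

lemma measurable_coord: "(\<lambda>x :: int \<Rightarrow> real. x i) \<in> borel_measurable borel"
  by measurable

lemma pred_eq_real [measurable (raw)]:
  fixes f g :: "'a \<Rightarrow> real"
  assumes "f \<in> borel_measurable M" "g \<in> borel_measurable M"
  shows "Measurable.pred M (\<lambda>w. f w = g w)"
  unfolding Measurable.pred_def by (rule borel_measurable_eq[OF assms])

lemma pred_le_real [measurable (raw)]:
  fixes f g :: "'a \<Rightarrow> real"
  assumes "f \<in> borel_measurable M" "g \<in> borel_measurable M"
  shows "Measurable.pred M (\<lambda>w. f w \<le> g w)"
  unfolding Measurable.pred_def by (rule borel_measurable_le[OF assms])

lemma strict_mono_int: "strict_mono x \<longleftrightarrow> (\<forall>k :: int. x k < (x (k + 1) :: 'a :: order))"
proof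
  assume s: "\<forall>k. x k < x (k + 1)"
  show "strict_mono x"
  proof (rule strict_monoI)
    fix a b :: int assume "a < b"
    then show "x a < x b" by (induction rule: int_gr_induct) (use s in \<open>auto intro: less_trans\<close>)
  qed
qed (auto simp: strict_mono_def)

lemma strict_mono_sets: "{x :: int \<Rightarrow> real. strict_mono x} \<in> sets borel"
  unfolding strict_mono_int by measurable

lemma measurable_has_rank: "Measurable.pred borel (\<lambda>z. has_rank z k i)"
proof -
  have in_range: "Measurable.pred borel (\<lambda>z :: int \<Rightarrow> real.
      if 0 < k then 0 < z j \<and> z j \<le> z i else z i < z j \<and> z j \<le> 0)" for j
    by (cases "0 < k"; simp; measurable)
  have atoms: "Measurable.pred borel (\<lambda>z :: int \<Rightarrow> real. z a = z b)"
    "Measurable.pred borel (\<lambda>z :: int \<Rightarrow> real. z a \<noteq> z b)"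
    "Measurable.pred borel (\<lambda>z :: int \<Rightarrow> real. 0 < z i)" for a b :: int
    by measurable
  show ?thesis
    unfolding has_rank_def
    by (intro pred_intros_logic pred_intros_countable pred_intros_imp' pred_intros_conj1' in_range atoms) simp_all
qed

lemma measurable_candidate: "candidate \<in> borel_measurable borel"
proof (rule measurable_coordinatewise_then_product)
  fix k
  have "(\<lambda>z. LEAST n. has_rank z k (from_nat n)) \<in> borel \<rightarrow>\<^sub>M count_space UNIV"
    by (intro measurable_Least measurable_has_rank)
  then have "(\<lambda>z. z (from_nat (LEAST n. has_rank z k (from_nat n)))) \<in> borel_measurable (borel :: (int \<Rightarrow> real) measure)"
    by (rule measurable_compose_countable[OF measurable_coord])
  then show "(\<lambda>z. candidate z k) \<in> borel_measurable borel" unfolding candidate_def .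
qed

lemma measurable_enum_points [measurable]:
  "(\<lambda>z :: int \<Rightarrow> real. enum_points (range z)) \<in> borel_measurable borel"
proof -
  note measurable_candidate[measurable]
  have [measurable]: "(\<lambda>z. candidate z k) \<in> borel_measurable borel" for k
    using measurable_compose[OF measurable_candidate measurable_coord] .
  have eq: "enumerates (candidate z) (range z) \<longleftrightarrow>
     (\<forall>k. candidate z k < candidate z (k + 1)) \<and> (\<forall>k. \<exists>i. candidate z k = z i) \<and>
     (\<forall>i. \<exists>k. z i = candidate z k) \<and> candidate z 0 \<le> 0 \<and> 0 < candidate z 1" for z
    unfolding enumerates_def strict_mono_int by (auto simp: set_eq_iff image_iff)
  have "Measurable.pred borel (\<lambda>z. enumerates (candidate z) (range z))"
    unfolding eq by measurable
  then show ?thesis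
    unfolding enum_points_candidate
    by (intro measurable_If) (auto simp: measurable_candidate)
qed

section \<open>Mass transport and Palm inversion\<close>

definition zsum :: "(int \<Rightarrow> ennreal) \<Rightarrow> ennreal" where
  "zsum f = (\<integral>\<^sup>+i. f i \<partial>count_space UNIV)"

lemma measurable_pair_int:
  assumes "\<And>i :: int. (\<lambda>x. f (x, i)) \<in> N \<rightarrow>\<^sub>M K"
  shows "f \<in> N \<Otimes>\<^sub>M count_space UNIV \<rightarrow>\<^sub>M K"
proof -
  have "(\<lambda>w. (\<lambda>i w. f (fst w, i)) (snd w) w) \<in> N \<Otimes>\<^sub>M count_space UNIV \<rightarrow>\<^sub>M K"
    by (rule measurable_compose_countable[OF measurable_compose[OF measurable_fst assms] measurable_snd])
  then show ?thesis by simp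
qed

lemma zsum_measurable [measurable (raw)]:
  assumes "\<And>i. (\<lambda>x. f x i) \<in> borel_measurable M"
  shows "(\<lambda>x. zsum (f x)) \<in> borel_measurable M"
  unfolding zsum_def
  by (intro sigma_finite_measure.borel_measurable_nn_integral[OF sigma_finite_measure_count_space]
      measurable_pair_int) (simp add: assms)

lemma zsum_swap:
  assumes "\<And>i. f i \<in> borel_measurable M"
  shows "(\<integral>\<^sup>+x. zsum (\<lambda>i. f i x) \<partial>M) = zsum (\<lambda>i. \<integral>\<^sup>+x. f i x \<partial>M)"
  unfolding zsum_def by (rule nn_integral_count_space_nn_integral) (use assms in auto)

lemma zsum_cmult: "c * zsum f = zsum (\<lambda>i. c * f i)"
  unfolding zsum_def by (simp add: nn_integral_cmult)

lemma zsum_multc: "zsum f * c = zsum (\<lambda>i. f i * c)"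
  unfolding zsum_def by (simp add: nn_integral_multc)

lemma zsum_uminus: "zsum (\<lambda>i. f (- i)) = zsum f"
  unfolding zsum_def by (intro nn_integral_bij_count_space bij_uminus)

lemma zsum_shift: "zsum (\<lambda>i. f (k + i)) = zsum f"
  unfolding zsum_def by (intro nn_integral_bij_count_space) simp

lemma zsum_unique:
  assumes "\<exists>!i. P i" shows "zsum (\<lambda>i. of_bool (P i)) = 1"
proof -
  obtain k where "P k" "\<And>i. P i \<Longrightarrow> i = k" using assms by blast
  then have P: "P i \<longleftrightarrow> i = k" for i by blast
  have "of_bool (P i) = (indicator {k} i :: ennreal)" for i
    unfolding P by (simp add: indicator_def)
  then show ?thesis unfolding zsum_def by simp
qed

lemma num_points_zsum: "num_points x B = zsum (\<lambda>i. of_bool (x i \<in> B))"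
proof -
  have "of_bool (x i \<in> B) = (indicator {i. x i \<in> B} i :: ennreal)" for i
    by (simp add: indicator_def)
  then show ?thesis unfolding zsum_def num_points_def by simp
qed

definition reindex :: "int \<Rightarrow> (int \<Rightarrow> real) \<Rightarrow> int \<Rightarrow> real" where
  "reindex i x = (\<lambda>j. x (i + j))"

definition from_point :: "int \<Rightarrow> (int \<Rightarrow> real) \<Rightarrow> int \<Rightarrow> real" where
  "from_point i x = (\<lambda>j. x (i + j) - x i)"

lemma from_point_recenter: "from_point i x = recenter (\<lambda>j. x (i + j))"
  by (simp add: from_point_def recenter_def)

lemma from_point_apply [simp]: "from_point i x j = x (i + j) - x i"
  by (simp add: from_point_def)

text \<open>
  The configurations to which Palm theory applies: their half-open cells between consecutive points
  tile the line.
\<close>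

definition two_sided :: "(int \<Rightarrow> real) \<Rightarrow> bool" where
  "two_sided x \<longleftrightarrow> mono x \<and> (\<forall>c. \<exists>i. c < x i) \<and> (\<forall>c. \<exists>i. x i < c)"

lemma two_sided_ex1: assumes x: "two_sided x" shows "\<exists>!i. x i \<le> s \<and> s < x (i + 1)"
proof -
  have m: "mono x" using x by (simp add: two_sided_def)
  obtain a where a: "x a < s" using x by (auto simp: two_sided_def)
  obtain b where b: "s < x b" using x by (auto simp: two_sided_def)
  have ab: "a \<le> b" using a b m by (meson less_le_trans linear monoD not_less order.asym)
  have "\<exists>i. x i \<le> s \<and> s < x (i + 1)"
  proof (rule ccontr)
    assume n: "\<not> ?thesis"
    from ab have "x b \<le> s"
      by (induction rule: int_ge_induct) (use n a in \<open>auto simp: not_less\<close>)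
    then show False using b by simp
  qed
  moreover have "i = j" if "x i \<le> s \<and> s < x (i + 1)" "x j \<le> s \<and> s < x (j + 1)" for i j
  proof (rule ccontr)
    assume "i \<noteq> j"
    then have "i + 1 \<le> j \<or> j + 1 \<le> i" by linarith
    then have "x (i + 1) \<le> x j \<or> x (j + 1) \<le> x i" using m by (auto dest: monoD)
    then show False using that by linarith
  qed
  ultimately show ?thesis by blast
qed

lemma two_sided_tiling:
  "two_sided x \<Longrightarrow> zsum (\<lambda>i. of_bool (x i \<le> s \<and> s < x (i + 1))) = 1"
  by (intro zsum_unique two_sided_ex1)

lemma borel_seqI:
  fixes f :: "'a \<Rightarrow> int \<Rightarrow> real"
  assumes "\<And>j. (\<lambda>w. f w j) \<in> borel_measurable M"
  shows "f \<in> borel_measurable M"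
  by (rule measurable_coordinatewise_then_product) (rule assms)

lemma measurable_two_sided: "{x. two_sided x} \<in> sets borel"
proof -
  have eq: "two_sided x \<longleftrightarrow> (\<forall>i. x i \<le> x (i + 1)) \<and> (\<forall>n::nat. \<exists>i. real n < x i) \<and> (\<forall>n::nat. \<exists>i. x i < - real n)" for x
  proof -
    have "mono x \<longleftrightarrow> (\<forall>i. x i \<le> x (i + 1))"
    proof
      assume s: "\<forall>i. x i \<le> x (i + 1)"
      show "mono x"
      proof (rule monoI)
        fix a b :: int assume "a \<le> b"
        then show "x a \<le> x b" by (induction rule: int_ge_induct) (use s in \<open>auto intro: order_trans\<close>)
      qed
    qed (auto simp: mono_def)
    moreover have "(\<forall>c. \<exists>i. c < x i) \<longleftrightarrow> (\<forall>n::nat. \<exists>i. real n < x i)"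
    proof (intro iffI allI)
      fix c :: real assume "\<forall>n::nat. \<exists>i. real n < x i"
      then obtain i where "real (nat \<lceil>c\<rceil>) < x i" by blast
      then show "\<exists>i. c < x i" by (intro exI[of _ i]) linarith
    qed blast
    moreover have "(\<forall>c. \<exists>i. x i < c) \<longleftrightarrow> (\<forall>n::nat. \<exists>i. x i < - real n)"
    proof (intro iffI allI)
      fix c :: real assume "\<forall>n::nat. \<exists>i. x i < - real n"
      then obtain i where "x i < - real (nat \<lceil>- c\<rceil>)" by blast
      then show "\<exists>i. x i < c" by (intro exI[of _ i]) linarith
    qed blast
    ultimately show ?thesis unfolding two_sided_def by blast
  qed
  show ?thesis unfolding eq by measurable
qed

lemma from_point_measurable [measurable]: "from_point i \<in> borel_measurable borel"
  unfolding from_point_def by (intro borel_seqI) measurable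

lemma reindex_measurable [measurable]: "reindex i \<in> borel_measurable borel"
  unfolding reindex_def by (intro borel_seqI) measurable

lemma two_sided_from_point: assumes "two_sided x" shows "two_sided (from_point i x)"
  unfolding two_sided_def
proof (intro conjI allI)
  show "mono (from_point i x)" using assms by (auto simp: two_sided_def mono_def)
  fix c
  obtain a where "c + x i < x a" using assms by (auto simp: two_sided_def)
  then show "\<exists>j. c < from_point i x j" by (intro exI[of _ "a - i"]) simp
  obtain a where "x a < c + x i" using assms by (auto simp: two_sided_def)
  then show "\<exists>j. from_point i x j < c" by (intro exI[of _ "a - i"]) simp
qed

lemma two_sided_translate: assumes "two_sided x" shows "two_sided (\<lambda>j. x j - u)"
  unfolding two_sided_def
proof (intro conjI allI)
  show "mono (\<lambda>j. x j - u)" using assms by (auto simp: two_sided_def mono_def)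
  fix c
  show "\<exists>j. c < x j - u" using assms by (simp add: two_sided_def less_diff_eq)
  show "\<exists>j. x j - u < c" using assms by (simp add: two_sided_def diff_less_eq)
qed

lemma nn_integral_translate:
  fixes f :: "real \<Rightarrow> ennreal"
  assumes "f \<in> borel_measurable borel"
  shows "(\<integral>\<^sup>+s. f (s + u) \<partial>lborel) = (\<integral>\<^sup>+s. f s \<partial>lborel)"
  using nn_integral_real_affine[OF assms, of 1 u] by (simp add: add.commute)

text \<open>
  The mass transport principle for a measure-preserving action of the integers: the mass that the
  origin sends to \<open>i\<close> has the same mean as the mass that \<open>- i\<close> sends to the origin. Here
  \<open>\<Phi> i \<omega>\<close> is the configuration seen from point \<open>i\<close> and \<open>X i \<omega>\<close> is the position of that point, so the two
  functions of a configuration and a position are compared at one common location of the line. Both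
  sides are sums over \<open>i\<close>; the summands agree after the substitution \<open>\<omega> \<mapsto> \<Phi> (- i) \<omega>\<close> and a translation
  of the line.
\<close>

lemma mass_transport:
  fixes M :: "'w measure" and \<Phi> :: "int \<Rightarrow> 'w \<Rightarrow> 'w" and X :: "int \<Rightarrow> 'w \<Rightarrow> real"
    and a c :: "'w \<Rightarrow> real \<Rightarrow> ennreal"
  assumes \<Phi> [measurable]: "\<And>i. \<Phi> i \<in> M \<rightarrow>\<^sub>M M" and pres: "\<And>i. distr M M (\<Phi> i) = M"
    and X [measurable]: "\<And>i. X i \<in> borel_measurable M"
    and cocycle: "\<And>i. AE \<omega> in M. \<Phi> i (\<Phi> (- i) \<omega>) = \<omega> \<and> X i (\<Phi> (- i) \<omega>) = - X (- i) \<omega>"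
    and a [measurable]: "case_prod a \<in> borel_measurable (M \<Otimes>\<^sub>M borel)"
    and c [measurable]: "case_prod c \<in> borel_measurable (M \<Otimes>\<^sub>M borel)"
  shows "(\<integral>\<^sup>+\<omega>. \<integral>\<^sup>+s. a \<omega> s * zsum (\<lambda>i. c (\<Phi> i \<omega>) (s - X i \<omega>)) \<partial>lborel \<partial>M) =
    (\<integral>\<^sup>+\<omega>. \<integral>\<^sup>+s. zsum (\<lambda>i. a (\<Phi> i \<omega>) (s - X i \<omega>)) * c \<omega> s \<partial>lborel \<partial>M)"
proof -
  have moved: "(\<lambda>(\<omega>, s). f (\<Phi> i \<omega>) (s - Y \<omega>)) \<in> borel_measurable (M \<Otimes>\<^sub>M borel)"
    if f: "case_prod f \<in> borel_measurable (M \<Otimes>\<^sub>M borel)" and [measurable]: "Y \<in> borel_measurable M"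
    for f :: "'w \<Rightarrow> real \<Rightarrow> ennreal" and i Y
  proof -
    have "(\<lambda>(\<omega>, s). (\<Phi> i \<omega>, s - Y \<omega>)) \<in> M \<Otimes>\<^sub>M borel \<rightarrow>\<^sub>M M \<Otimes>\<^sub>M borel" by measurable
    from measurable_compose[OF this f] show ?thesis by (simp add: case_prod_beta')
  qed
  have moved0: "(\<lambda>(\<omega>, s). f (\<Phi> i \<omega>) s) \<in> borel_measurable (M \<Otimes>\<^sub>M borel)"
    if f: "case_prod f \<in> borel_measurable (M \<Otimes>\<^sub>M borel)"
    for f :: "'w \<Rightarrow> real \<Rightarrow> ennreal" and i
    using moved[OF f, of "\<lambda>_. 0"] by simp
  note ma = moved[OF a] moved0[OF a] and mc = moved[OF c] moved0[OF c]
  have sec: "(\<lambda>s. f \<omega> s) \<in> borel_measurable lborel"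
    if "(\<lambda>(\<omega>, s). f \<omega> s) \<in> borel_measurable (M \<Otimes>\<^sub>M borel)" "\<omega> \<in> space M"
    for f :: "'w \<Rightarrow> real \<Rightarrow> ennreal" and \<omega>
    using measurable_Pair2[OF that] by simp
  have int: "(\<lambda>\<omega>. \<integral>\<^sup>+s. f \<omega> s \<partial>lborel) \<in> borel_measurable M"
    if "(\<lambda>(\<omega>, s). f \<omega> s) \<in> borel_measurable (M \<Otimes>\<^sub>M borel)"
    for f :: "'w \<Rightarrow> real \<Rightarrow> ennreal"
    using that by (intro sigma_finite_measure.borel_measurable_nn_integral[OF sigma_finite_lborel]) simp
  have mult: "(\<lambda>(\<omega>, s). f \<omega> s * g \<omega> s) \<in> borel_measurable (M \<Otimes>\<^sub>M borel)"
    if "(\<lambda>(\<omega>, s). f \<omega> s) \<in> borel_measurable (M \<Otimes>\<^sub>M borel)" "(\<lambda>(\<omega>, s). g \<omega> s) \<in> borel_measurable (M \<Otimes>\<^sub>M borel)"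
    for f g :: "'w \<Rightarrow> real \<Rightarrow> ennreal"
    using borel_measurable_times_ennreal[OF that] by (simp add: case_prod_beta')
  have swap: "(\<integral>\<^sup>+\<omega>. \<integral>\<^sup>+s. zsum (\<lambda>i. f i \<omega> s) \<partial>lborel \<partial>M) = zsum (\<lambda>i. \<integral>\<^sup>+\<omega>. \<integral>\<^sup>+s. f i \<omega> s \<partial>lborel \<partial>M)"
    if f: "\<And>i. (\<lambda>(\<omega>, s). f i \<omega> s) \<in> borel_measurable (M \<Otimes>\<^sub>M borel)"
    for f :: "int \<Rightarrow> 'w \<Rightarrow> real \<Rightarrow> ennreal"
  proof -
    have "(\<integral>\<^sup>+\<omega>. \<integral>\<^sup>+s. zsum (\<lambda>i. f i \<omega> s) \<partial>lborel \<partial>M) = (\<integral>\<^sup>+\<omega>. zsum (\<lambda>i. \<integral>\<^sup>+s. f i \<omega> s \<partial>lborel) \<partial>M)"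
      by (intro nn_integral_cong zsum_swap sec[OF f])
    also have "\<dots> = zsum (\<lambda>i. \<integral>\<^sup>+\<omega>. \<integral>\<^sup>+s. f i \<omega> s \<partial>lborel \<partial>M)"
      by (intro zsum_swap int f)
    finally show ?thesis .
  qed
  have "(\<integral>\<^sup>+\<omega>. \<integral>\<^sup>+s. a \<omega> s * zsum (\<lambda>i. c (\<Phi> i \<omega>) (s - X i \<omega>)) \<partial>lborel \<partial>M) =
     zsum (\<lambda>i. \<integral>\<^sup>+\<omega>. \<integral>\<^sup>+s. a \<omega> s * c (\<Phi> i \<omega>) (s - X i \<omega>) \<partial>lborel \<partial>M)"
    unfolding zsum_cmult by (intro swap mult mc X) (use a in simp)
  also have "\<dots> = zsum (\<lambda>i. \<integral>\<^sup>+\<omega>. \<integral>\<^sup>+s. a (\<Phi> (- i) \<omega>) (s - X (- i) \<omega>) * c \<omega> s \<partial>lborel \<partial>M)"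
  proof (intro arg_cong[of _ _ zsum] ext)
    fix i
    define G where "G \<omega> = (\<integral>\<^sup>+s. a \<omega> s * c (\<Phi> i \<omega>) (s - X i \<omega>) \<partial>lborel)" for \<omega>
    have G: "G \<in> borel_measurable M"
      unfolding G_def by (intro int mult mc X) (use a in simp)
    have "(\<integral>\<^sup>+\<omega>. G \<omega> \<partial>M) = (\<integral>\<^sup>+\<omega>. G \<omega> \<partial>distr M M (\<Phi> (- i)))" by (simp add: pres)
    also have "\<dots> = (\<integral>\<^sup>+\<omega>. G (\<Phi> (- i) \<omega>) \<partial>M)" by (intro nn_integral_distr) (use G in auto)
    also have "\<dots> = (\<integral>\<^sup>+\<omega>. \<integral>\<^sup>+s. a (\<Phi> (- i) \<omega>) (s - X (- i) \<omega>) * c \<omega> s \<partial>lborel \<partial>M)"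
    proof (rule nn_integral_cong_AE)
      show "AE \<omega> in M. G (\<Phi> (- i) \<omega>) = (\<integral>\<^sup>+s. a (\<Phi> (- i) \<omega>) (s - X (- i) \<omega>) * c \<omega> s \<partial>lborel)"
        using cocycle[of i] AE_space
      proof eventually_elim
        case (elim \<omega>)
        have "(\<integral>\<^sup>+s. a (\<Phi> (- i) \<omega>) (s - X (- i) \<omega>) * c \<omega> s \<partial>lborel) =
              (\<integral>\<^sup>+s. a (\<Phi> (- i) \<omega>) ((s + X (- i) \<omega>) - X (- i) \<omega>) * c \<omega> (s + X (- i) \<omega>) \<partial>lborel)"
          by (subst nn_integral_translate[symmetric, where u = "X (- i) \<omega>"])
             (use elim sec[OF mult[OF ma(1)[OF X, of "-i" "-i"], of c]] c in auto)
        then show ?case using elim by (simp add: G_def)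
      qed
    qed
    finally show "(\<integral>\<^sup>+\<omega>. \<integral>\<^sup>+s. a \<omega> s * c (\<Phi> i \<omega>) (s - X i \<omega>) \<partial>lborel \<partial>M) =
       (\<integral>\<^sup>+\<omega>. \<integral>\<^sup>+s. a (\<Phi> (- i) \<omega>) (s - X (- i) \<omega>) * c \<omega> s \<partial>lborel \<partial>M)" by (simp add: G_def)
  qed
  also have "\<dots> = zsum (\<lambda>i. \<integral>\<^sup>+\<omega>. \<integral>\<^sup>+s. a (\<Phi> i \<omega>) (s - X i \<omega>) * c \<omega> s \<partial>lborel \<partial>M)"
    by (rule zsum_uminus)
  also have "\<dots> = (\<integral>\<^sup>+\<omega>. \<integral>\<^sup>+s. zsum (\<lambda>i. a (\<Phi> i \<omega>) (s - X i \<omega>)) * c \<omega> s \<partial>lborel \<partial>M)"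
    unfolding zsum_multc by (intro swap[symmetric] mult ma X) (use c in simp)
  finally show ?thesis .
qed

text \<open>
  The invariance that characterises Palm laws: moving the origin from one point to another does not
  change the law.
\<close>

definition cycle_stationary :: "(int \<Rightarrow> real) measure \<Rightarrow> bool" where
  "cycle_stationary P \<longleftrightarrow> prob_space P \<and> sets P = sets borel \<and> (AE x in P. two_sided x) \<and>
     (\<forall>i. distr P borel (from_point i) = P)"

lemma cycle_stationary_zero: assumes "cycle_stationary P" shows "AE x in P. x 0 = 0"
proof -
  have "distr P borel (from_point 0) = P" "sets P = sets borel" using assms by (auto simp: cycle_stationary_def)
  then have [measurable]: "from_point 0 \<in> P \<rightarrow>\<^sub>M borel" using measurable_cong_sets from_point_measurable by blast
  have "AE x in distr P borel (from_point 0). x 0 = 0"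
  proof (subst AE_distr_iff)
    show "{x \<in> space borel. x 0 = (0::real)} \<in> sets borel" by simp
  qed simp_all
  then show ?thesis unfolding \<open>distr P borel (from_point 0) = P\<close> .
qed

text \<open>
  The Palm inversion formula for intensity one: \<open>P\<close> is recovered from the Palm law \<open>P0\<close> by viewing a
  configuration from a position spread over the cell to the right of its point at the origin, with
  Lebesgue measure as weight. Only functions that ignore the indexing are tested, because laws of
  stationary processes are compared only as laws of sets of points.
\<close>

definition inverts :: "(int \<Rightarrow> real) measure \<Rightarrow> (int \<Rightarrow> real) measure \<Rightarrow> bool" where
  "inverts P P0 \<longleftrightarrow> (\<forall>F \<in> borel_measurable borel. (\<forall>i x. F (reindex i x) = F x) \<longrightarrow>
     (\<integral>\<^sup>+x. F x \<partial>P) = (\<integral>\<^sup>+x. \<integral>\<^sup>+s. of_bool (0 \<le> s \<and> s < x 1) * F (\<lambda>j. x j - s) \<partial>lborel \<partial>P0))"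

text \<open>
  Mass transport from cells to points: since the cells tile the line, a position that is
  distributed over the cell of the origin can be replaced by a position anywhere on the line that is
  assigned to the origin by \<open>c\<close>.
\<close>

lemma cell_transport:
  assumes P: "cycle_stationary P" and c: "case_prod c \<in> borel_measurable (borel \<Otimes>\<^sub>M borel)"
  shows "(\<integral>\<^sup>+x. \<integral>\<^sup>+s. of_bool (0 \<le> s \<and> s < x 1) * zsum (\<lambda>i. c (from_point i x) (s - x i)) \<partial>lborel \<partial>P) =
    (\<integral>\<^sup>+x. \<integral>\<^sup>+s. c x s \<partial>lborel \<partial>P)"
proof -
  have s [measurable_cong]: "sets P = sets borel" using P by (simp add: cycle_stationary_def)
  have sP: "sets (P \<Otimes>\<^sub>M (borel :: real measure)) = sets (borel \<Otimes>\<^sub>M borel)"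
    using s by (intro sets_pair_measure_cong) auto
  have "(\<integral>\<^sup>+x. \<integral>\<^sup>+s. of_bool (0 \<le> s \<and> s < x 1) * zsum (\<lambda>i. c (from_point i x) (s - x i)) \<partial>lborel \<partial>P) =
    (\<integral>\<^sup>+x. \<integral>\<^sup>+s. zsum (\<lambda>i. of_bool (0 \<le> s - x i \<and> s - x i < from_point i x 1)) * c x s \<partial>lborel \<partial>P)"
  proof (rule mass_transport)
    show "distr P P (from_point i) = P" for i
      using P distr_cong[OF refl s, of P "from_point i"] by (simp add: cycle_stationary_def)
    show "from_point i \<in> P \<rightarrow>\<^sub>M P" for i
      using from_point_measurable s measurable_cong_sets by blast
    show "AE x in P. from_point i (from_point (- i) x) = x \<and> from_point (- i) x i = - x (- i)" for i
      using cycle_stationary_zero[OF P] by eventually_elim (auto simp: from_point_def)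
    show "case_prod c \<in> borel_measurable (P \<Otimes>\<^sub>M borel)"
      using c sP measurable_cong_sets by blast
  qed measurable
  also have "\<dots> = (\<integral>\<^sup>+x. \<integral>\<^sup>+s. c x s \<partial>lborel \<partial>P)"
  proof (rule nn_integral_cong_AE)
    show "AE x in P. (\<integral>\<^sup>+s. zsum (\<lambda>i. of_bool (0 \<le> s - x i \<and> s - x i < from_point i x 1)) * c x s \<partial>lborel) =
       (\<integral>\<^sup>+s. c x s \<partial>lborel)"
      using P[unfolded cycle_stationary_def, THEN conjunct2, THEN conjunct2, THEN conjunct1]
    proof eventually_elim
      case (elim x)
      have "zsum (\<lambda>i. of_bool (0 \<le> s - x i \<and> s - x i < from_point i x 1)) = 1" for s
        using two_sided_tiling[OF elim, of s] by simp
      then show ?case by simp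
    qed
  qed
  finally show ?thesis .
qed

lemma measurable_translated:
  fixes F :: "(int \<Rightarrow> real) \<Rightarrow> ennreal"
  assumes "F \<in> borel_measurable borel"
  shows "(\<lambda>(x, s). F (\<lambda>j. x j - s)) \<in> borel_measurable (borel \<Otimes>\<^sub>M borel)"
proof -
  have "(\<lambda>w :: (int \<Rightarrow> real) \<times> real. (\<lambda>j. fst w j - snd w)) \<in> borel_measurable (borel \<Otimes>\<^sub>M borel)"
    by (rule borel_seqI) measurable
  from measurable_compose[OF this assms] show ?thesis by (simp add: case_prod_beta')
qed

lemma cell_integral_measurable:
  fixes U V :: "'z \<Rightarrow> int \<Rightarrow> real" and N :: "'z measure" and F :: "(int \<Rightarrow> real) \<Rightarrow> ennreal"
  assumes F: "F \<in> borel_measurable borel" and U: "U \<in> N \<rightarrow>\<^sub>M borel" and V: "V \<in> N \<rightarrow>\<^sub>M borel"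
  shows "(\<lambda>w. \<integral>\<^sup>+s. of_bool (0 \<le> s \<and> s < U w 1) * F (\<lambda>j. V w j - s) \<partial>lborel) \<in> borel_measurable N"
proof -
  have "(\<lambda>v :: 'z \<times> real. (V (fst v), snd v)) \<in> N \<Otimes>\<^sub>M borel \<rightarrow>\<^sub>M borel \<Otimes>\<^sub>M borel"
    by (intro measurable_Pair measurable_compose[OF measurable_fst V] measurable_snd)
  from measurable_compose[OF this measurable_translated[OF F]]
  have 1: "(\<lambda>v. F (\<lambda>j. V (fst v) j - snd v)) \<in> borel_measurable (N \<Otimes>\<^sub>M borel)" by simp
  have [measurable]: "(\<lambda>v :: 'z \<times> real. U (fst v) 1) \<in> borel_measurable (N \<Otimes>\<^sub>M borel)"
    by (rule measurable_compose[OF measurable_compose[OF measurable_fst U] measurable_coord])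
  have 2: "(\<lambda>v :: 'z \<times> real. of_bool (0 \<le> snd v \<and> snd v < U (fst v) 1) :: ennreal) \<in> borel_measurable (N \<Otimes>\<^sub>M borel)"
    by measurable
  show ?thesis using borel_measurable_times_ennreal[OF 2 1]
    by (intro sigma_finite_measure.borel_measurable_nn_integral[OF sigma_finite_lborel]) (simp add: case_prod_beta')
qed

lemma measurable_translate: "(\<lambda>x :: int \<Rightarrow> real. (\<lambda>j. x j - u)) \<in> borel_measurable borel"
  by (rule borel_seqI) measurable

lemma ennreal_divide_1: "x / 1 = (x :: ennreal)"
  using ennreal_mult_divide_eq[of 1 x] by simp

lemma num_points_measurable [measurable]:
  assumes [measurable]: "B \<in> sets borel"
  shows "(\<lambda>x. num_points x B) \<in> borel_measurable borel"
  unfolding num_points_zsum by measurable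

lemma num_points_reindex: "num_points (reindex i x) B = num_points x B"
  unfolding num_points_zsum reindex_def by (rule zsum_shift)

lemma zsum_cong: "(\<And>i. f i = g i) \<Longrightarrow> zsum f = zsum g"
  by (simp add: zsum_def)

lemma nn_integral_reflect_of_bool:
  assumes "B \<in> sets borel"
  shows "(\<integral>\<^sup>+s. of_bool (- s \<in> B) \<partial>lborel) = emeasure lborel (B :: real set)"
proof -
  have ob: "of_bool (s \<in> B) = (indicator B s :: ennreal)" for s by (simp add: indicator_def)
  have "emeasure lborel B = (\<integral>\<^sup>+s. indicator B s \<partial>lborel)" using assms by simp
  also have "\<dots> = (\<integral>\<^sup>+s. indicator B (0 + (- 1) * s) \<partial>lborel)"
    using assms by (subst nn_integral_real_affine[where c = "- 1" and t = 0]) auto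
  finally show ?thesis unfolding ob by simp
qed

section \<open>Consequences of Palm inversion\<close>

text \<open>
  Every point of the stationary process is charged to the cell that contains the observer. By
  transport this becomes the length of the set of positions from which the typical point itself is
  seen in \<open>B\<close>.
\<close>

lemma inverts_intensity:
  assumes P0: "cycle_stationary P0" and inv: "inverts P P0" and B [measurable]: "B \<in> sets borel"
  shows "(\<integral>\<^sup>+x. num_points x B \<partial>P) = emeasure lborel B"
proof -
  interpret prob_space P0 using P0 by (simp add: cycle_stationary_def)
  define c :: "(int \<Rightarrow> real) \<Rightarrow> real \<Rightarrow> ennreal" where "c = (\<lambda>_ s. of_bool (- s \<in> B))"
  have "(\<integral>\<^sup>+x. num_points x B \<partial>P) =
     (\<integral>\<^sup>+x. \<integral>\<^sup>+s. of_bool (0 \<le> s \<and> s < x 1) * num_points (\<lambda>j. x j - s) B \<partial>lborel \<partial>P0)"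
    using inv num_points_reindex unfolding inverts_def by (auto intro!: num_points_measurable)
  also have "\<dots> = (\<integral>\<^sup>+x. \<integral>\<^sup>+s. of_bool (0 \<le> s \<and> s < x 1) * zsum (\<lambda>i. c (from_point i x) (s - x i)) \<partial>lborel \<partial>P0)"
    unfolding num_points_zsum c_def by simp
  also have "\<dots> = (\<integral>\<^sup>+x. \<integral>\<^sup>+s. c x s \<partial>lborel \<partial>P0)"
  proof (rule cell_transport[OF P0])
    have [measurable]: "(\<lambda>s :: real. - s) -` B \<in> sets borel"
      using measurable_sets_borel[of uminus borel B] by simp
    have "(\<lambda>w :: (int \<Rightarrow> real) \<times> real. indicator ((\<lambda>s. - s) -` B) (snd w) :: ennreal) \<in> borel_measurable (borel \<Otimes>\<^sub>M borel)"
      by measurable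
    then show "case_prod c \<in> borel_measurable (borel \<Otimes>\<^sub>M borel)"
      unfolding c_def by (simp add: case_prod_beta' indicator_def)
  qed
  also have "\<dots> = emeasure lborel B"
    unfolding c_def by (simp add: nn_integral_reflect_of_bool emeasure_space_1)
  finally show ?thesis .
qed

lemma inverts_has_intensity:
  assumes P0: "cycle_stationary P0" and inv: "inverts P P0"
  shows "has_intensity P 1"
proof -
  have "(\<integral>\<^sup>+x. num_points x {0<..t} \<partial>P) / ennreal t = 1" if "0 < t" for t
    using that by (simp add: inverts_intensity[OF P0 inv] ennreal_divide_self)
  moreover have "(\<integral>\<^sup>+x. num_points x {t<..0} \<partial>P) / ennreal (- t) = 1" if "t < 0" for t
    using that by (simp add: inverts_intensity[OF P0 inv] ennreal_divide_self)
  ultimately show ?thesis unfolding has_intensity_def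
    by (intro conjI tendsto_eventually) (auto simp: eventually_at_top_dense eventually_at_bot_dense)
qed

lemma palm_nn_integral:
  assumes P [measurable_cong]: "sets P = sets borel" and f [measurable]: "f \<in> borel_measurable borel"
  shows "(\<integral>\<^sup>+x. f x \<partial>palm P) =
    (\<integral>\<^sup>+x. zsum (\<lambda>i. of_bool (x i \<in> {0<..1}) * f (from_point i x)) \<partial>P) / (\<integral>\<^sup>+x. num_points x {0<..1} \<partial>P)"
proof -
  interpret C: sigma_finite_measure "count_space (UNIV :: int set)"
    by (rule sigma_finite_measure_count_space)
  let ?N = "P \<Otimes>\<^sub>M count_space (UNIV :: int set)"
  let ?A = "{(x, i). x i \<in> {0<..1}} :: ((int \<Rightarrow> real) \<times> int) set"
  have ind: "indicator ?A (x, i) = (of_bool (x i \<in> {0<..1}) :: ennreal)" for x i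
    by (simp add: indicator_def)
  have spN: "space ?N = UNIV"
    using sets_eq_imp_space_eq[OF P] by (simp add: space_pair_measure)
  have "Measurable.pred ?N (\<lambda>w. fst w (snd w) \<in> {0<..1})"
  proof (rule measurable_pair_int)
    fix i
    have "Measurable.pred P (\<lambda>x. 0 < x i \<and> x i \<le> 1)" by measurable
    then show "Measurable.pred P (\<lambda>x. fst (x, i) (snd (x, i)) \<in> {0<..1})" by simp
  qed
  then have A: "?A \<in> sets ?N"
    using spN by (simp add: Measurable.pred_def case_prod_beta')
  have g: "(\<lambda>(x, i). recenter (\<lambda>j. x (i + j))) \<in> ?N \<rightarrow>\<^sub>M borel"
    by (rule measurable_pair_int) (simp add: from_point_recenter[symmetric])
  have fg: "(\<lambda>w. f (case w of (x, i) \<Rightarrow> recenter (\<lambda>j. x (i + j)))) \<in> borel_measurable ?N"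
    by (rule measurable_compose[OF g f])
  have i: "(\<lambda>w. f (case w of (x, i) \<Rightarrow> recenter (\<lambda>j. x (i + j))) * indicator ?A w) \<in> borel_measurable ?N"
    using fg A by simp
  have "(\<integral>\<^sup>+x. f x \<partial>palm P) = (\<integral>\<^sup>+w. f (case w of (x, i) \<Rightarrow> recenter (\<lambda>j. x (i + j))) \<partial>uniform_measure ?N ?A)"
    unfolding palm_def using g by (intro nn_integral_distr) (auto simp: f)
  also have "\<dots> = (\<integral>\<^sup>+w. f (case w of (x, i) \<Rightarrow> recenter (\<lambda>j. x (i + j))) * indicator ?A w \<partial>?N) / emeasure ?N ?A"
    by (rule nn_integral_uniform_measure[OF fg A])
  also have "(\<integral>\<^sup>+w. f (case w of (x, i) \<Rightarrow> recenter (\<lambda>j. x (i + j))) * indicator ?A w \<partial>?N) =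
     (\<integral>\<^sup>+x. zsum (\<lambda>i. of_bool (x i \<in> {0<..1}) * f (from_point i x)) \<partial>P)"
    unfolding C.nn_integral_fst[OF i, symmetric] zsum_def
    by (simp only: ind from_point_recenter mult.commute prod.case)
  also have "emeasure ?N ?A = (\<integral>\<^sup>+w. indicator ?A w \<partial>?N)" using A by simp
  also have "\<dots> = (\<integral>\<^sup>+x. num_points x {0<..1} \<partial>P)"
    using A unfolding num_points_zsum zsum_def
    by (subst C.nn_integral_fst[symmetric]) (auto simp: ind simp del: greaterThanAtMost_iff)
  finally show ?thesis .
qed

lemma sets_palm: "sets (palm P) = sets borel"
  by (simp add: palm_def)

lemma measure_eqI_nn_integral:
  assumes "sets M = sets N" and "\<And>f :: 'a \<Rightarrow> ennreal. f \<in> borel_measurable M \<Longrightarrow> (\<integral>\<^sup>+x. f x \<partial>M) = (\<integral>\<^sup>+x. f x \<partial>N)"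
  shows "M = N"
proof (rule measure_eqI[OF assms(1)])
  fix A assume A: "A \<in> sets M"
  then show "emeasure M A = emeasure N A"
    using assms(2)[of "indicator A"] assms(1) by simp
qed

text \<open>
  Palm inversion can be undone: the sum over the points in the window \<open>(0, 1]\<close> turns, by transport, into
  an integral over the reflected window, which has length one.
\<close>

lemma palm_eq:
  assumes P0: "cycle_stationary P0" and inv: "inverts P P0" and P: "sets P = sets borel"
  shows "palm P = P0"
proof (rule measure_eqI_nn_integral)
  have s0: "sets P0 = sets borel" using P0 by (simp add: cycle_stationary_def)
  show "sets (palm P) = sets P0" by (simp add: s0 sets_palm)
  fix f :: "(int \<Rightarrow> real) \<Rightarrow> ennreal" assume "f \<in> borel_measurable (palm P)"
  then have f [measurable]: "f \<in> borel_measurable borel"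
    using measurable_cong_sets[OF sets_palm refl] by blast
  define c :: "(int \<Rightarrow> real) \<Rightarrow> real \<Rightarrow> ennreal" where "c = (\<lambda>x s. of_bool (- s \<in> {0<..1}) * f x)"
  define F where "F x = zsum (\<lambda>i. of_bool (x i \<in> {0<..1}) * f (from_point i x))" for x
  have [measurable]: "Measurable.pred borel (\<lambda>x :: int \<Rightarrow> real. x i \<in> {0<..1})" for i
    unfolding greaterThanAtMost_iff by measurable
  have F: "F \<in> borel_measurable borel"
    unfolding F_def by (intro zsum_measurable borel_measurable_times_ennreal measurable_compose[OF from_point_measurable f]) measurable
  have Fr: "F (reindex i x) = F x" for i x
  proof -
    have "F (reindex i x) = zsum (\<lambda>j. of_bool (x (i + j) \<in> {0<..1}) * f (from_point (i + j) x))"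
      unfolding F_def by (simp add: reindex_def from_point_def add.assoc)
    also have "\<dots> = F x" unfolding F_def by (rule zsum_shift)
    finally show ?thesis .
  qed
  have "(\<integral>\<^sup>+x. num_points x {0<..1} \<partial>P) = 1"
    by (simp add: inverts_intensity[OF P0 inv])
  then have "(\<integral>\<^sup>+x. f x \<partial>palm P) = (\<integral>\<^sup>+x. F x \<partial>P)"
    unfolding palm_nn_integral[OF P f] F_def by (simp add: ennreal_divide_1)
  also have "\<dots> = (\<integral>\<^sup>+x. \<integral>\<^sup>+s. of_bool (0 \<le> s \<and> s < x 1) * F (\<lambda>j. x j - s) \<partial>lborel \<partial>P0)"
    using inv F Fr unfolding inverts_def by blast
  also have "\<dots> = (\<integral>\<^sup>+x. \<integral>\<^sup>+s. of_bool (0 \<le> s \<and> s < x 1) * zsum (\<lambda>i. c (from_point i x) (s - x i)) \<partial>lborel \<partial>P0)"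
    unfolding F_def c_def by (simp add: from_point_def)
  also have "\<dots> = (\<integral>\<^sup>+x. \<integral>\<^sup>+s. c x s \<partial>lborel \<partial>P0)"
  proof (rule cell_transport[OF P0])
    have "(\<lambda>w :: (int \<Rightarrow> real) \<times> real. of_bool (0 < - snd w \<and> - snd w \<le> 1) * f (fst w)) \<in> borel_measurable (borel \<Otimes>\<^sub>M borel)"
      by (intro borel_measurable_times_ennreal measurable_compose[OF measurable_fst f]) measurable
    then show "case_prod c \<in> borel_measurable (borel \<Otimes>\<^sub>M borel)"
      unfolding c_def by (simp add: case_prod_beta')
  qed
  also have "\<dots> = (\<integral>\<^sup>+x. f x \<partial>P0)"
  proof (rule nn_integral_cong)
    fix x
    have "(\<lambda>s :: real. of_bool (- s \<in> {0<..1}) :: ennreal) \<in> borel_measurable borel"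
      unfolding greaterThanAtMost_iff by measurable
    then have "(\<integral>\<^sup>+s. c x s \<partial>lborel) = (\<integral>\<^sup>+s. of_bool (- s \<in> {0<..1 :: real}) \<partial>lborel) * f x"
      unfolding c_def by (subst nn_integral_multc) (simp_all del: greaterThanAtMost_iff)
    also have "\<dots> = f x"
      by (subst nn_integral_reflect_of_bool) auto
    finally show "(\<integral>\<^sup>+s. c x s \<partial>lborel) = f x" .
  qed
  finally show "(\<integral>\<^sup>+x. f x \<partial>palm P) = (\<integral>\<^sup>+x. f x \<partial>P0)" .
qed

text \<open>
  The translated cells still tile the line, so the position can equally well be spread over the cell
  shifted by \<open>u\<close>.
\<close>

lemma inverts_translate:
  assumes P0: "cycle_stationary P0" and inv: "inverts P P0"
    and F [measurable]: "F \<in> borel_measurable borel" and Fr: "\<And>i x. F (reindex i x) = F x"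
  shows "(\<integral>\<^sup>+x. F (\<lambda>j. x j - u) \<partial>P) = (\<integral>\<^sup>+x. F x \<partial>P)"
proof -
  have ts: "AE x in P0. two_sided x" using P0 by (simp add: cycle_stationary_def)
  have s0 [measurable_cong]: "sets P0 = sets borel" using P0 by (simp add: cycle_stationary_def)
  define c :: "(int \<Rightarrow> real) \<Rightarrow> real \<Rightarrow> ennreal"
    where "c = (\<lambda>x s. of_bool (0 \<le> s - u \<and> s - u < x 1) * F (\<lambda>j. x j - s))"
  have Fsh: "F (\<lambda>j. x (i + j) - d) = F (\<lambda>j. x j - d)" for x i d
    using Fr[of i "\<lambda>j. x j - d"] by (simp add: reindex_def)
  have "(\<integral>\<^sup>+x. F x \<partial>P) = (\<integral>\<^sup>+x. \<integral>\<^sup>+s. of_bool (0 \<le> s \<and> s < x 1) * F (\<lambda>j. x j - s) \<partial>lborel \<partial>P0)"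
    using inv F Fr unfolding inverts_def by blast
  also have "\<dots> = (\<integral>\<^sup>+x. \<integral>\<^sup>+s. of_bool (0 \<le> s \<and> s < x 1) * zsum (\<lambda>i. c (from_point i x) (s - x i)) \<partial>lborel \<partial>P0)"
  proof (rule nn_integral_cong_AE, use ts in eventually_elim)
    case (elim x)
    \<comment> \<open>Exactly one of the cells shifted by \<open>u\<close> contains the position \<open>s\<close>.\<close>
    have "zsum (\<lambda>i. c (from_point i x) (s - x i)) = F (\<lambda>j. x j - s)" for s
    proof -
      have "zsum (\<lambda>i. c (from_point i x) (s - x i)) =
         zsum (\<lambda>i. of_bool (x i \<le> s - u \<and> s - u < x (i + 1)) * F (\<lambda>j. x j - s))"
        unfolding c_def by (intro zsum_cong) (simp add: from_point_def Fsh algebra_simps)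
      also have "\<dots> = F (\<lambda>j. x j - s)"
        unfolding zsum_multc[symmetric] two_sided_tiling[OF elim] by simp
      finally show ?thesis .
    qed
    then show ?case by simp
  qed
  also have "\<dots> = (\<integral>\<^sup>+x. \<integral>\<^sup>+s. c x s \<partial>lborel \<partial>P0)"
  proof (rule cell_transport[OF P0])
    have "(\<lambda>w :: (int \<Rightarrow> real) \<times> real. of_bool (0 \<le> snd w - u \<and> snd w - u < fst w 1) * F (\<lambda>j. fst w j - snd w)) \<in> borel_measurable (borel \<Otimes>\<^sub>M borel)"
    proof (rule borel_measurable_times_ennreal)
      show "(\<lambda>w :: (int \<Rightarrow> real) \<times> real. F (\<lambda>j. fst w j - snd w)) \<in> borel_measurable (borel \<Otimes>\<^sub>M borel)"
        using measurable_translated[OF F] by (simp add: case_prod_beta')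
    qed measurable
    then show "case_prod c \<in> borel_measurable (borel \<Otimes>\<^sub>M borel)"
      unfolding c_def by (simp add: case_prod_beta')
  qed
  also have "\<dots> = (\<integral>\<^sup>+x. \<integral>\<^sup>+s. of_bool (0 \<le> s \<and> s < x 1) * F (\<lambda>j. x j - s - u) \<partial>lborel \<partial>P0)"
  proof (rule nn_integral_cong)
    fix x
    have F': "(\<lambda>s. F (\<lambda>j. x j - s)) \<in> borel_measurable borel"
      using measurable_Pair2[OF measurable_translated[OF F], of x] by simp
    have "(\<lambda>s. c x s) \<in> borel_measurable borel"
      unfolding c_def by (rule borel_measurable_times_ennreal[OF _ F']) measurable
    from nn_integral_translate[OF this, of u]
    show "(\<integral>\<^sup>+s. c x s \<partial>lborel) = (\<integral>\<^sup>+s. of_bool (0 \<le> s \<and> s < x 1) * F (\<lambda>j. x j - s - u) \<partial>lborel)"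
      unfolding c_def by (simp add: algebra_simps)
  qed
  also have "\<dots> = (\<integral>\<^sup>+x. F (\<lambda>j. x j - u) \<partial>P)"
  proof -
    have "(\<lambda>x. F (\<lambda>j. x j - u)) \<in> borel_measurable borel"
      by (rule measurable_compose[OF measurable_translate F])
    moreover have "F (\<lambda>j. reindex i x j - u) = F (\<lambda>j. x j - u)" for i x
      unfolding reindex_def by (rule Fsh)
    ultimately show ?thesis using inv unfolding inverts_def by simp
  qed
  finally show ?thesis by simp
qed

lemma num_points_translate: "num_points x ((\<lambda>v. v + s) ` B) = num_points (\<lambda>j. x j - s) B"
proof -
  have "x i \<in> (\<lambda>v. v + s) ` B \<longleftrightarrow> x i - s \<in> B" for i
    by (auto simp: image_iff intro: bexI[of _ "x i - s"])
  then show ?thesis by (simp add: num_points_zsum)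
qed

lemma counts_measurable:
  assumes "\<And>j. j < k \<Longrightarrow> B j \<in> sets borel"
  shows "counts k B \<in> borel_measurable borel"
proof (rule measurable_coordinatewise_then_product)
  fix j
  show "(\<lambda>x. counts k B x j) \<in> borel_measurable borel"
    using assms unfolding counts_def by (cases "j < k") auto
qed

lemma inverts_stationary:
  assumes P0: "cycle_stationary P0" and inv: "inverts P P0" and P: "sets P = sets borel"
  shows "stationary P"
  unfolding stationary_def
proof (intro allI impI)
  fix s k and B :: "nat \<Rightarrow> real set" assume B: "\<forall>j<k. B j \<in> sets borel"
  have tr: "(\<lambda>u. u + s) ` B j \<in> sets borel" if "j < k" for j
  proof -
    have "(\<lambda>u. u + s) ` B j = (\<lambda>u. u - s) -` B j"
    proof (intro equalityI subsetI)
      fix v assume "v \<in> (\<lambda>u. u - s) -` B j"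
      then show "v \<in> (\<lambda>u. u + s) ` B j" by (intro image_eqI[of _ _ "v - s"]) auto
    qed auto
    then show ?thesis using measurable_sets_borel[of "\<lambda>u. u - s" borel "B j"] B that by simp
  qed
  have m1: "counts k B \<in> P \<rightarrow>\<^sub>M borel" and m2: "counts k (\<lambda>j. (\<lambda>u. u + s) ` B j) \<in> P \<rightarrow>\<^sub>M borel"
    using counts_measurable[of k B] counts_measurable[of k "\<lambda>j. (\<lambda>u. u + s) ` B j"] B tr
    by (auto simp: measurable_cong_sets[OF P refl])
  have tc: "counts k (\<lambda>j. (\<lambda>u. u + s) ` B j) x = counts k B (\<lambda>j. x j - s)" for x
    by (simp add: counts_def num_points_translate fun_eq_iff cong: if_cong)
  show "distr P borel (counts k (\<lambda>j. (\<lambda>u. u + s) ` B j)) = distr P borel (counts k B)"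
  proof (rule measure_eqI_nn_integral)
    fix f :: "(nat \<Rightarrow> ennreal) \<Rightarrow> ennreal" assume "f \<in> borel_measurable (distr P borel (counts k (\<lambda>j. (\<lambda>u. u + s) ` B j)))"
    then have f: "f \<in> borel_measurable borel" by simp
    have "(\<integral>\<^sup>+x. f (counts k B (\<lambda>j. x j - s)) \<partial>P) = (\<integral>\<^sup>+x. f (counts k B x) \<partial>P)"
    proof (rule inverts_translate[OF P0 inv, where F = "\<lambda>x. f (counts k B x)"])
      show "(\<lambda>x. f (counts k B x)) \<in> borel_measurable borel"
        using measurable_compose[OF counts_measurable f] B by blast
      show "f (counts k B (reindex i x)) = f (counts k B x)" for i x
        by (simp add: counts_def num_points_reindex cong: if_cong)
    qed
    then show "(\<integral>\<^sup>+x. f x \<partial>distr P borel (counts k (\<lambda>j. (\<lambda>u. u + s) ` B j))) = (\<integral>\<^sup>+x. f x \<partial>distr P borel (counts k B))"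
      by (simp add: nn_integral_distr[OF m1] nn_integral_distr[OF m2] f tc)
  qed simp
qed

section \<open>Recovering a point process from its counts\<close>

definition probe :: "nat \<Rightarrow> real set" where
  "probe n = (case from_nat n of (p :: rat, q :: rat) \<Rightarrow> {of_rat p<..of_rat q})"

definition counts_below :: "int \<Rightarrow> rat \<Rightarrow> (nat \<Rightarrow> ennreal) \<Rightarrow> bool" where
  "counts_below k q c \<longleftrightarrow>
     (if 0 < k then 0 < q \<and> of_nat (nat k) \<le> c (to_nat (0 :: rat, q))
      else 0 \<le> q \<or> c (to_nat (q, 0 :: rat)) \<le> of_nat (nat (- k)))"

text \<open>
  The position of the point with index \<open>k\<close> as the infimum of the rationals above it, where being above is
  read off from the counts.
\<close>

definition rebuild :: "(nat \<Rightarrow> ennreal) \<Rightarrow> int \<Rightarrow> real" where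
  "rebuild c k = real_of_ereal (INF q. if counts_below k q c then ereal (of_rat q) else \<infinity>)"

lemma probe_borel [measurable]: "probe n \<in> sets borel"
  by (simp add: probe_def split: prod.split)

lemma INF_rat_above: "(INF q. if y \<le> of_rat q then ereal (of_rat q) else \<infinity>) = ereal y"
proof (rule antisym)
  show "ereal y \<le> (INF q. if y \<le> of_rat q then ereal (of_rat q) else \<infinity>)"
    by (rule INF_greatest) simp
  show "(INF q. if y \<le> of_rat q then ereal (of_rat q) else \<infinity>) \<le> ereal y" (is "?I \<le> _")
  proof (rule ccontr)
    assume "\<not> ?I \<le> ereal y"
    then have "ereal y < ?I" by (simp only: not_le)
    then obtain z where z: "ereal y < ereal z" "ereal z < ?I" using ereal_dense2 by blast
    then obtain q where q: "y < of_rat q" "of_rat q < z" using of_rat_dense[of y z] by auto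
    have "?I \<le> (if y \<le> of_rat q then ereal (of_rat q) else \<infinity>)" by (rule INF_lower) simp
    also have "\<dots> = ereal (of_rat q)" using q by simp
    also have "\<dots> < ereal z" using q by simp
    finally show False using z(2) by simp
  qed
qed

lemma num_points_ge:
  assumes "finite I" "\<And>i. i \<in> I \<Longrightarrow> y i \<in> B" shows "of_nat (card I) \<le> num_points y B"
proof -
  have "of_nat (card I) = emeasure (count_space UNIV) I" using assms(1) by simp
  also have "\<dots> \<le> num_points y B"
    unfolding num_points_def by (rule emeasure_mono) (use assms(2) in auto)
  finally show ?thesis .
qed

lemma num_points_le:
  assumes "finite I" "\<And>i. y i \<in> B \<Longrightarrow> i \<in> I" shows "num_points y B \<le> of_nat (card I)"
proof -
  have "num_points y B \<le> emeasure (count_space UNIV) I"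
    unfolding num_points_def by (rule emeasure_mono) (use assms(2) in auto)
  also have "\<dots> = of_nat (card I)" using assms(1) by simp
  finally show ?thesis .
qed

text \<open>
  With the normalisation \<open>y 0 \<le> 0 < y 1\<close>, the position of each point relative to a rational level is
  visible in the number of points between \<open>0\<close> and this level.
\<close>

lemma counts_below_iff:
  assumes y: "mono y" "y 0 \<le> 0" "0 < y 1"
  shows "counts_below k q (\<lambda>n. num_points y (probe n)) \<longleftrightarrow> y k \<le> of_rat q"
proof (cases "0 < k")
  case True
  have m: "a \<le> b \<Longrightarrow> y a \<le> y b" for a b using y(1) by (rule monoD)
  have c: "counts_below k q (\<lambda>n. num_points y (probe n)) \<longleftrightarrow>
     0 < q \<and> of_nat (nat k) \<le> num_points y {0<..of_rat q}"
    using True by (simp add: counts_below_def probe_def)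
  show ?thesis unfolding c
  proof
    assume a: "0 < q \<and> of_nat (nat k) \<le> num_points y {0<..of_rat q}"
    show "y k \<le> of_rat q"
    proof (rule ccontr)
      assume n: "\<not> y k \<le> of_rat q"
      have "num_points y {0<..of_rat q} \<le> of_nat (card {1..k - 1})"
      proof (rule num_points_le)
        fix i assume i: "y i \<in> {0<..of_rat q}"
        have "1 \<le> i" using m[of i 0] i y by (cases "i \<le> 0") auto
        moreover have "i < k" using m[of k i] i n by (cases "k \<le> i") auto
        ultimately show "i \<in> {1..k - 1}" by simp
      qed simp
      also have "\<dots> = of_nat (nat k - 1)" using True by (simp add: nat_diff_distrib)
      finally have "of_nat (nat k) \<le> (of_nat (nat k - 1) :: ennreal)" using a by (meson order_trans)
      then have "nat k \<le> nat k - 1" unfolding of_nat_le_iff .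
      then show False using True by simp
    qed
  next
    assume a: "y k \<le> of_rat q"
    have "0 < (of_rat q :: real)" using a m[of 1 k] True y(3) by linarith
    moreover have "of_nat (card {1..k}) \<le> num_points y {0<..of_rat q}"
    proof (rule num_points_ge)
      fix i assume "i \<in> {1..k}"
      then show "y i \<in> {0<..of_rat q}" using m[of 1 i] m[of i k] a y(3) by auto
    qed simp
    ultimately show "0 < q \<and> of_nat (nat k) \<le> num_points y {0<..of_rat q}" by simp
  qed
next
  case False
  have m: "a \<le> b \<Longrightarrow> y a \<le> y b" for a b using y(1) by (rule monoD)
  have c: "counts_below k q (\<lambda>n. num_points y (probe n)) \<longleftrightarrow>
     0 \<le> q \<or> num_points y {of_rat q<..0} \<le> of_nat (nat (- k))"
    using False by (simp add: counts_below_def probe_def)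
  show ?thesis unfolding c
  proof
    assume a: "0 \<le> q \<or> num_points y {of_rat q<..0} \<le> of_nat (nat (- k))"
    show "y k \<le> of_rat q"
    proof (rule ccontr)
      assume n: "\<not> y k \<le> of_rat q"
      then have "\<not> 0 \<le> (of_rat q :: real)" using m[of k 0] False y(2) by linarith
      then have np: "num_points y {of_rat q<..0} \<le> of_nat (nat (- k))" using a by simp
      have "of_nat (card {k..0}) \<le> num_points y {of_rat q<..0}"
      proof (rule num_points_ge)
        fix i assume "i \<in> {k..0}"
        then show "y i \<in> {of_rat q<..0}" using m[of k i] m[of i 0] n y(2) by auto
      qed simp
      then have "of_nat (card {k..0}) \<le> (of_nat (nat (- k)) :: ennreal)" using np by (rule order_trans)
      then have "card {k..0} \<le> nat (- k)" unfolding of_nat_le_iff .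
      then show False using False by simp
    qed
  next
    assume a: "y k \<le> of_rat q"
    have "num_points y {of_rat q<..0} \<le> of_nat (card {k + 1..0})"
    proof (rule num_points_le)
      fix i assume i: "y i \<in> {of_rat q<..0}"
      have "i \<le> 0" using m[of 1 i] i y by (cases "1 \<le> i") auto
      moreover have "k < i" using m[of i k] i a by (cases "i \<le> k") auto
      ultimately show "i \<in> {k + 1..0}" by simp
    qed simp
    then show "0 \<le> q \<or> num_points y {of_rat q<..0} \<le> of_nat (nat (- k))" by simp
  qed
qed

lemma rebuild_counts:
  assumes "two_sided x" shows "\<exists>i. rebuild (\<lambda>n. num_points x (probe n)) = reindex i x"
proof -
  obtain i where i: "x i \<le> 0" "0 < x (i + 1)" using two_sided_ex1[OF assms, of 0] by blast
  have m: "mono (reindex i x)" using assms by (auto simp: two_sided_def mono_def reindex_def)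
  have np: "num_points x B = num_points (reindex i x) B" for B by (simp add: num_points_reindex)
  have "reindex i x 0 \<le> 0" "0 < reindex i x 1" using i by (simp_all add: reindex_def)
  then have "rebuild (\<lambda>n. num_points x (probe n)) k = reindex i x k" for k
    unfolding np rebuild_def by (simp only: counts_below_iff[OF m] INF_rat_above real_of_ereal.simps)
  then show ?thesis by blast
qed

lemma rebuild_measurable: "rebuild \<in> borel_measurable borel"
proof (rule borel_seqI)
  fix k
  have [measurable]: "(\<lambda>c :: nat \<Rightarrow> ennreal. c n) \<in> borel_measurable borel" for n
    by (rule measurable_product_coordinates)
  have p: "Measurable.pred borel (counts_below k q)" for q
    unfolding counts_below_def[abs_def] by (cases "0 < k") simp_all
  have "(\<lambda>c. if counts_below k q c then ereal (of_rat q) else \<infinity>) \<in> borel_measurable borel" for q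
    by (rule measurable_If) (use p in \<open>auto simp: Measurable.pred_def\<close>)
  then have "(\<lambda>c. INF q. if counts_below k q c then ereal (of_rat q) else \<infinity>) \<in> borel_measurable borel"
    by (intro borel_measurable_INF) auto
  then show "(\<lambda>c. rebuild c k) \<in> borel_measurable borel"
    unfolding rebuild_def by (rule borel_measurable_real_of_ereal)
qed

lemma stationary_counts:
  assumes st: "stationary P" and P: "sets P = sets borel" and B: "\<And>j. j < k \<Longrightarrow> B j \<in> sets borel"
    and f: "f \<in> borel_measurable borel"
  shows "(\<integral>\<^sup>+x. f (counts k B (\<lambda>j. x j - u)) \<partial>P) = (\<integral>\<^sup>+x. f (counts k B x) \<partial>P)"
proof -
  have m1: "counts k B \<in> P \<rightarrow>\<^sub>M borel" and m2: "(\<lambda>x. counts k B (\<lambda>j. x j - u)) \<in> P \<rightarrow>\<^sub>M borel"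
    using counts_measurable[of k B] measurable_compose[OF measurable_translate counts_measurable[of k B]] B
    by (auto simp: measurable_cong_sets[OF P refl])
  have tc: "counts k (\<lambda>j. (\<lambda>v. v + u) ` B j) = (\<lambda>x. counts k B (\<lambda>j. x j - u))"
    by (simp add: counts_def num_points_translate fun_eq_iff cong: if_cong)
  have "distr P borel (\<lambda>x. counts k B (\<lambda>j. x j - u)) = distr P borel (counts k B)"
    using st B unfolding stationary_def tc[symmetric] by blast
  then show ?thesis
    using nn_integral_distr[OF m1, of f] nn_integral_distr[OF m2, of f] f by simp
qed

text \<open>
  Stationarity speaks of finitely many counts at a time. The joint law of the counts on all rational
  intervals is determined by its finite-dimensional marginals, and these counts determine the
  configuration up to the choice of its indices.
\<close>

lemma stationary_translate:
  assumes pr: "prob_space P" and P: "sets P = sets borel" and st: "stationary P" and ts: "AE x in P. two_sided x"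
    and F: "F \<in> borel_measurable borel" and Fr: "\<And>i x. F (reindex i x) = F x"
  shows "(\<integral>\<^sup>+x. F (\<lambda>j. x j - u) \<partial>P) = (\<integral>\<^sup>+x. F x \<partial>P)"
proof -
  interpret prob_space P by (rule pr)
  define C where "C x = (\<lambda>n. num_points x (probe n))" for x
  let ?S = "Pi\<^sub>M UNIV (\<lambda>_ :: nat. borel :: ennreal measure)"
  have C: "C \<in> P \<rightarrow>\<^sub>M ?S"
    unfolding C_def measurable_cong_sets[OF P refl]
    by (intro measurable_PiM_single') (auto simp: num_points_measurable)
  have Cu: "(\<lambda>x. C (\<lambda>j. x j - u)) \<in> P \<rightarrow>\<^sub>M ?S"
  proof -
    have "(\<lambda>x. num_points (\<lambda>j. x j - u) (probe n)) \<in> borel_measurable borel" for n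
      by (rule measurable_compose[OF measurable_translate num_points_measurable[OF probe_borel]])
    then show ?thesis
      unfolding C_def measurable_cong_sets[OF P refl]
      by (intro measurable_PiM_single') auto
  qed
  have eq: "distr P ?S (\<lambda>x. C (\<lambda>j. x j - u)) = distr P ?S C"
  proof (rule measure_eqI_PiM_infinite)
    show "finite_measure (distr P ?S (\<lambda>x. C (\<lambda>j. x j - u)))"
      using prob_space.finite_measure[OF prob_space_distr[OF Cu]] .
    fix A :: "nat \<Rightarrow> ennreal set" and J :: "nat set"
    assume J: "finite J" "J \<subseteq> UNIV" and A: "\<And>i. i \<in> J \<Longrightarrow> A i \<in> sets borel"
    obtain k where k: "\<And>j. j \<in> J \<Longrightarrow> j < k" using J(1) finite_nat_set_iff_bounded by auto
    define E where "E = {c :: nat \<Rightarrow> ennreal. \<forall>j\<in>J. c j \<in> A j}"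
    have pe: "prod_emb UNIV (\<lambda>_. borel) J (Pi\<^sub>E J A) = E"
      by (auto simp: prod_emb_def E_def)
    have ES: "E \<in> sets ?S" unfolding pe[symmetric] using J A by (intro sets_PiM_I) auto
    then have Eb: "E \<in> sets borel" by (simp add: sets_PiM_equal_borel)
    have CE: "indicator E (C x) = (indicator E (counts k probe x) :: ennreal)" for x
      using k by (auto simp: E_def C_def counts_def indicator_def)
    have "emeasure (distr P ?S (\<lambda>x. C (\<lambda>j. x j - u))) E = (\<integral>\<^sup>+x. indicator E (C (\<lambda>j. x j - u)) \<partial>P)"
      using ES Cu by (simp add: nn_integral_distr flip: nn_integral_indicator)
    also have "\<dots> = (\<integral>\<^sup>+x. indicator E (C x) \<partial>P)"
      unfolding CE by (rule stationary_counts[OF st P]) (use Eb in auto)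
    also have "\<dots> = emeasure (distr P ?S C) E"
      using ES C by (simp add: nn_integral_distr flip: nn_integral_indicator)
    finally show "emeasure (distr P ?S (\<lambda>x. C (\<lambda>j. x j - u))) (prod_emb UNIV (\<lambda>_. borel) J (Pi\<^sub>E J A)) =
       emeasure (distr P ?S C) (prod_emb UNIV (\<lambda>_. borel) J (Pi\<^sub>E J A))" unfolding pe .
  qed simp_all
  have FR: "(\<lambda>c. F (rebuild c)) \<in> borel_measurable ?S"
    using measurable_compose[OF rebuild_measurable F] by (simp add: measurable_cong_sets[OF sets_PiM_equal_borel refl])
  have Fx: "F x = F (rebuild (C x))" if "two_sided x" for x
    using rebuild_counts[OF that] Fr unfolding C_def by metis
  have "(\<integral>\<^sup>+x. F (\<lambda>j. x j - u) \<partial>P) = (\<integral>\<^sup>+x. F (rebuild (C (\<lambda>j. x j - u))) \<partial>P)"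
    by (rule nn_integral_cong_AE) (use ts in eventually_elim, rule Fx, rule two_sided_translate)
  also have "\<dots> = (\<integral>\<^sup>+c. F (rebuild c) \<partial>distr P ?S (\<lambda>x. C (\<lambda>j. x j - u)))"
    using FR by (simp add: nn_integral_distr[OF Cu])
  also have "\<dots> = (\<integral>\<^sup>+x. F (rebuild (C x)) \<partial>P)"
    unfolding eq using FR by (simp add: nn_integral_distr[OF C])
  also have "\<dots> = (\<integral>\<^sup>+x. F x \<partial>P)"
    by (rule nn_integral_cong_AE) (use ts in eventually_elim, rule Fx[symmetric])
  finally show ?thesis .
qed

lemma stationary_mean_translate:
  assumes st: "stationary P" and P: "sets P = sets borel" and B: "B \<in> sets borel"
  shows "(\<integral>\<^sup>+x. num_points (\<lambda>j. x j - u) B \<partial>P) = (\<integral>\<^sup>+x. num_points x B \<partial>P)"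
proof -
  have "(\<lambda>c :: nat \<Rightarrow> ennreal. c 0) \<in> borel_measurable borel" by (rule measurable_product_coordinates)
  from stationary_counts[OF st P, where k = 1 and B = "\<lambda>_. B", OF B this, of u]
  show ?thesis by (simp add: counts_def)
qed

lemma num_points_translate_Ioc: "num_points (\<lambda>j. x j - u) {a<..b} = num_points x {a + u<..b + u}"
  unfolding num_points_zsum by (intro zsum_cong) (auto simp: algebra_simps)

lemma num_points_Un:
  assumes "B \<inter> C = {}"
  shows "num_points x (B \<union> C) = num_points x B + num_points x C"
  unfolding num_points_def
  using plus_emeasure[of "{i. x i \<in> B}" "count_space UNIV" "{i. x i \<in> C}"] assms
  by (auto simp: disjoint_iff Collect_disj_eq[symmetric])

text \<open>
  By stationarity the mean count on \<open>(0, n]\<close> is a multiple of \<open>n\<close>, and the limit that defines the intensity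
  identifies the factor.
\<close>

lemma stationary_intensity:
  assumes st: "stationary P" and P [measurable_cong]: "sets P = sets borel" and int: "has_intensity P 1"
  shows "(\<integral>\<^sup>+x. num_points x {0<..real n} \<partial>P) = of_nat n"
    and "(\<integral>\<^sup>+x. num_points x {- real n<..0} \<partial>P) = of_nat n"
proof -
  define c where "c = (\<integral>\<^sup>+x. num_points x {0<..1} \<partial>P)"
  have [measurable]: "(\<lambda>x. num_points x B) \<in> borel_measurable P" if "B \<in> sets borel" for B
    using num_points_measurable[OF that] by (simp add: measurable_cong_sets[OF P refl])
  have nc: "(\<integral>\<^sup>+x. num_points x {0<..real n} \<partial>P) = of_nat n * c" for n
  proof (induction n)
    case (Suc n)
    have "{0<..real (Suc n)} = {0<..real n} \<union> {real n<..real (Suc n)}" by auto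
    then have "num_points x {0<..real (Suc n)} = num_points x {0<..real n} + num_points x {real n<..real (Suc n)}" for x
      by (simp only:) (rule num_points_Un, auto)
    then have "(\<integral>\<^sup>+x. num_points x {0<..real (Suc n)} \<partial>P) =
       (\<integral>\<^sup>+x. num_points x {0<..real n} \<partial>P) + (\<integral>\<^sup>+x. num_points x {real n<..real (Suc n)} \<partial>P)"
      by (simp only:) (rule nn_integral_add, auto)
    also have "(\<integral>\<^sup>+x. num_points x {real n<..real (Suc n)} \<partial>P) = c"
      using stationary_mean_translate[OF st P, of "{0<..1}" "real n"]
      by (simp add: num_points_translate_Ioc c_def)
    finally show ?case using Suc by (simp add: algebra_simps)
  qed (simp add: num_points_def)
  have "((\<lambda>t. (\<integral>\<^sup>+x. num_points x {0<..t} \<partial>P) / ennreal t) \<longlongrightarrow> 1) at_top"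
    using int by (simp add: has_intensity_def)
  from filterlim_compose[OF this filterlim_real_sequentially]
  have "(\<lambda>n. of_nat n * c / ennreal (real n)) \<longlonglongrightarrow> 1" unfolding nc .
  moreover have "(\<lambda>n. of_nat n * c / ennreal (real n)) \<longlonglongrightarrow> c"
  proof (rule tendsto_eventually, rule eventually_sequentiallyI)
    fix n :: nat assume "1 \<le> n"
    then show "of_nat n * c / ennreal (real n) = c"
      by (subst mult.commute) (simp add: ennreal_of_nat_eq_real_of_nat ennreal_mult_divide_eq)
  qed
  ultimately have c: "c = 1" using LIMSEQ_unique by blast
  show "(\<integral>\<^sup>+x. num_points x {0<..real n} \<partial>P) = of_nat n" using nc c by simp
  then show "(\<integral>\<^sup>+x. num_points x {- real n<..0} \<partial>P) = of_nat n"
    using stationary_mean_translate[OF st P, of "{- real n<..0}" "real n"]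
    by (simp add: num_points_translate_Ioc)
qed

text \<open>
  Finite mean counts exclude accumulation points, and a monotone sequence without accumulation points is
  unbounded on both sides.
\<close>

lemma stationary_two_sided:
  assumes pp: "point_process P" and st: "stationary P" and int: "has_intensity P 1"
  shows "AE x in P. two_sided x"
proof -
  have P: "sets P = sets borel" using pp by (simp add: point_process_def)
  have m: "(\<lambda>x. num_points x B) \<in> borel_measurable P" if "B \<in> sets borel" for B
    using num_points_measurable[OF that] by (simp add: measurable_cong_sets[OF P refl])
  have "AE x in P. \<forall>n :: nat. num_points x {0<..real n} \<noteq> \<infinity> \<and> num_points x {- real n<..0} \<noteq> \<infinity>"
    unfolding AE_all_countable
  proof
    fix n :: nat
    have "AE x in P. num_points x {0<..real n} \<noteq> \<infinity>" "AE x in P. num_points x {- real n<..0} \<noteq> \<infinity>"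
      by (intro nn_integral_PInf_AE m; simp add: stationary_intensity[OF st P int])+
    then show "AE x in P. num_points x {0<..real n} \<noteq> \<infinity> \<and> num_points x {- real n<..0} \<noteq> \<infinity>" by eventually_elim simp
  qed
  moreover have "AE x in P. mono x" using pp by (simp add: point_process_def)
  ultimately show ?thesis
  proof eventually_elim
    case (elim x)
    have fin: "finite {i. a \<le> x i \<and> x i \<le> b}" for a b
    proof -
      define n where "n = nat \<lceil>max \<bar>a\<bar> \<bar>b\<bar>\<rceil> + 1"
      have n: "- real n < a" "b \<le> real n" unfolding n_def by linarith+
      have "finite {i. x i \<in> {0<..real n}}" "finite {i. x i \<in> {- real n<..0}}"
        using elim(1)[rule_format, of n] by (auto simp: num_points_def emeasure_count_space split: if_splits)
      then have "finite ({i. x i \<in> {0<..real n}} \<union> {i. x i \<in> {- real n<..0}})" by simp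
      then show ?thesis by (rule rev_finite_subset) (use n in auto)
    qed
    have "\<exists>i. c < x i" for c
    proof (rule ccontr)
      assume "\<not> (\<exists>i. c < x i)"
      then have "{0..} \<subseteq> {i. x 0 \<le> x i \<and> x i \<le> c}" using elim(2) by (auto simp: mono_def not_less)
      then show False using fin[of "x 0" c] finite_subset infinite_Ici[of "0 :: int"] by blast
    qed
    moreover have "\<exists>i. x i < c" for c
    proof (rule ccontr)
      assume "\<not> (\<exists>i. x i < c)"
      then have "{..0} \<subseteq> {i. c \<le> x i \<and> x i \<le> x 0}" using elim(2) by (auto simp: mono_def not_less)
      then show False using fin[of c "x 0"] finite_subset infinite_Iic[of "0 :: int"] by blast
    qed
    ultimately show ?case using elim(2) by (simp add: two_sided_def)
  qed
qed

section \<open>Palm laws of stationary and renewal processes\<close>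

lemma nn_integral_lborel_swap:
  fixes f :: "'a \<Rightarrow> real \<Rightarrow> ennreal"
  assumes "prob_space M" and f: "(\<lambda>(x, s). f x s) \<in> borel_measurable (M \<Otimes>\<^sub>M borel)"
  shows "(\<integral>\<^sup>+x. \<integral>\<^sup>+s. f x s \<partial>lborel \<partial>M) = (\<integral>\<^sup>+s. \<integral>\<^sup>+x. f x s \<partial>M \<partial>lborel)"
proof -
  interpret prob_space M by fact
  interpret pair_sigma_finite M lborel by unfold_locales
  have "case_prod f \<in> borel_measurable (M \<Otimes>\<^sub>M lborel)"
    using f measurable_cong_sets[OF sets_pair_measure_cong[OF refl sets_lborel] refl] by blast
  from Fubini'[OF this] show ?thesis by (rule sym)
qed

lemma palm_AE:
  assumes P: "sets P = sets borel" and Q: "{x. Q x} \<in> sets borel"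
    and ae: "AE x in P. \<forall>i. Q (from_point i x)"
  shows "AE x in palm P. Q x"
proof -
  have Q': "{x. \<not> Q x} \<in> sets borel" using sets.compl_sets[OF Q] by (simp add: Collect_neg_eq Compl_eq_Diff_UNIV)
  have "(\<integral>\<^sup>+x. zsum (\<lambda>i. of_bool (x i \<in> {0<..1}) * indicator {x. \<not> Q x} (from_point i x)) \<partial>P) = (\<integral>\<^sup>+x. 0 \<partial>P)"
  proof (rule nn_integral_cong_AE, use ae in eventually_elim)
    case (elim x)
    then show ?case by (simp add: zsum_def del: greaterThanAtMost_iff)
  qed
  then have "(\<integral>\<^sup>+x. indicator {x. \<not> Q x} x \<partial>palm P) = 0"
    using Q' by (subst palm_nn_integral[OF P]) simp_all
  then have "emeasure (palm P) {x. \<not> Q x} = 0"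
    using Q' by (simp add: sets_palm)
  then show ?thesis
    by (intro AE_I[where N = "{x. \<not> Q x}"]) (use Q' in \<open>auto simp: sets_palm\<close>)
qed

text \<open>
  Fubini and stationarity. A point in \<open>(0, 1]\<close> together with a position in its cell is a pair of positions;
  moving the origin to the second one turns the condition on the pair into: the cell of the origin
  belongs to a point that lies in a window of length one. The window integrates to one and exactly
  one cell contains the origin.
\<close>

lemma palm_inverts:
  assumes pr: "prob_space P" and P [measurable_cong]: "sets P = sets borel" and st: "stationary P"
    and ts: "AE x in P. two_sided x" and int: "has_intensity P 1"
  shows "inverts P (palm P)"
  unfolding inverts_def
proof (intro ballI impI)
  fix F :: "(int \<Rightarrow> real) \<Rightarrow> ennreal"
  assume F: "F \<in> borel_measurable borel" and Fr': "\<forall>i x. F (reindex i x) = F x"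
  interpret prob_space P by (rule pr)
  have Fsh: "F (\<lambda>j. x (i + j) - d) = F (\<lambda>j. x j - d)" for x i d
    using Fr'[rule_format, of i "\<lambda>j. x j - d"] by (simp add: reindex_def)
  have Fsh0: "F (\<lambda>j. x (i + j)) = F x" for x i
    using Fr'[rule_format, of i x] by (simp add: reindex_def)
  have FTs: "(\<lambda>s. F (\<lambda>j. x j - s)) \<in> borel_measurable borel" for x
    using measurable_Pair2[OF measurable_translated[OF F], of x] by simp
  have fm: "(\<lambda>x :: int \<Rightarrow> real. \<integral>\<^sup>+s. of_bool (0 \<le> s \<and> s < x 1) * F (\<lambda>j. x j - s) \<partial>lborel) \<in> borel_measurable borel"
    by (rule cell_integral_measurable[where U = "\<lambda>y. y" and V = "\<lambda>y. y", OF F]) simp_all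
  have one: "(\<integral>\<^sup>+x. num_points x {0<..1} \<partial>P) = 1"
    using stationary_intensity(1)[OF st P int, of 1] by simp
  \<comment> \<open>The observer at \<open>s\<close> becomes the origin; the point that owns the cell of the origin was in \<open>(0, 1]\<close> before the move.\<close>
  define H where "H s x = zsum (\<lambda>i. of_bool (0 < x i + s \<and> x i + s \<le> 1 \<and> x i \<le> 0 \<and> 0 < x (i + 1))) * F x" for s x
  have mH: "(\<lambda>w :: real \<times> (int \<Rightarrow> real). H (fst w) (snd w)) \<in> borel_measurable (borel \<Otimes>\<^sub>M borel)"
    unfolding H_def
    by (rule borel_measurable_times_ennreal[OF _ measurable_compose[OF measurable_snd F]], rule zsum_measurable) measurable
  have Hs: "H s \<in> borel_measurable borel" for s
    using measurable_compose[OF measurable_Pair1' mH, of s] by simp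
  have Hr: "H s (reindex k x) = H s x" for s k x
  proof -
    have "H s (reindex k x) =
       zsum (\<lambda>i. of_bool (0 < x (k + i) + s \<and> x (k + i) + s \<le> 1 \<and> x (k + i) \<le> 0 \<and> 0 < x (k + i + 1))) * F x"
      unfolding H_def using Fsh0 by (simp add: reindex_def add.assoc)
    also have "\<dots> = H s x" unfolding H_def by (subst zsum_shift) simp
    finally show ?thesis .
  qed
  have mHt: "(\<lambda>(x, s). H s (\<lambda>j. x j - s)) \<in> borel_measurable (borel \<Otimes>\<^sub>M borel)"
  proof -
    have t: "(\<lambda>w :: (int \<Rightarrow> real) \<times> real. (\<lambda>j. fst w j - snd w)) \<in> borel_measurable (borel \<Otimes>\<^sub>M borel)"
      by (rule borel_seqI) measurable
    have "(\<lambda>w :: (int \<Rightarrow> real) \<times> real. (snd w, (\<lambda>j. fst w j - snd w))) \<in> borel \<Otimes>\<^sub>M borel \<rightarrow>\<^sub>M borel \<Otimes>\<^sub>M borel"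
      by (rule measurable_Pair[OF measurable_snd t])
    from measurable_compose[OF this mH] show ?thesis by (simp add: case_prod_beta')
  qed
  have "(\<integral>\<^sup>+x. \<integral>\<^sup>+s. of_bool (0 \<le> s \<and> s < x 1) * F (\<lambda>j. x j - s) \<partial>lborel \<partial>palm P) =
    (\<integral>\<^sup>+x. zsum (\<lambda>i. of_bool (x i \<in> {0<..1}) *
       (\<integral>\<^sup>+s. of_bool (0 \<le> s \<and> s < from_point i x 1) * F (\<lambda>j. from_point i x j - s) \<partial>lborel)) \<partial>P)"
    by (subst palm_nn_integral[OF P fm]) (simp only: one ennreal_divide_1)
  also have "\<dots> = (\<integral>\<^sup>+x. \<integral>\<^sup>+s. H s (\<lambda>j. x j - s) \<partial>lborel \<partial>P)"
  proof (rule nn_integral_cong)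
    fix x :: "int \<Rightarrow> real"
    have mb: "(\<lambda>s. of_bool (0 < x i \<and> x i \<le> 1 \<and> x i \<le> s \<and> s < x (i + 1)) * F (\<lambda>j. x j - s)) \<in> borel_measurable borel" for i
      by (rule borel_measurable_times_ennreal[OF _ FTs]) measurable
    have "of_bool (x i \<in> {0<..1}) *
         (\<integral>\<^sup>+s. of_bool (0 \<le> s \<and> s < from_point i x 1) * F (\<lambda>j. from_point i x j - s) \<partial>lborel) =
       (\<integral>\<^sup>+s. of_bool (0 < x i \<and> x i \<le> 1 \<and> x i \<le> s \<and> s < x (i + 1)) * F (\<lambda>j. x j - s) \<partial>lborel)" for i
    proof -
      have F2: "F (\<lambda>j. from_point i x j - s) = F (\<lambda>j. x j - (s + x i))" for s
        using Fsh[of x i "s + x i"] by (simp add: from_point_def algebra_simps)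
      have "(\<integral>\<^sup>+s. of_bool (0 < x i \<and> x i \<le> 1 \<and> x i \<le> s \<and> s < x (i + 1)) * F (\<lambda>j. x j - s) \<partial>lborel) =
        (\<integral>\<^sup>+s. of_bool (0 < x i \<and> x i \<le> 1 \<and> x i \<le> s + x i \<and> s + x i < x (i + 1)) * F (\<lambda>j. x j - (s + x i)) \<partial>lborel)"
        by (rule nn_integral_translate[OF mb, symmetric])
      also have "\<dots> = (\<integral>\<^sup>+s. of_bool (x i \<in> {0<..1}) * (of_bool (0 \<le> s \<and> s < from_point i x 1) * F (\<lambda>j. from_point i x j - s)) \<partial>lborel)"
        unfolding F2 by (intro nn_integral_cong) (auto simp: algebra_simps)
      also have "\<dots> = of_bool (x i \<in> {0<..1}) * (\<integral>\<^sup>+s. of_bool (0 \<le> s \<and> s < from_point i x 1) * F (\<lambda>j. from_point i x j - s) \<partial>lborel)"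
      proof (rule nn_integral_cmult)
        have "(\<lambda>s. of_bool (0 \<le> s \<and> s < from_point i x 1) * F (\<lambda>j. from_point i x j - s)) \<in> borel_measurable borel"
          by (rule borel_measurable_times_ennreal[OF _ FTs]) measurable
        then show "(\<lambda>s. of_bool (0 \<le> s \<and> s < from_point i x 1) * F (\<lambda>j. from_point i x j - s)) \<in> borel_measurable lborel" by simp
      qed
      finally show ?thesis by simp
    qed
    then have "zsum (\<lambda>i. of_bool (x i \<in> {0<..1}) *
         (\<integral>\<^sup>+s. of_bool (0 \<le> s \<and> s < from_point i x 1) * F (\<lambda>j. from_point i x j - s) \<partial>lborel)) =
       zsum (\<lambda>i. \<integral>\<^sup>+s. of_bool (0 < x i \<and> x i \<le> 1 \<and> x i \<le> s \<and> s < x (i + 1)) * F (\<lambda>j. x j - s) \<partial>lborel)"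
      by (rule zsum_cong)
    also have "\<dots> = (\<integral>\<^sup>+s. zsum (\<lambda>i. of_bool (0 < x i \<and> x i \<le> 1 \<and> x i \<le> s \<and> s < x (i + 1)) * F (\<lambda>j. x j - s)) \<partial>lborel)"
    proof -
      define K where "K i s = of_bool (0 < x i \<and> x i \<le> 1 \<and> x i \<le> s \<and> s < x (i + 1)) * F (\<lambda>j. x j - s)" for i s
      have "K i \<in> borel_measurable lborel" for i
        using mb unfolding K_def measurable_lborel2 .
      from zsum_swap[of K, OF this] show ?thesis unfolding K_def by (rule sym)
    qed
    also have "\<dots> = (\<integral>\<^sup>+s. H s (\<lambda>j. x j - s) \<partial>lborel)"
      unfolding H_def zsum_multc[symmetric] by simp
    finally show "zsum (\<lambda>i. of_bool (x i \<in> {0<..1}) *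
         (\<integral>\<^sup>+s. of_bool (0 \<le> s \<and> s < from_point i x 1) * F (\<lambda>j. from_point i x j - s) \<partial>lborel)) =
       (\<integral>\<^sup>+s. H s (\<lambda>j. x j - s) \<partial>lborel)" .
  qed
  also have "\<dots> = (\<integral>\<^sup>+s. \<integral>\<^sup>+x. H s (\<lambda>j. x j - s) \<partial>P \<partial>lborel)"
    using mHt by (intro nn_integral_lborel_swap pr) (simp add: measurable_cong_sets[OF sets_pair_measure_cong[OF P refl] refl])
  also have "\<dots> = (\<integral>\<^sup>+s. \<integral>\<^sup>+x. H s x \<partial>P \<partial>lborel)"
    by (intro nn_integral_cong stationary_translate[OF pr P st ts Hs Hr])
  also have "\<dots> = (\<integral>\<^sup>+x. \<integral>\<^sup>+s. H s x \<partial>lborel \<partial>P)"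
    using measurable_compose[OF measurable_pair_swap' mH]
    by (intro nn_integral_lborel_swap[symmetric] pr)
       (simp add: measurable_cong_sets[OF sets_pair_measure_cong[OF P refl] refl] case_prod_beta')
  also have "\<dots> = (\<integral>\<^sup>+x. F x \<partial>P)"
  proof (rule nn_integral_cong_AE, use ts in eventually_elim)
    case (elim x)
    have ind: "of_bool (0 < x i + s \<and> x i + s \<le> 1 \<and> x i \<le> 0 \<and> 0 < x (i + 1)) =
       (of_bool (x i \<le> 0 \<and> 0 < x (i + 1)) * indicator {- x i<..1 - x i} s :: ennreal)" for i s
      by (auto simp: indicator_def)
    have mi: "(\<lambda>s. of_bool (0 < x i + s \<and> x i + s \<le> 1 \<and> x i \<le> 0 \<and> 0 < x (i + 1)) :: ennreal) \<in> borel_measurable lborel" for i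
      unfolding ind by (intro borel_measurable_times_ennreal) simp_all
    have cell: "(\<integral>\<^sup>+s. of_bool (0 < x i + s \<and> x i + s \<le> 1 \<and> x i \<le> 0 \<and> 0 < x (i + 1)) \<partial>lborel) =
       (of_bool (x i \<le> 0 \<and> 0 < x (i + 1)) :: ennreal)" for i
      unfolding ind by (subst nn_integral_cmult_indicator) simp_all
    have "(\<integral>\<^sup>+s. H s x \<partial>lborel) =
       (\<integral>\<^sup>+s. zsum (\<lambda>i. of_bool (0 < x i + s \<and> x i + s \<le> 1 \<and> x i \<le> 0 \<and> 0 < x (i + 1))) \<partial>lborel) * F x"
      unfolding H_def by (rule nn_integral_multc) (rule zsum_measurable, rule mi)
    also have "(\<integral>\<^sup>+s. zsum (\<lambda>i. of_bool (0 < x i + s \<and> x i + s \<le> 1 \<and> x i \<le> 0 \<and> 0 < x (i + 1))) \<partial>lborel) =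
       zsum (\<lambda>i. of_bool (x i \<le> 0 \<and> 0 < x (i + 1)))"
      by (subst zsum_swap[OF mi]) (simp only: cell)
    also have "\<dots> = 1" using two_sided_tiling[OF elim, of 0] by simp
    finally show ?case by simp
  qed
  finally show "(\<integral>\<^sup>+x. F x \<partial>P) =
     (\<integral>\<^sup>+x. \<integral>\<^sup>+s. of_bool (0 \<le> s \<and> s < x 1) * F (\<lambda>j. x j - s) \<partial>lborel \<partial>palm P)" ..
qed

text \<open>
  The inverse of forming gaps, for configurations with a point of index \<open>0\<close> at the origin.
\<close>

definition partial_sums :: "(int \<Rightarrow> real) \<Rightarrow> int \<Rightarrow> real" where
  "partial_sums g j = (if 0 \<le> j then \<Sum>i\<in>{0..<j}. g i else - (\<Sum>i\<in>{j..<0}. g i))"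

lemma sum_gap: "a \<le> b \<Longrightarrow> (\<Sum>i\<in>{a..<b}. gap i x) = x b - x a"
proof (induction rule: int_ge_induct)
  case (step b)
  have "{a..<b + 1} = insert b {a..<b}" using step by auto
  then show ?case using step by (simp add: gap_def)
qed simp

lemma partial_sums_gap: "partial_sums (\<lambda>i. gap i x) j = x j - x 0"
  by (simp add: partial_sums_def sum_gap)

lemma partial_sums_measurable: "partial_sums \<in> borel_measurable borel"
proof (rule borel_seqI)
  fix j
  have "(\<lambda>g :: int \<Rightarrow> real. \<Sum>i\<in>I. g i) \<in> borel_measurable borel" for I
    by (intro borel_measurable_sum measurable_coordinate) simp
  then show "(\<lambda>g. partial_sums g j) \<in> borel_measurable borel"
    unfolding partial_sums_def by (cases "0 \<le> j") auto
qed

lemma gap_measurable [measurable]: "gap i \<in> borel_measurable borel"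
  unfolding gap_def by measurable

lemma renewal_gaps_PiM:
  assumes rn: "renewal P"
  shows "distr (palm P) (\<Pi>\<^sub>M i\<in>UNIV. borel) (\<lambda>x i. gap i x) = (\<Pi>\<^sub>M i\<in>UNIV. gap_law P)"
proof -
  interpret prob_space "palm P" using rn by (simp add: renewal_def)
  have rv: "random_variable borel (gap i)" for i
    using gap_measurable by (simp add: measurable_cong_sets[OF sets_palm refl])
  have "indep_vars (\<lambda>_. borel) gap UNIV" using rn by (simp add: renewal_def)
  then have "distr (palm P) (\<Pi>\<^sub>M i\<in>UNIV. borel) (\<lambda>x. \<lambda>i\<in>UNIV. gap i x) = (\<Pi>\<^sub>M i\<in>UNIV. distr (palm P) borel (gap i))"
    by (subst (asm) indep_vars_iff_distr_eq_PiM) (use rv in auto)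
  then show ?thesis using rn by (simp add: renewal_def restrict_def)
qed

text \<open>
  A shift of the index permutes the independent and identically distributed gaps, and the gaps
  determine the configuration.
\<close>

lemma renewal_cycle_stationary:
  assumes rn: "renewal P" and ts: "AE x in P. two_sided x"
  shows "cycle_stationary (palm P)"
  unfolding cycle_stationary_def
proof (intro conjI allI)
  show pp: "prob_space (palm P)" using rn by (simp add: renewal_def)
  show "sets (palm P) = sets borel" by (rule sets_palm)
  have P: "sets P = sets borel" using rn by (simp add: renewal_def simple_process_def point_process_def)
  show "AE x in palm P. two_sided x"
    by (rule palm_AE[OF P measurable_two_sided]) (use ts in eventually_elim, simp add: two_sided_from_point)
  have z: "AE x in palm P. x 0 = 0"
    by (rule palm_AE[OF P]) simp_all
  fix n
  let ?S = "\<Pi>\<^sub>M i\<in>(UNIV :: int set). borel :: real measure" and ?D = "\<Pi>\<^sub>M i\<in>(UNIV :: int set). gap_law P"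
  have sD: "sets ?D = sets ?S" by (intro sets_PiM_cong) (auto simp: gap_law_def)
  have pD: "prob_space (gap_law P)"
    unfolding gap_law_def using gap_measurable
    by (intro prob_space.prob_space_distr[OF pp]) (simp add: measurable_cong_sets[OF sets_palm refl])
  have G: "(\<lambda>x i. gap i x) \<in> palm P \<rightarrow>\<^sub>M ?S"
    unfolding measurable_cong_sets[OF sets_palm refl] by (intro measurable_PiM_single') auto
  have sh: "(\<lambda>g i. g (n + i)) \<in> ?S \<rightarrow>\<^sub>M ?S"
    by (intro measurable_PiM_single') (auto simp: space_PiM)
  have ps: "partial_sums \<in> ?S \<rightarrow>\<^sub>M borel"
    using partial_sums_measurable by (simp add: measurable_cong_sets[OF sets_PiM_equal_borel refl])
  have shD: "distr ?D ?S (\<lambda>g i. g (n + i)) = ?D"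
  proof -
    have "distr ?D (\<Pi>\<^sub>M i\<in>(UNIV :: int set). gap_law P) (\<lambda>\<omega>. \<lambda>i\<in>UNIV. \<omega> (n + i)) = ?D"
      by (rule distr_PiM_reindex[where f = "\<lambda>i. n + i"]) (auto simp: pD)
    then show ?thesis using distr_cong[OF refl sD, of ?D] by (simp add: restrict_def)
  qed
  have "distr (palm P) borel (from_point n) = distr (palm P) borel (\<lambda>x. partial_sums (\<lambda>i. gap (n + i) x))"
  proof (rule distr_cong[OF refl refl])
    fix x
    show "from_point n x = partial_sums (\<lambda>i. gap (n + i) x)"
      using partial_sums_gap[of "\<lambda>j. x (n + j)"] by (simp add: gap_def from_point_def fun_eq_iff add.assoc)
  qed
  also have "\<dots> = distr (distr (distr (palm P) ?S (\<lambda>x i. gap i x)) ?S (\<lambda>g i. g (n + i))) borel partial_sums"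
    using G sh ps by (simp add: distr_distr comp_def)
  also have "\<dots> = distr (distr (palm P) ?S (\<lambda>x i. gap i x)) borel partial_sums"
    unfolding renewal_gaps_PiM[OF rn] shD ..
  also have "\<dots> = distr (palm P) borel (\<lambda>x. partial_sums (\<lambda>i. gap i x))"
    using G ps by (simp add: distr_distr comp_def)
  also have "\<dots> = distr (palm P) borel (\<lambda>x. x)"
  proof (rule distr_cong_AE[OF refl refl])
    show "AE x in palm P. partial_sums (\<lambda>i. gap i x) = x"
      using z by eventually_elim (simp add: partial_sums_gap fun_eq_iff)
    show "(\<lambda>x. partial_sums (\<lambda>i. gap i x)) \<in> palm P \<rightarrow>\<^sub>M borel"
      using measurable_compose[OF G ps] .
    show "(\<lambda>x. x) \<in> palm P \<rightarrow>\<^sub>M borel" by (simp add: measurable_cong_sets[OF sets_palm refl])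
  qed
  also have "\<dots> = palm P" by (rule distr_id2) (simp add: sets_palm)
  finally show "distr (palm P) borel (from_point n) = palm P" .
qed

lemma palm_strict_mono:
  assumes sp: "simple_process P"
  shows "AE x in palm P. strict_mono x"
proof (rule palm_AE)
  show P: "sets P = sets borel" using sp by (simp add: simple_process_def point_process_def)
  show "{x :: int \<Rightarrow> real. strict_mono x} \<in> sets borel" by (rule strict_mono_sets)
  have "AE x in P. mono x" "AE x in P. inj x" using sp by (auto simp: simple_process_def point_process_def)
  then show "AE x in P. \<forall>i. strict_mono (from_point i x)"
  proof eventually_elim
    case (elim x)
    have "x a < x b" if "a < b" for a b
      using that elim by (metis injD less_eq_real_def less_imp_le less_irrefl monoD)
    then show ?case by (auto simp: strict_mono_def)
  qed
qed

section \<open>Fair flips and occupied edges\<close>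

definition flips :: "(int \<Rightarrow> bool) measure" where
  "flips = (\<Pi>\<^sub>M i\<in>UNIV. measure_pmf (bernoulli_pmf (1 / 2)))"

text \<open>
  Coins with indices in the natural numbers, for computations that consume the coins one by one.
\<close>

definition flips_from :: "(nat \<Rightarrow> bool) measure" where
  "flips_from = (\<Pi>\<^sub>M n\<in>UNIV. measure_pmf (bernoulli_pmf (1 / 2)))"

lemma prob_space_flips: "prob_space flips" "prob_space flips_from"
  unfolding flips_def flips_from_def by (intro prob_space_PiM prob_space_measure_pmf)+

lemma space_flips [simp]: "space flips = UNIV" "space flips_from = UNIV"
  by (simp_all add: flips_def flips_from_def space_PiM)

lemma measurable_flip [measurable]: "(\<lambda>r. r i) \<in> flips \<rightarrow>\<^sub>M count_space UNIV"
  "(\<lambda>r. r n) \<in> flips_from \<rightarrow>\<^sub>M count_space UNIV"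
proof -
  have "(\<lambda>r. r i) \<in> flips \<rightarrow>\<^sub>M measure_pmf (bernoulli_pmf (1 / 2))"
    "(\<lambda>r. r n) \<in> flips_from \<rightarrow>\<^sub>M measure_pmf (bernoulli_pmf (1 / 2))"
    unfolding flips_def flips_from_def by (rule measurable_component_singleton, simp)+
  then show "(\<lambda>r. r i) \<in> flips \<rightarrow>\<^sub>M count_space UNIV"
    "(\<lambda>r. r n) \<in> flips_from \<rightarrow>\<^sub>M count_space UNIV" by simp_all
qed

lemma measurable_into_flips:
  assumes "\<And>i. (\<lambda>w. f w i) \<in> M \<rightarrow>\<^sub>M count_space UNIV"
  shows "f \<in> M \<rightarrow>\<^sub>M flips"
  unfolding flips_def using assms by (intro measurable_PiM_single') auto

lemma measurable_into_flips_from: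
  assumes "\<And>i. (\<lambda>w. f w i) \<in> M \<rightarrow>\<^sub>M count_space UNIV"
  shows "f \<in> M \<rightarrow>\<^sub>M flips_from"
  unfolding flips_from_def using assms by (intro measurable_PiM_single') auto

definition shift_flips :: "int \<Rightarrow> (int \<Rightarrow> bool) \<Rightarrow> int \<Rightarrow> bool" where
  "shift_flips d r = (\<lambda>i. r (d + i))"

lemma shift_flips_apply [simp]: "shift_flips d r i = r (d + i)" by (simp add: shift_flips_def)

lemma measurable_shift [measurable]: "shift_flips d \<in> flips \<rightarrow>\<^sub>M flips"
  unfolding shift_flips_def by (rule measurable_into_flips) (rule measurable_flip)

lemma distr_shift: "distr flips flips (shift_flips d) = flips"
proof -
  have "distr (\<Pi>\<^sub>M i\<in>(UNIV :: int set). measure_pmf (bernoulli_pmf (1 / 2))) (\<Pi>\<^sub>M i\<in>(UNIV :: int set). measure_pmf (bernoulli_pmf (1 / 2)))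
     (\<lambda>\<omega>. \<lambda>i\<in>UNIV. \<omega> (d + i)) = (\<Pi>\<^sub>M i\<in>(UNIV :: int set). measure_pmf (bernoulli_pmf (1 / 2)))"
    by (rule distr_PiM_reindex[where f = "\<lambda>i. d + i"]) (auto simp: prob_space_measure_pmf)
  then show ?thesis by (simp add: flips_def shift_flips_def[abs_def] restrict_def)
qed

lemma distr_flips_from: "distr flips flips_from (\<lambda>r n. r (int n)) = flips_from"
proof -
  have "distr (\<Pi>\<^sub>M i\<in>(UNIV :: int set). measure_pmf (bernoulli_pmf (1 / 2))) (\<Pi>\<^sub>M i\<in>(UNIV :: nat set). measure_pmf (bernoulli_pmf (1 / 2)))
     (\<lambda>\<omega>. \<lambda>i\<in>UNIV. \<omega> (int i)) = (\<Pi>\<^sub>M i\<in>(UNIV :: nat set). measure_pmf (bernoulli_pmf (1 / 2)))"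
    by (rule distr_PiM_reindex[where f = int]) (auto simp: prob_space_measure_pmf inj_on_def)
  then show ?thesis by (simp add: flips_def flips_from_def restrict_def)
qed

lemma nn_integral_shift:
  assumes "f \<in> borel_measurable flips"
  shows "(\<integral>\<^sup>+r. f (shift_flips d r) \<partial>flips) = (\<integral>\<^sup>+r. f r \<partial>flips)"
  using nn_integral_distr[OF measurable_shift, of f d] assms by (simp add: distr_shift)

lemma measurable_forward: "(\<lambda>(r :: int \<Rightarrow> bool) n. r (int n)) \<in> flips \<rightarrow>\<^sub>M flips_from"
  by (rule measurable_into_flips_from) (rule measurable_flip)

lemma nn_integral_forward:
  assumes "f \<in> borel_measurable flips_from"
  shows "(\<integral>\<^sup>+r. f (\<lambda>n. r (int n)) \<partial>flips) = (\<integral>\<^sup>+\<omega>. f \<omega> \<partial>flips_from)"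
  using nn_integral_distr[OF measurable_forward, of f] assms by (simp add: distr_flips_from)

lemma measurable_case_nat_flips: "case_nat s \<in> flips_from \<rightarrow>\<^sub>M flips_from"
proof (rule measurable_into_flips_from)
  fix i show "(\<lambda>w. case_nat s w i) \<in> flips_from \<rightarrow>\<^sub>M count_space UNIV"
    by (cases i) simp_all
qed

lemma ennreal_half: "x / 2 = ennreal (1 / 2) * x"
proof -
  have "inverse 2 = ennreal (1 / 2)" using inverse_ennreal[of 2] by simp
  then show ?thesis unfolding divide_ennreal_def by (simp only: mult.commute)
qed

lemma nn_integral_first_flip:
  assumes f: "f \<in> borel_measurable flips_from"
  shows "(\<integral>\<^sup>+\<omega>. f \<omega> \<partial>flips_from) =
    (\<integral>\<^sup>+\<omega>. f (case_nat True \<omega>) \<partial>flips_from) / 2 + (\<integral>\<^sup>+\<omega>. f (case_nat False \<omega>) \<partial>flips_from) / 2"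
proof -
  interpret sequence_space "measure_pmf (bernoulli_pmf (1 / 2))" by unfold_locales
  interpret F: prob_space flips_from by (rule prob_space_flips)
  let ?b = "measure_pmf (bernoulli_pmf (1 / 2))"
  have it: "distr (?b \<Otimes>\<^sub>M flips_from) flips_from (\<lambda>(s, \<omega>). case_nat s \<omega>) = flips_from"
    using PiM_iter by (simp add: flips_from_def)
  have m: "(\<lambda>(s, \<omega>). case_nat s \<omega>) \<in> ?b \<Otimes>\<^sub>M flips_from \<rightarrow>\<^sub>M flips_from"
  proof (rule measurable_into_flips_from)
    fix i show "(\<lambda>w. (case w of (s, \<omega>) \<Rightarrow> case_nat s \<omega>) i) \<in> ?b \<Otimes>\<^sub>M flips_from \<rightarrow>\<^sub>M count_space UNIV"
      by (cases i) (simp_all add: case_prod_beta')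
  qed
  have "(\<integral>\<^sup>+\<omega>. f \<omega> \<partial>flips_from) = (\<integral>\<^sup>+w. f (case w of (s, \<omega>) \<Rightarrow> case_nat s \<omega>) \<partial>(?b \<Otimes>\<^sub>M flips_from))"
    using nn_integral_distr[OF m, of f] f by (simp add: it)
  also have "\<dots> = (\<integral>\<^sup>+s. \<integral>\<^sup>+\<omega>. f (case_nat s \<omega>) \<partial>flips_from \<partial>?b)"
    using F.nn_integral_fst[OF measurable_compose[OF m f]] by simp
  finally show ?thesis unfolding ennreal_half by (simp add: mult.commute)
qed

text \<open>
  Edge \<open>i\<close> joins the points \<open>i\<close> and \<open>i + 1\<close>. If the points are distinct, only these two can move to its midpoint, so
  after the move the midpoint carries a point if and only if the left end moves right or the right
  end moves left.
\<close>

definition occ :: "(int \<Rightarrow> bool) \<Rightarrow> int \<Rightarrow> bool" where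
  "occ r i \<longleftrightarrow> r i \<or> \<not> r (i + 1)"

text \<open>
  If edge \<open>j + 1\<close> is unoccupied, point \<open>j + 2\<close> moves right and thereby occupies edge \<open>j + 2\<close>. Hence at most one
  edge in a row is missing.
\<close>

definition next_occ :: "(int \<Rightarrow> bool) \<Rightarrow> int \<Rightarrow> int" where
  "next_occ r j = (if occ r (j + 1) then j + 1 else j + 2)"

definition prev_occ :: "(int \<Rightarrow> bool) \<Rightarrow> int \<Rightarrow> int" where
  "prev_occ r j = (if occ r (j - 1) then j - 1 else j - 2)"

text \<open>
  The enumeration of the occupied edges, when edge \<open>0\<close> is occupied and gets index \<open>0\<close>.
\<close>

definition occs :: "(int \<Rightarrow> bool) \<Rightarrow> int \<Rightarrow> int" where
  "occs r k = (if 0 \<le> k then (next_occ r ^^ nat k) 0 else (prev_occ r ^^ nat (- k)) 0)"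

text \<open>
  Between the occupied edges with indices \<open>k\<close> and \<open>k + 1\<close> an unoccupied edge is passed over.
\<close>

definition skip :: "(int \<Rightarrow> bool) \<Rightarrow> int \<Rightarrow> bool" where
  "skip r k \<longleftrightarrow> \<not> occ r (occs r k + 1)"

lemma occ_next: "occ r (next_occ r j)"
  by (auto simp: next_occ_def occ_def add.assoc)

lemma occ_prev: "occ r j \<Longrightarrow> occ r (prev_occ r j)"
  by (auto simp: prev_occ_def occ_def)

lemma next_prev: "occ r j \<Longrightarrow> next_occ r (prev_occ r j) = j"
  by (auto simp: next_occ_def prev_occ_def)

lemma prev_next: "occ r j \<Longrightarrow> prev_occ r (next_occ r j) = j"
  by (auto simp: next_occ_def prev_occ_def add.commute)

lemma occs_0 [simp]: "occs r 0 = 0" by (simp add: occs_def)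

lemma occ_occs: assumes "occ r 0" shows "occ r (occs r k)"
proof -
  have "occ r ((next_occ r ^^ n) 0)" for n using assms by (cases n) (simp_all add: occ_next)
  moreover have "occ r ((prev_occ r ^^ n) 0)" for n using assms by (induction n) (simp_all add: occ_prev)
  ultimately show ?thesis by (simp add: occs_def)
qed

lemma occs_step: assumes "occ r 0" shows "occs r (k + 1) = next_occ r (occs r k)"
proof (cases "0 \<le> k")
  case True
  then have "nat (k + 1) = Suc (nat k)" by simp
  then show ?thesis using True by (simp add: occs_def)
next
  case False
  define n where "n = nat (- k - 1)"
  have k: "nat (- k) = Suc n" "k + 1 = - int n" using False by (auto simp: n_def)
  have "occ r ((prev_occ r ^^ n) 0)" using assms by (induction n) (simp_all add: occ_prev)
  then have "next_occ r (occs r k) = (prev_occ r ^^ n) 0"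
    using False k(1) by (simp add: occs_def next_prev)
  also have "\<dots> = occs r (k + 1)" unfolding k(2) by (cases "n = 0") (simp_all add: occs_def)
  finally show ?thesis by simp
qed

lemma occs_step_skip: "occ r 0 \<Longrightarrow> occs r (k + 1) = occs r k + (if skip r k then 2 else 1)"
  by (simp add: occs_step skip_def next_occ_def)

lemma occs_strict_mono: assumes "occ r 0" shows "strict_mono (occs r)"
proof (rule strict_monoI)
  fix a b :: int assume "a < b"
  then show "occs r a < occs r b"
    by (induction rule: int_gr_induct) (auto simp: occs_step_skip[OF assms])
qed

lemma occs_unique:
  assumes r: "occ r 0" and s0: "s 0 = 0" and st: "\<And>j. s (j + 1) = next_occ r (s j)" and oc: "\<And>j. occ r (s j)"
  shows "s = occs r"
proof
  fix j
  show "s j = occs r j"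
  proof (induction j rule: int_induct[of _ 0])
    case (step2 i)
    have "s (i - 1) = prev_occ r (s i)" using prev_next[OF oc[of "i - 1"]] st[of "i - 1"] by simp
    moreover have "occs r (i - 1) = prev_occ r (occs r i)"
      using prev_next[OF occ_occs[OF r, of "i - 1"]] occs_step[OF r, of "i - 1"] by simp
    ultimately show ?case using step2 by simp
  qed (simp_all add: s0 st occs_step[OF r])
qed

definition palm_shift :: "(int \<Rightarrow> bool) \<Rightarrow> int \<Rightarrow> bool" where
  "palm_shift r = shift_flips (occs r 1) r"

lemma occ_shift: "occ (shift_flips d r) i = occ r (d + i)" by (simp add: occ_def add.assoc)

lemma next_occ_shift: "next_occ (shift_flips d r) j = next_occ r (d + j) - d"
  by (auto simp: next_occ_def occ_shift add.assoc)

lemma occ_palm_shift: "occ r 0 \<Longrightarrow> occ (palm_shift r) 0"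
  by (simp add: palm_shift_def occ_shift occ_occs)

lemma occs_palm_shift:
  assumes r: "occ r 0" shows "occs (palm_shift r) j = occs r (1 + j) - occs r 1"
proof -
  have "(\<lambda>j. occs r (1 + j) - occs r 1) = occs (palm_shift r)"
  proof (rule occs_unique[OF occ_palm_shift[OF r]])
    fix j
    show "occs r (1 + (j + 1)) - occs r 1 = next_occ (palm_shift r) (occs r (1 + j) - occs r 1)"
      unfolding palm_shift_def next_occ_shift using occs_step[OF r, of "1 + j"] by (simp add: algebra_simps)
    show "occ (palm_shift r) (occs r (1 + j) - occs r 1)"
      by (simp add: palm_shift_def occ_shift occ_occs[OF r])
  qed simp
  then show ?thesis by metis
qed

lemma skip_palm_shift: "occ r 0 \<Longrightarrow> skip (palm_shift r) k = skip r (1 + k)"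
  unfolding skip_def occs_palm_shift by (simp add: palm_shift_def occ_shift add.assoc)

lemma occs_1: "occs r 1 = (if occ r 1 then 1 else 2)"
  by (simp add: occs_def next_occ_def)

lemma skip_0: "skip r 0 \<longleftrightarrow> \<not> occ r 1" by (simp add: skip_def)

lemma measurable_occ [measurable]: "Measurable.pred flips (\<lambda>r. occ r i)"
  unfolding occ_def by measurable

lemma measurable_occs [measurable]: "(\<lambda>r. occs r k) \<in> flips \<rightarrow>\<^sub>M count_space UNIV"
proof -
  have n: "(\<lambda>r. (next_occ r ^^ n) 0) \<in> flips \<rightarrow>\<^sub>M count_space UNIV" for n
  proof (induction n)
    case (Suc n)
    have "(\<lambda>r. next_occ r j) \<in> flips \<rightarrow>\<^sub>M count_space UNIV" for j unfolding next_occ_def by measurable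
    then show ?case using Suc by (simp add: measurable_compose_countable)
  qed simp
  have p: "(\<lambda>r. (prev_occ r ^^ n) 0) \<in> flips \<rightarrow>\<^sub>M count_space UNIV" for n
  proof (induction n)
    case (Suc n)
    have "(\<lambda>r. prev_occ r j) \<in> flips \<rightarrow>\<^sub>M count_space UNIV" for j unfolding prev_occ_def by measurable
    then show ?case using Suc by (simp add: measurable_compose_countable)
  qed simp
  show ?thesis unfolding occs_def using n p by (cases "0 \<le> k") simp_all
qed

lemma measurable_skip [measurable]: "Measurable.pred flips (\<lambda>r. skip r k)"
proof -
  have "Measurable.pred flips (\<lambda>r. occ r (occs r k + 1))"
    by (rule measurable_compose_countable[where f = "\<lambda>j r. occ r (j + 1)"]) measurable
  then show ?thesis unfolding skip_def by measurable
qed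

lemma measurable_palm_shift [measurable]: "palm_shift \<in> flips \<rightarrow>\<^sub>M flips"
  unfolding palm_shift_def[abs_def]
  by (rule measurable_compose_countable[where f = shift_flips]) measurable

text \<open>
  A typical point of the new process is the midpoint of a typical occupied edge, so the Palm law of the
  coins is the fair one conditioned on edge \<open>0\<close> being occupied.
\<close>

definition palm_flips :: "(int \<Rightarrow> bool) measure" where
  "palm_flips = uniform_measure flips {r. occ r 0}"

lemma sets_palm_flips [simp, measurable_cong]: "sets palm_flips = sets flips"
  by (simp add: palm_flips_def)

lemma space_palm_flips [simp]: "space palm_flips = UNIV"
  by (simp add: palm_flips_def)

lemma measurable_palm_flips [simp]: "measurable palm_flips N = measurable flips N"
  by (rule measurable_cong_sets) simp_all

lemma occ_sets: "{r. occ r 0} \<in> sets flips"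
proof -
  have "{r \<in> space flips. occ r 0} \<in> sets flips" using measurable_occ unfolding Measurable.pred_def .
  then show ?thesis by simp
qed

lemma emeasure_occ: "emeasure flips {r. occ r 0} = ennreal (3 / 4)"
proof -
  interpret F: prob_space flips_from by (rule prob_space_flips)
  define f :: "(nat \<Rightarrow> bool) \<Rightarrow> ennreal" where "f \<omega> = of_bool (\<omega> 0 \<or> \<not> \<omega> 1)" for \<omega>
  have f: "f \<in> borel_measurable flips_from" unfolding f_def by measurable
  have "emeasure flips {r. occ r 0} = (\<integral>\<^sup>+r. indicator {r. occ r 0} r \<partial>flips)" using occ_sets by simp
  also have "\<dots> = (\<integral>\<^sup>+r. f (\<lambda>n. r (int n)) \<partial>flips)"
    by (intro nn_integral_cong) (simp add: f_def occ_def indicator_def)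
  also have "\<dots> = 1 / 2 + (\<integral>\<^sup>+\<omega>. of_bool (\<not> \<omega> 0) \<partial>flips_from) / 2"
    unfolding nn_integral_forward[OF f] nn_integral_first_flip[OF f] by (simp add: f_def F.emeasure_space_1[simplified])
  also have "(\<integral>\<^sup>+\<omega>. of_bool (\<not> \<omega> 0) \<partial>flips_from) = (1 / 2 :: ennreal)"
    by (subst nn_integral_first_flip) (simp_all add: F.emeasure_space_1[simplified])
  also have "1 / 2 + 1 / 2 / 2 = ennreal (3 / 4)"
  proof -
    have "ennreal (1 / 2) + ennreal (1 / 2) * ennreal (1 / 2) = ennreal (3 / 4)"
      using ennreal_plus[of "1 / 2" "1 / 4"] ennreal_mult[of "1 / 2" "1 / 2"] by (simp del: ennreal_plus)
    then show ?thesis unfolding ennreal_half by (simp only: mult_1_right)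
  qed
  finally show ?thesis .
qed

lemma prob_space_palm_flips: "prob_space palm_flips"
  unfolding palm_flips_def by (rule prob_space_uniform_measure) (simp_all add: emeasure_occ)

lemma AE_palm_flips: "AE r in palm_flips. occ r 0"
  unfolding palm_flips_def by (rule AE_uniform_measureI) (simp_all add: occ_sets)

lemma nn_integral_palm_flips:
  assumes "f \<in> borel_measurable flips"
  shows "(\<integral>\<^sup>+r. f r \<partial>palm_flips) = ennreal (4 / 3) * (\<integral>\<^sup>+r. of_bool (occ r 0) * f r \<partial>flips)"
proof -
  have "(\<integral>\<^sup>+r. f r \<partial>palm_flips) = (\<integral>\<^sup>+r. f r * indicator {r. occ r 0} r \<partial>flips) / ennreal (3 / 4)"
    unfolding palm_flips_def by (subst nn_integral_uniform_measure[OF assms occ_sets]) (simp only: emeasure_occ)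
  also have "(\<integral>\<^sup>+r. f r * indicator {r. occ r 0} r \<partial>flips) = (\<integral>\<^sup>+r. of_bool (occ r 0) * f r \<partial>flips)"
    by (intro nn_integral_cong) (simp add: indicator_def)
  finally show ?thesis by (simp add: divide_ennreal_def inverse_ennreal mult.commute)
qed

text \<open>
  The next occupied edge is at distance one or two. Shifting back in each of these two cases turns the
  event into a statement about the previous edge, and the two resulting events partition the event
  that edge \<open>0\<close> is occupied.
\<close>

lemma nn_integral_palm_shift:
  assumes f [measurable]: "f \<in> borel_measurable flips"
  shows "(\<integral>\<^sup>+r. f (palm_shift r) \<partial>palm_flips) = (\<integral>\<^sup>+r. f r \<partial>palm_flips)"
proof -
  have f': "(\<lambda>r. f (palm_shift r)) \<in> borel_measurable flips" by measurable
  have fs: "(\<lambda>r. f (shift_flips d r)) \<in> borel_measurable flips" for d by measurable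
  \<comment> \<open>If edge \<open>1\<close> is unoccupied, edge \<open>0\<close> is occupied, so its occupation need not be recorded in the second summand.\<close>
  have "(\<integral>\<^sup>+r. of_bool (occ r 0) * f (palm_shift r) \<partial>flips) =
    (\<integral>\<^sup>+r. of_bool (occ r 0 \<and> occ r 1) * f (shift_flips 1 r) + of_bool (\<not> occ r 1) * f (shift_flips 2 r) \<partial>flips)"
    by (intro nn_integral_cong) (auto simp: palm_shift_def occs_1 occ_def)
  also have "\<dots> = (\<integral>\<^sup>+r. of_bool (occ r 0 \<and> occ r 1) * f (shift_flips 1 r) \<partial>flips) + (\<integral>\<^sup>+r. of_bool (\<not> occ r 1) * f (shift_flips 2 r) \<partial>flips)"
    by (rule nn_integral_add; intro borel_measurable_times_ennreal fs; measurable)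
  also have "(\<integral>\<^sup>+r. of_bool (occ r 0 \<and> occ r 1) * f (shift_flips 1 r) \<partial>flips) =
     (\<integral>\<^sup>+r. of_bool (occ r (- 1) \<and> occ r 0) * f r \<partial>flips)"
  proof -
    have "(\<lambda>r. of_bool (occ r (- 1) \<and> occ r 0) * f r) \<in> borel_measurable flips"
      by (intro borel_measurable_times_ennreal f) measurable
    from nn_integral_shift[OF this, of 1] show ?thesis by (simp add: occ_shift)
  qed
  also have "(\<integral>\<^sup>+r. of_bool (\<not> occ r 1) * f (shift_flips 2 r) \<partial>flips) =
     (\<integral>\<^sup>+r. of_bool (\<not> occ r (- 1)) * f r \<partial>flips)"
  proof -
    have "(\<lambda>r. of_bool (\<not> occ r (- 1)) * f r) \<in> borel_measurable flips"
      by (intro borel_measurable_times_ennreal f) measurable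
    from nn_integral_shift[OF this, of 2] show ?thesis by (simp add: occ_shift)
  qed
  also have "(\<integral>\<^sup>+r. of_bool (occ r (- 1) \<and> occ r 0) * f r \<partial>flips) + (\<integral>\<^sup>+r. of_bool (\<not> occ r (- 1)) * f r \<partial>flips) =
    (\<integral>\<^sup>+r. of_bool (occ r (- 1) \<and> occ r 0) * f r + of_bool (\<not> occ r (- 1)) * f r \<partial>flips)"
    by (rule nn_integral_add[symmetric]; intro borel_measurable_times_ennreal f; measurable)
  also have "\<dots> = (\<integral>\<^sup>+r. of_bool (occ r 0) * f r \<partial>flips)"
    by (intro nn_integral_cong) (auto simp: occ_def)
  finally show ?thesis unfolding nn_integral_palm_flips[OF f] nn_integral_palm_flips[OF f'] by simp
qed

section \<open>Exponential bounds for the skipped edges\<close>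

text \<open>
  The usual inequality behind sub-Gaussian bounds for centred variables: the linear term has mean zero
  and the remainder depends on the square only.
\<close>

lemma exp_le_add_exp_square: "exp x \<le> x + exp (x\<^sup>2)" for x :: real
proof -
  have sq: "1 + x\<^sup>2 \<le> exp (x\<^sup>2)" by (rule exp_ge_add_one_self)
  consider "1 < x" | "0 \<le> x" "x \<le> 1" | "- 1 \<le> x" "x < 0" | "x < - 1" by linarith
  then show ?thesis
  proof cases
    case 1
    then have "x \<le> x\<^sup>2" by (simp add: power2_eq_square)
    then have "exp x \<le> exp (x\<^sup>2)" by simp
    then show ?thesis using 1 by linarith
  next
    case 2
    then show ?thesis using exp_bound[of x] sq by linarith
  next
    case 3
    define y where "y = - x"
    have y: "0 < y" "y \<le> 1" using 3 by (auto simp: y_def)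
    have e: "1 + y + y\<^sup>2 / 2 \<le> exp y" using exp_lower_Taylor_quadratic[of y] y by simp
    have p: "0 \<le> 1 - y + y\<^sup>2" using y by (simp add: add_nonneg_nonneg)
    have "1 \<le> 1 + y\<^sup>2 / 2 + y ^ 3 / 2 + y ^ 4 / 2" using y by simp
    also have "\<dots> = (1 - y + y\<^sup>2) * (1 + y + y\<^sup>2 / 2)" by (simp add: power2_eq_square power3_eq_cube power4_eq_xxxx field_simps)
    also have "\<dots> \<le> (1 - y + y\<^sup>2) * exp y" using e p by (rule mult_left_mono)
    finally have "exp (- y) \<le> 1 - y + y\<^sup>2" by (simp add: exp_minus field_simps)
    then have "exp x \<le> 1 + x + x\<^sup>2" by (simp add: y_def)
    then show ?thesis using sq by linarith
  next
    case 4
    have "exp x \<le> 1" using 4 by simp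
    moreover have "0 \<le> x + x\<^sup>2"
      using mult_nonpos_nonpos[of x "1 + x"] 4 by (simp add: power2_eq_square algebra_simps)
    ultimately show ?thesis using sq by linarith
  qed
qed

text \<open>
  The skips, revealed from left to right, form a Markov chain whose state is the first coin not yet used.
  A coin that points right never starts a skip. After one that points left the next coin decides: if
  it points right there is a skip and two coins are used up, otherwise there is no skip and this coin
  is the new state. The second eigenvalue of the chain is \<open>1 / 2 + 3 / 4 - 1 = 1 / 4\<close>, which is the discount factor.
\<close>

fun discounted :: "real list \<Rightarrow> real" where
  "discounted [] = 0"
| "discounted (a # as) = a + discounted as / 4"

definition sum_sq :: "real list \<Rightarrow> real" where "sum_sq as = (\<Sum>a\<leftarrow>as. a\<^sup>2)"

text \<open>
  The exponent that survives the induction. The subtracted square pays for the last step, where the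
  initial state is averaged out.
\<close>

definition log_bound :: "real list \<Rightarrow> real" where
  "log_bound as = 2 * sum_sq as - 2 / 3 * (discounted as)\<^sup>2"

text \<open>
  The conditional mean of the centred weighted number of skips, given that the first coin is \<open>s\<close>. The
  state is \<open>False\<close> with stationary probability \<open>2 / 3\<close>, under which the potential has mean zero.
\<close>

definition potential :: "real list \<Rightarrow> bool \<Rightarrow> real" where
  "potential as s = discounted as / 2 * (of_bool (\<not> s) - 2 / 3)"

lemma log_bound_Cons: "log_bound as + (a\<^sup>2 + (discounted as)\<^sup>2) / 2 \<le> log_bound (a # as)"
proof -
  define A where "A = discounted as"
  \<comment> \<open>Completing the square.\<close>
  have "log_bound (a # as) - log_bound as - (a\<^sup>2 + A\<^sup>2) / 2 = (a - A / 2)\<^sup>2 / 3 + a\<^sup>2 / 2 + A\<^sup>2 / 24"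
    by (simp add: log_bound_def sum_sq_def A_def[symmetric] power2_eq_square field_simps)
  also have "\<dots> \<ge> 0" by simp
  finally show ?thesis unfolding A_def by linarith
qed

lemma square_sum_bound: "(p * a + q * b)\<^sup>2 \<le> 2 * p\<^sup>2 * a\<^sup>2 + 2 * q\<^sup>2 * b\<^sup>2" for a b p q :: real
proof -
  have "0 \<le> (p * a - q * b)\<^sup>2" by simp
  then show ?thesis by (simp add: power2_eq_square algebra_simps)
qed

text \<open>
  One step of the chain from a coin pointing right. After the potential has been split off, the
  exponents are centred and their squares are at most the increment of the bound.
\<close>

lemma right_step:
  "exp (- a / 3) * (exp (potential as True + log_bound as) + exp (potential as False + log_bound as)) / 2
     \<le> exp (potential (a # as) True + log_bound (a # as))"
proof -
  define A where "A = discounted as"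
  have "exp (- A / 4) + exp (A / 4) \<le> (- A / 4 + exp ((- A / 4)\<^sup>2)) + (A / 4 + exp ((A / 4)\<^sup>2))"
    by (intro add_mono exp_le_add_exp_square)
  also have "\<dots> = 2 * exp (A\<^sup>2 / 16)" by (simp add: power2_eq_square)
  also have "\<dots> \<le> 2 * exp ((a\<^sup>2 + A\<^sup>2) / 2)"
    using zero_le_power2[of a] zero_le_power2[of A] by (simp add: field_simps)
  finally have b: "(exp (- A / 4) + exp (A / 4)) / 2 \<le> exp ((a\<^sup>2 + A\<^sup>2) / 2)" by simp
  have e: "- a / 3 + (potential as True + log_bound as) = potential (a # as) True + log_bound as + - A / 4"
    "- a / 3 + (potential as False + log_bound as) = potential (a # as) True + log_bound as + A / 4"
    by (simp_all add: potential_def A_def field_simps)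
  have "exp (- a / 3) * exp (potential as True + log_bound as) = exp (potential (a # as) True + log_bound as) * exp (- A / 4)"
    "exp (- a / 3) * exp (potential as False + log_bound as) = exp (potential (a # as) True + log_bound as) * exp (A / 4)"
    by (simp_all only: exp_add[symmetric] e)
  then have "exp (- a / 3) * (exp (potential as True + log_bound as) + exp (potential as False + log_bound as)) / 2
     = exp (potential (a # as) True + log_bound as) * ((exp (- A / 4) + exp (A / 4)) / 2)"
    by (simp only: distrib_left times_divide_eq_right)
  also have "\<dots> \<le> exp (potential (a # as) True + log_bound as) * exp ((a\<^sup>2 + A\<^sup>2) / 2)"
    using b by (intro mult_left_mono) auto
  also have "\<dots> \<le> exp (potential (a # as) True + log_bound (a # as))"
    using log_bound_Cons[of as a] by (simp add: A_def flip: exp_add)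
  finally show ?thesis .
qed

text \<open>
  The same for a coin pointing left, with three outcomes of probabilities \<open>1 / 4\<close>, \<open>1 / 4\<close>, \<open>1 / 2\<close>: a skip followed
  by either state, or no skip.
\<close>

lemma left_step:
  "exp (2 * a / 3) * (exp (potential as True + log_bound as) + exp (potential as False + log_bound as)) / 4
     + exp (- a / 3) * exp (potential as False + log_bound as) / 2
     \<le> exp (potential (a # as) False + log_bound (a # as))"
proof -
  define A where "A = discounted as"
  define B where "B = (a\<^sup>2 + A\<^sup>2) / 2"
  have "2 * (- 1 / 2)\<^sup>2 * a\<^sup>2 + 2 * (1 / 8)\<^sup>2 * A\<^sup>2 \<le> B" "2 * (1 / 2)\<^sup>2 * a\<^sup>2 + 2 * (1 / 8)\<^sup>2 * A\<^sup>2 \<le> B"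
    "2 * (1 / 2)\<^sup>2 * a\<^sup>2 + 2 * (- 3 / 8)\<^sup>2 * A\<^sup>2 \<le> B"
    using zero_le_power2[of A] by (simp_all add: B_def power2_eq_square)
  then have sq: "(- 1 / 2 * a + 1 / 8 * A)\<^sup>2 \<le> B" "(1 / 2 * a + 1 / 8 * A)\<^sup>2 \<le> B" "(1 / 2 * a + - 3 / 8 * A)\<^sup>2 \<le> B"
    by (meson order_trans square_sum_bound)+
  have e: "exp x \<le> x + exp B" if "x\<^sup>2 \<le> B" for x
    using exp_le_add_exp_square[of x] that by (meson add_left_mono exp_le_cancel_iff order_trans)
  have "exp (- 1 / 2 * a + 1 / 8 * A) / 2 + exp (1 / 2 * a + 1 / 8 * A) / 4 + exp (1 / 2 * a + - 3 / 8 * A) / 4 \<le> exp B"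
    using e[OF sq(1)] e[OF sq(2)] e[OF sq(3)] by simp
  then have b: "exp (- a / 2 + A / 8) / 2 + exp (a / 2 + A / 8) / 4 + exp (a / 2 - 3 * A / 8) / 4 \<le> exp B"
    by (simp add: algebra_simps)
  define E where "E = potential (a # as) False + log_bound as"
  have ex: "2 * a / 3 + (potential as True + log_bound as) = E + (a / 2 - 3 * A / 8)"
    "2 * a / 3 + (potential as False + log_bound as) = E + (a / 2 + A / 8)"
    "- a / 3 + (potential as False + log_bound as) = E + (- a / 2 + A / 8)"
    by (simp_all add: E_def potential_def A_def field_simps)
  have "exp (2 * a / 3) * exp (potential as True + log_bound as) = exp E * exp (a / 2 - 3 * A / 8)"
    "exp (2 * a / 3) * exp (potential as False + log_bound as) = exp E * exp (a / 2 + A / 8)"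
    "exp (- a / 3) * exp (potential as False + log_bound as) = exp E * exp (- a / 2 + A / 8)"
    by (simp_all only: exp_add[symmetric] ex)
  then have "exp (2 * a / 3) * (exp (potential as True + log_bound as) + exp (potential as False + log_bound as)) / 4
     + exp (- a / 3) * exp (potential as False + log_bound as) / 2
     = exp E * (exp (- a / 2 + A / 8) / 2 + exp (a / 2 + A / 8) / 4 + exp (a / 2 - 3 * A / 8) / 4)"
    by (simp only: distrib_left times_divide_eq_right add_divide_distrib)
  also have "\<dots> \<le> exp (potential (a # as) False + log_bound as) * exp B"
    using b unfolding E_def by (intro mult_left_mono) auto
  also have "\<dots> \<le> exp (potential (a # as) False + log_bound (a # as))"
    using log_bound_Cons[of as a] by (simp add: A_def B_def flip: exp_add)
  finally show ?thesis .
qed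

lemma start_step:
  "exp (potential as True + log_bound as) / 3 + 2 / 3 * exp (potential as False + log_bound as) \<le> exp (2 * sum_sq as)"
proof -
  define A where "A = discounted as"
  have e: "exp x \<le> x + exp (2 / 3 * A\<^sup>2)" if "x\<^sup>2 \<le> 2 / 3 * A\<^sup>2" for x
    using exp_le_add_exp_square[of x] that by (meson add_left_mono exp_le_cancel_iff order_trans)
  have "exp (- A / 3) / 3 + 2 / 3 * exp (A / 6) \<le> exp (2 / 3 * A\<^sup>2)"
    using e[of "- A / 3"] e[of "A / 6"] zero_le_power2[of A] by (simp add: power_divide)
  then have "exp (log_bound as) * (exp (- A / 3) / 3 + 2 / 3 * exp (A / 6)) \<le> exp (log_bound as) * exp (2 / 3 * A\<^sup>2)"
    by (intro mult_left_mono) auto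
  then show ?thesis
    by (simp add: log_bound_def potential_def A_def[symmetric] field_simps flip: exp_add)
qed

text \<open>
  The weighted sum of the centred skip indicators, read off the coins from left to right. A skip consumes two
  coins, and skips have mean \<open>1 / 3\<close>.
\<close>

fun skip_sum :: "real list \<Rightarrow> (nat \<Rightarrow> bool) \<Rightarrow> real" where
  "skip_sum [] \<omega> = 0"
| "skip_sum (a # as) \<omega> =
     (if \<not> \<omega> 0 \<and> \<omega> 1 then 2 * a / 3 + skip_sum as (\<lambda>n. \<omega> (n + 2)) else - a / 3 + skip_sum as (\<lambda>n. \<omega> (n + 1)))"

lemma measurable_drop: "(\<lambda>\<omega> n. \<omega> (n + d)) \<in> flips_from \<rightarrow>\<^sub>M flips_from"
  by (rule measurable_into_flips_from) (rule measurable_flip)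

lemma skip_sum_measurable [measurable]: "skip_sum as \<in> borel_measurable flips_from"
proof (induction as)
  case (Cons a as)
  have "(\<lambda>\<omega>. skip_sum as (\<lambda>n. \<omega> (n + d))) \<in> borel_measurable flips_from" for d
    by (rule measurable_compose[OF measurable_drop Cons])
  note this[measurable]
  have "(\<lambda>\<omega>. if \<not> \<omega> 0 \<and> \<omega> 1 then 2 * a / 3 + skip_sum as (\<lambda>n. \<omega> (n + 2)) else - a / 3 + skip_sum as (\<lambda>n. \<omega> (n + 1)))
    \<in> borel_measurable flips_from" by measurable
  then show ?case by (simp add: skip_sum.simps[abs_def])
qed simp

lemma ennreal_linear:
  assumes "0 \<le> c" "0 \<le> p" "0 \<le> q" "0 \<le> u" "0 \<le> v"
  shows "ennreal c * (ennreal p * ennreal u + ennreal q * ennreal v) = ennreal (c * (p * u + q * v))"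
  using assms by (simp add: ennreal_mult ennreal_plus)

lemma ennreal_linear':
  assumes "0 \<le> c" "0 \<le> p" "0 \<le> q" "0 \<le> u" "0 \<le> v"
  shows "ennreal p * ennreal u + ennreal q * (ennreal c * ennreal v) = ennreal (p * u + q * (c * v))"
  using assms by (simp add: ennreal_mult ennreal_plus)

lemma ennreal_linear'':
  assumes "0 \<le> c" "0 \<le> p" "0 \<le> u" "0 \<le> v"
  shows "ennreal c * (ennreal p * (ennreal p * ennreal u + ennreal p * ennreal v) + ennreal p * (ennreal p * ennreal v)) =
    ennreal (c * (p * (p * u + p * v) + p * (p * v)))"
  using assms by (simp add: ennreal_mult ennreal_plus)

lemma skip_sum_exp_bound:
  "(\<integral>\<^sup>+\<omega>. ennreal (exp (skip_sum as (case_nat s \<omega>))) \<partial>flips_from) \<le> ennreal (exp (potential as s + log_bound as))"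
proof (induction as arbitrary: s)
  case Nil
  interpret prob_space flips_from by (rule prob_space_flips)
  show ?case by (simp add: potential_def log_bound_def sum_sq_def emeasure_space_1[simplified])
next
  case (Cons a as)
  define g where "g s = (\<integral>\<^sup>+\<omega>. ennreal (exp (skip_sum as (case_nat s \<omega>))) \<partial>flips_from)" for s
  define E where "E s = exp (potential as s + log_bound as)" for s
  have gE: "g s \<le> ennreal (E s)" for s unfolding g_def E_def by (rule Cons)
  have meas: "(\<lambda>\<omega>. ennreal (exp (skip_sum as \<omega>))) \<in> borel_measurable flips_from" by measurable
  have meas': "(\<lambda>\<omega>. ennreal (exp (skip_sum (a # as) (case_nat s \<omega>)))) \<in> borel_measurable flips_from" for s
    using measurable_compose[OF measurable_case_nat_flips, of "\<lambda>\<omega>. ennreal (exp (skip_sum (a # as) \<omega>))"] by measurable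
  have base: "(\<integral>\<^sup>+\<omega>. ennreal (exp (c + skip_sum as \<omega>)) \<partial>flips_from) = ennreal (exp c) * (g True / 2 + g False / 2)" for c
  proof -
    have "(\<integral>\<^sup>+\<omega>. ennreal (exp (c + skip_sum as \<omega>)) \<partial>flips_from) = ennreal (exp c) * (\<integral>\<^sup>+\<omega>. ennreal (exp (skip_sum as \<omega>)) \<partial>flips_from)"
      using meas by (subst nn_integral_cmult[symmetric]) (simp_all add: exp_add ennreal_mult)
    then show ?thesis unfolding nn_integral_first_flip[OF meas] g_def by simp
  qed
  have avg: "ennreal (exp c) * (g True / 2 + g False / 2) \<le> ennreal (exp c * (E True + E False) / 2)" for c
  proof -
    have "ennreal (exp c) * (g True / 2 + g False / 2) \<le> ennreal (exp c) * (ennreal (1/2) * ennreal (E True) + ennreal (1/2) * ennreal (E False))"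
      unfolding ennreal_half by (intro mult_left_mono add_mono gE) auto
    also have "\<dots> = ennreal (exp c * (1 / 2 * E True + 1 / 2 * E False))"
      by (rule ennreal_linear) (simp_all add: E_def)
    also have "exp c * (1 / 2 * E True + 1 / 2 * E False) = exp c * (E True + E False) / 2" by (simp add: field_simps)
    finally show ?thesis .
  qed
  show ?case
  proof (cases s)
    case True
    have "(\<integral>\<^sup>+\<omega>. ennreal (exp (skip_sum (a # as) (case_nat True \<omega>))) \<partial>flips_from) =
       (\<integral>\<^sup>+\<omega>. ennreal (exp (- a / 3 + skip_sum as \<omega>)) \<partial>flips_from)" by simp
    also have "\<dots> \<le> ennreal (exp (- a / 3) * (E True + E False) / 2)" unfolding base by (rule avg)
    also have "\<dots> \<le> ennreal (exp (potential (a # as) True + log_bound (a # as)))"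
      unfolding E_def by (intro ennreal_leI right_step)
    finally show ?thesis using True by simp
  next
    case False
    have 1: "skip_sum (a # as) (case_nat False (case_nat True \<omega>)) = 2 * a / 3 + skip_sum as \<omega>" for \<omega>
      by (simp add: numeral_2_eq_2)
    have 2: "skip_sum (a # as) (case_nat False (case_nat False \<omega>)) = - a / 3 + skip_sum as (case_nat False \<omega>)" for \<omega>
      by simp
    have "(\<integral>\<^sup>+\<omega>. ennreal (exp (skip_sum (a # as) (case_nat False \<omega>))) \<partial>flips_from) =
      (\<integral>\<^sup>+\<omega>. ennreal (exp (2 * a / 3 + skip_sum as \<omega>)) \<partial>flips_from) / 2 +
      (\<integral>\<^sup>+\<omega>. ennreal (exp (- a / 3 + skip_sum as (case_nat False \<omega>))) \<partial>flips_from) / 2"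
      unfolding nn_integral_first_flip[OF meas'] 1 2 ..
    also have "(\<integral>\<^sup>+\<omega>. ennreal (exp (- a / 3 + skip_sum as (case_nat False \<omega>))) \<partial>flips_from) = ennreal (exp (- a / 3)) * g False"
    proof -
      have "ennreal (exp (- a / 3 + y)) = ennreal (exp (- a / 3)) * ennreal (exp y)" for y
        by (simp only: exp_add ennreal_mult exp_ge_zero)
      then show ?thesis
        using nn_integral_cmult[OF measurable_compose[OF measurable_case_nat_flips meas, of False], of "ennreal (exp (- a / 3))"]
        unfolding g_def by (simp only:)
    qed
    also have "(\<integral>\<^sup>+\<omega>. ennreal (exp (2 * a / 3 + skip_sum as \<omega>)) \<partial>flips_from) / 2 + ennreal (exp (- a / 3)) * g False / 2
      \<le> ennreal (1 / 2) * ennreal (exp (2 * a / 3) * (E True + E False) / 2) + ennreal (1 / 2) * (ennreal (exp (- a / 3)) * ennreal (E False))"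
      unfolding ennreal_half base by (intro add_mono mult_left_mono avg[unfolded ennreal_half] gE) auto
    also have "\<dots> = ennreal (1 / 2 * (exp (2 * a / 3) * (E True + E False) / 2) + 1 / 2 * (exp (- a / 3) * E False))"
      by (rule ennreal_linear') (simp_all add: E_def)
    also have "1 / 2 * (exp (2 * a / 3) * (E True + E False) / 2) + 1 / 2 * (exp (- a / 3) * E False) =
      exp (2 * a / 3) * (E True + E False) / 4 + exp (- a / 3) * E False / 2" by (simp add: field_simps)
    also have "\<dots> \<le> ennreal (exp (potential (a # as) False + log_bound (a # as)))"
      unfolding E_def by (intro ennreal_leI left_step)
    finally have "(\<integral>\<^sup>+\<omega>. ennreal (exp (skip_sum (a # as) (case_nat False \<omega>))) \<partial>flips_from)
      \<le> ennreal (exp (potential (a # as) False + log_bound (a # as)))" .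
    moreover have "s = False" using False by simp
    ultimately show ?thesis by (simp only:)
  qed
qed

lemma skip_sum_occs:
  assumes "occ r 0"
  shows "(\<Sum>k<length as. as ! k * (of_bool (skip r (int k)) - 1 / 3)) = skip_sum as (\<lambda>n. r (1 + int n))"
  using assms
proof (induction as arbitrary: r)
  case (Cons a as)
  have sk: "skip r (int (Suc k)) = skip (palm_shift r) (int k)" for k
    using skip_palm_shift[OF Cons.prems, of "int k"] by simp
  have "(\<Sum>k<length (a # as). (a # as) ! k * (of_bool (skip r (int k)) - 1 / 3)) =
     a * (of_bool (skip r 0) - 1 / 3) + (\<Sum>k<length as. as ! k * (of_bool (skip r (int (Suc k))) - 1 / 3))"
    by (simp only: length_Cons sum.lessThan_Suc_shift nth_Cons_0 nth_Cons_Suc of_nat_0)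
  also have "(\<Sum>k<length as. as ! k * (of_bool (skip r (int (Suc k))) - 1 / 3)) =
     skip_sum as (\<lambda>n. palm_shift r (1 + int n))"
    unfolding sk by (rule Cons.IH[OF occ_palm_shift[OF Cons.prems]])
  finally have eq: "(\<Sum>k<length (a # as). (a # as) ! k * (of_bool (skip r (int k)) - 1 / 3)) =
     a * (of_bool (skip r 0) - 1 / 3) + skip_sum as (\<lambda>n. palm_shift r (1 + int n))" .
  have o: "skip r 0 \<longleftrightarrow> \<not> r 1 \<and> r 2" by (simp add: skip_0 occ_def)
  show ?case
  proof (cases "skip r 0")
    case True
    then have "occs r 1 = 2" by (simp add: skip_0 occs_1)
    then show ?thesis unfolding eq using True o by (simp add: palm_shift_def add.assoc[symmetric] add.commute)
  next
    case False
    then have "occs r 1 = 1" by (simp add: skip_0 occs_1)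
    then show ?thesis unfolding eq using False o by (auto simp: palm_shift_def add.assoc[symmetric] add.commute)
  qed
qed simp

lemma palm_exp_bound_list:
  "(\<integral>\<^sup>+r. ennreal (exp (\<Sum>k<length as. as ! k * (of_bool (skip r (int k)) - 1 / 3))) \<partial>palm_flips)
     \<le> ennreal (exp (2 * sum_sq as))"
proof -
  \<comment> \<open>Edge \<open>0\<close> is occupied unless coin \<open>0\<close> points left and coin \<open>1\<close> points right; the skips depend on the coins from \<open>1\<close> on.\<close>
  define G where "G \<omega> = of_bool (\<omega> 0 \<or> \<not> \<omega> 1) * ennreal (exp (skip_sum as (\<lambda>n. \<omega> (n + 1))))" for \<omega>
  define g where "g s = (\<integral>\<^sup>+\<omega>. ennreal (exp (skip_sum as (case_nat s \<omega>))) \<partial>flips_from)" for s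
  define E where "E s = exp (potential as s + log_bound as)" for s
  have gE: "g s \<le> ennreal (E s)" for s unfolding g_def E_def by (rule skip_sum_exp_bound)
  have [measurable]: "(\<lambda>\<omega>. skip_sum as (\<lambda>n. \<omega> (n + 1))) \<in> borel_measurable flips_from"
    by (rule measurable_compose[OF measurable_drop skip_sum_measurable])
  have G: "G \<in> borel_measurable flips_from" unfolding G_def by measurable
  have m1: "(\<lambda>r. ennreal (exp (\<Sum>k<length as. as ! k * (of_bool (skip r (int k)) - 1 / 3)))) \<in> borel_measurable flips"
    by measurable
  have m2: "(\<lambda>\<omega>. ennreal (exp (skip_sum as \<omega>))) \<in> borel_measurable flips_from" by measurable
  have m3: "(\<lambda>\<omega>. of_bool (\<not> \<omega> 0) * ennreal (exp (skip_sum as \<omega>))) \<in> borel_measurable flips_from" by measurable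
  have "(\<integral>\<^sup>+r. ennreal (exp (\<Sum>k<length as. as ! k * (of_bool (skip r (int k)) - 1 / 3))) \<partial>palm_flips) =
     ennreal (4 / 3) * (\<integral>\<^sup>+r. G (\<lambda>n. r (int n)) \<partial>flips)"
    unfolding nn_integral_palm_flips[OF m1]
    by (intro arg_cong2[of _ _ _ _ "(*)"] nn_integral_cong refl) (auto simp: G_def occ_def skip_sum_occs add.commute)
  also have "(\<integral>\<^sup>+r. G (\<lambda>n. r (int n)) \<partial>flips) = (g True / 2 + g False / 2) / 2 + g False / 2 / 2"
    unfolding nn_integral_forward[OF G] nn_integral_first_flip[OF G]
    by (simp add: G_def nn_integral_first_flip[OF m2] nn_integral_first_flip[OF m3] g_def)
  also have "ennreal (4 / 3) * \<dots> \<le> ennreal (4 / 3) * (ennreal (1/2) * (ennreal (1/2) * ennreal (E True) + ennreal (1/2) * ennreal (E False)) + ennreal (1/2) * (ennreal (1/2) * ennreal (E False)))"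
    unfolding ennreal_half by (intro mult_left_mono add_mono gE) auto
  also have "\<dots> = ennreal (4 / 3 * (1 / 2 * (1 / 2 * E True + 1 / 2 * E False) + 1 / 2 * (1 / 2 * E False)))"
    by (rule ennreal_linear'') (simp_all add: E_def)
  also have "4 / 3 * (1 / 2 * (1 / 2 * E True + 1 / 2 * E False) + 1 / 2 * (1 / 2 * E False)) = E True / 3 + 2 / 3 * E False"
    by (simp add: field_simps)
  also have "\<dots> \<le> ennreal (exp (2 * sum_sq as))"
    unfolding E_def by (intro ennreal_leI start_step)
  finally show ?thesis .
qed

text \<open>
  Shift invariance moves the window to the origin, where the Markov chain bound applies.
\<close>

lemma palm_exp_bound:
  fixes c :: "int \<Rightarrow> real"
  shows "(\<integral>\<^sup>+r. ennreal (exp (\<Sum>k\<in>{m..<m + int n}. c k * (of_bool (skip r k) - 1 / 3))) \<partial>palm_flips)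
     \<le> ennreal (exp (2 * (\<Sum>k\<in>{m..<m + int n}. (c k)\<^sup>2)))"
proof -
  have reix: "(\<Sum>k\<in>{m + d..<m + d + int n}. f k) = (\<Sum>k\<in>{m..<m + int n}. f (k + d))" for m d and f :: "int \<Rightarrow> real"
    by (rule sum.reindex_bij_witness[of _ "\<lambda>k. k + d" "\<lambda>k. k - d"]) auto
  have step: "(\<integral>\<^sup>+r. ennreal (exp (\<Sum>k\<in>{m + 1..<m + 1 + int n}. c k * (of_bool (skip r k) - 1 / 3))) \<partial>palm_flips) =
     (\<integral>\<^sup>+r. ennreal (exp (\<Sum>k\<in>{m..<m + int n}. c (k + 1) * (of_bool (skip r k) - 1 / 3))) \<partial>palm_flips)" for m and c :: "int \<Rightarrow> real"
  proof -
    have "(\<lambda>r. ennreal (exp (\<Sum>k\<in>{m..<m + int n}. c (k + 1) * (of_bool (skip r k) - 1 / 3)))) \<in> borel_measurable flips"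
      by measurable
    from nn_integral_palm_shift[OF this]
    have "(\<integral>\<^sup>+r. ennreal (exp (\<Sum>k\<in>{m..<m + int n}. c (k + 1) * (of_bool (skip r k) - 1 / 3))) \<partial>palm_flips) =
      (\<integral>\<^sup>+r. ennreal (exp (\<Sum>k\<in>{m..<m + int n}. c (k + 1) * (of_bool (skip (palm_shift r) k) - 1 / 3))) \<partial>palm_flips)" by simp
    also have "\<dots> = (\<integral>\<^sup>+r. ennreal (exp (\<Sum>k\<in>{m..<m + int n}. c (k + 1) * (of_bool (skip r (k + 1)) - 1 / 3))) \<partial>palm_flips)"
      by (rule nn_integral_cong_AE) (use AE_palm_flips in eventually_elim, simp add: skip_palm_shift add.commute)
    finally show ?thesis unfolding reix by simp
  qed
  show ?thesis
  proof (induction m arbitrary: c rule: int_induct[of _ 0])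
    case base
    define as where "as = map (\<lambda>k. c (int k)) [0..<n]"
    have "(\<Sum>k\<in>{0..<0 + int n}. f k) = (\<Sum>k<n. f (int k))" for f :: "int \<Rightarrow> real"
      by (rule sum.reindex_bij_witness[of _ int nat]) auto
    moreover have "sum_sq as = (\<Sum>k<n. (c (int k))\<^sup>2)"
      by (simp add: sum_sq_def as_def comp_def interv_sum_list_conv_sum_set_nat atLeast0LessThan)
    ultimately show ?case using palm_exp_bound_list[of as] by (simp add: as_def)
  next
    case (step1 i)
    show ?case using step1(2)[of "\<lambda>k. c (k + 1)"] step[where m = i and c = c] reix[where m = i and d = 1 and f = "\<lambda>k. (c k)\<^sup>2"] by simp
  next
    case (step2 i)
    show ?case using step2(2)[of "\<lambda>k. c (k - 1)"] step[where m = "i - 1" and c = "\<lambda>k. c (k - 1)"]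
      reix[where m = "i - 1" and d = 1 and f = "\<lambda>k. (c (k - 1))\<^sup>2"] by simp
  qed
qed

lemma exp_add_exp_minus_ge: "2 + x\<^sup>2 \<le> exp x + exp (- x)" for x :: real
proof -
  define y where "y = x / 2"
  have "\<bar>y\<bar> \<le> \<bar>(exp y - inverse (exp y)) / 2\<bar>" by (rule real_le_abs_sinh)
  then have "y\<^sup>2 \<le> ((exp y - inverse (exp y)) / 2)\<^sup>2" by (simp only: abs_le_square_iff)
  also have "\<dots> = (exp x + exp (- x) - 2) / 4"
  proof -
    define e where "e = exp y"
    define i where "i = inverse (exp y)"
    have "exp x = e * e" "exp (- x) = i * i"
      by (simp_all add: e_def i_def y_def exp_minus[symmetric] flip: exp_add)
    moreover have "e * i = 1" by (simp add: e_def i_def)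
    moreover have "((e - i) / 2)\<^sup>2 = (e * e + i * i - 2 * (e * i)) / 4"
      by (simp add: power2_eq_square field_simps)
    ultimately show ?thesis by (simp add: e_def i_def)
  qed
  finally show ?thesis by (simp add: y_def power2_eq_square)
qed

text \<open>
  Follows from the exponential bound at the two opposite points where its right-hand side is the
  constant \<open>e\<close>, by comparing squares with the hyperbolic cosine.
\<close>

lemma palm_square_bound:
  fixes c :: "int \<Rightarrow> real"
  shows "(\<integral>\<^sup>+r. ennreal ((\<Sum>k\<in>{m..<m + int n}. c k * (of_bool (skip r k) - 1 / 3))\<^sup>2) \<partial>palm_flips)
     \<le> ennreal (8 * (\<Sum>k\<in>{m..<m + int n}. (c k)\<^sup>2))"
proof -
  interpret prob_space palm_flips by (rule prob_space_palm_flips)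
  define S where "S = (\<Sum>k\<in>{m..<m + int n}. (c k)\<^sup>2)"
  define X where "X r = (\<Sum>k\<in>{m..<m + int n}. c k * (of_bool (skip r k) - 1 / 3))" for r
  have X [measurable]: "X \<in> borel_measurable flips" unfolding X_def by measurable
  show ?thesis
  proof (cases "S = 0")
    case True
    then have "c k = 0" if "k \<in> {m..<m + int n}" for k
      using that unfolding S_def by (subst (asm) sum_nonneg_eq_0_iff) auto
    then show ?thesis by simp
  next
    case False
    moreover have "0 \<le> S" unfolding S_def by (rule sum_nonneg) simp
    ultimately have S: "0 < S" by linarith
    \<comment> \<open>The scale at which the exponential bound equals \<open>e\<close>, so that \<open>2 + l\<^sup>2 X\<^sup>2 \<le> exp (l X) + exp (- l X)\<close> yields \<open>l\<^sup>2 E X\<^sup>2 \<le> 2 e - 2 \<le> 4\<close>.\<close>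
    define l where "l = 1 / sqrt (2 * S)"
    have l2: "l\<^sup>2 = 1 / (2 * S)" using S by (simp add: l_def power_divide)
    have e: "(\<integral>\<^sup>+r. ennreal (exp (e * l * X r)) \<partial>palm_flips) \<le> ennreal (exp 1)" if "e = 1 \<or> e = - 1" for e
    proof -
      have "e * l * X r = (\<Sum>k\<in>{m..<m + int n}. (e * l * c k) * (of_bool (skip r k) - 1 / 3))" for r
        unfolding X_def by (simp add: sum_distrib_left mult.assoc)
      moreover have "2 * (\<Sum>k\<in>{m..<m + int n}. (e * l * c k)\<^sup>2) = 1"
      proof -
        have "(e * l * c k)\<^sup>2 = l\<^sup>2 * (c k)\<^sup>2" for k using that by (auto simp: power_mult_distrib)
        then have "(\<Sum>k\<in>{m..<m + int n}. (e * l * c k)\<^sup>2) = l\<^sup>2 * S" by (simp add: S_def sum_distrib_left)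
        then show ?thesis using S by (simp add: l2)
      qed
      ultimately show ?thesis using palm_exp_bound[where m = m and n = n and c = "\<lambda>k. e * l * c k"] by simp
    qed
    have "2 + ennreal (l\<^sup>2) * (\<integral>\<^sup>+r. ennreal ((X r)\<^sup>2) \<partial>palm_flips) = (\<integral>\<^sup>+r. ennreal (2 + l\<^sup>2 * (X r)\<^sup>2) \<partial>palm_flips)"
      by (simp add: ennreal_plus ennreal_mult nn_integral_add nn_integral_cmult emeasure_space_1[simplified])
    also have "\<dots> \<le> (\<integral>\<^sup>+r. ennreal (exp (1 * l * X r)) + ennreal (exp (- 1 * l * X r)) \<partial>palm_flips)"
      using exp_add_exp_minus_ge[of "l * X _"]
      by (intro nn_integral_mono) (simp add: power_mult_distrib ennreal_leI flip: ennreal_plus)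
    also have "\<dots> = (\<integral>\<^sup>+r. ennreal (exp (1 * l * X r)) \<partial>palm_flips) + (\<integral>\<^sup>+r. ennreal (exp (- 1 * l * X r)) \<partial>palm_flips)"
      by (intro nn_integral_add) simp_all
    also have "\<dots> \<le> ennreal (exp 1) + ennreal (exp 1)"
      by (intro add_mono e) auto
    also have "\<dots> = ennreal (exp 1 + exp 1)" by (rule ennreal_plus[symmetric]) auto
    also have "\<dots> \<le> ennreal (2 + 4)"
      by (rule ennreal_leI) (use exp_le in simp)
    also have "\<dots> = 2 + ennreal 4" by (simp flip: ennreal_plus ennreal_numeral)
    finally have b: "ennreal (l\<^sup>2) * (\<integral>\<^sup>+r. ennreal ((X r)\<^sup>2) \<partial>palm_flips) \<le> ennreal 4"
      unfolding ennreal_add_left_cancel_le by simp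
    have "(\<integral>\<^sup>+r. ennreal ((X r)\<^sup>2) \<partial>palm_flips) = ennreal (2 * S) * (ennreal (l\<^sup>2) * (\<integral>\<^sup>+r. ennreal ((X r)\<^sup>2) \<partial>palm_flips))"
      using S by (simp add: l2 mult.assoc[symmetric] flip: ennreal_mult)
    also have "\<dots> \<le> ennreal (2 * S) * ennreal 4" using b by (rule mult_left_mono) simp
    also have "\<dots> = ennreal (2 * S * 4)" using S by (intro ennreal_mult[symmetric]) auto
    also have "2 * S * 4 = 8 * S" by simp
    finally show ?thesis unfolding X_def S_def .
  qed
qed

text \<open>
  Edge \<open>1\<close> is unoccupied with probability \<open>1 / 4\<close>, in which case edge \<open>0\<close> is occupied automatically; the latter has
  probability \<open>3 / 4\<close>.
\<close>

lemma palm_skip_mean: "(\<integral>\<^sup>+r. of_bool (skip r k) \<partial>palm_flips) = ennreal (1 / 3)"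
proof -
  interpret F: prob_space flips_from by (rule prob_space_flips)
  have step: "(\<integral>\<^sup>+r. of_bool (skip r (1 + k)) \<partial>palm_flips) = (\<integral>\<^sup>+r. of_bool (skip r k) \<partial>palm_flips)" for k
  proof -
    have "(\<integral>\<^sup>+r. of_bool (skip r (1 + k)) \<partial>palm_flips) = (\<integral>\<^sup>+r. of_bool (skip (palm_shift r) k) \<partial>palm_flips)"
      by (rule nn_integral_cong_AE) (use AE_palm_flips in eventually_elim, simp add: skip_palm_shift)
    also have "\<dots> = (\<integral>\<^sup>+r. of_bool (skip r k) \<partial>palm_flips)"
      by (rule nn_integral_palm_shift) measurable
    finally show ?thesis .
  qed
  show ?thesis
  proof (induction k rule: int_induct[of _ 0])
    case base
    define G :: "(nat \<Rightarrow> bool) \<Rightarrow> ennreal" where "G \<omega> = of_bool (\<not> \<omega> 1 \<and> \<omega> 2)" for \<omega>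
    have G: "G \<in> borel_measurable flips_from" unfolding G_def by measurable
    have m1: "(\<lambda>\<omega>. of_bool (\<not> \<omega> 0 \<and> \<omega> 1) :: ennreal) \<in> borel_measurable flips_from" by measurable
    have m2: "(\<lambda>\<omega>. of_bool (\<omega> 0) :: ennreal) \<in> borel_measurable flips_from" by measurable
    have m0: "(\<lambda>r. of_bool (skip r 0) :: ennreal) \<in> borel_measurable flips" by measurable
    have i2: "(\<integral>\<^sup>+\<omega>. of_bool (\<omega> 0) \<partial>flips_from) = ennreal (1 / 2)"
      unfolding nn_integral_first_flip[OF m2] ennreal_half by (simp add: F.emeasure_space_1[simplified])
    have q: "inverse 2 * inverse 2 = ennreal (1 / 4)" using ennreal_mult[of "1 / 2" "1 / 2"] by simp
    have i1: "(\<integral>\<^sup>+\<omega>. of_bool (\<not> \<omega> 0 \<and> \<omega> 1) \<partial>flips_from) = ennreal (1 / 4)"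
      unfolding nn_integral_first_flip[OF m1] ennreal_half by (simp add: i2 q)
    have i0: "(\<integral>\<^sup>+\<omega>. G \<omega> \<partial>flips_from) = ennreal (1 / 4)"
      unfolding nn_integral_first_flip[OF G] ennreal_half unfolding G_def using i1 ennreal_linear[of 1 "1 / 2" "1 / 2" "1 / 4" "1 / 4"] by (simp add: numeral_2_eq_2)
    have "(\<integral>\<^sup>+r. of_bool (skip r 0) \<partial>palm_flips) = ennreal (4 / 3) * (\<integral>\<^sup>+r. G (\<lambda>n. r (int n)) \<partial>flips)"
      unfolding nn_integral_palm_flips[OF m0]
      by (intro arg_cong2[of _ _ _ _ "(*)"] nn_integral_cong refl) (auto simp: G_def skip_0 occ_def)
    then show ?case unfolding nn_integral_forward[OF G] i0 by (simp flip: ennreal_mult)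
  next
    case (step1 i)
    then show ?case using step[of i] by (simp add: add.commute)
  next
    case (step2 i)
    then show ?case using step[of "i - 1"] by simp
  qed
qed

section \<open>One clustering step\<close>

definition mid :: "(int \<Rightarrow> real) \<Rightarrow> int \<Rightarrow> real" where
  "mid x i = (x i + x (i + 1)) / 2"

text \<open>
  The clustering step seen from the midpoint of edge \<open>0\<close>. Contrary to \<open>cluster_step\<close>, it is linear in the
  configuration, which is what the analysis below is based on.
\<close>

definition coarsen :: "(int \<Rightarrow> bool) \<Rightarrow> (int \<Rightarrow> real) \<Rightarrow> int \<Rightarrow> real" where
  "coarsen r x k = 3 / 4 * (mid x (occs r k) - mid x 0)"

definition cluster_step :: "(int \<Rightarrow> real) \<Rightarrow> (int \<Rightarrow> bool) \<Rightarrow> int \<Rightarrow> real" where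
  "cluster_step x r = enum_points ((\<lambda>u. 3 / 4 * u) ` range (move x r))"

lemma range_move: "range (move x r) = mid x ` {i. occ r i}"
proof (intro equalityI subsetI)
  fix v assume "v \<in> range (move x r)"
  then obtain i where v: "v = move x r i" by auto
  show "v \<in> mid x ` {i. occ r i}"
  proof (cases "r i")
    case True
    then show ?thesis by (intro image_eqI[of _ _ i]) (simp_all add: v move_def mid_def occ_def)
  next
    case False
    then show ?thesis by (intro image_eqI[of _ _ "i - 1"]) (simp_all add: v move_def mid_def occ_def)
  qed
next
  fix v assume "v \<in> mid x ` {i. occ r i}"
  then obtain i where v: "v = mid x i" and i: "occ r i" by auto
  show "v \<in> range (move x r)"
  proof (cases "r i")
    case True
    then show ?thesis by (intro image_eqI[of _ _ i]) (simp_all add: v move_def mid_def)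
  next
    case False
    then have "\<not> r (i + 1)" using i by (simp add: occ_def)
    then show ?thesis by (intro image_eqI[of _ _ "i + 1"]) (simp_all add: v move_def mid_def)
  qed
qed

lemma mid_strict_mono: assumes "strict_mono x" shows "strict_mono (mid x)"
proof -
  have "x k < x (k + 1)" "x (k + 1) < x (k + 1 + 1)" for k using assms by (auto simp: strict_mono_def)
  then show ?thesis unfolding strict_mono_int mid_def by (auto simp: add_strict_mono)
qed

lemma mid_two_sided: assumes "two_sided x" shows "two_sided (mid x)"
  unfolding two_sided_def
proof (intro conjI allI)
  have m: "i \<le> j \<Longrightarrow> x i \<le> x j" for i j using assms by (auto simp: two_sided_def mono_def)
  show "mono (mid x)" unfolding mono_def mid_def using m by (auto intro!: add_mono)
  fix c
  obtain i where "c < x i" using assms by (auto simp: two_sided_def)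
  then show "\<exists>i. c < mid x i" using m[of i "i + 1"] by (intro exI[of _ i]) (auto simp: mid_def)
  obtain i where "x i < c" using assms by (auto simp: two_sided_def)
  then show "\<exists>i. mid x i < c" using m[of "i - 1" i] by (intro exI[of _ "i - 1"]) (auto simp: mid_def)
qed

lemma occs_two_sided: assumes "occ r 0" shows "two_sided (\<lambda>k. real_of_int (occs r k))"
  unfolding two_sided_def
proof (intro conjI allI)
  have sm: "strict_mono (occs r)" by (rule occs_strict_mono[OF assms])
  then show "mono (\<lambda>k. real_of_int (occs r k))" by (auto simp: mono_def strict_mono_less_eq)
  have up: "0 \<le> k \<Longrightarrow> k \<le> occs r k" for k
    by (induction rule: int_ge_induct) (auto simp: occs_step_skip[OF assms])
  have down: "k \<le> 0 \<Longrightarrow> occs r k \<le> k" for k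
  proof (induction rule: int_le_induct)
    case (step i)
    then show ?case using occs_step_skip[OF assms, of "i - 1"] by (simp split: if_splits)
  qed simp
  fix c
  show "\<exists>i. c < real_of_int (occs r i)"
    using up[of "\<lceil>\<bar>c\<bar>\<rceil> + 1"] by (intro exI[of _ "\<lceil>\<bar>c\<bar>\<rceil> + 1"]) linarith
  show "\<exists>i. real_of_int (occs r i) < c"
    using down[of "- \<lceil>\<bar>c\<bar>\<rceil> - 1"] by (intro exI[of _ "- \<lceil>\<bar>c\<bar>\<rceil> - 1"]) linarith
qed

lemma occs_cell: assumes "occ r 0" shows "\<exists>!k. occs r k \<le> j \<and> j < occs r (k + 1)"
  using two_sided_ex1[OF occs_two_sided[OF assms], of "real_of_int j"] by simp

lemma range_occs: assumes r: "occ r 0" shows "range (occs r) = {i. occ r i}"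
proof (intro equalityI subsetI)
  fix i assume i: "i \<in> {i. occ r i}"
  obtain k where k: "occs r k \<le> i" "i < occs r (k + 1)" using occs_cell[OF r, of i] by blast
  have "i = occs r k \<or> i = occs r k + 1 \<and> skip r k"
    using k unfolding occs_step_skip[OF r] by (auto split: if_splits)
  then have "i = occs r k" using i by (auto simp: skip_def)
  then show "i \<in> range (occs r)" by simp
qed (auto simp: occ_occs[OF r])

lemma two_sided_comp:
  assumes x: "two_sided x" and e: "two_sided (\<lambda>k. real_of_int (e k))"
  shows "two_sided (\<lambda>k. x (e k))"
  unfolding two_sided_def
proof (intro conjI allI)
  have m: "i \<le> j \<Longrightarrow> x i \<le> x j" for i j using x by (auto simp: two_sided_def mono_def)
  show "mono (\<lambda>k. x (e k))" using e m by (auto simp: two_sided_def mono_def)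
  fix c
  obtain i where i: "c < x i" using x by (auto simp: two_sided_def)
  obtain k where "real_of_int i < real_of_int (e k)" using e unfolding two_sided_def by blast
  then show "\<exists>k. c < x (e k)" using i m[of i "e k"] by (intro exI[of _ k]) auto
  obtain i where i: "x i < c" using x by (auto simp: two_sided_def)
  obtain k where "real_of_int (e k) < real_of_int i" using e unfolding two_sided_def by blast
  then show "\<exists>k. x (e k) < c" using i m[of "e k" i] by (intro exI[of _ k]) auto
qed

lemma two_sided_scale: assumes "two_sided x" "0 < a" shows "two_sided (\<lambda>k. a * x k)"
  unfolding two_sided_def
proof (intro conjI allI)
  show "mono (\<lambda>k. a * x k)" using assms by (auto simp: two_sided_def mono_def)
  fix c
  obtain i where i: "c / a < x i" using assms(1) unfolding two_sided_def by blast
  then show "\<exists>k. c < a * x k" using assms(2) by (intro exI[of _ i]) (simp add: field_simps)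
  obtain i where i: "x i < c / a" using assms(1) unfolding two_sided_def by blast
  then show "\<exists>k. a * x k < c" using assms(2) by (intro exI[of _ i]) (simp add: field_simps)
qed

lemma coarsen_two_sided:
  assumes "two_sided x" "occ r 0" shows "two_sided (coarsen r x)"
  using two_sided_scale[OF two_sided_translate[OF two_sided_comp[OF mid_two_sided occs_two_sided], of x r "mid x 0"], of "3 / 4"] assms
  by (simp add: coarsen_def[abs_def])

lemma coarsen_strict_mono:
  assumes "strict_mono x" "occ r 0" shows "strict_mono (coarsen r x)"
  using mid_strict_mono[OF assms(1)] occs_strict_mono[OF assms(2)]
  by (auto simp: strict_mono_def coarsen_def)

lemma cluster_step_reindex:
  assumes x: "two_sided x" "strict_mono x" and r: "occ r 0"
  shows "\<exists>i. cluster_step x r = reindex i (\<lambda>k. 3 / 4 * mid x (occs r k))"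
proof -
  define z where "z k = 3 / 4 * mid x (occs r k)" for k
  have z2: "two_sided z" unfolding z_def[abs_def]
    by (rule two_sided_scale[OF two_sided_comp[OF mid_two_sided[OF x(1)] occs_two_sided[OF r]]]) simp
  have zs: "strict_mono z"
    using mid_strict_mono[OF x(2)] occs_strict_mono[OF r] by (auto simp: strict_mono_def z_def)
  obtain i where i: "z i \<le> 0" "0 < z (i + 1)" using two_sided_ex1[OF z2, of 0] by blast
  have "(\<lambda>u. 3 / 4 * u) ` range (move x r) = range z"
    unfolding range_move range_occs[OF r, symmetric] by (auto simp: z_def)
  moreover have "enumerates (reindex i z) (range z)"
    unfolding enumerates_def
  proof (intro conjI)
    show "strict_mono (reindex i z)" using zs by (simp add: strict_mono_def reindex_def)
    show "range (reindex i z) = range z"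
    proof (intro equalityI subsetI)
      fix v assume "v \<in> range z"
      then obtain j where "v = z j" by auto
      then show "v \<in> range (reindex i z)" by (intro image_eqI[of _ _ "j - i"]) (simp_all add: reindex_def)
    qed (auto simp: reindex_def)
  qed (use i in \<open>simp_all add: reindex_def\<close>)
  ultimately show ?thesis using enum_points_eq unfolding cluster_step_def z_def[symmetric] by metis
qed

lemma cluster_step_shift: "cluster_step (reindex i x) (shift_flips i r) = cluster_step x r"
proof -
  have "range (move (reindex i x) (shift_flips i r)) = range (move x r)"
  proof (intro equalityI subsetI)
    fix v assume "v \<in> range (move x r)"
    then obtain j where "v = move x r j" by auto
    then show "v \<in> range (move (reindex i x) (shift_flips i r))"
      by (intro image_eqI[of _ _ "j - i"]) (simp_all add: move_def reindex_def algebra_simps)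
  next
    fix v assume "v \<in> range (move (reindex i x) (shift_flips i r))"
    then obtain j where "v = move (reindex i x) (shift_flips i r) j" by auto
    then show "v \<in> range (move x r)"
      by (intro image_eqI[of _ _ "i + j"]) (simp_all add: move_def reindex_def algebra_simps)
  qed
  then show ?thesis by (simp add: cluster_step_def)
qed

lemma measurable_cluster_step:
  "(\<lambda>w. cluster_step (fst w) (snd w)) \<in> borel \<Otimes>\<^sub>M flips \<rightarrow>\<^sub>M borel"
proof -
  let ?z = "\<lambda>w :: (int \<Rightarrow> real) \<times> (int \<Rightarrow> bool). (\<lambda>i. 3 / 4 * move (fst w) (snd w) i)"
  have m: "?z \<in> borel_measurable (borel \<Otimes>\<^sub>M flips)"
  proof (rule borel_seqI)
    fix i
    have "(\<lambda>w :: (int \<Rightarrow> real) \<times> (int \<Rightarrow> bool). snd w i) \<in> borel \<Otimes>\<^sub>M flips \<rightarrow>\<^sub>M count_space UNIV"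
      by (rule measurable_compose[OF measurable_snd measurable_flip(1)])
    then show "(\<lambda>w :: (int \<Rightarrow> real) \<times> (int \<Rightarrow> bool). 3 / 4 * move (fst w) (snd w) i) \<in> borel_measurable (borel \<Otimes>\<^sub>M flips)"
      unfolding move_def by measurable
  qed
  have "cluster_step x r = enum_points (range (\<lambda>i. 3 / 4 * move x r i))" for x r
    by (simp add: cluster_step_def image_image)
  then show ?thesis using measurable_compose[OF m measurable_enum_points] by simp
qed

lemma measurable_coarsen:
  "(\<lambda>w. coarsen (snd w) (fst w)) \<in> borel \<Otimes>\<^sub>M flips \<rightarrow>\<^sub>M borel"
proof (rule borel_seqI)
  fix k
  have "(\<lambda>w :: (int \<Rightarrow> real) \<times> (int \<Rightarrow> bool). occs (snd w) k) \<in> borel \<Otimes>\<^sub>M flips \<rightarrow>\<^sub>M count_space UNIV"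
    by (rule measurable_compose[OF measurable_snd measurable_occs])
  then have "(\<lambda>w :: (int \<Rightarrow> real) \<times> (int \<Rightarrow> bool). 3 / 4 * (mid (fst w) (occs (snd w) k) - mid (fst w) 0)) \<in> borel_measurable (borel \<Otimes>\<^sub>M flips)"
    by (intro measurable_compose_countable[where g = "\<lambda>w. occs (snd w) k" and f = "\<lambda>e w. 3 / 4 * (mid (fst w) e - mid (fst w) 0)"])
       (unfold mid_def, measurable)
  then show "(\<lambda>w. coarsen (snd w) (fst w) k) \<in> borel_measurable (borel \<Otimes>\<^sub>M flips)"
    by (simp add: coarsen_def)
qed

definition step_law :: "(int \<Rightarrow> real) measure \<Rightarrow> (int \<Rightarrow> real) measure" where
  "step_law P = distr (P \<Otimes>\<^sub>M flips) borel (\<lambda>w. cluster_step (fst w) (snd w))"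

definition palm_step_law :: "(int \<Rightarrow> real) measure \<Rightarrow> (int \<Rightarrow> real) measure" where
  "palm_step_law P = distr (P \<Otimes>\<^sub>M palm_flips) borel (\<lambda>w. coarsen (snd w) (fst w))"

lemma pair_measurable_cong:
  assumes "sets P = sets borel" "sets R = sets flips"
  shows "measurable (P \<Otimes>\<^sub>M R) N = measurable (borel \<Otimes>\<^sub>M flips) N"
  by (rule measurable_cong_sets[OF sets_pair_measure_cong[OF assms] refl])

lemma nn_integral_step_law:
  assumes P: "sets P = sets borel" and f: "f \<in> borel_measurable borel"
  shows "(\<integral>\<^sup>+x. f x \<partial>step_law P) = (\<integral>\<^sup>+x. \<integral>\<^sup>+r. f (cluster_step x r) \<partial>flips \<partial>P)"
proof -
  interpret prob_space flips by (rule prob_space_flips)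
  have m: "(\<lambda>w. cluster_step (fst w) (snd w)) \<in> P \<Otimes>\<^sub>M flips \<rightarrow>\<^sub>M borel"
    using measurable_cluster_step by (simp add: pair_measurable_cong[OF P refl])
  show ?thesis
    unfolding step_law_def nn_integral_distr[OF m, simplified, OF f]
    using nn_integral_fst[OF measurable_compose[OF m f]] by simp
qed

lemma nn_integral_palm_step_law:
  assumes P: "sets P = sets borel" and f: "f \<in> borel_measurable borel"
  shows "(\<integral>\<^sup>+x. f x \<partial>palm_step_law P) = (\<integral>\<^sup>+x. \<integral>\<^sup>+r. f (coarsen r x) \<partial>palm_flips \<partial>P)"
proof -
  interpret prob_space palm_flips by (rule prob_space_palm_flips)
  have m: "(\<lambda>w. coarsen (snd w) (fst w)) \<in> P \<Otimes>\<^sub>M palm_flips \<rightarrow>\<^sub>M borel"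
    using measurable_coarsen by (simp add: pair_measurable_cong[OF P sets_palm_flips])
  show ?thesis
    unfolding palm_step_law_def nn_integral_distr[OF m, simplified, OF f]
    using nn_integral_fst[OF measurable_compose[OF m f]] by simp
qed

lemma AE_pair_fst:
  assumes R: "prob_space R" and Q: "AE x in P. Q x"
  shows "AE w in P \<Otimes>\<^sub>M R. Q (fst w)"
proof -
  have "AE x in distr (P \<Otimes>\<^sub>M R) P fst. Q x" unfolding prob_space.distr_pair_fst[OF R] by (rule Q)
  then show ?thesis by (rule AE_distrD[OF measurable_fst])
qed

text \<open>
  The cells between midpoints of consecutive occupied edges tile the line, because each of them is the
  union of one or two cells between consecutive midpoints.
\<close>

lemma cell_of_midpoints:
  assumes x: "two_sided x"
  shows "\<exists>!i. occ r i \<and> mid x i \<le> s \<and> s < mid x (next_occ r i)"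
proof -
  have m2: "two_sided (mid x)" by (rule mid_two_sided[OF x])
  have m: "i \<le> j \<Longrightarrow> mid x i \<le> mid x j" for i j using m2 by (auto simp: two_sided_def mono_def)
  obtain j where j: "mid x j \<le> s" "s < mid x (j + 1)" and u: "\<And>i. mid x i \<le> s \<Longrightarrow> s < mid x (i + 1) \<Longrightarrow> i = j"
    using two_sided_ex1[OF m2, of s] by blast
  \<comment> \<open>The midpoint to the left of \<open>s\<close>, or the one before it if that edge is unoccupied.\<close>
  define i where "i = (if occ r j then j else j - 1)"
  have oj: "occ r (j - 1)" if "\<not> occ r j" using that by (auto simp: occ_def)
  show ?thesis
  proof (intro ex1I conjI)
    show "occ r i" using oj by (simp add: i_def)
    show "mid x i \<le> s" using j m[of "j - 1" j] by (auto simp: i_def)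
    show "s < mid x (next_occ r i)"
      using j m[of "j + 1" "j + 2"] by (auto simp: i_def next_occ_def add.commute)
    fix i' assume i': "occ r i' \<and> mid x i' \<le> s \<and> s < mid x (next_occ r i')"
    show "i' = i"
    proof (cases "s < mid x (i' + 1)")
      case True
      then have "i' = j" using u i' by blast
      then show ?thesis using i' by (simp add: i_def)
    next
      case False
      then have n: "\<not> occ r (i' + 1)" "s < mid x (i' + 2)" using i' by (auto simp: next_occ_def split: if_splits)
      then have "i' + 1 = j" using u[of "i' + 1"] False by (simp add: add.assoc)
      then show ?thesis using n by (auto simp: i_def)
    qed
  qed
qed

text \<open>
  The central fact about a single step. The observer sits in a cell of the old process, and also in
  exactly one cell of the new one, whose left end is the midpoint of an occupied edge. Transport from
  old cells to new cells moves the origin to the corresponding edge. This edge is occupied, which is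
  the conditioning of the coins, and the factor \<open>4 / 3\<close> from rescaling the line cancels the
  probability \<open>3 / 4\<close> of this event.
\<close>

lemma inverts_step:
  assumes P0: "cycle_stationary P0" and sm: "AE x in P0. strict_mono x" and inv: "inverts P P0"
    and P: "sets P = sets borel"
  shows "inverts (step_law P) (palm_step_law P0)"
  unfolding inverts_def
proof (intro ballI impI)
  fix F :: "(int \<Rightarrow> real) \<Rightarrow> ennreal"
  assume F: "F \<in> borel_measurable borel" and Fr': "\<forall>i x. F (reindex i x) = F x"
  note Fr = Fr'[rule_format]
  have s0: "sets P0 = sets borel" and ts: "AE x in P0. two_sided x" using P0 by (simp_all add: cycle_stationary_def)
  interpret F: prob_space flips by (rule prob_space_flips)
  let ?M = "P0 \<Otimes>\<^sub>M flips"
  have ts_pair: "AE w in ?M. two_sided (fst w)" by (rule AE_pair_fst[OF prob_space_flips(1) ts])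
  define h where "h w s = F (cluster_step (\<lambda>j. fst w j - s) (snd w))" for w s
  define a :: "(int \<Rightarrow> real) \<times> (int \<Rightarrow> bool) \<Rightarrow> real \<Rightarrow> ennreal"
    where "a w s = of_bool (0 \<le> s \<and> s < fst w 1)" for w s
  \<comment> \<open>An old cell sends mass to the edge whose midpoint is the left end of the new cell around \<open>s\<close>.\<close>
  define c where "c w s = of_bool (occ (snd w) 0 \<and> mid (fst w) 0 \<le> s \<and> s < mid (fst w) (next_occ (snd w) 0)) * h w s" for w s
  define \<Phi> :: "int \<Rightarrow> (int \<Rightarrow> real) \<times> (int \<Rightarrow> bool) \<Rightarrow> (int \<Rightarrow> real) \<times> (int \<Rightarrow> bool)"
    where "\<Phi> i w = (from_point i (fst w), shift_flips i (snd w))" for i w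
  have Mc: "measurable ?M N = measurable (borel \<Otimes>\<^sub>M flips) N" for N by (rule pair_measurable_cong[OF s0 refl])
  have M3: "measurable (?M \<Otimes>\<^sub>M borel) N = measurable ((borel \<Otimes>\<^sub>M flips) \<Otimes>\<^sub>M borel) N" for N :: "'z measure"
    by (intro measurable_cong_sets sets_pair_measure_cong s0 refl)
  have mstep: "(\<lambda>(w, s). cluster_step (\<lambda>j. fst w j - s) (snd w)) \<in> (borel \<Otimes>\<^sub>M flips) \<Otimes>\<^sub>M borel \<rightarrow>\<^sub>M borel"
  proof -
    have "(\<lambda>v :: ((int \<Rightarrow> real) \<times> (int \<Rightarrow> bool)) \<times> real. (\<lambda>j. fst (fst v) j - snd v)) \<in> borel_measurable ((borel \<Otimes>\<^sub>M flips) \<Otimes>\<^sub>M borel)"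
      by (rule borel_seqI) measurable
    then have "(\<lambda>v :: ((int \<Rightarrow> real) \<times> (int \<Rightarrow> bool)) \<times> real. ((\<lambda>j. fst (fst v) j - snd v), snd (fst v))) \<in> (borel \<Otimes>\<^sub>M flips) \<Otimes>\<^sub>M borel \<rightarrow>\<^sub>M borel \<Otimes>\<^sub>M flips"
      by (rule measurable_Pair) measurable
    from measurable_compose[OF this measurable_cluster_step] show ?thesis by (simp add: case_prod_beta')
  qed
  have mh: "(\<lambda>v. h (fst v) (snd v)) \<in> borel_measurable ((borel \<Otimes>\<^sub>M flips) \<Otimes>\<^sub>M borel)"
    using measurable_compose[OF mstep F] unfolding h_def by (simp add: case_prod_beta')
  have ma: "(\<lambda>v. a (fst v) (snd v)) \<in> borel_measurable ((borel \<Otimes>\<^sub>M flips) \<Otimes>\<^sub>M borel)"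
    unfolding a_def by measurable
  have mc: "(\<lambda>v. c (fst v) (snd v)) \<in> borel_measurable ((borel \<Otimes>\<^sub>M flips) \<Otimes>\<^sub>M borel)"
  proof -
    have "(\<lambda>v :: ((int \<Rightarrow> real) \<times> (int \<Rightarrow> bool)) \<times> real. occ (snd (fst v)) i) \<in> (borel \<Otimes>\<^sub>M flips) \<Otimes>\<^sub>M borel \<rightarrow>\<^sub>M count_space UNIV" for i
      by (rule measurable_compose[OF measurable_compose[OF measurable_fst measurable_snd] measurable_occ])
    note this[measurable]
    have [measurable]: "(\<lambda>v :: ((int \<Rightarrow> real) \<times> (int \<Rightarrow> bool)) \<times> real. mid (fst (fst v)) i) \<in> borel_measurable ((borel \<Otimes>\<^sub>M flips) \<Otimes>\<^sub>M borel)" for i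
      unfolding mid_def by measurable
    have "(\<lambda>v :: ((int \<Rightarrow> real) \<times> (int \<Rightarrow> bool)) \<times> real. of_bool (occ (snd (fst v)) 0 \<and> mid (fst (fst v)) 0 \<le> snd v \<and>
        (if occ (snd (fst v)) 1 then snd v < mid (fst (fst v)) 1 else snd v < mid (fst (fst v)) 2)) :: ennreal) \<in> borel_measurable ((borel \<Otimes>\<^sub>M flips) \<Otimes>\<^sub>M borel)"
      by measurable
    also have "(\<lambda>v :: ((int \<Rightarrow> real) \<times> (int \<Rightarrow> bool)) \<times> real. of_bool (occ (snd (fst v)) 0 \<and> mid (fst (fst v)) 0 \<le> snd v \<and>
        (if occ (snd (fst v)) 1 then snd v < mid (fst (fst v)) 1 else snd v < mid (fst (fst v)) 2)) :: ennreal) =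
      (\<lambda>v. of_bool (occ (snd (fst v)) 0 \<and> mid (fst (fst v)) 0 \<le> snd v \<and> snd v < mid (fst (fst v)) (next_occ (snd (fst v)) 0)))"
      by (simp add: next_occ_def fun_eq_iff)
    finally show ?thesis unfolding c_def by (intro borel_measurable_times_ennreal mh)
  qed
  have \<Phi>m: "\<Phi> i \<in> ?M \<rightarrow>\<^sub>M ?M" for i
  proof -
    have "\<Phi> i \<in> borel \<Otimes>\<^sub>M flips \<rightarrow>\<^sub>M borel \<Otimes>\<^sub>M flips" unfolding \<Phi>_def
      by (intro measurable_Pair measurable_compose[OF measurable_fst from_point_measurable] measurable_compose[OF measurable_snd measurable_shift])
    then show ?thesis unfolding Mc measurable_cong_sets[OF refl sets_pair_measure_cong[OF s0 refl]] .
  qed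
  have pres: "distr ?M ?M (\<Phi> i) = ?M" for i
  proof -
    have d1: "distr P0 P0 (from_point i) = P0"
      using P0 distr_cong[OF refl s0, of P0 "from_point i"] by (simp add: cycle_stationary_def)
    have m1: "from_point i \<in> P0 \<rightarrow>\<^sub>M P0" using from_point_measurable s0 measurable_cong_sets by blast
    have "distr P0 P0 (from_point i) \<Otimes>\<^sub>M distr flips flips (shift_flips i) = distr ?M (P0 \<Otimes>\<^sub>M flips) (\<lambda>(x, y). (from_point i x, shift_flips i y))"
      by (rule pair_measure_distr[OF m1 measurable_shift])
         (simp add: distr_shift prob_space_imp_sigma_finite[OF prob_space_flips(1)])
    then show ?thesis by (simp add: d1 distr_shift \<Phi>_def[abs_def] case_prod_beta')
  qed
  have h_shift: "h (\<Phi> i w) (s - fst w i) = h w s" for i w s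
  proof -
    have "(\<lambda>j. from_point i (fst w) j - (s - fst w i)) = reindex i (\<lambda>j. fst w j - s)"
      by (simp add: reindex_def fun_eq_iff)
    then show ?thesis by (simp add: h_def \<Phi>_def cluster_step_shift)
  qed
  have mid_shift: "mid (from_point i x) j = mid x (i + j) - x i" for i j x
    by (simp add: mid_def field_simps add.assoc)
  define F1 where "F1 x = (\<integral>\<^sup>+r. F (cluster_step x r) \<partial>flips)" for x
  have Fstep: "(\<lambda>w. F (cluster_step (fst w) (snd w))) \<in> borel_measurable (borel \<Otimes>\<^sub>M flips)"
    using measurable_compose[OF measurable_cluster_step F] .
  have F1m: "F1 \<in> borel_measurable borel"
    unfolding F1_def using Fstep by (intro F.borel_measurable_nn_integral) (simp add: case_prod_beta')
  have F1r: "F1 (reindex i x) = F1 x" for i x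
  proof -
    have "(\<lambda>r. F (cluster_step (reindex i x) r)) \<in> borel_measurable flips"
      using measurable_compose[OF measurable_Pair1' Fstep, of "reindex i x"] by simp
    from nn_integral_shift[OF this, of i] show ?thesis unfolding F1_def by (simp add: cluster_step_shift)
  qed
  have "(\<integral>\<^sup>+x. F x \<partial>step_law P) = (\<integral>\<^sup>+x. F1 x \<partial>P)"
    unfolding nn_integral_step_law[OF P F] F1_def ..
  also have "\<dots> = (\<integral>\<^sup>+x. \<integral>\<^sup>+s. of_bool (0 \<le> s \<and> s < x 1) * F1 (\<lambda>j. x j - s) \<partial>lborel \<partial>P0)"
    using inv F1m F1r unfolding inverts_def by blast
  also have "\<dots> = (\<integral>\<^sup>+x. \<integral>\<^sup>+r. \<integral>\<^sup>+s. a (x, r) s * h (x, r) s \<partial>lborel \<partial>flips \<partial>P0)"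
  proof (rule nn_integral_cong)
    fix x assume "x \<in> space P0"
    have hm: "(\<lambda>v. h (x, fst v) (snd v)) \<in> borel_measurable (flips \<Otimes>\<^sub>M borel)"
    proof -
      have "(\<lambda>v :: (int \<Rightarrow> bool) \<times> real. ((x, fst v), snd v)) \<in> flips \<Otimes>\<^sub>M borel \<rightarrow>\<^sub>M (borel \<Otimes>\<^sub>M flips) \<Otimes>\<^sub>M borel"
        by measurable
      from measurable_compose[OF this mh] show ?thesis by simp
    qed
    have hm1: "(\<lambda>r. h (x, r) s) \<in> borel_measurable flips" for s
      using measurable_compose[OF measurable_Pair2' hm, of s] by simp
    have am: "(\<lambda>v. a (x, fst v) (snd v) * h (x, fst v) (snd v)) \<in> borel_measurable (flips \<Otimes>\<^sub>M borel)"
    proof (rule borel_measurable_times_ennreal[OF _ hm])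
      have "(\<lambda>v :: (int \<Rightarrow> bool) \<times> real. ((x, fst v), snd v)) \<in> flips \<Otimes>\<^sub>M borel \<rightarrow>\<^sub>M (borel \<Otimes>\<^sub>M flips) \<Otimes>\<^sub>M borel"
        by measurable
      from measurable_compose[OF this ma] show "(\<lambda>v. a (x, fst v) (snd v)) \<in> borel_measurable (flips \<Otimes>\<^sub>M borel)" by simp
    qed
    have "(\<integral>\<^sup>+s. of_bool (0 \<le> s \<and> s < x 1) * F1 (\<lambda>j. x j - s) \<partial>lborel) =
      (\<integral>\<^sup>+s. \<integral>\<^sup>+r. a (x, r) s * h (x, r) s \<partial>flips \<partial>lborel)"
    proof (rule nn_integral_cong)
      fix s
      show "of_bool (0 \<le> s \<and> s < x 1) * F1 (\<lambda>j. x j - s) = (\<integral>\<^sup>+r. a (x, r) s * h (x, r) s \<partial>flips)"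
        using nn_integral_cmult[OF hm1, of "of_bool (0 \<le> s \<and> s < x 1)" s]
        by (simp add: a_def h_def F1_def)
    qed
    also have "\<dots> = (\<integral>\<^sup>+r. \<integral>\<^sup>+s. a (x, r) s * h (x, r) s \<partial>lborel \<partial>flips)"
      using am by (intro nn_integral_lborel_swap[symmetric] prob_space_flips) (simp add: case_prod_beta')
    finally show "(\<integral>\<^sup>+s. of_bool (0 \<le> s \<and> s < x 1) * F1 (\<lambda>j. x j - s) \<partial>lborel) =
      (\<integral>\<^sup>+r. \<integral>\<^sup>+s. a (x, r) s * h (x, r) s \<partial>lborel \<partial>flips)" .
  qed
  also have "\<dots> = (\<integral>\<^sup>+w. \<integral>\<^sup>+s. a w s * h w s \<partial>lborel \<partial>?M)"
  proof -
    have "(\<lambda>w. \<integral>\<^sup>+s. a w s * h w s \<partial>lborel) \<in> borel_measurable ?M"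
      unfolding Mc using borel_measurable_times_ennreal[OF ma mh]
      by (intro sigma_finite_measure.borel_measurable_nn_integral[OF sigma_finite_lborel]) (simp add: case_prod_beta')
    from F.nn_integral_fst[OF this] show ?thesis by simp
  qed
  also have "\<dots> = (\<integral>\<^sup>+w. \<integral>\<^sup>+s. a w s * zsum (\<lambda>i. c (\<Phi> i w) (s - fst w i)) \<partial>lborel \<partial>?M)"
  proof (rule nn_integral_cong_AE)
    show "AE w in ?M. (\<integral>\<^sup>+s. a w s * h w s \<partial>lborel) = (\<integral>\<^sup>+s. a w s * zsum (\<lambda>i. c (\<Phi> i w) (s - fst w i)) \<partial>lborel)"
      using ts_pair
    proof eventually_elim
      case (elim w)
      have "zsum (\<lambda>i. c (\<Phi> i w) (s - fst w i)) = h w s" for s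
      proof -
        have "c (\<Phi> i w) (s - fst w i) = of_bool (occ (snd w) i \<and> mid (fst w) i \<le> s \<and> s < mid (fst w) (next_occ (snd w) i)) * h w s" for i
          unfolding c_def h_shift by (simp add: \<Phi>_def occ_shift mid_shift next_occ_shift)
        then have "zsum (\<lambda>i. c (\<Phi> i w) (s - fst w i)) =
          zsum (\<lambda>i. of_bool (occ (snd w) i \<and> mid (fst w) i \<le> s \<and> s < mid (fst w) (next_occ (snd w) i))) * h w s"
          unfolding zsum_multc by (rule zsum_cong)
        then show ?thesis by (simp only: zsum_unique[OF cell_of_midpoints[OF elim]] mult_1_left)
      qed
      then show ?case by simp
    qed
  qed
  also have "\<dots> = (\<integral>\<^sup>+w. \<integral>\<^sup>+s. zsum (\<lambda>i. a (\<Phi> i w) (s - fst w i)) * c w s \<partial>lborel \<partial>?M)"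
  proof (rule mass_transport[where X = "\<lambda>i w. fst w i", OF \<Phi>m pres])
    show "(\<lambda>w. fst w i) \<in> borel_measurable ?M" for i unfolding Mc by measurable
    have "AE w in ?M. fst w 0 = 0" by (rule AE_pair_fst[OF prob_space_flips(1) cycle_stationary_zero[OF P0]])
    then show "AE w in ?M. \<Phi> i (\<Phi> (- i) w) = w \<and> fst (\<Phi> (- i) w) i = - fst w (- i)" for i
      by eventually_elim (auto simp: \<Phi>_def from_point_def shift_flips_def prod_eq_iff)
    show "case_prod a \<in> borel_measurable (?M \<Otimes>\<^sub>M borel)" unfolding M3 using ma by (simp add: case_prod_beta')
    show "case_prod c \<in> borel_measurable (?M \<Otimes>\<^sub>M borel)" unfolding M3 using mc by (simp add: case_prod_beta')
  qed
  also have "\<dots> = (\<integral>\<^sup>+w. \<integral>\<^sup>+s. c w s \<partial>lborel \<partial>?M)"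
  proof (rule nn_integral_cong_AE)
    show "AE w in ?M. (\<integral>\<^sup>+s. zsum (\<lambda>i. a (\<Phi> i w) (s - fst w i)) * c w s \<partial>lborel) = (\<integral>\<^sup>+s. c w s \<partial>lborel)"
      using ts_pair
    proof eventually_elim
      case (elim w)
      have "zsum (\<lambda>i. a (\<Phi> i w) (s - fst w i)) = 1" for s
        using two_sided_tiling[OF elim, of s] by (simp add: a_def \<Phi>_def)
      then show ?case by simp
    qed
  qed
  also have "\<dots> = (\<integral>\<^sup>+x. \<integral>\<^sup>+r. \<integral>\<^sup>+s. c (x, r) s \<partial>lborel \<partial>flips \<partial>P0)"
  proof -
    have "(\<lambda>w. \<integral>\<^sup>+s. c w s \<partial>lborel) \<in> borel_measurable ?M"
      unfolding Mc using mc
      by (intro sigma_finite_measure.borel_measurable_nn_integral[OF sigma_finite_lborel]) (simp add: case_prod_beta')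
    from F.nn_integral_fst[OF this] show ?thesis by simp
  qed
  also have "\<dots> = (\<integral>\<^sup>+x. \<integral>\<^sup>+r. (\<integral>\<^sup>+s. of_bool (0 \<le> s \<and> s < coarsen r x 1) * F (\<lambda>j. coarsen r x j - s) \<partial>lborel) \<partial>palm_flips \<partial>P0)"
  proof (rule nn_integral_cong_AE)
    show "AE x in P0. (\<integral>\<^sup>+r. \<integral>\<^sup>+s. c (x, r) s \<partial>lborel \<partial>flips) =
      (\<integral>\<^sup>+r. (\<integral>\<^sup>+s. of_bool (0 \<le> s \<and> s < coarsen r x 1) * F (\<lambda>j. coarsen r x j - s) \<partial>lborel) \<partial>palm_flips)"
      using ts sm
    proof eventually_elim
      case (elim x)
      define g where "g y = (\<integral>\<^sup>+s. of_bool (0 \<le> s \<and> s < y 1) * F (\<lambda>j. y j - s) \<partial>lborel)" for y :: "int \<Rightarrow> real"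
      have gm: "g \<in> borel_measurable borel"
        unfolding g_def by (rule cell_integral_measurable[where U = "\<lambda>y. y" and V = "\<lambda>y. y", OF F]) simp_all
      have cm: "(\<lambda>r. coarsen r x) \<in> flips \<rightarrow>\<^sub>M borel"
        using measurable_compose[OF measurable_Pair1' measurable_coarsen, of x] by simp
      have gcm: "(\<lambda>r. g (coarsen r x)) \<in> borel_measurable flips" by (rule measurable_compose[OF cm gm])
      have eq: "(\<integral>\<^sup>+s. c (x, r) s \<partial>lborel) = ennreal (4 / 3) * (of_bool (occ r 0) * g (coarsen r x))" for r
      proof (cases "occ r 0")
        case True
        have o1: "next_occ r 0 = occs r 1" by (simp add: occs_1 next_occ_def)
        have hs: "h (x, r) s = F (\<lambda>k. 3 / 4 * (mid x (occs r k) - s))" for s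
        proof -
          have "two_sided (\<lambda>j. x j - s)" "strict_mono (\<lambda>j. x j - s)"
            using elim two_sided_translate[of x s] by (auto simp: strict_mono_def)
          then obtain i where "cluster_step (\<lambda>j. x j - s) r = reindex i (\<lambda>k. 3 / 4 * mid (\<lambda>j. x j - s) (occs r k))"
            using cluster_step_reindex True by blast
          moreover have "mid (\<lambda>j. x j - s) k = mid x k - s" for k by (simp add: mid_def field_simps)
          ultimately show ?thesis by (simp add: h_def Fr)
        qed
        have csm: "(\<lambda>s. c (x, r) s) \<in> borel_measurable borel"
        proof -
          have "(\<lambda>s :: real. ((x, r), s)) \<in> borel \<rightarrow>\<^sub>M (borel \<Otimes>\<^sub>M flips) \<Otimes>\<^sub>M borel" by measurable
          from measurable_compose[OF this mc] show ?thesis by simp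
        qed
        \<comment> \<open>Positions are measured from the new point at the origin, in the rescaled unit of length.\<close>
        have "(\<integral>\<^sup>+s. c (x, r) s \<partial>lborel) = ennreal \<bar>4 / 3\<bar> * (\<integral>\<^sup>+s. c (x, r) (mid x 0 + 4 / 3 * s) \<partial>lborel)"
          by (rule nn_integral_real_affine[OF csm]) simp
        also have "(\<integral>\<^sup>+s. c (x, r) (mid x 0 + 4 / 3 * s) \<partial>lborel) = g (coarsen r x)"
          unfolding g_def
        proof (rule nn_integral_cong)
          fix s
          have "(\<lambda>k. 3 / 4 * (mid x (occs r k) - (mid x 0 + 4 / 3 * s))) = (\<lambda>j. coarsen r x j - s)"
            by (simp add: coarsen_def fun_eq_iff field_simps)
          moreover have "(mid x 0 \<le> mid x 0 + 4 / 3 * s \<and> mid x 0 + 4 / 3 * s < mid x (occs r 1)) \<longleftrightarrow> (0 \<le> s \<and> s < coarsen r x 1)"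
            by (auto simp: coarsen_def field_simps)
          ultimately show "c (x, r) (mid x 0 + 4 / 3 * s) = of_bool (0 \<le> s \<and> s < coarsen r x 1) * F (\<lambda>j. coarsen r x j - s)"
            using True by (simp add: c_def hs o1)
        qed
        finally show ?thesis using True by simp
      qed (simp add: c_def)
      have "(\<integral>\<^sup>+r. \<integral>\<^sup>+s. c (x, r) s \<partial>lborel \<partial>flips) = ennreal (4 / 3) * (\<integral>\<^sup>+r. of_bool (occ r 0) * g (coarsen r x) \<partial>flips)"
        unfolding eq by (rule nn_integral_cmult) (intro borel_measurable_times_ennreal gcm, measurable)
      then show ?case using nn_integral_palm_flips[OF gcm] unfolding g_def by simp
    qed
  qed
  also have "\<dots> = (\<integral>\<^sup>+x. \<integral>\<^sup>+s. of_bool (0 \<le> s \<and> s < x 1) * F (\<lambda>j. x j - s) \<partial>lborel \<partial>palm_step_law P0)"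
  proof -
    have "(\<lambda>x :: int \<Rightarrow> real. \<integral>\<^sup>+s. of_bool (0 \<le> s \<and> s < x 1) * F (\<lambda>j. x j - s) \<partial>lborel) \<in> borel_measurable borel"
      by (rule cell_integral_measurable[where U = "\<lambda>y. y" and V = "\<lambda>y. y", OF F]) simp_all
    from nn_integral_palm_step_law[OF s0 this] show ?thesis ..
  qed
  finally show "(\<integral>\<^sup>+x. F x \<partial>step_law P) =
    (\<integral>\<^sup>+x. \<integral>\<^sup>+s. of_bool (0 \<le> s \<and> s < x 1) * F (\<lambda>j. x j - s) \<partial>lborel \<partial>palm_step_law P0)" .
qed

section \<open>Iterating the dynamics\<close>

text \<open>
  Invariance under the shift to the next point generates invariance under all shifts: the shifts form a
  group of transformations on configurations with point \<open>0\<close> at the origin.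
\<close>

lemma cycle_stationaryI:
  assumes pr: "prob_space P" and s: "sets P = sets borel" and ts: "AE x in P. two_sided x"
    and z: "AE x in P. x 0 = 0" and one: "distr P borel (from_point 1) = P"
  shows "cycle_stationary P"
proof -
  have m: "from_point i \<in> P \<rightarrow>\<^sub>M borel" for i using from_point_measurable s measurable_cong_sets by blast
  have comp: "from_point i (from_point j x) = from_point (i + j) x" for i j x
    by (simp add: from_point_def fun_eq_iff algebra_simps)
  have dd: "distr (distr P borel (from_point j)) borel (from_point i) = distr P borel (from_point (i + j))" for i j
    using m by (subst distr_distr) (auto simp: comp_def comp)
  have zero: "distr P borel (from_point 0) = P"
  proof -
    have "distr P borel (from_point 0) = distr P borel (\<lambda>x. x)"
      by (rule distr_cong_AE[OF refl refl]) (use z m s in \<open>auto simp: from_point_def fun_eq_iff elim!: eventually_mono\<close>)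
    also have "\<dots> = P" by (rule distr_id2) (simp add: s)
    finally show ?thesis .
  qed
  have "distr P borel (from_point i) = P" for i
  proof (induction i rule: int_induct[of _ 0])
    case (step1 i)
    then show ?case using dd[of 1 i] one by (metis add.commute)
  next
    case (step2 i)
    have "distr P borel (from_point (i - 1)) = distr (distr P borel (from_point 1)) borel (from_point (i - 1))" by (simp add: one)
    also have "\<dots> = P" unfolding dd diff_add_cancel by (rule step2(2))
    finally show ?case .
  qed (rule zero)
  then show ?thesis using pr s ts by (simp add: cycle_stationary_def)
qed

lemma sets_palm_step_law [simp]: "sets (palm_step_law P) = sets borel"
  by (simp add: palm_step_law_def)

lemma AE_palm_step_law:
  assumes P: "sets P = sets borel" "prob_space P" and Q: "{x. Q x} \<in> sets borel"
    and ae: "AE x in P. \<forall>r. occ r 0 \<longrightarrow> Q (coarsen r x)"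
  shows "AE x in palm_step_law P. Q x"
proof -
  have Q': "{x. \<not> Q x} \<in> sets borel" using sets.compl_sets[OF Q] by (simp add: Collect_neg_eq Compl_eq_Diff_UNIV)
  have "emeasure (palm_step_law P) {x. \<not> Q x} = (\<integral>\<^sup>+x. indicator {x. \<not> Q x} x \<partial>palm_step_law P)"
    using Q' by simp
  also have "\<dots> = (\<integral>\<^sup>+x. \<integral>\<^sup>+r. indicator {x. \<not> Q x} (coarsen r x) \<partial>palm_flips \<partial>P)"
    by (rule nn_integral_palm_step_law[OF P(1)]) (use Q' in simp)
  also have "\<dots> = (\<integral>\<^sup>+x. 0 \<partial>P)"
  proof (rule nn_integral_cong_AE, use ae in eventually_elim)
    case (elim x)
    have "(\<integral>\<^sup>+r. indicator {x. \<not> Q x} (coarsen r x) \<partial>palm_flips) = (\<integral>\<^sup>+r. 0 \<partial>palm_flips)"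
      by (rule nn_integral_cong_AE) (use AE_palm_flips elim in \<open>auto simp: indicator_def elim!: eventually_mono\<close>)
    then show ?case by simp
  qed
  finally show ?thesis
    by (intro AE_I[where N = "{x. \<not> Q x}"]) (use Q' in auto)
qed

text \<open>
  Passing to the next point of the new process means passing to the next occupied edge. For fixed coins
  the old configuration is shifted by a fixed number of points, which preserves its law, and
  afterwards the coins are shifted to their next occupied edge, which preserves theirs.
\<close>

lemma palm_step_cycle_stationary:
  assumes P: "cycle_stationary P"
  shows "cycle_stationary (palm_step_law P)"
proof (rule cycle_stationaryI)
  interpret R: prob_space palm_flips by (rule prob_space_palm_flips)
  interpret P: prob_space P using P by (simp add: cycle_stationary_def)
  interpret PR: pair_prob_space P palm_flips by unfold_locales
  have s: "sets P = sets borel" and ts: "AE x in P. two_sided x" using P by (simp_all add: cycle_stationary_def)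
  have m: "(\<lambda>w. coarsen (snd w) (fst w)) \<in> P \<Otimes>\<^sub>M palm_flips \<rightarrow>\<^sub>M borel"
    using measurable_coarsen by (simp add: pair_measurable_cong[OF s sets_palm_flips])
  show "prob_space (palm_step_law P)"
    unfolding palm_step_law_def by (rule PR.prob_space_distr[OF m])
  show "sets (palm_step_law P) = sets borel" by simp
  show "AE x in palm_step_law P. two_sided x"
    by (rule AE_palm_step_law[OF s P.prob_space_axioms measurable_two_sided])
       (use ts in \<open>auto simp: coarsen_two_sided elim!: eventually_mono\<close>)
  show "AE x in palm_step_law P. x 0 = 0"
    by (rule AE_palm_step_law[OF s P.prob_space_axioms]) (auto simp: coarsen_def)
  show "distr (palm_step_law P) borel (from_point 1) = palm_step_law P"
  proof (rule measure_eqI_nn_integral)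
    fix f :: "(int \<Rightarrow> real) \<Rightarrow> ennreal" assume "f \<in> borel_measurable (distr (palm_step_law P) borel (from_point 1))"
    then have f: "f \<in> borel_measurable borel" by simp
    have ff: "(\<lambda>x. f (from_point 1 x)) \<in> borel_measurable borel"
      by (rule measurable_compose[OF from_point_measurable f])
    have fc: "(\<lambda>w. f (coarsen (snd w) (fst w))) \<in> borel_measurable (borel \<Otimes>\<^sub>M flips)"
      by (rule measurable_compose[OF measurable_coarsen f])
    have fx: "(\<lambda>x. f (coarsen r x)) \<in> borel_measurable borel" for r
      using measurable_compose[OF measurable_Pair2' fc, of r] by simp
    have fub: "(\<integral>\<^sup>+x. \<integral>\<^sup>+r. G x r \<partial>palm_flips \<partial>P) = (\<integral>\<^sup>+r. \<integral>\<^sup>+x. G x r \<partial>P \<partial>palm_flips)"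
      if "(\<lambda>w. G (fst w) (snd w)) \<in> borel_measurable (borel \<Otimes>\<^sub>M flips)" for G :: "(int \<Rightarrow> real) \<Rightarrow> (int \<Rightarrow> bool) \<Rightarrow> ennreal"
      using that by (intro PR.Fubini'[symmetric]) (simp add: pair_measurable_cong[OF s sets_palm_flips] case_prod_beta')
    \<comment> \<open>The next new point is the midpoint of the old edge \<open>occs r 1\<close>; seen from its left end the coins are those of \<open>palm_shift r\<close>.\<close>
    have shifted: "from_point 1 (coarsen r x) = coarsen (palm_shift r) (from_point (occs r 1) x)" if "occ r 0" for r x
    proof -
      have m: "mid (from_point d x) j = mid x (d + j) - x d" for d j by (simp add: mid_def field_simps add.assoc)
      show ?thesis
      proof
        fix k
        have "from_point 1 (coarsen r x) k = coarsen r x (1 + k) - coarsen r x 1" by simp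
        also have "\<dots> = coarsen (palm_shift r) (from_point (occs r 1) x) k"
          unfolding coarsen_def occs_palm_shift[OF that] m by (simp add: algebra_simps)
        finally show "from_point 1 (coarsen r x) k = coarsen (palm_shift r) (from_point (occs r 1) x) k" .
      qed
    qed
    have "(\<integral>\<^sup>+x. f x \<partial>distr (palm_step_law P) borel (from_point 1)) = (\<integral>\<^sup>+x. f (from_point 1 x) \<partial>palm_step_law P)"
      by (rule nn_integral_distr) (auto simp: f measurable_cong_sets[OF sets_palm_step_law refl])
    also have "\<dots> = (\<integral>\<^sup>+x. \<integral>\<^sup>+r. f (from_point 1 (coarsen r x)) \<partial>palm_flips \<partial>P)"
      by (rule nn_integral_palm_step_law[OF s ff])
    also have "\<dots> = (\<integral>\<^sup>+r. \<integral>\<^sup>+x. f (from_point 1 (coarsen r x)) \<partial>P \<partial>palm_flips)"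
      by (rule fub) (rule measurable_compose[OF measurable_coarsen ff])
    also have "\<dots> = (\<integral>\<^sup>+r. \<integral>\<^sup>+x. f (coarsen (palm_shift r) x) \<partial>P \<partial>palm_flips)"
    proof (rule nn_integral_cong_AE, use AE_palm_flips in eventually_elim)
      case (elim r)
      have "(\<integral>\<^sup>+x. f (coarsen (palm_shift r) x) \<partial>P) = (\<integral>\<^sup>+x. f (coarsen (palm_shift r) x) \<partial>distr P borel (from_point (occs r 1)))"
        using P by (simp add: cycle_stationary_def)
      also have "\<dots> = (\<integral>\<^sup>+x. f (coarsen (palm_shift r) (from_point (occs r 1) x)) \<partial>P)"
        by (rule nn_integral_distr) (use fx in \<open>auto simp: measurable_cong_sets[OF s refl]\<close>)
      finally show ?case by (simp add: shifted[OF elim])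
    qed
    also have "\<dots> = (\<integral>\<^sup>+r. \<integral>\<^sup>+x. f (coarsen r x) \<partial>P \<partial>palm_flips)"
    proof (rule nn_integral_palm_shift[where f = "\<lambda>r. \<integral>\<^sup>+x. f (coarsen r x) \<partial>P"])
      have "(\<lambda>(r, x). f (coarsen r x)) \<in> borel_measurable (flips \<Otimes>\<^sub>M P)"
        using measurable_pair_swap[OF fc[folded pair_measurable_cong[OF s refl]]] by (simp add: case_prod_beta')
      then show "(\<lambda>r. \<integral>\<^sup>+x. f (coarsen r x) \<partial>P) \<in> borel_measurable flips"
        by (intro P.borel_measurable_nn_integral)
    qed
    also have "\<dots> = (\<integral>\<^sup>+x. \<integral>\<^sup>+r. f (coarsen r x) \<partial>palm_flips \<partial>P)"
      by (rule fub[symmetric]) (rule fc)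
    also have "\<dots> = (\<integral>\<^sup>+x. f x \<partial>palm_step_law P)"
      by (rule nn_integral_palm_step_law[OF s f, symmetric])
    finally show "(\<integral>\<^sup>+x. f x \<partial>distr (palm_step_law P) borel (from_point 1)) = (\<integral>\<^sup>+x. f x \<partial>palm_step_law P)" .
  qed simp
qed

lemma palm_step_strict_mono:
  assumes P: "cycle_stationary P" and sm: "AE x in P. strict_mono x"
  shows "AE x in palm_step_law P. strict_mono x"
  by (rule AE_palm_step_law[OF _ _ strict_mono_sets])
     (use P sm in \<open>auto simp: cycle_stationary_def coarsen_strict_mono elim!: eventually_mono\<close>)

lemma coins_eq: "coins = (\<Pi>\<^sub>M t\<in>UNIV. flips)"
  by (simp add: coins_def flips_def)

lemma nn_integral_case_nat:
  fixes M :: "'a measure"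
  assumes pr: "prob_space M" and f: "f \<in> borel_measurable (\<Pi>\<^sub>M n\<in>(UNIV :: nat set). M)"
  shows "(\<integral>\<^sup>+r. f r \<partial>(\<Pi>\<^sub>M n\<in>(UNIV :: nat set). M)) = (\<integral>\<^sup>+r0. \<integral>\<^sup>+r. f (case_nat r0 r) \<partial>(\<Pi>\<^sub>M n\<in>(UNIV :: nat set). M) \<partial>M)"
proof -
  interpret M: prob_space M by fact
  interpret sequence_space M by unfold_locales
  have m: "(\<lambda>(s, \<omega>). case_nat s \<omega>) \<in> M \<Otimes>\<^sub>M S \<rightarrow>\<^sub>M S"
  proof (rule measurable_PiM_single')
    fix i :: nat show "(\<lambda>w. (case w of (s, \<omega>) \<Rightarrow> case_nat s \<omega>) i) \<in> M \<Otimes>\<^sub>M S \<rightarrow>\<^sub>M M"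
      by (cases i) (simp_all add: case_prod_beta')
  qed (auto simp: space_pair_measure space_PiM PiE_iff split: nat.split)
  have "(\<integral>\<^sup>+r. f r \<partial>S) = (\<integral>\<^sup>+w. f (case w of (s, \<omega>) \<Rightarrow> case_nat s \<omega>) \<partial>(M \<Otimes>\<^sub>M S))"
    using nn_integral_distr[OF m, of f] f by (simp add: PiM_iter)
  also have "\<dots> = (\<integral>\<^sup>+s. \<integral>\<^sup>+\<omega>. f (case_nat s \<omega>) \<partial>S \<partial>M)"
    using nn_integral_fst[OF measurable_compose[OF m f]] by simp
  finally show ?thesis .
qed

lemma clustering_Suc: "clustering x r (Suc t) = clustering (cluster_step x (r 0)) (\<lambda>n. r (Suc n)) t"
  by (induction t) (simp_all add: cluster_step_def)

lemma prob_space_coins: "prob_space coins"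
  unfolding coins_eq by (intro prob_space_PiM prob_space_flips)

lemma measurable_clustering: "(\<lambda>w. clustering (fst w) (snd w) t) \<in> borel \<Otimes>\<^sub>M coins \<rightarrow>\<^sub>M borel"
proof (induction t)
  case (Suc t)
  have c: "(\<lambda>r. r t) \<in> coins \<rightarrow>\<^sub>M flips" unfolding coins_eq by (rule measurable_component_singleton) simp
  have "(\<lambda>w. (clustering (fst w) (snd w) t, snd w t)) \<in> borel \<Otimes>\<^sub>M coins \<rightarrow>\<^sub>M borel \<Otimes>\<^sub>M flips"
    by (intro measurable_Pair Suc measurable_compose[OF measurable_snd c])
  from measurable_compose[OF this measurable_cluster_step] show ?case by (simp add: cluster_step_def)
qed simp

lemma nn_integral_clustering_law:
  assumes P: "sets P = sets borel" and f: "f \<in> borel_measurable borel"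
  shows "(\<integral>\<^sup>+x. f x \<partial>clustering_law P t) = (\<integral>\<^sup>+x. \<integral>\<^sup>+r. f (clustering x r t) \<partial>coins \<partial>P)"
proof -
  interpret prob_space coins by (rule prob_space_coins)
  have m: "(\<lambda>(x, r). clustering x r t) \<in> P \<Otimes>\<^sub>M coins \<rightarrow>\<^sub>M borel"
    using measurable_clustering[of t] measurable_cong_sets[OF sets_pair_measure_cong[OF P refl] refl]
    by (simp add: case_prod_beta') blast
  show ?thesis
    unfolding clustering_law_def nn_integral_distr[OF m, simplified, OF f]
    using nn_integral_fst[OF measurable_compose[OF m f]] by simp
qed

lemma sets_clustering_law [simp]: "sets (clustering_law P t) = sets borel"
  by (simp add: clustering_law_def)

lemma sets_step_law [simp]: "sets (step_law P) = sets borel"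
  by (simp add: step_law_def)

lemma clustering_law_0:
  assumes P: "sets P = sets borel" shows "clustering_law P 0 = P"
proof (rule measure_eqI_nn_integral)
  interpret prob_space coins by (rule prob_space_coins)
  fix f :: "(int \<Rightarrow> real) \<Rightarrow> ennreal" assume "f \<in> borel_measurable (clustering_law P 0)"
  then have "f \<in> borel_measurable borel" by (simp add: measurable_cong_sets[OF sets_clustering_law refl])
  from nn_integral_clustering_law[OF P this, of 0] show "(\<integral>\<^sup>+x. f x \<partial>clustering_law P 0) = (\<integral>\<^sup>+x. f x \<partial>P)"
    by (simp add: emeasure_space_1)
qed (simp add: P)

text \<open>
  The first step uses the coins with index \<open>0\<close>, the later ones use an independent copy of the same coins.
\<close>

lemma clustering_law_Suc:
  assumes P: "sets P = sets borel" shows "clustering_law P (Suc t) = clustering_law (step_law P) t"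
proof (rule measure_eqI_nn_integral)
  interpret C: prob_space coins by (rule prob_space_coins)
  fix f :: "(int \<Rightarrow> real) \<Rightarrow> ennreal" assume "f \<in> borel_measurable (clustering_law P (Suc t))"
  then have f: "f \<in> borel_measurable borel" by (simp add: measurable_cong_sets[OF sets_clustering_law refl])
  have fc: "(\<lambda>w. f (clustering (fst w) (snd w) t)) \<in> borel_measurable (borel \<Otimes>\<^sub>M coins)" for t
    by (rule measurable_compose[OF measurable_clustering f])
  have fr: "(\<lambda>r. f (clustering x r t)) \<in> borel_measurable coins" for x t
    using measurable_compose[OF measurable_Pair1' fc, of x] by simp
  define g where "g x = (\<integral>\<^sup>+r. f (clustering x r t) \<partial>coins)" for x
  have g: "g \<in> borel_measurable borel" unfolding g_def
    using fc by (intro C.borel_measurable_nn_integral) (simp add: case_prod_beta')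
  have "(\<integral>\<^sup>+x. f x \<partial>clustering_law P (Suc t)) = (\<integral>\<^sup>+x. \<integral>\<^sup>+r. f (clustering x r (Suc t)) \<partial>coins \<partial>P)"
    by (rule nn_integral_clustering_law[OF P f])
  also have "\<dots> = (\<integral>\<^sup>+x. \<integral>\<^sup>+r0. g (cluster_step x r0) \<partial>flips \<partial>P)"
  proof (rule nn_integral_cong)
    fix x
    show "(\<integral>\<^sup>+r. f (clustering x r (Suc t)) \<partial>coins) = (\<integral>\<^sup>+r0. g (cluster_step x r0) \<partial>flips)"
      unfolding coins_eq
      by (subst nn_integral_case_nat[OF prob_space_flips(1) fr[of x "Suc t", unfolded coins_eq]])
         (simp add: clustering_Suc g_def coins_eq del: clustering.simps(2))
  qed
  also have "\<dots> = (\<integral>\<^sup>+x. g x \<partial>step_law P)" by (rule nn_integral_step_law[OF P g, symmetric])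
  also have "\<dots> = (\<integral>\<^sup>+x. f x \<partial>clustering_law (step_law P) t)"
    unfolding g_def by (rule nn_integral_clustering_law[OF sets_step_law f, symmetric])
  finally show "(\<integral>\<^sup>+x. f x \<partial>clustering_law P (Suc t)) = (\<integral>\<^sup>+x. f x \<partial>clustering_law (step_law P) t)" .
qed simp

lemma clustering_law_inverts:
  assumes "cycle_stationary P0" "AE x in P0. strict_mono x" "inverts P P0" "sets P = sets borel"
  shows "inverts (clustering_law P t) ((palm_step_law ^^ t) P0) \<and> cycle_stationary ((palm_step_law ^^ t) P0)"
  using assms
proof (induction t arbitrary: P P0)
  case 0
  then show ?case by (simp add: clustering_law_0)
next
  case (Suc t)
  show ?case
    unfolding clustering_law_Suc[OF Suc.prems(4)] funpow_Suc_right comp_def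
    by (rule Suc.IH) (use Suc.prems in \<open>simp_all add: palm_step_cycle_stationary palm_step_strict_mono inverts_step\<close>)
qed

definition palm_coins :: "(nat \<Rightarrow> int \<Rightarrow> bool) measure" where
  "palm_coins = (\<Pi>\<^sub>M t\<in>UNIV. palm_flips)"

text \<open>
  The coins with index \<open>0\<close> are used by the last step. For every fixed number of steps this gives the same law as
  the order in time, but now an additional step is inserted at the innermost place, next to the
  starting configuration, where it changes very little: this order converges almost surely.
\<close>

primrec coarsenings :: "nat \<Rightarrow> (nat \<Rightarrow> int \<Rightarrow> bool) \<Rightarrow> (int \<Rightarrow> real) \<Rightarrow> int \<Rightarrow> real" where
  "coarsenings 0 r x = x"
| "coarsenings (Suc t) r x = coarsen (r 0) (coarsenings t (\<lambda>n. r (Suc n)) x)"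

lemma prob_space_palm_coins: "prob_space palm_coins"
  unfolding palm_coins_def by (intro prob_space_PiM prob_space_palm_flips)

lemma measurable_palm_coin: "(\<lambda>r. r t) \<in> palm_coins \<rightarrow>\<^sub>M flips"
  using measurable_component_singleton[of t UNIV "\<lambda>_. palm_flips"]
  unfolding palm_coins_def by (simp add: measurable_cong_sets[OF refl sets_palm_flips])

lemma measurable_shift_coins: "(\<lambda>r n. r (Suc n)) \<in> palm_coins \<rightarrow>\<^sub>M palm_coins"
  using measurable_palm_coin
  by (subst (2) palm_coins_def, intro measurable_PiM_single')
     (auto simp: measurable_cong_sets[OF refl sets_palm_flips])

lemma space_palm_coins [simp]: "space palm_coins = UNIV"
  by (simp add: palm_coins_def space_PiM)

lemma measurable_coarsenings: "(\<lambda>w. coarsenings t (snd w) (fst w)) \<in> borel \<Otimes>\<^sub>M palm_coins \<rightarrow>\<^sub>M borel"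
proof (induction t)
  case (Suc t)
  have "(\<lambda>w :: (int \<Rightarrow> real) \<times> (nat \<Rightarrow> int \<Rightarrow> bool). (fst w, (\<lambda>n. snd w (Suc n)))) \<in> borel \<Otimes>\<^sub>M palm_coins \<rightarrow>\<^sub>M borel \<Otimes>\<^sub>M palm_coins"
    by (intro measurable_Pair measurable_fst measurable_compose[OF measurable_snd measurable_shift_coins])
  from measurable_compose[OF this Suc]
  have "(\<lambda>w. coarsenings t (\<lambda>n. snd w (Suc n)) (fst w)) \<in> borel \<Otimes>\<^sub>M palm_coins \<rightarrow>\<^sub>M borel" by simp
  then have "(\<lambda>w. (coarsenings t (\<lambda>n. snd w (Suc n)) (fst w), snd w 0)) \<in> borel \<Otimes>\<^sub>M palm_coins \<rightarrow>\<^sub>M borel \<Otimes>\<^sub>M flips"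
    by (intro measurable_Pair measurable_compose[OF measurable_snd measurable_palm_coin])
  from measurable_compose[OF this measurable_coarsen] show ?case by simp
qed simp

lemma nn_integral_palm_coins:
  assumes "f \<in> borel_measurable palm_coins"
  shows "(\<integral>\<^sup>+r. f r \<partial>palm_coins) = (\<integral>\<^sup>+r0. \<integral>\<^sup>+r. f (case_nat r0 r) \<partial>palm_coins \<partial>palm_flips)"
  using nn_integral_case_nat[OF prob_space_palm_flips] assms unfolding palm_coins_def by blast

lemma nn_integral_palm_step_iter:
  assumes pr: "prob_space P0" and s: "sets P0 = sets borel" and f: "f \<in> borel_measurable borel"
  shows "(\<integral>\<^sup>+x. f x \<partial>(palm_step_law ^^ t) P0) = (\<integral>\<^sup>+x. \<integral>\<^sup>+r. f (coarsenings t r x) \<partial>palm_coins \<partial>P0)"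
  using f
proof (induction t arbitrary: f)
  case 0
  interpret prob_space palm_coins by (rule prob_space_palm_coins)
  show ?case by (simp add: emeasure_space_1[simplified])
next
  case (Suc t)
  interpret R: prob_space palm_flips by (rule prob_space_palm_flips)
  interpret C: prob_space palm_coins by (rule prob_space_palm_coins)
  interpret RC: pair_prob_space palm_flips palm_coins by unfold_locales
  note f = Suc.prems
  have fc: "(\<lambda>w. f (coarsen (snd w) (fst w))) \<in> borel_measurable (borel \<Otimes>\<^sub>M flips)"
    by (rule measurable_compose[OF measurable_coarsen f])
  define g where "g z = (\<integral>\<^sup>+r0. f (coarsen r0 z) \<partial>palm_flips)" for z
  have g: "g \<in> borel_measurable borel" unfolding g_def
    using fc by (intro R.borel_measurable_nn_integral)
      (simp add: case_prod_beta' measurable_cong_sets[OF sets_pair_measure_cong[OF refl sets_palm_flips] refl])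
  have sT: "sets ((palm_step_law ^^ t) P0) = sets borel" using s by (cases t) simp_all
  have "(\<integral>\<^sup>+x. f x \<partial>(palm_step_law ^^ Suc t) P0) = (\<integral>\<^sup>+z. g z \<partial>(palm_step_law ^^ t) P0)"
    unfolding g_def using nn_integral_palm_step_law[OF sT f] by simp
  also have "\<dots> = (\<integral>\<^sup>+x. \<integral>\<^sup>+r. g (coarsenings t r x) \<partial>palm_coins \<partial>P0)" by (rule Suc.IH[OF g])
  also have "\<dots> = (\<integral>\<^sup>+x. \<integral>\<^sup>+r. f (coarsenings (Suc t) r x) \<partial>palm_coins \<partial>P0)"
  proof (rule nn_integral_cong)
    fix x
    have z: "(\<lambda>r. coarsenings t r x) \<in> palm_coins \<rightarrow>\<^sub>M borel" for t
      using measurable_compose[OF measurable_Pair1' measurable_coarsenings, of x] by simp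
    have fz: "(\<lambda>r. f (coarsenings (Suc t) r x)) \<in> borel_measurable palm_coins"
      by (rule measurable_compose[OF z f])
    have "(\<lambda>w. (coarsenings t (snd w) x, fst w)) \<in> flips \<Otimes>\<^sub>M palm_coins \<rightarrow>\<^sub>M borel \<Otimes>\<^sub>M flips"
      by (intro measurable_Pair measurable_fst measurable_compose[OF measurable_snd z])
    from measurable_compose[OF this fc]
    have m: "(\<lambda>(r0, r). f (coarsen r0 (coarsenings t r x))) \<in> borel_measurable (palm_flips \<Otimes>\<^sub>M palm_coins)"
      by (simp add: case_prod_beta' measurable_cong_sets[OF sets_pair_measure_cong[OF sets_palm_flips refl] refl])
    have "(\<integral>\<^sup>+r. g (coarsenings t r x) \<partial>palm_coins) = (\<integral>\<^sup>+r0. \<integral>\<^sup>+r. f (coarsen r0 (coarsenings t r x)) \<partial>palm_coins \<partial>palm_flips)"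
      unfolding g_def by (rule RC.Fubini'[OF m])
    also have "\<dots> = (\<integral>\<^sup>+r. f (coarsenings (Suc t) r x) \<partial>palm_coins)"
      unfolding nn_integral_palm_coins[OF fz] by simp
    finally show "(\<integral>\<^sup>+r. g (coarsenings t r x) \<partial>palm_coins) = (\<integral>\<^sup>+r. f (coarsenings (Suc t) r x) \<partial>palm_coins)" .
  qed
  finally show ?case .
qed

section \<open>Contraction of weighted gaps\<close>

text \<open>
  Linear functionals of a configuration with point \<open>0\<close> at the origin; the positions of its points are
  the case of constant weights.
\<close>

definition weighted_gaps :: "int \<Rightarrow> nat \<Rightarrow> (int \<Rightarrow> real) \<Rightarrow> (int \<Rightarrow> real) \<Rightarrow> real" where
  "weighted_gaps m n w x = (\<Sum>k\<in>{m..<m + int n}. w k * gap k x)"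

definition weight :: "int \<Rightarrow> nat \<Rightarrow> (int \<Rightarrow> real) \<Rightarrow> real" where
  "weight m n w = (\<Sum>k\<in>{m..<m + int n}. w k)"

definition unit_weights :: "(int \<Rightarrow> real) \<Rightarrow> bool" where
  "unit_weights w \<longleftrightarrow> (\<forall>k. 0 \<le> w k \<and> w k \<le> 1)"

text \<open>
  The weight of the old gap \<open>j\<close> in the new gap \<open>k\<close>: one half at each of the two occupied edges that bound the new
  gap, and one at a skipped edge in between.
\<close>

definition coef :: "(int \<Rightarrow> bool) \<Rightarrow> int \<Rightarrow> int \<Rightarrow> real" where
  "coef r k j = of_bool (j = occs r k) / 2 + of_bool (occs r k < j \<and> j < occs r (k + 1)) + of_bool (j = occs r (k + 1)) / 2"

lemma weight_nonneg: "unit_weights w \<Longrightarrow> 0 \<le> weight m n w"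
  unfolding weight_def unit_weights_def by (intro sum_nonneg) auto

lemma weighted_gaps_measurable: "weighted_gaps m n w \<in> borel_measurable borel"
  unfolding weighted_gaps_def[abs_def] by (intro borel_measurable_sum borel_measurable_times gap_measurable) simp

lemma coef_cell:
  assumes r: "occ r 0" and J: "finite J" "{occs r k..occs r (k + 1)} \<subseteq> J"
  shows "(\<Sum>j\<in>J. coef r k j * g j) =
    (g (occs r k) + g (occs r (k + 1))) / 2 + of_bool (skip r k) * g (occs r k + 1)"
proof -
  have z: "coef r k j * g j = 0" if "j \<notin> {occs r k..occs r (k + 1)}" for j
    using that occs_step_skip[OF r, of k] by (auto simp: coef_def split: if_splits)
  have "(\<Sum>j\<in>J. coef r k j * g j) = (\<Sum>j\<in>{occs r k..occs r (k + 1)}. coef r k j * g j)"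
    by (rule sum.mono_neutral_right[OF J]) (use z in auto)
  also have "\<dots> = (g (occs r k) + g (occs r (k + 1))) / 2 + of_bool (skip r k) * g (occs r k + 1)"
  proof (cases "skip r k")
    case True
    then have e: "occs r (k + 1) = occs r k + 2" by (simp add: occs_step_skip[OF r])
    have "{occs r k..occs r (k + 1)} = {occs r k, occs r k + 1, occs r k + 2}" unfolding e by auto
    then show ?thesis using True by (simp add: coef_def e add_divide_distrib)
  next
    case False
    then have e: "occs r (k + 1) = occs r k + 1" by (simp add: occs_step_skip[OF r])
    have "{occs r k..occs r (k + 1)} = {occs r k, occs r k + 1}" unfolding e by auto
    then show ?thesis using False by (simp add: coef_def e add_divide_distrib)
  qed
  finally show ?thesis .
qed

lemma gap_coarsen:
  assumes r: "occ r 0"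
  shows "gap k (coarsen r z) =
    3 / 4 * ((gap (occs r k) z + gap (occs r (k + 1)) z) / 2 + of_bool (skip r k) * gap (occs r k + 1) z)"
  unfolding gap_def coarsen_def mid_def occs_step_skip[OF r]
  by (cases "skip r k") (simp_all add: field_simps add.assoc)

lemma sum_of_bool_le_1:
  assumes "finite K" "\<And>a b. a \<in> K \<Longrightarrow> b \<in> K \<Longrightarrow> Q a \<Longrightarrow> Q b \<Longrightarrow> a = b"
  shows "(\<Sum>k\<in>K. of_bool (Q k) :: real) \<le> 1"
proof (cases "\<exists>a\<in>K. Q a")
  case True
  then obtain a where a: "a \<in> K" "Q a" by blast
  have "(\<Sum>k\<in>K. of_bool (Q k) :: real) = (\<Sum>k\<in>K. if k = a then 1 else 0)"
    by (intro sum.cong refl) (use assms(2) a in auto)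
  also have "\<dots> = 1" using assms(1) a by simp
  finally show ?thesis by (rule eq_refl)
next
  case False
  then have "(\<Sum>k\<in>K. of_bool (Q k) :: real) = 0" by (intro sum.neutral) auto
  then show ?thesis by simp
qed

text \<open>
  An occupied edge is shared by two new gaps with weight one half each, and a skipped edge belongs to a
  single new gap. No old gap is used more than once in total.
\<close>

lemma sum_coef_le_1:
  assumes r: "occ r 0" and K: "finite K"
  shows "(\<Sum>k\<in>K. coef r k j) \<le> 1"
proof (cases "occ r j")
  case True
  have no: "\<not> (occs r k < j \<and> j < occs r (k + 1))" for k
  proof
    assume k: "occs r k < j \<and> j < occs r (k + 1)"
    then have "skip r k" and "j = occs r k + 1" using occs_step_skip[OF r, of k] by (auto split: if_splits)
    then show False using True by (simp add: skip_def)
  qed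
  have inj: "occs r a = occs r b \<Longrightarrow> a = b" for a b
    using occs_strict_mono[OF r] strict_mono_eq by blast
  have "(\<Sum>k\<in>K. coef r k j) = (\<Sum>k\<in>K. of_bool (j = occs r k)) / 2 + (\<Sum>k\<in>K. of_bool (j = occs r (k + 1))) / 2"
  proof -
    have nz: "of_bool (occs r k < j \<and> j < occs r (k + 1)) = (0 :: real)" for k using no[of k] by simp
    show ?thesis unfolding coef_def nz by (simp only: sum.distrib sum_divide_distrib add_0_right)
  qed
  also have "\<dots> \<le> 1 / 2 + 1 / 2"
  proof (intro add_mono divide_right_mono sum_of_bool_le_1 K)
    show "a = b" if "j = occs r a" "j = occs r b" for a b using that inj by simp
    show "a = b" if "j = occs r (a + 1)" "j = occs r (b + 1)" for a b using that inj[of "a + 1" "b + 1"] by simp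
  qed auto
  finally show ?thesis by simp
next
  case False
  then have "j \<noteq> occs r k" for k using occ_occs[OF r] by auto
  then have "(\<Sum>k\<in>K. coef r k j) = (\<Sum>k\<in>K. of_bool (occs r k < j \<and> j < occs r (k + 1)))"
    unfolding coef_def by simp
  also have "\<dots> \<le> 1"
    by (rule sum_of_bool_le_1[OF K]) (use occs_cell[OF r, of j] in \<open>auto simp: less_imp_le\<close>)
  finally show ?thesis .
qed

text \<open>
  The dual action of a step on weights. Weights stay between \<open>0\<close> and \<open>1\<close>, and a new gap distributes the weight \<open>1\<close> or
  \<open>2\<close>, depending on whether it contains a skipped edge.
\<close>

lemma pullback:
  assumes r: "occ r 0" and w: "unit_weights w"
  obtains m' n' w' where "unit_weights w'"
    "\<And>z. weighted_gaps m n w (coarsen r z) = 3 / 4 * weighted_gaps m' n' w' z"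
    "weight m' n' w' = (\<Sum>k\<in>{m..<m + int n}. w k * (1 + of_bool (skip r k)))"
proof
  define K where "K = {m..<m + int n}"
  define m' where "m' = occs r m"
  \<comment> \<open>The new gaps \<open>m\<close>, ..., \<open>m + n - 1\<close> involve the old gaps from \<open>occs r m\<close> to \<open>occs r (m + n)\<close>, both included.\<close>
  define n' where "n' = nat (occs r (m + int n) - occs r m + 1)"
  define w' where "w' j = (\<Sum>k\<in>K. w k * coef r k j)" for j
  have mono: "a \<le> b \<Longrightarrow> occs r a \<le> occs r b" for a b
    using occs_strict_mono[OF r] by (simp add: strict_mono_less_eq)
  have J: "{m'..<m' + int n'} = {occs r m..occs r (m + int n)}"
    using mono[of m "m + int n"] by (auto simp: m'_def n'_def)
  have sub: "{occs r k..occs r (k + 1)} \<subseteq> {m'..<m' + int n'}" if "k \<in> K" for k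
    unfolding J using that mono[of m k] mono[of "k + 1" "m + int n"] by (auto simp: K_def)
  have sw: "(\<Sum>j\<in>{m'..<m' + int n'}. w' j * g j) =
    (\<Sum>k\<in>K. w k * ((g (occs r k) + g (occs r (k + 1))) / 2 + of_bool (skip r k) * g (occs r k + 1)))" for g
  proof -
    have "(\<Sum>j\<in>{m'..<m' + int n'}. w' j * g j) = (\<Sum>j\<in>{m'..<m' + int n'}. \<Sum>k\<in>K. w k * (coef r k j * g j))"
      unfolding w'_def sum_distrib_right by (simp add: mult.assoc)
    also have "\<dots> = (\<Sum>k\<in>K. w k * (\<Sum>j\<in>{m'..<m' + int n'}. coef r k j * g j))"
      unfolding sum_distrib_left by (rule sum.swap)
    also have "\<dots> = (\<Sum>k\<in>K. w k * ((g (occs r k) + g (occs r (k + 1))) / 2 + of_bool (skip r k) * g (occs r k + 1)))"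
      by (intro sum.cong refl arg_cong2[of _ _ _ _ "(*)"] coef_cell[OF r]) (use sub in auto)
    finally show ?thesis .
  qed
  have c0: "0 \<le> coef r k j" for k j by (simp add: coef_def)
  show "unit_weights w'"
    unfolding unit_weights_def
  proof (intro allI conjI)
    fix j
    show "0 \<le> w' j" unfolding w'_def using w c0 by (intro sum_nonneg) (auto simp: unit_weights_def)
    have "w' j \<le> (\<Sum>k\<in>K. coef r k j)"
      unfolding w'_def using w c0 by (intro sum_mono) (auto simp: unit_weights_def mult_left_le_one_le)
    also have "\<dots> \<le> 1" by (rule sum_coef_le_1[OF r]) (simp add: K_def)
    finally show "w' j \<le> 1" .
  qed
  show "weighted_gaps m n w (coarsen r z) = 3 / 4 * weighted_gaps m' n' w' z" for z
    unfolding weighted_gaps_def sw gap_coarsen[OF r] K_def[symmetric] sum_distrib_left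
    by (intro sum.cong refl) simp
  show "weight m' n' w' = (\<Sum>k\<in>{m..<m + int n}. w k * (1 + of_bool (skip r k)))"
    using sw[of "\<lambda>_. 1"] by (simp add: weight_def K_def)
qed

text \<open>
  The mean factor is \<open>1 + 1 / 3\<close>, the inverse of the scaling factor.
\<close>

lemma palm_mean_weight:
  assumes w: "unit_weights w"
  shows "(\<integral>\<^sup>+r. ennreal (\<Sum>k\<in>{m..<m + int n}. w k * (1 + of_bool (skip r k))) \<partial>palm_flips) = ennreal (4 / 3 * weight m n w)"
proof -
  interpret prob_space palm_flips by (rule prob_space_palm_flips)
  have w0: "0 \<le> w k" for k using w by (simp add: unit_weights_def)
  have one: "(\<integral>\<^sup>+r. ennreal (w k * (1 + of_bool (skip r k))) \<partial>palm_flips) = ennreal (4 / 3 * w k)" for k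
  proof -
    have "ennreal (w k * (1 + of_bool (skip r k))) = ennreal (w k) * (1 + of_bool (skip r k))" for r
      using w0[of k] by (cases "skip r k") (simp_all add: ennreal_mult flip: ennreal_numeral)
    then have "(\<integral>\<^sup>+r. ennreal (w k * (1 + of_bool (skip r k))) \<partial>palm_flips) = ennreal (w k) * (1 + ennreal (1 / 3))"
      by (simp add: nn_integral_cmult nn_integral_add palm_skip_mean emeasure_space_1[simplified])
    also have "1 + ennreal (1 / 3) = ennreal (4 / 3)" using ennreal_plus[of 1 "1 / 3"] by simp
    finally show ?thesis using w0[of k] by (simp add: ennreal_mult[symmetric] mult.commute)
  qed
  have "(\<integral>\<^sup>+r. ennreal (\<Sum>k\<in>{m..<m + int n}. w k * (1 + of_bool (skip r k))) \<partial>palm_flips) =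
    (\<integral>\<^sup>+r. (\<Sum>k\<in>{m..<m + int n}. ennreal (w k * (1 + of_bool (skip r k)))) \<partial>palm_flips)"
    using w0 by (intro nn_integral_cong) (simp add: sum_ennreal)
  also have "\<dots> = (\<Sum>k\<in>{m..<m + int n}. ennreal (4 / 3 * w k))"
    by (subst nn_integral_sum) (simp_all add: one)
  also have "\<dots> = ennreal (4 / 3 * weight m n w)"
    using w0 by (simp add: sum_ennreal weight_def sum_distrib_left)
  finally show ?thesis .
qed

lemma coarsenings_measurable [measurable]: "(\<lambda>r. coarsenings t r x) \<in> palm_coins \<rightarrow>\<^sub>M borel"
  using measurable_compose[OF measurable_Pair1' measurable_coarsenings, of x] by simp

text \<open>
  The contraction. A quadratic quantity picks up the square of the scaling factor \<open>3 / 4\<close> at each step. Its bound is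
  linear in the total weight, which grows by the factor \<open>4 / 3\<close> in the mean only, so that \<open>9 / 16 * 4 / 3 = 3 / 4\<close>
  remains.
\<close>

lemma iterated_bound:
  fixes G :: "nat \<Rightarrow> (nat \<Rightarrow> int \<Rightarrow> bool) \<Rightarrow> int \<Rightarrow> nat \<Rightarrow> (int \<Rightarrow> real) \<Rightarrow> ennreal"
  assumes meas: "\<And>t m n w. (\<lambda>r. G t r m n w) \<in> borel_measurable palm_coins"
    and step: "\<And>t r m n w m' n' w'. (\<And>z. weighted_gaps m n w (coarsen (r 0) z) = 3 / 4 * weighted_gaps m' n' w' z) \<Longrightarrow>
      G (Suc t) r m n w = ennreal (9 / 16) * G t (\<lambda>n. r (Suc n)) m' n' w'"
    and base: "\<And>m n w. unit_weights w \<Longrightarrow> (\<integral>\<^sup>+r. G 0 r m n w \<partial>palm_coins) \<le> ennreal (K * weight m n w)"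
    and K: "0 \<le> K" and w: "unit_weights w"
  shows "(\<integral>\<^sup>+r. G t r m n w \<partial>palm_coins) \<le> ennreal (K * (3 / 4) ^ t * weight m n w)"
  using w
proof (induction t arbitrary: m n w)
  case 0
  then show ?case using base by simp
next
  case (Suc t)
  have sk: "(\<lambda>r. ennreal (\<Sum>k\<in>{m..<m + int n}. w k * (1 + of_bool (skip r k)))) \<in> borel_measurable palm_flips"
    by measurable
  have "(\<integral>\<^sup>+r. G (Suc t) r m n w \<partial>palm_coins) = (\<integral>\<^sup>+r0. \<integral>\<^sup>+r. G (Suc t) (case_nat r0 r) m n w \<partial>palm_coins \<partial>palm_flips)"
    by (rule nn_integral_palm_coins[OF meas])
  also have "\<dots> \<le> (\<integral>\<^sup>+r0. ennreal (9 / 16 * (K * (3 / 4) ^ t)) * ennreal (\<Sum>k\<in>{m..<m + int n}. w k * (1 + of_bool (skip r0 k))) \<partial>palm_flips)"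
  proof (rule nn_integral_mono_AE, use AE_palm_flips in eventually_elim)
    case (elim r0)
    obtain m' n' w' where p: "unit_weights w'"
      "\<And>z. weighted_gaps m n w (coarsen r0 z) = 3 / 4 * weighted_gaps m' n' w' z"
      "weight m' n' w' = (\<Sum>k\<in>{m..<m + int n}. w k * (1 + of_bool (skip r0 k)))"
      by (rule pullback[OF elim Suc.prems]) blast
    have "(\<integral>\<^sup>+r. G (Suc t) (case_nat r0 r) m n w \<partial>palm_coins) = (\<integral>\<^sup>+r. ennreal (9 / 16) * G t r m' n' w' \<partial>palm_coins)"
      by (intro nn_integral_cong) (subst step[of m n w _ m' n' w'], simp_all add: p(2))
    also have "\<dots> = ennreal (9 / 16) * (\<integral>\<^sup>+r. G t r m' n' w' \<partial>palm_coins)"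
      by (rule nn_integral_cmult[OF meas])
    also have "\<dots> \<le> ennreal (9 / 16) * ennreal (K * (3 / 4) ^ t * weight m' n' w')"
      by (intro mult_left_mono Suc.IH p(1)) simp
    also have "\<dots> = ennreal (9 / 16 * (K * (3 / 4) ^ t)) * ennreal (weight m' n' w')"
      using K weight_nonneg[OF p(1)] by (simp add: ennreal_mult[symmetric] mult.assoc)
    finally show ?case unfolding p(3) .
  qed
  also have "\<dots> = ennreal (9 / 16 * (K * (3 / 4) ^ t)) * ennreal (4 / 3 * weight m n w)"
    using sk by (subst nn_integral_cmult) (simp_all add: palm_mean_weight[OF Suc.prems])
  also have "\<dots> = ennreal (K * (3 / 4) ^ Suc t * weight m n w)"
    using K weight_nonneg[OF Suc.prems] by (subst ennreal_mult[symmetric]) (auto simp: field_simps)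
  finally show ?case .
qed

lemma weighted_gaps_lattice: "weighted_gaps m n w real_of_int = weight m n w"
  by (simp add: weighted_gaps_def weight_def gap_def)

lemma weighted_gaps_coarsen_lattice:
  assumes "occ r 0" "unit_weights w"
  shows "weighted_gaps m n w (coarsen r real_of_int) - weight m n w = 3 / 4 * (\<Sum>k\<in>{m..<m + int n}. w k * (of_bool (skip r k) - 1 / 3))"
proof -
  obtain m' n' w' where p: "\<And>z. weighted_gaps m n w (coarsen r z) = 3 / 4 * weighted_gaps m' n' w' z"
    "weight m' n' w' = (\<Sum>k\<in>{m..<m + int n}. w k * (1 + of_bool (skip r k)))"
    by (rule pullback[OF assms]) blast
  show ?thesis unfolding p(1) weighted_gaps_lattice p(2)
    unfolding weight_def sum_distrib_left sum_subtractf[symmetric] by (intro sum.cong refl) (simp add: field_simps)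
qed

lemma sum_squares_le_weight:
  assumes "unit_weights w" shows "(\<Sum>k\<in>{m..<m + int n}. (w k)\<^sup>2) \<le> weight m n w"
  unfolding weight_def using assms
  by (intro sum_mono) (auto simp: unit_weights_def power2_eq_square mult_left_le_one_le)

text \<open>
  In the reversed order the next iterate starts from a coarsened lattice instead of the lattice. For one step
  the difference is a centred sum of skips, and the contraction propagates its second moment.
\<close>

lemma lattice_increment_bound:
  assumes w: "unit_weights w"
  shows "(\<integral>\<^sup>+r. ennreal ((weighted_gaps m n w (coarsenings (Suc t) r real_of_int) - weighted_gaps m n w (coarsenings t r real_of_int))\<^sup>2) \<partial>palm_coins)
    \<le> ennreal (5 * (3 / 4) ^ t * weight m n w)"
proof -
  define G where "G t r m n w = ennreal ((weighted_gaps m n w (coarsenings (Suc t) r real_of_int) - weighted_gaps m n w (coarsenings t r real_of_int))\<^sup>2)"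
    for t r m n w
  interpret C: prob_space palm_coins by (rule prob_space_palm_coins)
  have meas: "(\<lambda>r. G t r m n w) \<in> borel_measurable palm_coins" for t m n w
  proof -
    have [measurable]: "(\<lambda>r. weighted_gaps m n w (coarsenings t r real_of_int)) \<in> borel_measurable palm_coins" for t
      by (rule measurable_compose[OF coarsenings_measurable weighted_gaps_measurable])
    show ?thesis unfolding G_def by measurable
  qed
  have "(\<integral>\<^sup>+r. G t r m n w \<partial>palm_coins) \<le> ennreal (5 * (3 / 4) ^ t * weight m n w)"
  proof (rule iterated_bound[OF meas _ _ _ w])
    fix t m n w m' n' w' and r :: "nat \<Rightarrow> int \<Rightarrow> bool"
    assume p: "\<And>z. weighted_gaps m n w (coarsen (r 0) z) = 3 / 4 * weighted_gaps m' n' w' z"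
    have sq: "(3 / 4 * a - 3 / 4 * b)\<^sup>2 = 9 / 16 * (a - b)\<^sup>2" for a b :: real by (simp add: power2_eq_square field_simps)
    show "G (Suc t) r m n w = ennreal (9 / 16) * G t (\<lambda>n. r (Suc n)) m' n' w'"
      unfolding G_def coarsenings.simps(2)[of "Suc t"] coarsenings.simps(2)[of t r] p sq by (rule ennreal_mult) auto
  next
    fix m n and w :: "int \<Rightarrow> real" assume w: "unit_weights w"
    have "(\<integral>\<^sup>+r. G 0 r m n w \<partial>palm_coins) = (\<integral>\<^sup>+r0. \<integral>\<^sup>+r. G 0 (case_nat r0 r) m n w \<partial>palm_coins \<partial>palm_flips)"
      by (rule nn_integral_palm_coins[OF meas])
    also have "\<dots> = (\<integral>\<^sup>+r0. ennreal (9 / 16) * ennreal ((\<Sum>k\<in>{m..<m + int n}. w k * (of_bool (skip r0 k) - 1 / 3))\<^sup>2) \<partial>palm_flips)"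
    proof (rule nn_integral_cong_AE, use AE_palm_flips in eventually_elim)
      case (elim r0)
      have "G 0 (case_nat r0 r) m n w = ennreal (9 / 16) * ennreal ((\<Sum>k\<in>{m..<m + int n}. w k * (of_bool (skip r0 k) - 1 / 3))\<^sup>2)" for r
      proof -
        have "G 0 (case_nat r0 r) m n w = ennreal ((weighted_gaps m n w (coarsen r0 real_of_int) - weight m n w)\<^sup>2)"
          by (simp add: G_def weighted_gaps_lattice)
        also have "\<dots> = ennreal (9 / 16 * (\<Sum>k\<in>{m..<m + int n}. w k * (of_bool (skip r0 k) - 1 / 3))\<^sup>2)"
          unfolding weighted_gaps_coarsen_lattice[OF elim w] by (simp only: power_mult_distrib) (simp add: power_divide)
        finally show ?thesis by (simp only: ennreal_mult zero_le_power2 zero_le_divide_iff zero_le_numeral simp_thms)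
      qed
      then show ?case by (simp add: C.emeasure_space_1[simplified])
    qed
    also have "\<dots> = ennreal (9 / 16) * (\<integral>\<^sup>+r0. ennreal ((\<Sum>k\<in>{m..<m + int n}. w k * (of_bool (skip r0 k) - 1 / 3))\<^sup>2) \<partial>palm_flips)"
      by (rule nn_integral_cmult) measurable
    also have "\<dots> \<le> ennreal (9 / 16) * ennreal (8 * (\<Sum>k\<in>{m..<m + int n}. (w k)\<^sup>2))"
      by (intro mult_left_mono palm_square_bound) simp
    also have "\<dots> = ennreal (9 / 16 * (8 * (\<Sum>k\<in>{m..<m + int n}. (w k)\<^sup>2)))"
      by (rule ennreal_mult[symmetric]) (auto intro!: sum_nonneg)
    also have "\<dots> \<le> ennreal (5 * weight m n w)"
      using sum_squares_le_weight[OF w, of m n] weight_nonneg[OF w, of m n] by (intro ennreal_leI) linarith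
    finally show "(\<integral>\<^sup>+r. G 0 r m n w \<partial>palm_coins) \<le> ennreal (5 * weight m n w)" .
  qed simp
  then show ?thesis unfolding G_def .
qed

text \<open>
  Two starting configurations are moved by the same coins; linearity reduces the difference to time
  zero.
\<close>

lemma start_difference_bound:
  assumes pr: "prob_space P" and s: "sets P = sets borel" and K: "0 \<le> K"
    and var: "\<And>m n w. unit_weights w \<Longrightarrow> (\<integral>\<^sup>+x. ennreal ((weighted_gaps m n w x - weight m n w)\<^sup>2) \<partial>P) \<le> ennreal (K * weight m n w)"
    and w: "unit_weights w"
  shows "(\<integral>\<^sup>+r. \<integral>\<^sup>+x. ennreal ((weighted_gaps m n w (coarsenings t r x) - weighted_gaps m n w (coarsenings t r real_of_int))\<^sup>2) \<partial>P \<partial>palm_coins)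
    \<le> ennreal (K * (3 / 4) ^ t * weight m n w)"
proof -
  interpret P: prob_space P by (rule pr)
  interpret C: prob_space palm_coins by (rule prob_space_palm_coins)
  define D where "D t r m n w x = ennreal ((weighted_gaps m n w (coarsenings t r x) - weighted_gaps m n w (coarsenings t r real_of_int))\<^sup>2)"
    for t r m n w x
  define G where "G t r m n w = (\<integral>\<^sup>+x. D t r m n w x \<partial>P)" for t r m n w
  have Dm: "(\<lambda>v. D t (fst v) m n w (snd v)) \<in> borel_measurable (palm_coins \<Otimes>\<^sub>M borel)" for t m n w
  proof -
    have [measurable]: "(\<lambda>v. weighted_gaps m n w (coarsenings t (fst v) (snd v))) \<in> borel_measurable (palm_coins \<Otimes>\<^sub>M borel)"
      using measurable_compose[OF measurable_pair_swap' measurable_compose[OF measurable_coarsenings weighted_gaps_measurable]]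
      by (simp add: case_prod_beta')
    have [measurable]: "(\<lambda>v :: (nat \<Rightarrow> int \<Rightarrow> bool) \<times> (int \<Rightarrow> real). weighted_gaps m n w (coarsenings t (fst v) real_of_int)) \<in> borel_measurable (palm_coins \<Otimes>\<^sub>M borel)"
      by (rule measurable_compose[OF measurable_compose[OF measurable_fst coarsenings_measurable] weighted_gaps_measurable])
    show ?thesis unfolding D_def by measurable
  qed
  have Dx: "(\<lambda>x. D t r m n w x) \<in> borel_measurable P" for t r m n w
    using measurable_compose[OF measurable_Pair1' Dm, of r] by (simp add: measurable_cong_sets[OF s refl])
  have "(\<integral>\<^sup>+r. G t r m n w \<partial>palm_coins) \<le> ennreal (K * (3 / 4) ^ t * weight m n w)"
  proof (rule iterated_bound[OF _ _ _ K w])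
    show "(\<lambda>r. G t r m n w) \<in> borel_measurable palm_coins" for t m n w
      unfolding G_def using Dm
      by (intro P.borel_measurable_nn_integral) (simp add: case_prod_beta' measurable_cong_sets[OF sets_pair_measure_cong[OF refl s] refl])
    fix t m n w m' n' w' and r :: "nat \<Rightarrow> int \<Rightarrow> bool"
    assume p: "\<And>z. weighted_gaps m n w (coarsen (r 0) z) = 3 / 4 * weighted_gaps m' n' w' z"
    have sq: "(3 / 4 * a - 3 / 4 * b)\<^sup>2 = 9 / 16 * (a - b)\<^sup>2" for a b :: real by (simp add: power2_eq_square field_simps)
    have "D (Suc t) r m n w x = ennreal (9 / 16) * D t (\<lambda>n. r (Suc n)) m' n' w' x" for x
      unfolding D_def coarsenings.simps(2) p sq by (rule ennreal_mult) auto
    then have "G (Suc t) r m n w = (\<integral>\<^sup>+x. ennreal (9 / 16) * D t (\<lambda>n. r (Suc n)) m' n' w' x \<partial>P)"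
      unfolding G_def by (intro nn_integral_cong)
    then show "G (Suc t) r m n w = ennreal (9 / 16) * G t (\<lambda>n. r (Suc n)) m' n' w'"
      unfolding nn_integral_cmult[OF Dx] G_def .
  next
    fix m n and w :: "int \<Rightarrow> real" assume w: "unit_weights w"
    show "(\<integral>\<^sup>+r. G 0 r m n w \<partial>palm_coins) \<le> ennreal (K * weight m n w)"
      using var[OF w, of m n] by (simp add: G_def D_def weighted_gaps_lattice C.emeasure_space_1[simplified])
  qed
  then show ?thesis unfolding G_def D_def .
qed

text \<open>
  The exponent \<open>l\<close> is multiplied by \<open>3 / 4\<close> at each step and the total weight by \<open>4 / 3\<close> in the mean, so that only the fluctuations of
  the weight cost something, namely a term quadratic in \<open>l\<close>. The factor \<open>1 + 18 l\<close> absorbs these terms,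
  which form a geometric series; the induction closes for \<open>l\<close> up to \<open>1 / 18\<close>.
\<close>

lemma lattice_exp_bound:
  assumes w: "unit_weights w" and l: "0 \<le> l" "l \<le> 1 / 18"
  shows "(\<integral>\<^sup>+r. ennreal (exp (l * weighted_gaps m n w (coarsenings t r real_of_int))) \<partial>palm_coins)
    \<le> ennreal (exp (l * (1 + 18 * l) * weight m n w))"
  using w l
proof (induction t arbitrary: m n w l)
  case 0
  interpret C: prob_space palm_coins by (rule prob_space_palm_coins)
  have "l * weight m n w \<le> l * (1 + 18 * l) * weight m n w"
    using 0 weight_nonneg[OF 0(1)] by (intro mult_right_mono) (auto simp: algebra_simps)
  then show ?case by (simp add: weighted_gaps_lattice C.emeasure_space_1[simplified] ennreal_leI)
next
  case (Suc t)
  \<comment> \<open>The induction hypothesis is applied to the exponent \<open>3 / 4 * l\<close> and gives the coefficient \<open>u\<close> of the pulled-back weight.\<close>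
  define u where "u = 3 / 4 * l * (1 + 18 * (3 / 4 * l))"
  define W where "W = weight m n w"
  have W: "0 \<le> W" unfolding W_def by (rule weight_nonneg[OF Suc.prems(1)])
  have mG: "(\<lambda>r. ennreal (exp (l * weighted_gaps m n w (coarsenings t r real_of_int)))) \<in> borel_measurable palm_coins" for t m n l and w :: "int \<Rightarrow> real"
  proof -
    have [measurable]: "(\<lambda>r. weighted_gaps m n w (coarsenings t r real_of_int)) \<in> borel_measurable palm_coins"
      by (rule measurable_compose[OF coarsenings_measurable weighted_gaps_measurable])
    show ?thesis by measurable
  qed
  have "(\<integral>\<^sup>+r. ennreal (exp (l * weighted_gaps m n w (coarsenings (Suc t) r real_of_int))) \<partial>palm_coins) =
    (\<integral>\<^sup>+r0. \<integral>\<^sup>+r. ennreal (exp (l * weighted_gaps m n w (coarsen r0 (coarsenings t r real_of_int)))) \<partial>palm_coins \<partial>palm_flips)"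
    by (subst nn_integral_palm_coins[OF mG]) simp
  also have "\<dots> \<le> (\<integral>\<^sup>+r0. ennreal (exp (4 / 3 * u * W)) * ennreal (exp (\<Sum>k\<in>{m..<m + int n}. (u * w k) * (of_bool (skip r0 k) - 1 / 3))) \<partial>palm_flips)"
  proof (rule nn_integral_mono_AE, use AE_palm_flips in eventually_elim)
    case (elim r0)
    obtain m' n' w' where p: "unit_weights w'"
      "\<And>z. weighted_gaps m n w (coarsen r0 z) = 3 / 4 * weighted_gaps m' n' w' z"
      "weight m' n' w' = (\<Sum>k\<in>{m..<m + int n}. w k * (1 + of_bool (skip r0 k)))"
      by (rule pullback[OF elim Suc.prems(1)]) blast
    have e: "u * weight m' n' w' = 4 / 3 * u * W + (\<Sum>k\<in>{m..<m + int n}. (u * w k) * (of_bool (skip r0 k) - 1 / 3))"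
      unfolding p(3) unfolding W_def weight_def sum_distrib_left sum.distrib[symmetric] by (intro sum.cong refl) (simp add: field_simps)
    have "(\<integral>\<^sup>+r. ennreal (exp (l * weighted_gaps m n w (coarsen r0 (coarsenings t r real_of_int)))) \<partial>palm_coins) =
      (\<integral>\<^sup>+r. ennreal (exp ((3 / 4 * l) * weighted_gaps m' n' w' (coarsenings t r real_of_int))) \<partial>palm_coins)"
      unfolding p(2) by (simp add: mult.assoc mult.left_commute)
    also have "\<dots> \<le> ennreal (exp (u * weight m' n' w'))"
      unfolding u_def by (rule Suc.IH[OF p(1)]) (use Suc.prems in auto)
    also have "\<dots> = ennreal (exp (4 / 3 * u * W)) * ennreal (exp (\<Sum>k\<in>{m..<m + int n}. (u * w k) * (of_bool (skip r0 k) - 1 / 3)))"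
      unfolding e by (simp add: exp_add ennreal_mult)
    finally show ?case .
  qed
  also have "\<dots> = ennreal (exp (4 / 3 * u * W)) * (\<integral>\<^sup>+r0. ennreal (exp (\<Sum>k\<in>{m..<m + int n}. (u * w k) * (of_bool (skip r0 k) - 1 / 3))) \<partial>palm_flips)"
    by (rule nn_integral_cmult) measurable
  also have "\<dots> \<le> ennreal (exp (4 / 3 * u * W)) * ennreal (exp (2 * (\<Sum>k\<in>{m..<m + int n}. (u * w k)\<^sup>2)))"
    by (intro mult_left_mono palm_exp_bound) simp
  also have "\<dots> = ennreal (exp (4 / 3 * u * W + 2 * (\<Sum>k\<in>{m..<m + int n}. (u * w k)\<^sup>2)))"
    by (simp add: exp_add ennreal_mult)
  also have "\<dots> \<le> ennreal (exp (l * (1 + 18 * l) * W))"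
  proof (intro ennreal_leI, subst exp_le_cancel_iff)
    have "(\<Sum>k\<in>{m..<m + int n}. (u * w k)\<^sup>2) = u\<^sup>2 * (\<Sum>k\<in>{m..<m + int n}. (w k)\<^sup>2)"
      by (simp add: power_mult_distrib sum_distrib_left)
    also have "\<dots> \<le> u\<^sup>2 * W"
      unfolding W_def by (intro mult_left_mono sum_squares_le_weight Suc.prems) simp
    finally have "4 / 3 * u * W + 2 * (\<Sum>k\<in>{m..<m + int n}. (u * w k)\<^sup>2) \<le> (4 / 3 * u + 2 * u\<^sup>2) * W"
      by (simp add: algebra_simps)
    also have "\<dots> \<le> (l * (1 + 18 * l)) * W"
    proof (rule mult_right_mono[OF _ W])
      \<comment> \<open>\<open>1 + 18 * (3 / 4 * l) \<le> 7 / 4\<close> because \<open>l \<le> 1 / 18\<close>; the terms of order \<open>l\<^sup>2\<close> are \<open>27 / 2 + 441 / 128 \<le> 18\<close>.\<close>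
      have "u \<le> 3 / 4 * l * (7 / 4)" unfolding u_def using Suc.prems by (intro mult_left_mono) auto
      moreover have "0 \<le> u" unfolding u_def using Suc.prems by simp
      ultimately have "u\<^sup>2 \<le> (3 / 4 * l * (7 / 4))\<^sup>2" by (rule power_mono)
      then have "2 * u\<^sup>2 \<le> 441 / 128 * l\<^sup>2" by (simp add: power_mult_distrib power2_eq_square)
      moreover have "4 / 3 * u = l + 27 / 2 * l\<^sup>2" by (simp add: u_def power2_eq_square algebra_simps)
      moreover have "l * (1 + 18 * l) = l + 18 * l\<^sup>2" by (simp add: power2_eq_square algebra_simps)
      ultimately show "4 / 3 * u + 2 * u\<^sup>2 \<le> l * (1 + 18 * l)" using zero_le_power2[of l] by linarith
    qed
    finally show "4 / 3 * u * W + 2 * (\<Sum>k\<in>{m..<m + int n}. (u * w k)\<^sup>2) \<le> l * (1 + 18 * l) * W" .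
  qed
  finally show ?case unfolding W_def .
qed

section \<open>The limit of the lattice under the dynamics\<close>

text \<open>
  A form of the Cauchy-Schwarz inequality in which the parameter \<open>c\<close> is still to be chosen.
\<close>

lemma nn_integral_abs_le:
  assumes pr: "prob_space M" and X [measurable]: "X \<in> borel_measurable M"
    and sq: "(\<integral>\<^sup>+r. ennreal ((X r)\<^sup>2) \<partial>M) \<le> ennreal B" and B: "0 \<le> B" and c: "0 < c"
  shows "(\<integral>\<^sup>+r. ennreal \<bar>X r\<bar> \<partial>M) \<le> ennreal ((B / c + c) / 2)"
proof -
  interpret prob_space M by (rule pr)
  have pt: "\<bar>X r\<bar> \<le> 1 / (2 * c) * (X r)\<^sup>2 + c / 2" for r
  proof -
    have "0 \<le> (\<bar>X r\<bar> - c)\<^sup>2" by simp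
    then have "\<bar>X r\<bar> * (2 * c) \<le> (X r)\<^sup>2 + c\<^sup>2" by (simp add: power2_diff algebra_simps)
    then have "\<bar>X r\<bar> \<le> ((X r)\<^sup>2 + c\<^sup>2) / (2 * c)" using c by (subst pos_le_divide_eq) auto
    also have "\<dots> = 1 / (2 * c) * (X r)\<^sup>2 + c / 2" using c by (simp add: field_simps power2_eq_square)
    finally show ?thesis .
  qed
  have "(\<integral>\<^sup>+r. ennreal \<bar>X r\<bar> \<partial>M) \<le> (\<integral>\<^sup>+r. ennreal (1 / (2 * c)) * ennreal ((X r)\<^sup>2) + ennreal (c / 2) \<partial>M)"
  proof (rule nn_integral_mono)
    fix r
    have "ennreal \<bar>X r\<bar> \<le> ennreal (1 / (2 * c) * (X r)\<^sup>2 + c / 2)" by (rule ennreal_leI[OF pt])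
    also have "\<dots> = ennreal (1 / (2 * c) * (X r)\<^sup>2) + ennreal (c / 2)" using c by (intro ennreal_plus) auto
    also have "ennreal (1 / (2 * c) * (X r)\<^sup>2) = ennreal (1 / (2 * c)) * ennreal ((X r)\<^sup>2)" using c by (intro ennreal_mult) auto
    finally show "ennreal \<bar>X r\<bar> \<le> ennreal (1 / (2 * c)) * ennreal ((X r)\<^sup>2) + ennreal (c / 2)" .
  qed
  also have "\<dots> = ennreal (1 / (2 * c)) * (\<integral>\<^sup>+r. ennreal ((X r)\<^sup>2) \<partial>M) + ennreal (c / 2)"
    by (subst nn_integral_add, measurable, subst nn_integral_cmult, measurable) (simp add: emeasure_space_1)
  also have "\<dots> \<le> ennreal (1 / (2 * c)) * ennreal B + ennreal (c / 2)"
    by (intro add_right_mono mult_left_mono sq) simp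
  also have "\<dots> = ennreal (1 / (2 * c) * B) + ennreal (c / 2)" using B c by (subst ennreal_mult[symmetric]) auto
  also have "\<dots> = ennreal (1 / (2 * c) * B + c / 2)" using B c by (intro ennreal_plus[symmetric]) auto
  also have "1 / (2 * c) * B + c / 2 = (B / c + c) / 2" by (simp add: field_simps)
  finally show ?thesis .
qed

text \<open>
  The rational rate \<open>7 / 8\<close> is a convenient upper bound for the square root of \<open>3 / 4\<close>.
\<close>

lemma nn_integral_abs_rate:
  assumes pr: "prob_space M" and X: "X \<in> borel_measurable M"
    and sq: "(\<integral>\<^sup>+r. ennreal ((X r)\<^sup>2) \<partial>M) \<le> ennreal (K * (3 / 4) ^ t * W)"
    and K: "0 \<le> K" and s: "0 < s" and W: "0 \<le> W" "W \<le> s\<^sup>2"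
  shows "(\<integral>\<^sup>+r. ennreal \<bar>X r\<bar> \<partial>M) \<le> ennreal ((K + 1) * s * (7 / 8) ^ t)"
proof -
  \<comment> \<open>The choice of \<open>c\<close> that balances the two terms.\<close>
  define c where "c = s * (7 / 8) ^ t"
  have c: "0 < c" using s by (simp add: c_def)
  have "(\<integral>\<^sup>+r. ennreal \<bar>X r\<bar> \<partial>M) \<le> ennreal ((K * (3 / 4) ^ t * W / c + c) / 2)"
    by (rule nn_integral_abs_le[OF pr X sq _ c]) (use K W in simp)
  also have "\<dots> \<le> ennreal ((K + 1) * c)"
  proof (rule ennreal_leI)
    have "(3 / 4) ^ t \<le> (7 / 8 * (7 / 8) :: real) ^ t" by (rule power_mono) auto
    then have p: "(3 / 4 :: real) ^ t \<le> (7 / 8) ^ t * (7 / 8) ^ t" by (simp only: power_mult_distrib)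
    have "K * (3 / 4) ^ t * W \<le> K * ((7 / 8) ^ t * (7 / 8) ^ t) * s\<^sup>2"
      by (intro mult_mono mult_nonneg_nonneg p W K) auto
    also have "\<dots> = K * c * c" by (simp add: c_def power2_eq_square)
    finally have "K * (3 / 4) ^ t * W / c \<le> K * c" using c by (simp add: divide_le_eq)
    moreover have "0 \<le> K * c" using K c by simp
    moreover have "(q + c) / 2 \<le> K * c + c" if "q \<le> K * c" "0 \<le> K * c" for q
      using that c by (simp add: divide_le_eq algebra_simps)
    ultimately have "(K * (3 / 4) ^ t * W / c + c) / 2 \<le> K * c + c" by blast
    then show "(K * (3 / 4) ^ t * W / c + c) / 2 \<le> (K + 1) * c" by (simp add: algebra_simps)
  qed
  finally show ?thesis by (simp add: c_def mult.assoc)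
qed

lemma geometric_suminf: "0 \<le> B \<Longrightarrow> (\<Sum>i. ennreal (B * (7 / 8) ^ (i + t))) = ennreal (8 * B * (7 / 8) ^ t)"
proof -
  assume B: "0 \<le> B"
  have "(\<lambda>i. (7 / 8 :: real) ^ i) sums 8" using geometric_sums[of "7 / 8 :: real"] by simp
  from sums_mult[OF this, of "B * (7 / 8) ^ t"]
  have "(\<lambda>i. B * (7 / 8) ^ (i + t)) sums (8 * B * (7 / 8) ^ t)" by (simp add: power_add algebra_simps)
  then show ?thesis using B by (intro suminf_ennreal_eq) auto
qed

lemma AE_summable:
  assumes X: "\<And>t. X t \<in> borel_measurable M" and B: "0 \<le> B"
    and bd: "\<And>t. (\<integral>\<^sup>+r. ennreal \<bar>X t r\<bar> \<partial>M) \<le> ennreal (B * (7 / 8) ^ t)"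
  shows "AE r in M. summable (\<lambda>t. \<bar>X t r\<bar>)"
proof -
  have m: "(\<lambda>r. ennreal \<bar>X t r\<bar>) \<in> borel_measurable M" for t using X[of t] by measurable
  have "(\<integral>\<^sup>+r. (\<Sum>t. ennreal \<bar>X t r\<bar>) \<partial>M) = (\<Sum>t. \<integral>\<^sup>+r. ennreal \<bar>X t r\<bar> \<partial>M)"
    by (rule nn_integral_suminf[OF m])
  also have "\<dots> \<le> (\<Sum>t. ennreal (B * (7 / 8) ^ (t + 0)))" by (intro suminf_le) (use bd in auto)
  also have "\<dots> < \<infinity>" unfolding geometric_suminf[OF B] by simp
  finally have fin: "(\<integral>\<^sup>+r. (\<Sum>t. ennreal \<bar>X t r\<bar>) \<partial>M) < \<infinity>" .
  have "AE r in M. (\<Sum>t. ennreal \<bar>X t r\<bar>) \<noteq> \<infinity>"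
  proof (rule nn_integral_PInf_AE)
    note m [measurable]
    show "(\<lambda>r. \<Sum>t. ennreal \<bar>X t r\<bar>) \<in> borel_measurable M" by measurable
  qed (use fin in simp)
  then show ?thesis by eventually_elim (auto intro!: summable_suminf_not_top simp: top_ennreal_def[symmetric])
qed

lemma summable_increments_convergent:
  fixes X :: "nat \<Rightarrow> real"
  assumes "summable (\<lambda>t. \<bar>X (Suc t) - X t\<bar>)" shows "convergent X"
proof -
  have "summable (\<lambda>t. X (Suc t) - X t)" using assms by (rule summable_rabs_cancel)
  then have "(\<lambda>n. \<Sum>t<n. X (Suc t) - X t) \<longlonglongrightarrow> (\<Sum>t. X (Suc t) - X t)" by (rule summable_LIMSEQ)
  then have "(\<lambda>n. X n - X 0) \<longlonglongrightarrow> (\<Sum>t. X (Suc t) - X t)" by (simp add: sum_lessThan_telescope)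
  from tendsto_add[OF this tendsto_const[of "X 0"]] show ?thesis by (auto simp: convergent_def)
qed

lemma limit_distance:
  fixes X :: "nat \<Rightarrow> real"
  assumes "convergent X"
  shows "ennreal \<bar>lim X - X t\<bar> \<le> (\<Sum>i. ennreal \<bar>X (Suc (i + t)) - X (i + t)\<bar>)"
proof -
  have l: "X \<longlonglongrightarrow> lim X" using assms by (simp add: convergent_LIMSEQ_iff)
  have conv: "(\<lambda>n. ennreal \<bar>X (n + t) - X t\<bar>) \<longlonglongrightarrow> ennreal \<bar>lim X - X t\<bar>"
    by (intro tendsto_ennrealI tendsto_rabs tendsto_diff tendsto_const LIMSEQ_ignore_initial_segment l)
  have "ennreal \<bar>X (n + t) - X t\<bar> \<le> (\<Sum>i. ennreal \<bar>X (Suc (i + t)) - X (i + t)\<bar>)" for n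
  proof -
    have "X (n + t) - X t = (\<Sum>i<n. X (Suc (i + t)) - X (i + t))"
      using sum_lessThan_telescope[of "\<lambda>i. X (i + t)" n] by simp
    then have "\<bar>X (n + t) - X t\<bar> \<le> (\<Sum>i<n. \<bar>X (Suc (i + t)) - X (i + t)\<bar>)" by (simp add: sum_abs)
    then have "ennreal \<bar>X (n + t) - X t\<bar> \<le> (\<Sum>i<n. ennreal \<bar>X (Suc (i + t)) - X (i + t)\<bar>)"
      by (simp add: sum_ennreal ennreal_leI)
    also have "\<dots> \<le> (\<Sum>i. ennreal \<bar>X (Suc (i + t)) - X (i + t)\<bar>)" by (rule sum_le_suminf) auto
    finally show ?thesis .
  qed
  then show ?thesis by (intro LIMSEQ_le_const2[OF conv]) blast
qed

text \<open>
  Increments that are summable in mean are summable almost surely, and the tail of the series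
  bounds the distance to the limit.
\<close>

lemma L1_limit:
  assumes X: "\<And>t. X t \<in> borel_measurable M" and B: "0 \<le> B"
    and bd: "\<And>t. (\<integral>\<^sup>+r. ennreal \<bar>X (Suc t) r - X t r\<bar> \<partial>M) \<le> ennreal (B * (7 / 8) ^ t)"
  shows "AE r in M. convergent (\<lambda>t. X t r)"
    and "(\<integral>\<^sup>+r. ennreal \<bar>lim (\<lambda>t. X t r) - X t r\<bar> \<partial>M) \<le> ennreal (8 * B * (7 / 8) ^ t)"
proof -
  have m: "(\<lambda>r. X (Suc t) r - X t r) \<in> borel_measurable M" for t using X[of t] X[of "Suc t"] by measurable
  have m': "(\<lambda>r. ennreal \<bar>X (Suc t) r - X t r\<bar>) \<in> borel_measurable M" for t using m[of t] by measurable
  show c: "AE r in M. convergent (\<lambda>t. X t r)"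
    using AE_summable[of "\<lambda>t r. X (Suc t) r - X t r" M B, OF m B bd]
    by eventually_elim (rule summable_increments_convergent)
  have "(\<integral>\<^sup>+r. ennreal \<bar>lim (\<lambda>t. X t r) - X t r\<bar> \<partial>M) \<le> (\<integral>\<^sup>+r. (\<Sum>i. ennreal \<bar>X (Suc (i + t)) r - X (i + t) r\<bar>) \<partial>M)"
    by (rule nn_integral_mono_AE) (use c in eventually_elim, rule limit_distance)
  also have "\<dots> = (\<Sum>i. \<integral>\<^sup>+r. ennreal \<bar>X (Suc (i + t)) r - X (i + t) r\<bar> \<partial>M)" by (rule nn_integral_suminf[OF m'])
  also have "\<dots> \<le> (\<Sum>i. ennreal (B * (7 / 8) ^ (i + t)))" by (intro suminf_le bd) auto
  also have "\<dots> = ennreal (8 * B * (7 / 8) ^ t)" by (rule geometric_suminf[OF B])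
  finally show "(\<integral>\<^sup>+r. ennreal \<bar>lim (\<lambda>t. X t r) - X t r\<bar> \<partial>M) \<le> ennreal (8 * B * (7 / 8) ^ t)" .
qed

text \<open>
  The lattice serves as the reference configuration because all its gaps are one: a weighted sum of its
  gaps is the total weight, which \<open>pullback\<close> keeps track of.
\<close>

definition limit_points :: "(nat \<Rightarrow> int \<Rightarrow> bool) \<Rightarrow> int \<Rightarrow> real" where
  "limit_points r k = lim (\<lambda>t. coarsenings t r real_of_int k)"

lemma limit_points_measurable: "limit_points \<in> palm_coins \<rightarrow>\<^sub>M borel"
proof (rule borel_seqI)
  fix k
  have "(\<lambda>r. coarsenings t r real_of_int k) \<in> borel_measurable palm_coins" for t
    using measurable_compose[OF coarsenings_measurable measurable_coord] .
  then show "(\<lambda>r. limit_points r k) \<in> borel_measurable palm_coins"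
    unfolding limit_points_def by (rule borel_measurable_lim_metric)
qed

lemma coarsenings_0: "x 0 = 0 \<Longrightarrow> coarsenings t r x 0 = 0"
  by (cases t) (simp_all add: coarsen_def)

lemma AE_palm_coins_occ: "AE r in palm_coins. \<forall>t. occ (r t) 0"
  unfolding AE_all_countable
proof
  fix t
  interpret product_prob_space "\<lambda>_ :: nat. palm_flips" UNIV
    by (simp add: product_prob_space_def product_prob_space_axioms_def product_sigma_finite_def prob_space_palm_flips
        prob_space_imp_sigma_finite)
  show "AE r in palm_coins. occ (r t) 0"
    unfolding palm_coins_def by (rule AE_component) (simp_all add: AE_palm_flips)
qed

lemma coarsenings_two_sided:
  "two_sided x \<Longrightarrow> \<forall>t. occ (r t) 0 \<Longrightarrow> two_sided (coarsenings t r x)"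
  by (induction t arbitrary: r) (simp_all add: coarsen_two_sided)

lemma two_sided_lattice: "two_sided real_of_int"
  unfolding two_sided_def
proof (intro conjI allI)
  fix c :: real
  show "\<exists>i. c < real_of_int i" by (rule ex_less_of_int)
  show "\<exists>i. real_of_int i < c" by (rule ex_of_int_less)
qed (auto simp: mono_def)

lemma unit_weights_1: "unit_weights (\<lambda>_. 1)" by (simp add: unit_weights_def)

lemma weight_1: "weight m n (\<lambda>_. 1) = real n" by (simp add: weight_def)

lemma weighted_gaps_1: "weighted_gaps m n (\<lambda>_. 1) x = x (m + int n) - x m"
  by (simp add: weighted_gaps_def sum_gap)

lemma points_increment_rate:
  assumes n: "0 < n"
  shows "(\<integral>\<^sup>+r. ennreal \<bar>weighted_gaps m n (\<lambda>_. 1) (coarsenings (Suc t) r real_of_int) - weighted_gaps m n (\<lambda>_. 1) (coarsenings t r real_of_int)\<bar> \<partial>palm_coins)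
    \<le> ennreal (6 * sqrt n * (7 / 8) ^ t)"
proof -
  have [measurable]: "(\<lambda>r. weighted_gaps m n (\<lambda>_. 1) (coarsenings t r real_of_int)) \<in> borel_measurable palm_coins" for t
    by (rule measurable_compose[OF coarsenings_measurable weighted_gaps_measurable])
  have "(\<integral>\<^sup>+r. ennreal \<bar>weighted_gaps m n (\<lambda>_. 1) (coarsenings (Suc t) r real_of_int) - weighted_gaps m n (\<lambda>_. 1) (coarsenings t r real_of_int)\<bar> \<partial>palm_coins)
    \<le> ennreal ((5 + 1) * sqrt n * (7 / 8) ^ t)"
    by (rule nn_integral_abs_rate[OF prob_space_palm_coins _ lattice_increment_bound[OF unit_weights_1]])
       (use n in \<open>measurable, simp_all add: weight_1\<close>)
  then show ?thesis by simp
qed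

lemma points_limit_rate:
  assumes n: "0 < n"
  shows "(\<integral>\<^sup>+r. ennreal \<bar>lim (\<lambda>t. weighted_gaps m n (\<lambda>_. 1) (coarsenings t r real_of_int)) - weighted_gaps m n (\<lambda>_. 1) (coarsenings t r real_of_int)\<bar> \<partial>palm_coins)
    \<le> ennreal (48 * sqrt n * (7 / 8) ^ t)"
proof -
  have "(\<lambda>r. weighted_gaps m n (\<lambda>_. 1) (coarsenings t r real_of_int)) \<in> borel_measurable palm_coins" for t
    by (rule measurable_compose[OF coarsenings_measurable weighted_gaps_measurable])
  from L1_limit(2)[where X = "\<lambda>t r. weighted_gaps m n (\<lambda>_. 1) (coarsenings t r real_of_int)", OF this _ points_increment_rate[OF n]]
  show ?thesis by (simp add: mult.assoc[symmetric])
qed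

lemma AE_limit_points: "AE r in palm_coins. \<forall>k. (\<lambda>t. coarsenings t r real_of_int k) \<longlonglongrightarrow> limit_points r k"
proof -
  have "(\<lambda>r. weighted_gaps m 1 (\<lambda>_. 1) (coarsenings t r real_of_int)) \<in> borel_measurable palm_coins" for t m
    by (rule measurable_compose[OF coarsenings_measurable weighted_gaps_measurable])
  from L1_limit(1)[where X = "\<lambda>t r. weighted_gaps _ 1 (\<lambda>_. 1) (coarsenings t r real_of_int)", OF this _ points_increment_rate]
  have "AE r in palm_coins. \<forall>m. convergent (\<lambda>t. weighted_gaps m 1 (\<lambda>_. 1) (coarsenings t r real_of_int))"
    unfolding AE_all_countable by simp
  then show ?thesis
  proof eventually_elim
    case (elim r)
    have g: "convergent (\<lambda>t. gap i (coarsenings t r real_of_int))" for i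
      using elim[rule_format, of i] by (simp add: weighted_gaps_1 gap_def)
    have "convergent (\<lambda>t. partial_sums (\<lambda>i. gap i (coarsenings t r real_of_int)) k)" for k
      unfolding partial_sums_def
      by (cases "0 \<le> k") (auto intro!: convergent_sum g simp: convergent_minus_iff[symmetric])
    then have "convergent (\<lambda>t. coarsenings t r real_of_int k)" for k
      unfolding partial_sums_gap by (simp add: coarsenings_0)
    then show ?case unfolding limit_points_def by (simp add: convergent_LIMSEQ_iff)
  qed
qed

text \<open>
  Without the law of large numbers: on the event that the sequence stays below \<open>c\<close>, the deviation for index \<open>n\<close> is at least
  \<open>n - c\<close>, while its mean is of the order of the square root of \<open>n\<close>.
\<close>

lemma AE_unbounded:
  assumes pr: "prob_space M" and A: "\<And>n. A n \<in> borel_measurable M"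
    and bd: "\<And>n. 0 < n \<Longrightarrow> (\<integral>\<^sup>+r. ennreal \<bar>A n r - real n\<bar> \<partial>M) \<le> ennreal (48 * sqrt n)"
  shows "AE r in M. \<forall>c. \<exists>n. c < A n r"
proof -
  interpret prob_space M by (rule pr)
  have "AE r in M. \<forall>c :: nat. \<exists>n. real c < A n r"
    unfolding AE_all_countable
  proof
    fix c :: nat
    define E where "E = {r \<in> space M. \<forall>n. A n r \<le> real c}"
    have E [measurable]: "E \<in> sets M" unfolding E_def using A by measurable
    have main: "real m * prob E \<le> 48 + real c" if m: "0 < m" for m :: nat
    proof -
      \<comment> \<open>Squares of integers avoid the discussion of roots.\<close>
      define n where "n = m * m"
      have n: "0 < n" "sqrt n = m" using m by (auto simp: n_def real_sqrt_mult)
      have "ennreal ((real n - real c) * prob E) \<le> ennreal (48 * sqrt n)"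
      proof (cases "real c \<le> real n")
        case True
        then have "ennreal ((real n - real c) * prob E) = (\<integral>\<^sup>+r. ennreal (real n - real c) * indicator E r \<partial>M)"
          by (subst nn_integral_cmult_indicator) (auto simp: ennreal_mult emeasure_eq_measure)
        also have "\<dots> \<le> (\<integral>\<^sup>+r. ennreal \<bar>A n r - real n\<bar> \<partial>M)"
        proof (rule nn_integral_mono)
          fix r
          have "A n r \<le> real c" if "r \<in> E" using that by (auto simp: E_def)
          then show "ennreal (real n - real c) * indicator E r \<le> ennreal \<bar>A n r - real n\<bar>"
            by (auto simp: indicator_def intro!: ennreal_leI)
        qed
        also have "\<dots> \<le> ennreal (48 * sqrt n)" by (rule bd[OF n(1)])
        finally show ?thesis .
      next
        case False
        then have "(real n - real c) * prob E \<le> 0" by (intro mult_nonpos_nonneg) auto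
        then show ?thesis by (simp add: ennreal_neg)
      qed
      then have "(real n - real c) * prob E \<le> 48 * m" unfolding n(2) by (subst (asm) ennreal_le_iff) auto
      then have "real m * (real m * prob E) \<le> 48 * m + real c * prob E" by (simp add: n_def algebra_simps)
      also have "\<dots> \<le> 48 * m + real c * real m"
        using m prob_le_1[of E] by (intro add_left_mono mult_left_mono order_trans[OF prob_le_1]) auto
      also have "\<dots> = real m * (48 + real c)" by (simp add: algebra_simps)
      finally show ?thesis using m by simp
    qed
    have "prob E = 0"
    proof (rule ccontr)
      assume "prob E \<noteq> 0"
      then have p: "0 < prob E" using measure_nonneg[of M E] by linarith
      obtain m :: nat where "(48 + real c) / prob E < real m" using reals_Archimedean2 by blast
      then have m: "48 + real c < real m * prob E" using p by (simp add: divide_less_eq)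
      have "0 < m" using m by (cases m) auto
      from main[OF this] m show False by linarith
    qed
    then have "AE r in M. r \<notin> E" by (simp add: AE_iff_null_sets[symmetric, OF E] emeasure_eq_measure null_setsI)
    then show "AE r in M. \<exists>n. real c < A n r" using AE_space by eventually_elim (auto simp: E_def not_le)
  qed
  then show ?thesis
  proof eventually_elim
    case (elim r)
    show ?case
    proof
      fix c :: real
      obtain k :: nat where "c < real k" using reals_Archimedean2 by blast
      moreover obtain n where "real k < A n r" using elim by blast
      ultimately show "\<exists>n. c < A n r" by (intro exI[of _ n]) linarith
    qed
  qed
qed

text \<open>
  Monotonicity passes to the limit. Unboundedness does not, but the distance between two points whose
  indices differ by \<open>n\<close> deviates from \<open>n\<close> in mean only by a multiple of the square root of \<open>n\<close>.
\<close>

lemma AE_limit_points_two_sided: "AE r in palm_coins. two_sided (limit_points r) \<and> limit_points r 0 = 0"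
proof -
  have lp: "(\<lambda>r. limit_points r k) \<in> borel_measurable palm_coins" for k
    using measurable_compose[OF limit_points_measurable measurable_coord] .
  have rate: "(\<integral>\<^sup>+r. ennreal \<bar>(limit_points r (m + int n) - limit_points r m) - real n\<bar> \<partial>palm_coins) \<le> ennreal (48 * sqrt n)"
    if n: "0 < n" for m n
  proof -
    have "(\<integral>\<^sup>+r. ennreal \<bar>(limit_points r (m + int n) - limit_points r m) - real n\<bar> \<partial>palm_coins) =
      (\<integral>\<^sup>+r. ennreal \<bar>lim (\<lambda>t. weighted_gaps m n (\<lambda>_. 1) (coarsenings t r real_of_int)) - weighted_gaps m n (\<lambda>_. 1) (coarsenings 0 r real_of_int)\<bar> \<partial>palm_coins)"
    proof (rule nn_integral_cong_AE, use AE_limit_points in eventually_elim)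
      case (elim r)
      have "(\<lambda>t. weighted_gaps m n (\<lambda>_. 1) (coarsenings t r real_of_int)) \<longlonglongrightarrow> limit_points r (m + int n) - limit_points r m"
        unfolding weighted_gaps_1 using elim by (intro tendsto_diff) auto
      from limI[OF this] show ?case by (simp add: weighted_gaps_lattice weight_1)
    qed
    also have "\<dots> \<le> ennreal (48 * sqrt n)" using points_limit_rate[OF n, of m 0] by simp
    finally show ?thesis .
  qed
  have up: "AE r in palm_coins. \<forall>c. \<exists>n. c < limit_points r (0 + int n) - limit_points r 0"
  proof (rule AE_unbounded[OF prob_space_palm_coins])
    show "(\<lambda>r. limit_points r (0 + int n) - limit_points r 0) \<in> borel_measurable palm_coins" for n
      by (intro borel_measurable_diff lp)
  qed (rule rate)
  \<comment> \<open>Towards \<open>- \<infinity>\<close> the increments end at point \<open>0\<close>.\<close>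
  have down: "AE r in palm_coins. \<forall>c. \<exists>n. c < limit_points r (- int n + int n) - limit_points r (- int n)"
  proof (rule AE_unbounded[OF prob_space_palm_coins])
    show "(\<lambda>r. limit_points r (- int n + int n) - limit_points r (- int n)) \<in> borel_measurable palm_coins" for n
      by (intro borel_measurable_diff lp)
  qed (rule rate)
  show ?thesis
    using AE_limit_points AE_palm_coins_occ up down
  proof eventually_elim
    case (elim r)
    have l: "(\<lambda>t. coarsenings t r real_of_int k) \<longlonglongrightarrow> limit_points r k" for k using elim by blast
    have ts: "two_sided (coarsenings t r real_of_int)" for t
      by (rule coarsenings_two_sided[OF two_sided_lattice elim(2)])
    have z: "limit_points r 0 = 0" using l[of 0] by (simp add: coarsenings_0 LIMSEQ_const_iff)
    have "mono (limit_points r)"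
    proof (rule monoI)
      fix a b :: int assume "a \<le> b"
      then show "limit_points r a \<le> limit_points r b"
        using ts by (intro LIMSEQ_le[OF l l]) (auto simp: two_sided_def mono_def)
    qed
    moreover have "\<exists>i. c < limit_points r i" for c
    proof -
      obtain n where "c < limit_points r (0 + int n) - limit_points r 0" using elim(3) by blast
      then show ?thesis using z by auto
    qed
    moreover have "\<exists>i. limit_points r i < c" for c
    proof -
      obtain n where "- c < limit_points r (- int n + int n) - limit_points r (- int n)" using elim(4) by blast
      then show ?thesis using z by (intro exI[of _ "- int n"]) simp
    qed
    ultimately show ?case using z by (simp add: two_sided_def)
  qed
qed

section \<open>Forgetting the starting configuration\<close>

lemma tendsto_seq:
  fixes F :: "'b \<Rightarrow> int \<Rightarrow> real"
  assumes "\<And>k. ((\<lambda>t. F t k) \<longlongrightarrow> l k) net"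
  shows "(F \<longlongrightarrow> l) net"
proof -
  have "limitin (product_topology (\<lambda>_. euclidean) UNIV) F l net"
    unfolding limitin_componentwise using assms by simp
  then show ?thesis by (simp add: euclidean_product_topology)
qed

text \<open>
  Indicators of closed sets are limits of bounded continuous functions of the distance to the set.
\<close>

lemma measure_eqI_bounded_continuous:
  fixes M N :: "'a :: metric_space measure"
  assumes M: "prob_space M" "sets M = sets borel" and N: "prob_space N" "sets N = sets borel"
    and eq: "\<And>f :: 'a \<Rightarrow> real. continuous_on UNIV f \<Longrightarrow> bounded (range f) \<Longrightarrow> (\<integral>x. f x \<partial>M) = (\<integral>x. f x \<partial>N)"
  shows "M = N"
proof (rule measure_eqI_generator_eq[where E = "Collect closed" and \<Omega> = UNIV and A = "\<lambda>_. UNIV"])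
  interpret M: prob_space M by (rule M)
  interpret N: prob_space N by (rule N)
  show "sets M = sigma_sets UNIV (Collect closed)" "sets N = sigma_sets UNIV (Collect closed)"
    by (simp_all add: M(2) N(2) borel_eq_closed)
  show "emeasure M UNIV \<noteq> \<infinity>" for i :: nat by simp
  fix C :: "'a set" assume "C \<in> Collect closed"
  then have C: "closed C" by simp
  show "emeasure M C = emeasure N C"
  proof (cases "C = {}")
    case False
    define f where "f n x = max 0 (1 - real n * infdist x C)" for n and x :: 'a
    have f01: "0 \<le> f n x" "f n x \<le> 1" for n x using infdist_nonneg[of x C] by (auto simp: f_def)
    have cont: "continuous_on UNIV (f n)" for n
      unfolding f_def[abs_def] by (intro continuous_intros)
    have bd: "bounded (range (f n))" for n
      by (rule boundedI[of _ 1]) (use f01 in auto)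
    have lim: "(\<lambda>n. f n x) \<longlonglongrightarrow> indicator C x" for x
    proof (cases "x \<in> C")
      case True
      then show ?thesis by (simp add: f_def)
    next
      case x: False
      then have p: "0 < infdist x C" using C False by (simp add: infdist_pos_not_in_closed)
      obtain m :: nat where m: "1 / infdist x C < real m" using reals_Archimedean2 by blast
      have "f n x = 0" if "m \<le> n" for n
      proof -
        have "1 \<le> real n * infdist x C" using m p that
          by (smt (verit, best) divide_less_eq mult_right_mono of_nat_le_iff)
        then show ?thesis by (simp add: f_def)
      qed
      then show ?thesis using x by (intro tendsto_eventually eventually_sequentiallyI[of m]) simp
    qed
    have conv: "(\<lambda>n. \<integral>x. f n x \<partial>R) \<longlonglongrightarrow> (\<integral>x. indicator C x \<partial>R)"
      if "prob_space R" and R: "sets R = sets borel" for R :: "'a measure"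
    proof (rule integral_dominated_convergence[where w = "\<lambda>_. 1"])
      interpret R: prob_space R by fact
      show "f n \<in> borel_measurable R" for n
        using borel_measurable_continuous_onI[OF cont, of n] measurable_cong_sets[OF R refl] by blast
      show "indicator C \<in> borel_measurable R"
        using C R by (intro borel_measurable_indicator) auto
    qed (use lim f01 that in \<open>auto simp: finite_measure.integrable_const prob_space.finite_measure\<close>)
    have "(\<lambda>n. \<integral>x. f n x \<partial>M) = (\<lambda>n. \<integral>x. f n x \<partial>N)" using eq[OF cont bd] by (simp add: fun_eq_iff)
    then have "(\<integral>x. indicator C x \<partial>M) = (\<integral>x. indicator C x \<partial>N :: real)"
      using conv[OF M] conv[OF N] LIMSEQ_unique by metis
    moreover have "C \<in> sets M" "C \<in> sets N" using C M N by auto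
    ultimately show ?thesis by (simp add: M.emeasure_eq_measure N.emeasure_eq_measure)
  qed simp
qed (auto simp: Int_stable_def)

lemma AE_zero_limit:
  assumes X: "\<And>t. X t \<in> borel_measurable M" and B: "0 \<le> B"
    and bd: "\<And>t. (\<integral>\<^sup>+r. ennreal \<bar>X t r\<bar> \<partial>M) \<le> ennreal (B * (7 / 8) ^ t)"
  shows "AE r in M. (\<lambda>t. X t r) \<longlonglongrightarrow> 0"
  using AE_summable[OF X B bd] by eventually_elim (auto dest: summable_LIMSEQ_zero simp: tendsto_rabs_zero_iff)

lemma pair_coins_measurable:
  assumes s: "sets P = sets borel"
  shows "(\<lambda>w. coarsenings t (snd w) (fst w)) \<in> P \<Otimes>\<^sub>M palm_coins \<rightarrow>\<^sub>M borel"
    and "(\<lambda>w. coarsenings t (snd w) real_of_int) \<in> P \<Otimes>\<^sub>M palm_coins \<rightarrow>\<^sub>M borel"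
    and "(\<lambda>w. limit_points (snd w)) \<in> P \<Otimes>\<^sub>M palm_coins \<rightarrow>\<^sub>M borel"
  using measurable_coarsenings measurable_cong_sets[OF sets_pair_measure_cong[OF s refl] refl]
    measurable_compose[OF measurable_snd coarsenings_measurable]
    measurable_compose[OF measurable_snd limit_points_measurable] by blast+

lemma distr_pair_coins:
  assumes P: "prob_space P"
  shows "distr (P \<Otimes>\<^sub>M palm_coins) palm_coins snd = palm_coins"
proof (rule measure_eqI)
  interpret P: prob_space P by (rule P)
  interpret C: prob_space palm_coins by (rule prob_space_palm_coins)
  fix A assume "A \<in> sets (distr (P \<Otimes>\<^sub>M palm_coins) palm_coins snd)"
  then have A: "A \<in> sets palm_coins" by simp
  have "snd -` A \<inter> space (P \<Otimes>\<^sub>M palm_coins) = space P \<times> A"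
    using sets.sets_into_space[OF A] by (auto simp: space_pair_measure)
  then show "emeasure (distr (P \<Otimes>\<^sub>M palm_coins) palm_coins snd) A = emeasure palm_coins A"
    using A by (simp add: emeasure_distr C.emeasure_pair_measure_Times P.emeasure_space_1)
qed simp

lemma AE_pair_coins:
  assumes P: "prob_space P" and Q: "AE r in palm_coins. Q r"
  shows "AE w in P \<Otimes>\<^sub>M palm_coins. Q (snd w)"
proof -
  have "AE r in distr (P \<Otimes>\<^sub>M palm_coins) palm_coins snd. Q r"
    unfolding distr_pair_coins[OF P] by (rule Q)
  then show ?thesis by (rule AE_distrD[OF measurable_snd])
qed

lemma nn_integral_pair_snd:
  assumes P: "prob_space P" and f: "f \<in> borel_measurable palm_coins"
  shows "(\<integral>\<^sup>+w. f (snd w) \<partial>(P \<Otimes>\<^sub>M palm_coins)) = (\<integral>\<^sup>+r. f r \<partial>palm_coins)"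
  using nn_integral_distr[OF measurable_snd[of P palm_coins], of f] f by (simp add: distr_pair_coins[OF P])

text \<open>
  The property of the starting law that is used for convergence: the variance of a weighted sum of gaps is at
  most linear in the total weight. It holds for uncorrelated gaps with mean one and a common finite variance.
\<close>

definition controlled_start :: "real \<Rightarrow> (int \<Rightarrow> real) measure \<Rightarrow> bool" where
  "controlled_start K P \<longleftrightarrow> prob_space P \<and> sets P = sets borel \<and> 0 \<le> K \<and> (AE x in P. x 0 = 0) \<and>
     (\<forall>m n w. unit_weights w \<longrightarrow> (\<integral>\<^sup>+x. ennreal ((weighted_gaps m n w x - weight m n w)\<^sup>2) \<partial>P) \<le> ennreal (K * weight m n w))"

lemma start_gap_rate:
  assumes st: "controlled_start K P"
  shows "(\<integral>\<^sup>+w. ennreal \<bar>gap m (coarsenings t (snd w) (fst w)) - gap m (coarsenings t (snd w) real_of_int)\<bar> \<partial>(P \<Otimes>\<^sub>M palm_coins))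
    \<le> ennreal ((K + 1) * (7 / 8) ^ t)"
proof -
  have pr: "prob_space P" and s: "sets P = sets borel" and K: "0 \<le> K" using st by (simp_all add: controlled_start_def)
  interpret P: prob_space P by (rule pr)
  interpret C: prob_space palm_coins by (rule prob_space_palm_coins)
  interpret PC: pair_prob_space P palm_coins by unfold_locales
  let ?X = "\<lambda>w. weighted_gaps m 1 (\<lambda>_. 1) (coarsenings t (snd w) (fst w)) - weighted_gaps m 1 (\<lambda>_. 1) (coarsenings t (snd w) real_of_int)"
  have X: "?X \<in> borel_measurable (P \<Otimes>\<^sub>M palm_coins)"
    by (intro borel_measurable_diff measurable_compose[OF pair_coins_measurable(1)[OF s] weighted_gaps_measurable]
       measurable_compose[OF pair_coins_measurable(2)[OF s] weighted_gaps_measurable])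
  then have X2: "(\<lambda>w. ennreal ((?X w)\<^sup>2)) \<in> borel_measurable (P \<Otimes>\<^sub>M palm_coins)" by measurable
  have "(\<integral>\<^sup>+w. ennreal ((?X w)\<^sup>2) \<partial>(P \<Otimes>\<^sub>M palm_coins)) = (\<integral>\<^sup>+r. \<integral>\<^sup>+x. ennreal ((?X (x, r))\<^sup>2) \<partial>P \<partial>palm_coins)"
    by (rule PC.nn_integral_snd[OF X2, symmetric])
  also have "\<dots> \<le> ennreal (K * (3 / 4) ^ t * weight m 1 (\<lambda>_. 1))"
    using start_difference_bound[OF pr s K _ unit_weights_1] st unfolding controlled_start_def by simp
  finally have "(\<integral>\<^sup>+w. ennreal \<bar>?X w\<bar> \<partial>(P \<Otimes>\<^sub>M palm_coins)) \<le> ennreal ((K + 1) * 1 * (7 / 8) ^ t)"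
    by (rule nn_integral_abs_rate[OF PC.prob_space_axioms X _ K]) (simp_all add: weight_1)
  then show ?thesis by (simp add: weighted_gaps_1 gap_def)
qed

text \<open>
  The difference of the two coupled processes has a second moment that decays geometrically, so it
  vanishes almost surely and both have the same limit.
\<close>

lemma start_points_limit:
  assumes st: "controlled_start K P"
  shows "AE w in P \<Otimes>\<^sub>M palm_coins. \<forall>k. (\<lambda>t. coarsenings t (snd w) (fst w) k) \<longlonglongrightarrow> limit_points (snd w) k"
proof -
  have pr: "prob_space P" and s: "sets P = sets borel" and K: "0 \<le> K" and z: "AE x in P. x 0 = 0"
    using st by (simp_all add: controlled_start_def)
  have "AE w in P \<Otimes>\<^sub>M palm_coins. \<forall>m. (\<lambda>t. gap m (coarsenings t (snd w) (fst w)) - gap m (coarsenings t (snd w) real_of_int)) \<longlonglongrightarrow> 0"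
    unfolding AE_all_countable
  proof
    fix m
    have X: "(\<lambda>w. gap m (coarsenings t (snd w) (fst w)) - gap m (coarsenings t (snd w) real_of_int)) \<in> borel_measurable (P \<Otimes>\<^sub>M palm_coins)" for t
      by (intro borel_measurable_diff measurable_compose[OF pair_coins_measurable(1)[OF s] gap_measurable]
         measurable_compose[OF pair_coins_measurable(2)[OF s] gap_measurable])
    show "AE w in P \<Otimes>\<^sub>M palm_coins. (\<lambda>t. gap m (coarsenings t (snd w) (fst w)) - gap m (coarsenings t (snd w) real_of_int)) \<longlonglongrightarrow> 0"
      using K by (intro AE_zero_limit[OF X _ start_gap_rate[OF st]]) simp
  qed
  then show ?thesis
    using AE_pair_coins[OF pr AE_limit_points] AE_pair_fst[OF prob_space_palm_coins z]
  proof eventually_elim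
    case (elim w)
    have g: "(\<lambda>t. gap i (coarsenings t (snd w) (fst w))) \<longlonglongrightarrow> limit_points (snd w) (i + 1) - limit_points (snd w) i" for i
    proof -
      have "(\<lambda>t. gap i (coarsenings t (snd w) real_of_int)) \<longlonglongrightarrow> limit_points (snd w) (i + 1) - limit_points (snd w) i"
        unfolding gap_def using elim(2) by (intro tendsto_diff) auto
      from tendsto_add[OF elim(1)[rule_format, of i] this] show ?thesis by simp
    qed
    have l0: "limit_points (snd w) 0 = 0"
      using elim(2)[rule_format, of 0] by (simp add: coarsenings_0 LIMSEQ_const_iff)
    have "(\<lambda>t. partial_sums (\<lambda>i. gap i (coarsenings t (snd w) (fst w))) k) \<longlonglongrightarrow> partial_sums (\<lambda>i. gap i (limit_points (snd w))) k" for k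
      unfolding partial_sums_def gap_def[of _ "limit_points (snd w)"]
      by (cases "0 \<le> k") (auto intro!: tendsto_sum tendsto_minus g)
    then show ?case unfolding partial_sums_gap using elim(3) l0 by (simp add: coarsenings_0)
  qed
qed

lemma start_first_gap_rate:
  assumes st: "controlled_start K P"
  shows "(\<integral>\<^sup>+w. ennreal \<bar>coarsenings t (snd w) (fst w) 1 - limit_points (snd w) 1\<bar> \<partial>(P \<Otimes>\<^sub>M palm_coins))
    \<le> ennreal ((K + 49) * (7 / 8) ^ t)"
proof -
  have pr: "prob_space P" and s: "sets P = sets borel" and K: "0 \<le> K" and z: "AE x in P. x 0 = 0"
    using st by (simp_all add: controlled_start_def)
  have mp [measurable]: "(\<lambda>w. coarsenings t (snd w) (fst w) k) \<in> borel_measurable (P \<Otimes>\<^sub>M palm_coins)"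
    "(\<lambda>w. coarsenings t (snd w) real_of_int k) \<in> borel_measurable (P \<Otimes>\<^sub>M palm_coins)"
    "(\<lambda>w. limit_points (snd w) k) \<in> borel_measurable (P \<Otimes>\<^sub>M palm_coins)" for k
    using pair_coins_measurable[OF s] measurable_compose[OF _ measurable_coord] by blast+
  have mc [measurable]: "(\<lambda>r. coarsenings t r real_of_int k) \<in> borel_measurable palm_coins"
    "(\<lambda>r. limit_points r k) \<in> borel_measurable palm_coins" for k
    using measurable_compose[OF coarsenings_measurable measurable_coord] measurable_compose[OF limit_points_measurable measurable_coord] by blast+
  \<comment> \<open>The process started from \<open>P\<close> is compared with the one started from the lattice, and the latter with its limit.\<close>
  have "(\<integral>\<^sup>+w. ennreal \<bar>coarsenings t (snd w) (fst w) 1 - limit_points (snd w) 1\<bar> \<partial>(P \<Otimes>\<^sub>M palm_coins)) \<le>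
    (\<integral>\<^sup>+w. ennreal \<bar>gap 0 (coarsenings t (snd w) (fst w)) - gap 0 (coarsenings t (snd w) real_of_int)\<bar> +
       ennreal \<bar>limit_points (snd w) 1 - coarsenings t (snd w) real_of_int 1\<bar> \<partial>(P \<Otimes>\<^sub>M palm_coins))"
  proof (rule nn_integral_mono_AE, use AE_pair_fst[OF prob_space_palm_coins z] in eventually_elim)
    case (elim w)
    have "\<bar>coarsenings t (snd w) (fst w) 1 - limit_points (snd w) 1\<bar> \<le>
      \<bar>gap 0 (coarsenings t (snd w) (fst w)) - gap 0 (coarsenings t (snd w) real_of_int)\<bar> + \<bar>limit_points (snd w) 1 - coarsenings t (snd w) real_of_int 1\<bar>"
      using elim by (simp add: gap_def coarsenings_0)
    from ennreal_leI[OF this] show ?case by (subst (asm) ennreal_plus) auto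
  qed
  also have "\<dots> = (\<integral>\<^sup>+w. ennreal \<bar>gap 0 (coarsenings t (snd w) (fst w)) - gap 0 (coarsenings t (snd w) real_of_int)\<bar> \<partial>(P \<Otimes>\<^sub>M palm_coins)) +
     (\<integral>\<^sup>+w. ennreal \<bar>limit_points (snd w) 1 - coarsenings t (snd w) real_of_int 1\<bar> \<partial>(P \<Otimes>\<^sub>M palm_coins))"
    by (rule nn_integral_add) (simp_all add: gap_def)
  also have "\<dots> \<le> ennreal ((K + 1) * (7 / 8) ^ t) + ennreal (48 * (7 / 8) ^ t)"
  proof (rule add_mono[OF start_gap_rate[OF st]])
    have "(\<integral>\<^sup>+w. ennreal \<bar>limit_points (snd w) 1 - coarsenings t (snd w) real_of_int 1\<bar> \<partial>(P \<Otimes>\<^sub>M palm_coins)) =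
       (\<integral>\<^sup>+r. ennreal \<bar>limit_points r 1 - coarsenings t r real_of_int 1\<bar> \<partial>palm_coins)"
      by (rule nn_integral_pair_snd[OF pr, of "\<lambda>r. ennreal \<bar>limit_points r 1 - coarsenings t r real_of_int 1\<bar>"]) measurable
    also have "\<dots> \<le> ennreal (48 * (7 / 8) ^ t)"
      using points_limit_rate[of 1 0 t] by (simp add: weighted_gaps_1 coarsenings_0 limit_points_def)
    finally show "(\<integral>\<^sup>+w. ennreal \<bar>limit_points (snd w) 1 - coarsenings t (snd w) real_of_int 1\<bar> \<partial>(P \<Otimes>\<^sub>M palm_coins)) \<le> ennreal (48 * (7 / 8) ^ t)" .
  qed
  also have "\<dots> = ennreal ((K + 49) * (7 / 8) ^ t)"
    using K by (subst ennreal_plus[symmetric]) (auto simp: algebra_simps)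
  finally show ?thesis .
qed

definition limit_palm :: "(int \<Rightarrow> real) measure" where
  "limit_palm = distr palm_coins borel limit_points"

lemma sets_limit_palm [simp]: "sets limit_palm = sets borel" by (simp add: limit_palm_def)

lemma prob_space_limit_palm: "prob_space limit_palm"
  unfolding limit_palm_def by (rule prob_space.prob_space_distr[OF prob_space_palm_coins limit_points_measurable])

lemma limit_palm_eq_pair:
  assumes pr: "prob_space P" and s: "sets P = sets borel"
  shows "limit_palm = distr (P \<Otimes>\<^sub>M palm_coins) borel (\<lambda>w. limit_points (snd w))"
proof -
  have "distr (P \<Otimes>\<^sub>M palm_coins) borel (\<lambda>w. limit_points (snd w)) = distr (distr (P \<Otimes>\<^sub>M palm_coins) palm_coins snd) borel limit_points"
    by (subst distr_distr) (auto simp: limit_points_measurable comp_def)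
  then show ?thesis by (simp add: limit_palm_def distr_pair_coins[OF pr])
qed

lemma sets_palm_step_iter: "sets P = sets borel \<Longrightarrow> sets ((palm_step_law ^^ t) P) = sets borel"
  by (cases t) simp_all

lemma palm_step_iter_eq_pair:
  assumes pr: "prob_space P" and s: "sets P = sets borel"
  shows "(palm_step_law ^^ t) P = distr (P \<Otimes>\<^sub>M palm_coins) borel (\<lambda>w. coarsenings t (snd w) (fst w))"
proof (rule measure_eqI_nn_integral)
  interpret C: prob_space palm_coins by (rule prob_space_palm_coins)
  show "sets ((palm_step_law ^^ t) P) = sets (distr (P \<Otimes>\<^sub>M palm_coins) borel (\<lambda>w. coarsenings t (snd w) (fst w)))"
    by (simp add: sets_palm_step_iter[OF s])
  fix f :: "(int \<Rightarrow> real) \<Rightarrow> ennreal" assume "f \<in> borel_measurable ((palm_step_law ^^ t) P)"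
  then have f: "f \<in> borel_measurable borel" by (simp add: measurable_cong_sets[OF sets_palm_step_iter[OF s] refl])
  have fm: "(\<lambda>w. f (coarsenings t (snd w) (fst w))) \<in> borel_measurable (P \<Otimes>\<^sub>M palm_coins)"
    by (rule measurable_compose[OF pair_coins_measurable(1)[OF s] f])
  show "(\<integral>\<^sup>+x. f x \<partial>(palm_step_law ^^ t) P) = (\<integral>\<^sup>+x. f x \<partial>distr (P \<Otimes>\<^sub>M palm_coins) borel (\<lambda>w. coarsenings t (snd w) (fst w)))"
    unfolding nn_integral_palm_step_iter[OF pr s f]
    using C.nn_integral_fst[OF fm] by (simp add: nn_integral_distr[OF pair_coins_measurable(1)[OF s]] f)
qed

lemma palm_weak_convergence:
  assumes st: "controlled_start K P"
  shows "weakly_converges (\<lambda>t. (palm_step_law ^^ t) P) limit_palm"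
  unfolding weakly_converges_def
proof (intro allI impI)
  have pr: "prob_space P" and s: "sets P = sets borel" using st by (simp_all add: controlled_start_def)
  interpret P: prob_space P by (rule pr)
  interpret C: prob_space palm_coins by (rule prob_space_palm_coins)
  interpret PC: pair_prob_space P palm_coins by unfold_locales
  fix f :: "(int \<Rightarrow> real) \<Rightarrow> real" assume c: "continuous_on UNIV f" and b: "bounded (range f)"
  have f: "f \<in> borel_measurable borel" by (rule borel_measurable_continuous_onI[OF c])
  obtain B where B: "\<And>x. \<bar>f x\<bar> \<le> B" using b unfolding bounded_iff by auto
  have "(\<lambda>t. \<integral>w. f (coarsenings t (snd w) (fst w)) \<partial>(P \<Otimes>\<^sub>M palm_coins)) \<longlonglongrightarrow> (\<integral>w. f (limit_points (snd w)) \<partial>(P \<Otimes>\<^sub>M palm_coins))"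
  proof (rule integral_dominated_convergence[where w = "\<lambda>_. B"])
    show "(\<lambda>w. f (limit_points (snd w))) \<in> borel_measurable (P \<Otimes>\<^sub>M palm_coins)"
      by (rule measurable_compose[OF pair_coins_measurable(3)[OF s] f])
    show "(\<lambda>w. f (coarsenings t (snd w) (fst w))) \<in> borel_measurable (P \<Otimes>\<^sub>M palm_coins)" for t
      by (rule measurable_compose[OF pair_coins_measurable(1)[OF s] f])
    show "AE w in P \<Otimes>\<^sub>M palm_coins. (\<lambda>t. f (coarsenings t (snd w) (fst w))) \<longlonglongrightarrow> f (limit_points (snd w))"
      using start_points_limit[OF st]
    proof eventually_elim
      case (elim w)
      have "(\<lambda>t. coarsenings t (snd w) (fst w)) \<longlonglongrightarrow> limit_points (snd w)" using elim by (intro tendsto_seq) blast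
      then show ?case by (rule continuous_on_tendsto_compose[OF c]) auto
    qed
  qed (use B in auto)
  then show "(\<lambda>t. \<integral>x. f x \<partial>(palm_step_law ^^ t) P) \<longlonglongrightarrow> (\<integral>x. f x \<partial>limit_palm)"
    unfolding palm_step_iter_eq_pair[OF pr s] limit_palm_eq_pair[OF pr s]
    by (simp add: integral_distr[OF pair_coins_measurable(1)[OF s] f] integral_distr[OF pair_coins_measurable(3)[OF s] f])
qed

definition lattice_law :: "(int \<Rightarrow> real) measure" where
  "lattice_law = return borel real_of_int"

lemma nn_integral_lattice_law: "f \<in> borel_measurable borel \<Longrightarrow> (\<integral>\<^sup>+x. f x \<partial>lattice_law) = f real_of_int"
  unfolding lattice_law_def by (rule nn_integral_return) auto

lemma lattice_law_AE: "{x. Q x} \<in> sets borel \<Longrightarrow> Q real_of_int \<Longrightarrow> AE x in lattice_law. Q x"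
  unfolding lattice_law_def by (subst AE_return) (auto simp: Measurable.pred_def)

text \<open>
  The lattice is itself a Palm law, so all that is known about iterates of Palm laws applies to it.
\<close>

lemma lattice_law_cycle_stationary: "cycle_stationary lattice_law"
  unfolding cycle_stationary_def
proof (intro conjI allI)
  show "prob_space lattice_law" unfolding lattice_law_def by (rule prob_space_return) simp
  show "sets lattice_law = sets borel" by (simp add: lattice_law_def)
  show "AE x in lattice_law. two_sided x" by (rule lattice_law_AE[OF measurable_two_sided two_sided_lattice])
  fix i
  have "from_point i real_of_int = real_of_int" by (simp add: from_point_def fun_eq_iff)
  then show "distr lattice_law borel (from_point i) = lattice_law"
    unfolding lattice_law_def by (subst distr_return) auto
qed

lemma lattice_law_strict_mono: "AE x in lattice_law. strict_mono x"
  by (rule lattice_law_AE[OF strict_mono_sets]) (simp add: strict_mono_def)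

lemma lattice_law_controlled: "controlled_start 0 lattice_law"
  unfolding controlled_start_def
proof (intro conjI allI impI)
  show "prob_space lattice_law" "sets lattice_law = sets borel"
    using lattice_law_cycle_stationary by (simp_all add: cycle_stationary_def)
  show "AE x in lattice_law. x 0 = 0" by (rule cycle_stationary_zero[OF lattice_law_cycle_stationary])
  fix m n w
  have "(\<lambda>x. ennreal ((weighted_gaps m n w x - weight m n w)\<^sup>2)) \<in> borel_measurable borel"
    using weighted_gaps_measurable[of m n w] by measurable
  from nn_integral_lattice_law[OF this]
  show "(\<integral>\<^sup>+x. ennreal ((weighted_gaps m n w x - weight m n w)\<^sup>2) \<partial>lattice_law) \<le> ennreal (0 * weight m n w)"
    by (simp add: weighted_gaps_lattice)
qed simp

lemma palm_step_iter_cycle_stationary: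
  "cycle_stationary P \<Longrightarrow> cycle_stationary ((palm_step_law ^^ t) P)"
  by (induction t) (simp_all add: palm_step_cycle_stationary)

lemma from_point_continuous: "continuous_on UNIV (from_point i)"
  unfolding from_point_def
  by (intro continuous_on_coordinatewise_then_product continuous_on_diff continuous_on_product_coordinates)

text \<open>
  Invariance passes to weak limits because moving the origin to the next point is continuous for
  coordinatewise convergence.
\<close>

lemma limit_palm_cycle_stationary: "cycle_stationary limit_palm"
proof (rule cycle_stationaryI)
  show "prob_space limit_palm" by (rule prob_space_limit_palm)
  have ae: "AE x in limit_palm. Q x" if "{x. Q x} \<in> sets borel" "AE r in palm_coins. Q (limit_points r)" for Q
    unfolding limit_palm_def by (subst AE_distr_iff[OF limit_points_measurable]) (use that in auto)
  show "AE x in limit_palm. two_sided x"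
    by (rule ae[OF measurable_two_sided]) (use AE_limit_points_two_sided in eventually_elim, simp)
  show "AE x in limit_palm. x 0 = 0"
    by (rule ae) (use AE_limit_points_two_sided in \<open>simp, eventually_elim, simp\<close>)
  have fp: "from_point 1 \<in> limit_palm \<rightarrow>\<^sub>M borel" by (simp add: measurable_cong_sets[OF sets_limit_palm refl])
  show "distr limit_palm borel (from_point 1) = limit_palm"
  proof (rule measure_eqI_bounded_continuous)
    show "prob_space (distr limit_palm borel (from_point 1))" by (rule prob_space.prob_space_distr[OF prob_space_limit_palm fp])
    show "prob_space limit_palm" by (rule prob_space_limit_palm)
    fix f :: "(int \<Rightarrow> real) \<Rightarrow> real" assume c: "continuous_on UNIV f" and b: "bounded (range f)"
    have f: "f \<in> borel_measurable borel" by (rule borel_measurable_continuous_onI[OF c])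
    have c': "continuous_on UNIV (\<lambda>x. f (from_point 1 x))"
      by (rule continuous_on_compose2[OF c from_point_continuous]) simp
    have b': "bounded (range (\<lambda>x. f (from_point 1 x)))" by (rule bounded_subset[OF b]) auto
    note w = palm_weak_convergence[OF lattice_law_controlled, unfolded weakly_converges_def, rule_format]
    have "(\<integral>x. f (from_point 1 x) \<partial>(palm_step_law ^^ t) lattice_law) = (\<integral>x. f x \<partial>(palm_step_law ^^ t) lattice_law)" for t
    proof -
      have cs: "cycle_stationary ((palm_step_law ^^ t) lattice_law)"
        by (rule palm_step_iter_cycle_stationary[OF lattice_law_cycle_stationary])
      then have "from_point 1 \<in> (palm_step_law ^^ t) lattice_law \<rightarrow>\<^sub>M borel"
        using from_point_measurable measurable_cong_sets unfolding cycle_stationary_def by blast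
      from integral_distr[OF this f] show ?thesis using cs by (simp add: cycle_stationary_def)
    qed
    then have "(\<integral>x. f (from_point 1 x) \<partial>limit_palm) = (\<integral>x. f x \<partial>limit_palm)"
      using LIMSEQ_unique[OF w[OF c' b']] w[OF c b] by simp
    then show "(\<integral>x. f x \<partial>distr limit_palm borel (from_point 1)) = (\<integral>x. f x \<partial>limit_palm)"
      by (simp add: integral_distr[OF fp f])
  qed simp_all
qed simp

section \<open>The limiting stationary law\<close>

text \<open>
  The stationary law that belongs to a given Palm law with mean gap one: the origin is moved to a
  position spread over the cell of point \<open>0\<close>.
\<close>

definition spread :: "(int \<Rightarrow> real) measure \<Rightarrow> (int \<Rightarrow> real) measure" where
  "spread P = distr (density (P \<Otimes>\<^sub>M lborel) (\<lambda>(x, s). of_bool (0 \<le> s \<and> s < x 1))) borel (\<lambda>(x, s) j. x j - s)"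

lemma sets_spread [simp]: "sets (spread P) = sets borel" by (simp add: spread_def)

lemma nn_integral_spread:
  assumes P: "sets P = sets borel" and F: "F \<in> borel_measurable borel"
  shows "(\<integral>\<^sup>+x. F x \<partial>spread P) = (\<integral>\<^sup>+x. \<integral>\<^sup>+s. of_bool (0 \<le> s \<and> s < x 1) * F (\<lambda>j. x j - s) \<partial>lborel \<partial>P)"
proof -
  have Mc: "measurable (P \<Otimes>\<^sub>M lborel) N = measurable (borel \<Otimes>\<^sub>M borel) N" for N :: "'z measure"
    by (intro measurable_cong_sets sets_pair_measure_cong P sets_lborel refl)
  have w: "(\<lambda>w :: (int \<Rightarrow> real) \<times> real. of_bool (0 \<le> snd w \<and> snd w < fst w 1) :: ennreal) \<in> borel_measurable (borel \<Otimes>\<^sub>M borel)"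
    by measurable
  have t: "(\<lambda>w :: (int \<Rightarrow> real) \<times> real. (\<lambda>j. fst w j - snd w)) \<in> borel_measurable (borel \<Otimes>\<^sub>M borel)"
    by (rule borel_seqI) measurable
  have "(\<integral>\<^sup>+x. F x \<partial>spread P) = (\<integral>\<^sup>+w. F (\<lambda>j. fst w j - snd w) \<partial>density (P \<Otimes>\<^sub>M lborel) (\<lambda>w. of_bool (0 \<le> snd w \<and> snd w < fst w 1)))"
    unfolding spread_def case_prod_beta' by (rule nn_integral_distr) (use t F Mc in auto)
  also have "\<dots> = (\<integral>\<^sup>+w. of_bool (0 \<le> snd w \<and> snd w < fst w 1) * F (\<lambda>j. fst w j - snd w) \<partial>(P \<Otimes>\<^sub>M lborel))"
    by (rule nn_integral_density) (simp_all only: Mc w measurable_compose[OF t F])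
  also have "\<dots> = (\<integral>\<^sup>+x. \<integral>\<^sup>+s. of_bool (0 \<le> s \<and> s < x 1) * F (\<lambda>j. x j - s) \<partial>lborel \<partial>P)"
  proof -
    have "(\<lambda>w. of_bool (0 \<le> snd w \<and> snd w < fst w 1) * F (\<lambda>j. fst w j - snd w)) \<in> borel_measurable (P \<Otimes>\<^sub>M lborel)"
      unfolding Mc using w measurable_compose[OF t F] by (rule borel_measurable_times_ennreal)
    from lborel.nn_integral_fst[OF this] show ?thesis by simp
  qed
  finally show ?thesis .
qed

lemma spread_inverts: "sets P = sets borel \<Longrightarrow> inverts (spread P) P"
  unfolding inverts_def by (auto simp: nn_integral_spread)

lemma cell_length: "(\<integral>\<^sup>+s. of_bool (0 \<le> s \<and> s < (a :: real)) \<partial>lborel) = ennreal a"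
proof -
  have "of_bool (0 \<le> s \<and> s < a) = (indicator {0..<a} s :: ennreal)" for s by (simp add: indicator_def)
  then show ?thesis by (cases "0 \<le> a") (simp_all only: nn_integral_indicator sets_lborel atLeastLessThan_borel, simp_all add: ennreal_neg)
qed

lemma inverts_mass:
  assumes "inverts P P0"
  shows "emeasure P (space P) = (\<integral>\<^sup>+x. ennreal (x 1) \<partial>P0)"
proof -
  have "(\<integral>\<^sup>+x. 1 \<partial>P) = (\<integral>\<^sup>+x. \<integral>\<^sup>+s. of_bool (0 \<le> s \<and> s < x 1) * 1 \<partial>lborel \<partial>P0)"
    using assms[unfolded inverts_def, rule_format, of "\<lambda>_. 1"] by simp
  then show ?thesis by (simp only: mult_1_right cell_length nn_integral_const mult_1_left)
qed

lemma emeasure_clustering_law: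
  assumes P: "sets P = sets borel" shows "emeasure (clustering_law P t) (space (clustering_law P t)) = emeasure P (space P)"
proof -
  interpret prob_space coins by (rule prob_space_coins)
  have "(\<integral>\<^sup>+x. 1 \<partial>clustering_law P t) = (\<integral>\<^sup>+x. 1 \<partial>P)"
    by (subst nn_integral_clustering_law[OF P]) (simp_all add: emeasure_space_1)
  then show ?thesis by simp
qed

text \<open>
  The mean gap of a Palm law is the total mass of the law that it inverts to, and the dynamics preserves
  total mass.
\<close>

lemma lattice_mean_gap: "(\<integral>\<^sup>+r. ennreal (coarsenings t r real_of_int 1) \<partial>palm_coins) = 1"
proof -
  interpret C: prob_space palm_coins by (rule prob_space_palm_coins)
  have sl: "sets lattice_law = sets borel" and pl: "prob_space lattice_law"
    using lattice_law_cycle_stationary by (simp_all add: cycle_stationary_def)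
  have x1: "(\<lambda>x :: int \<Rightarrow> real. ennreal (x 1)) \<in> borel_measurable borel" by measurable
  have "(\<integral>\<^sup>+x. ennreal (x 1) \<partial>(palm_step_law ^^ t) lattice_law) = emeasure (clustering_law (spread lattice_law) t) (space (clustering_law (spread lattice_law) t))"
    using clustering_law_inverts[OF lattice_law_cycle_stationary lattice_law_strict_mono spread_inverts[OF sl] sets_spread]
    by (intro inverts_mass[symmetric]) blast
  also have "\<dots> = emeasure (spread lattice_law) (space (spread lattice_law))" by (rule emeasure_clustering_law) simp
  also have "\<dots> = (\<integral>\<^sup>+x. ennreal (x 1) \<partial>lattice_law)" by (rule inverts_mass[OF spread_inverts[OF sl]])
  also have "\<dots> = 1" by (subst nn_integral_lattice_law[OF x1]) simp
  finally have "(\<integral>\<^sup>+x. \<integral>\<^sup>+r. ennreal (coarsenings t r x 1) \<partial>palm_coins \<partial>lattice_law) = 1"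
    unfolding nn_integral_palm_step_iter[OF pl sl x1] .
  moreover have "(\<lambda>x. \<integral>\<^sup>+r. ennreal (coarsenings t r x 1) \<partial>palm_coins) \<in> borel_measurable borel"
    using measurable_compose[OF measurable_coarsenings x1, of t]
    by (intro C.borel_measurable_nn_integral) (simp add: case_prod_beta')
  ultimately show ?thesis by (simp add: nn_integral_lattice_law)
qed

text \<open>
  No mass is lost in the limit because the first point converges in mean.
\<close>

lemma limit_mean_gap: "(\<integral>\<^sup>+r. ennreal (limit_points r 1) \<partial>palm_coins) = 1"
proof -
  define D where "D t = (\<integral>\<^sup>+r. ennreal \<bar>limit_points r 1 - coarsenings t r real_of_int 1\<bar> \<partial>palm_coins)" for t
  have mc [measurable]: "(\<lambda>r. coarsenings t r real_of_int k) \<in> borel_measurable palm_coins"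
    "(\<lambda>r. limit_points r k) \<in> borel_measurable palm_coins" for t k
    using measurable_compose[OF coarsenings_measurable measurable_coord] measurable_compose[OF limit_points_measurable measurable_coord] by blast+
  have D: "D t \<le> ennreal (48 * (7 / 8) ^ t)" for t
    using points_limit_rate[of 1 0 t] by (simp add: weighted_gaps_1 coarsenings_0 limit_points_def D_def)
  have "(\<lambda>t. ennreal (48 * (7 / 8) ^ t)) \<longlonglongrightarrow> ennreal (48 * 0)"
    by (intro tendsto_ennrealI tendsto_mult tendsto_const LIMSEQ_realpow_zero) auto
  then have D1: "(\<lambda>t. ennreal (48 * (7 / 8) ^ t)) \<longlonglongrightarrow> 0" by simp
  have D0: "D \<longlonglongrightarrow> 0" by (rule tendsto_sandwich[OF _ _ tendsto_const D1]) (simp_all add: D)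
  have le: "ennreal a \<le> ennreal b + ennreal \<bar>a - b\<bar>" for a b :: real
    by (cases "0 \<le> b") (auto simp: ennreal_neg simp flip: ennreal_plus intro!: ennreal_leI)
  have up: "(\<integral>\<^sup>+r. ennreal (limit_points r 1) \<partial>palm_coins) \<le> 1 + D t" for t
  proof -
    have "(\<integral>\<^sup>+r. ennreal (limit_points r 1) \<partial>palm_coins) \<le> (\<integral>\<^sup>+r. ennreal (coarsenings t r real_of_int 1) + ennreal \<bar>limit_points r 1 - coarsenings t r real_of_int 1\<bar> \<partial>palm_coins)"
      by (intro nn_integral_mono le)
    also have "\<dots> = 1 + D t" unfolding D_def lattice_mean_gap[of t, symmetric] by (rule nn_integral_add) measurable
    finally show ?thesis .
  qed
  have lo: "1 \<le> (\<integral>\<^sup>+r. ennreal (limit_points r 1) \<partial>palm_coins) + D t" for t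
  proof -
    have "1 = (\<integral>\<^sup>+r. ennreal (coarsenings t r real_of_int 1) \<partial>palm_coins)" by (simp add: lattice_mean_gap)
    also have "\<dots> \<le> (\<integral>\<^sup>+r. ennreal (limit_points r 1) + ennreal \<bar>limit_points r 1 - coarsenings t r real_of_int 1\<bar> \<partial>palm_coins)"
      using le[of "coarsenings t _ real_of_int 1" "limit_points _ 1"] by (intro nn_integral_mono) (simp add: abs_minus_commute)
    also have "\<dots> = (\<integral>\<^sup>+r. ennreal (limit_points r 1) \<partial>palm_coins) + D t" unfolding D_def by (rule nn_integral_add) measurable
    finally show ?thesis .
  qed
  have "(\<integral>\<^sup>+r. ennreal (limit_points r 1) \<partial>palm_coins) \<le> 1 + 0"
    by (rule LIMSEQ_le_const[OF tendsto_add[OF tendsto_const D0]]) (use up in auto)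
  moreover have "1 \<le> (\<integral>\<^sup>+r. ennreal (limit_points r 1) \<partial>palm_coins) + 0"
    by (rule LIMSEQ_le_const[OF tendsto_add[OF tendsto_const D0]]) (use lo in auto)
  ultimately show ?thesis by simp
qed

definition limit_law :: "(int \<Rightarrow> real) measure" where
  "limit_law = spread limit_palm"

lemma limit_law_inverts: "inverts limit_law limit_palm"
  unfolding limit_law_def by (rule spread_inverts) simp

lemma sets_limit_law [simp]: "sets limit_law = sets borel"
  by (simp add: limit_law_def)

lemma prob_space_limit_law: "prob_space limit_law"
proof
  have "(\<lambda>x :: int \<Rightarrow> real. ennreal (x 1)) \<in> borel_measurable borel" by measurable
  then show "emeasure limit_law (space limit_law) = 1"
    unfolding inverts_mass[OF limit_law_inverts] limit_palm_def
    by (subst nn_integral_distr[OF limit_points_measurable]) (simp_all add: limit_mean_gap)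
qed

lemma limit_law_point_process: "point_process limit_law"
  unfolding point_process_def
proof (intro conjI)
  show "prob_space limit_law" by (rule prob_space_limit_law)
  have ts: "AE x in limit_palm. two_sided x" using limit_palm_cycle_stationary by (simp add: cycle_stationary_def)
  have N: "{x. \<not> two_sided x} \<in> sets borel"
    using sets.compl_sets[OF measurable_two_sided] by (simp add: Collect_neg_eq Compl_eq_Diff_UNIV)
  have "emeasure limit_law {x. \<not> two_sided x} = (\<integral>\<^sup>+x. indicator {x. \<not> two_sided x} x \<partial>limit_law)"
    using N by simp
  also have "\<dots> = (\<integral>\<^sup>+x. \<integral>\<^sup>+s. of_bool (0 \<le> s \<and> s < x 1) * indicator {x. \<not> two_sided x} (\<lambda>j. x j - s) \<partial>lborel \<partial>limit_palm)"
    unfolding limit_law_def by (rule nn_integral_spread) (use N in auto)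
  also have "\<dots> = (\<integral>\<^sup>+x. 0 \<partial>limit_palm)"
    by (rule nn_integral_cong_AE) (use ts in eventually_elim, simp add: two_sided_translate)
  finally have "AE x in limit_law. two_sided x"
    by (intro AE_I[where N = "{x. \<not> two_sided x}"]) (use N in auto)
  then show "AE x in limit_law. mono x" by eventually_elim (simp add: two_sided_def)
qed simp

section \<open>Convergence of the counts\<close>

text \<open>
  Only finitely many points of the limit are relevant for a bounded set, none of them lies on its
  boundary, and by monotonicity the points outside a finite window of indices stay away.
\<close>

lemma num_points_eventually:
  assumes z: "\<And>k. (\<lambda>t. z t k) \<longlonglongrightarrow> y k" and mono: "\<And>t. mono (z t)" and y: "two_sided y"
    and B: "bounded B" and fr: "num_points y (frontier B) = 0"
  shows "eventually (\<lambda>t. num_points (z t) B = num_points y B) sequentially"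
proof -
  obtain b where b: "\<And>v. v \<in> B \<Longrightarrow> \<bar>v\<bar> \<le> b" using B unfolding bounded_iff by auto
  obtain hi where hi: "b < y hi" using y by (auto simp: two_sided_def)
  obtain lo where lo: "y lo < - b" using y by (auto simp: two_sided_def)
  have ym: "i \<le> j \<Longrightarrow> y i \<le> y j" for i j using y by (auto simp: two_sided_def mono_def)
  have "eventually (\<lambda>t. b < z t hi) sequentially" "eventually (\<lambda>t. z t lo < - b) sequentially"
    using order_tendstoD[OF z] hi lo by auto
  moreover have "eventually (\<lambda>t. \<forall>i\<in>{lo..hi}. z t i \<in> B \<longleftrightarrow> y i \<in> B) sequentially"
  proof (rule eventually_ball_finite, simp, rule ballI)
    fix i
    have "y i \<notin> frontier B"
    proof
      assume "y i \<in> frontier B"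
      then have "of_nat (card {i}) \<le> num_points y (frontier B)" by (intro num_points_ge) auto
      then show False using fr by simp
    qed
    then consider "y i \<in> interior B" | "y i \<in> - closure B" by (auto simp: frontier_def)
    then show "eventually (\<lambda>t. z t i \<in> B \<longleftrightarrow> y i \<in> B) sequentially"
    proof cases
      case 1
      then have "eventually (\<lambda>t. z t i \<in> interior B) sequentially" using topological_tendstoD[OF z] by auto
      then show ?thesis by eventually_elim (use 1 interior_subset in blast)
    next
      case 2
      then have "eventually (\<lambda>t. z t i \<in> - closure B) sequentially"
        using topological_tendstoD[OF z, of "- closure B"] by auto
      then show ?thesis by eventually_elim (use 2 closure_subset in blast)
    qed
  qed
  ultimately show ?thesis
  proof eventually_elim
    case (elim t)
    have "z t i \<in> B \<longleftrightarrow> y i \<in> B" for i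
    proof (cases "i \<in> {lo..hi}")
      case False
      then consider "i \<le> lo" | "hi \<le> i" by fastforce
      then show ?thesis
      proof cases
        case 1
        then have "z t i < - b" "y i < - b" using monoD[OF mono, of i lo t] ym[of i lo] elim lo by auto
        then show ?thesis using b[of "z t i"] b[of "y i"] by auto
      next
        case 2
        then have "b < z t i" "b < y i" using monoD[OF mono, of hi i t] ym[of hi i] elim hi by auto
        then show ?thesis using b[of "z t i"] b[of "y i"] by auto
      qed
    qed (use elim in blast)
    then show ?case by (simp add: num_points_def)
  qed
qed

lemma counts_eventually:
  assumes z: "\<And>i. (\<lambda>t. z t i) \<longlonglongrightarrow> y i" and mono: "\<And>t. mono (z t)" and y: "two_sided y"
    and B: "\<And>j. j < k \<Longrightarrow> bounded (B j)" and fr: "\<And>j. j < k \<Longrightarrow> num_points y (frontier (B j)) = 0"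
  shows "eventually (\<lambda>t. counts k B (z t) = counts k B y) sequentially"
proof -
  have "eventually (\<lambda>t. \<forall>j\<in>{..<k}. num_points (z t) (B j) = num_points y (B j)) sequentially"
    by (rule eventually_ball_finite) (auto intro!: num_points_eventually z mono y B fr)
  then show ?thesis by eventually_elim (auto simp: counts_def fun_eq_iff)
qed

lemma tendsto_ennreal_perturb:
  fixes a v e :: "nat \<Rightarrow> ennreal"
  assumes v: "v \<longlonglongrightarrow> l" and l: "l \<noteq> \<infinity>" and e: "e \<longlonglongrightarrow> 0" and fin: "\<And>t. e t \<noteq> \<infinity>"
    and up: "\<And>t. a t \<le> v t + e t" and lo: "\<And>t. v t \<le> a t + e t"
  shows "a \<longlonglongrightarrow> l"
proof (rule tendsto_sandwich[of "\<lambda>t. v t - e t" _ _ "\<lambda>t. v t + e t"])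
  show "(\<lambda>t. v t + e t) \<longlonglongrightarrow> l" using tendsto_add[OF v e] by simp
  show "(\<lambda>t. v t - e t) \<longlonglongrightarrow> l" using tendsto_diff_ennreal_general[OF v e] l by simp
  show "eventually (\<lambda>t. a t \<le> v t + e t) sequentially" using up by simp
  show "eventually (\<lambda>t. v t - e t \<le> a t) sequentially"
    using lo fin by (intro always_eventually allI) (simp add: ennreal_minus_le_iff add.commute)
qed

text \<open>
  Changing the length of the cell changes the integral of a bounded function by at most a multiple of the
  difference.
\<close>

lemma cell_compare:
  fixes H :: "real \<Rightarrow> ennreal"
  assumes H: "\<And>s. H s \<le> ennreal c" and Hm [measurable]: "H \<in> borel_measurable borel"
  shows "(\<integral>\<^sup>+s. of_bool (0 \<le> s \<and> s < a) * H s \<partial>lborel) \<le> (\<integral>\<^sup>+s. of_bool (0 \<le> s \<and> s < b) * H s \<partial>lborel) + ennreal c * ennreal \<bar>a - b\<bar>"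
proof -
  have "(\<integral>\<^sup>+s. of_bool (0 \<le> s \<and> s < a) * H s \<partial>lborel) \<le> (\<integral>\<^sup>+s. of_bool (0 \<le> s \<and> s < b) * H s + ennreal c * indicator {b..<a} s \<partial>lborel)"
    using H by (intro nn_integral_mono) (auto simp: indicator_def)
  also have "\<dots> = (\<integral>\<^sup>+s. of_bool (0 \<le> s \<and> s < b) * H s \<partial>lborel) + (\<integral>\<^sup>+s. ennreal c * indicator {b..<a} s \<partial>lborel)"
  proof (rule nn_integral_add)
    have "(\<lambda>s :: real. of_bool (0 \<le> s \<and> s < b) :: ennreal) \<in> borel_measurable borel" by measurable
    from borel_measurable_times_ennreal[OF this Hm]
    show "(\<lambda>s. of_bool (0 \<le> s \<and> s < b) * H s) \<in> borel_measurable lborel" by simp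
  qed simp
  also have "(\<integral>\<^sup>+s. ennreal c * indicator {b..<a} s \<partial>lborel) = ennreal c * emeasure lborel {b..<a}"
    by (rule nn_integral_cmult_indicator) simp
  also have "emeasure lborel {b..<a} \<le> ennreal \<bar>a - b\<bar>"
    by (cases "b \<le> a") auto
  finally show ?thesis by (meson add_left_mono mult_left_mono order_trans zero_le)
qed

lemma prob_space_clustering_law:
  assumes "prob_space P" "sets P = sets borel" shows "prob_space (clustering_law P t)"
  using emeasure_clustering_law[OF assms(2), of t] prob_space.emeasure_space_1[OF assms(1)] by (intro prob_spaceI) simp

text \<open>
  A null event of the stationary law is a null event for the typical point and almost every observer in
  its cell.
\<close>

lemma inverts_AE_no_points:
  assumes inv: "inverts P P0" and s0: "sets P0 = sets borel" and A: "A \<in> sets borel" and ae: "AE x in P. num_points x A = 0"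
  shows "AE x in P0. AE s in lborel. 0 \<le> s \<longrightarrow> s < x 1 \<longrightarrow> num_points (\<lambda>j. x j - s) A = 0"
proof -
  define N where "N x = (of_bool (num_points x A \<noteq> 0) :: ennreal)" for x
  have Nm: "N \<in> borel_measurable borel"
  proof -
    have "Measurable.pred borel (\<lambda>x. num_points x A = 0)"
      using pred_eq_const1[OF num_points_measurable[OF A], of 0] by simp
    then show ?thesis unfolding N_def by measurable
  qed
  have Nr: "N (reindex i x) = N x" for i x by (simp add: N_def num_points_reindex)
  define J where "J x = (\<integral>\<^sup>+s. of_bool (0 \<le> s \<and> s < x 1) * N (\<lambda>j. x j - s) \<partial>lborel)" for x :: "int \<Rightarrow> real"
  have Jm: "J \<in> borel_measurable P0"
    unfolding J_def by (rule cell_integral_measurable[OF Nm]) (simp_all add: measurable_cong_sets[OF s0 refl])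
  have b1: "(\<lambda>s :: real. of_bool (0 \<le> s \<and> s < x 1) :: ennreal) \<in> borel_measurable borel" for x :: "int \<Rightarrow> real" by measurable
  have Js: "(\<lambda>s. of_bool (0 \<le> s \<and> s < x 1) * N (\<lambda>j. x j - s)) \<in> borel_measurable lborel" for x
    using borel_measurable_times_ennreal[OF b1[of x]] measurable_Pair2[OF measurable_translated[OF Nm], of x] by simp
  have "(\<integral>\<^sup>+x. J x \<partial>P0) = (\<integral>\<^sup>+x. N x \<partial>P)"
    using inv Nm Nr unfolding inverts_def J_def by simp
  also have "\<dots> = (\<integral>\<^sup>+x. 0 \<partial>P)"
    by (rule nn_integral_cong_AE) (use ae in \<open>auto simp: N_def elim!: eventually_mono\<close>)
  finally have "AE x in P0. J x = 0" using Jm by (simp add: nn_integral_0_iff_AE)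
  then show ?thesis
  proof eventually_elim
    case (elim x)
    then have "AE s in lborel. of_bool (0 \<le> s \<and> s < x 1) * N (\<lambda>j. x j - s) = 0"
      unfolding J_def by (subst (asm) nn_integral_0_iff_AE[OF Js])
    then show ?case by eventually_elim (auto simp: N_def split: if_splits)
  qed
qed

text \<open>
  Palm inversion expresses the mean of a function of the counts, at time \<open>t\<close> and in the limit, as a mean over a position in the
  first cell of the Palm configuration. The coupled configurations converge almost surely, so the counts
  eventually agree for almost every position. The lengths of the cells converge in mean, which
  provides the uniform integrability.
\<close>

lemma clustering_fdd_convergence:
  assumes P: "prob_space P" "sets P = sets borel" and inv: "inverts P P0" and cs: "cycle_stationary P0"
    and sm: "AE x in P0. strict_mono x" and st: "controlled_start K P0"
  shows "fdd_converges (clustering_law P) limit_law"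
  unfolding fdd_converges_def weakly_converges_def
proof (intro allI impI)
  fix k :: nat and B :: "nat \<Rightarrow> real set" and f :: "(nat \<Rightarrow> ennreal) \<Rightarrow> real"
  assume B: "\<forall>j<k. B j \<in> sets borel \<and> bounded (B j) \<and> (AE x in limit_law. num_points x (frontier (B j)) = 0)"
    and fc: "continuous_on UNIV f" and fb: "bounded (range f)"
  have pr0: "prob_space P0" and s0: "sets P0 = sets borel" and K: "0 \<le> K" using st by (simp_all add: controlled_start_def)
  interpret P0: prob_space P0 by (rule pr0)
  interpret C: prob_space palm_coins by (rule prob_space_palm_coins)
  interpret PC: pair_prob_space P0 palm_coins by unfold_locales
  let ?M = "P0 \<Otimes>\<^sub>M palm_coins"
  have f: "f \<in> borel_measurable borel" by (rule borel_measurable_continuous_onI[OF fc])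
  obtain b where b: "\<And>v. \<bar>f v\<bar> \<le> b" using fb unfolding bounded_iff by auto
  have b0: "0 \<le> b" using b[of undefined] by linarith
  define h where "h x = f (counts k B x)" for x
  \<comment> \<open>Adding the bound \<open>b\<close> makes the function nonnegative, as the inversion formula requires.\<close>
  define H where "H x = ennreal (h x + b)" for x
  have cm: "counts k B \<in> borel_measurable borel" using B by (intro counts_measurable) auto
  have hm: "h \<in> borel_measurable borel" unfolding h_def by (rule measurable_compose[OF cm f])
  then have Hm: "H \<in> borel_measurable borel" unfolding H_def by measurable
  have Hr: "H (reindex i x) = H x" for i x by (simp add: H_def h_def counts_def num_points_reindex cong: if_cong)
  have Hb: "H x \<le> ennreal (2 * b)" for x
    unfolding H_def h_def using b[of "counts k B x"] by (intro ennreal_leI) linarith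
  have Ht: "(\<lambda>s. H (\<lambda>j. y j - s)) \<in> borel_measurable borel" for y
    using measurable_Pair2[OF measurable_translated[OF Hm], of y] by simp
  define Z where "Z t w = coarsenings t (snd w) (fst w)" for t and w :: "(int \<Rightarrow> real) \<times> (nat \<Rightarrow> int \<Rightarrow> bool)"
  define Y where "Y w = limit_points (snd w)" for w :: "(int \<Rightarrow> real) \<times> (nat \<Rightarrow> int \<Rightarrow> bool)"
  have Zm: "Z t \<in> ?M \<rightarrow>\<^sub>M borel" for t unfolding Z_def by (rule pair_coins_measurable(1)[OF s0])
  have Ym: "Y \<in> ?M \<rightarrow>\<^sub>M borel" unfolding Y_def by (rule pair_coins_measurable(3)[OF s0])
  \<comment> \<open>The cell of \<open>y\<close> and the points of \<open>z\<close> are kept apart, so that they can be sent to their limits one after the other.\<close>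
  define G where "G y z = (\<integral>\<^sup>+s. of_bool (0 \<le> s \<and> s < y 1) * H (\<lambda>j. z j - s) \<partial>lborel)" for y z :: "int \<Rightarrow> real"
  have Gm: "(\<lambda>w. G (U w) (V w)) \<in> borel_measurable N"
    if U: "U \<in> N \<rightarrow>\<^sub>M borel" and V: "V \<in> N \<rightarrow>\<^sub>M borel" for U V and N :: "'z measure"
    unfolding G_def by (rule cell_integral_measurable[OF Hm U V])
  have G1: "(\<lambda>x. G x x) \<in> borel_measurable borel" by (rule Gm) simp_all
  have Gb: "G y z \<le> ennreal (2 * b) * ennreal (y 1)" for y z
  proof -
    have "G y z \<le> (\<integral>\<^sup>+s. ennreal (2 * b) * of_bool (0 \<le> s \<and> s < y 1) \<partial>lborel)"
      unfolding G_def by (intro nn_integral_mono) (auto simp: Hb)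
    also have "\<dots> = ennreal (2 * b) * (\<integral>\<^sup>+s. of_bool (0 \<le> s \<and> s < y 1) \<partial>lborel)"
      by (rule nn_integral_cmult) measurable
    finally show ?thesis by (simp only: cell_length)
  qed
  have start: "(\<integral>\<^sup>+x. H x \<partial>clustering_law P t) = (\<integral>\<^sup>+w. G (Z t w) (Z t w) \<partial>?M)" for t
  proof -
    have "inverts (clustering_law P t) ((palm_step_law ^^ t) P0)"
      using clustering_law_inverts[OF cs sm inv P(2)] by blast
    then have "(\<integral>\<^sup>+x. H x \<partial>clustering_law P t) = (\<integral>\<^sup>+x. G x x \<partial>(palm_step_law ^^ t) P0)"
      using Hm Hr unfolding inverts_def G_def by blast
    also have "\<dots> = (\<integral>\<^sup>+w. G (Z t w) (Z t w) \<partial>?M)"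
      unfolding palm_step_iter_eq_pair[OF pr0 s0] Z_def
      by (rule nn_integral_distr[OF pair_coins_measurable(1)[OF s0]]) (use G1 in simp)
    finally show ?thesis .
  qed
  have goal: "(\<integral>\<^sup>+x. H x \<partial>limit_law) = (\<integral>\<^sup>+w. G (Y w) (Y w) \<partial>?M)"
  proof -
    have "(\<integral>\<^sup>+x. H x \<partial>limit_law) = (\<integral>\<^sup>+x. G x x \<partial>limit_palm)"
      using limit_law_inverts Hm Hr unfolding inverts_def G_def by blast
    also have "\<dots> = (\<integral>\<^sup>+w. G (Y w) (Y w) \<partial>?M)"
      unfolding limit_palm_eq_pair[OF pr0 s0] Y_def
      by (rule nn_integral_distr[OF pair_coins_measurable(3)[OF s0]]) (use G1 in simp)
    finally show ?thesis .
  qed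
  have Y1: "(\<integral>\<^sup>+w. ennreal (Y w 1) \<partial>?M) = 1"
  proof -
    have "(\<lambda>r. ennreal (limit_points r 1)) \<in> borel_measurable palm_coins"
      using measurable_compose[OF limit_points_measurable measurable_coord[of 1]] by measurable
    from nn_integral_pair_snd[OF pr0 this] show ?thesis by (simp add: Y_def limit_mean_gap)
  qed
  have Ym1: "(\<lambda>w. ennreal (Y w 1)) \<in> borel_measurable ?M"
    using measurable_compose[OF Ym measurable_coord[of 1]] by measurable
  have Zd: "(\<lambda>w. ennreal \<bar>Z t w 1 - Y w 1\<bar>) \<in> borel_measurable ?M" for t
    using measurable_compose[OF Ym measurable_coord[of 1]] measurable_compose[OF Zm measurable_coord[of 1], of t] by measurable
  have bad: "AE w in ?M. AE s in lborel. 0 \<le> s \<longrightarrow> s < Y w 1 \<longrightarrow> num_points (\<lambda>j. Y w j - s) (frontier (B j)) = 0" if j: "j < k" for j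
  proof -
    have "AE x in limit_palm. AE s in lborel. 0 \<le> s \<longrightarrow> s < x 1 \<longrightarrow> num_points (\<lambda>j. x j - s) (frontier (B j)) = 0"
      by (rule inverts_AE_no_points[OF limit_law_inverts sets_limit_palm]) (use B j in \<open>auto intro: borel_closed\<close>)
    then show ?thesis
      unfolding limit_palm_eq_pair[OF pr0 s0] Y_def by (rule AE_distrD[OF pair_coins_measurable(3)[OF s0]])
  qed
  have bad': "AE w in ?M. \<forall>j\<in>{..<k}. AE s in lborel. 0 \<le> s \<longrightarrow> s < Y w 1 \<longrightarrow> num_points (\<lambda>j. Y w j - s) (frontier (B j)) = 0"
    using bad by (intro AE_ball_countable') auto
  have inner: "AE w in ?M. (\<lambda>t. G (Y w) (Z t w)) \<longlonglongrightarrow> G (Y w) (Y w)"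
    using bad' start_points_limit[OF st] AE_pair_coins[OF pr0 AE_limit_points_two_sided] AE_pair_coins[OF pr0 AE_palm_coins_occ]
      AE_pair_fst[OF prob_space_palm_coins, where Q = two_sided, OF cs[unfolded cycle_stationary_def, THEN conjunct2, THEN conjunct2, THEN conjunct1]]
  proof eventually_elim
    case (elim w)
    have lim: "(\<lambda>t. Z t w i) \<longlonglongrightarrow> Y w i" for i using elim(2) by (simp add: Z_def Y_def)
    have Yt: "two_sided (Y w)" using elim(3) by (simp add: Y_def)
    have Zt: "two_sided (Z t w)" for t unfolding Z_def by (rule coarsenings_two_sided[OF elim(5) elim(4)])
    have good: "AE s in lborel. \<forall>j\<in>{..<k}. 0 \<le> s \<longrightarrow> s < Y w 1 \<longrightarrow> num_points (\<lambda>j. Y w j - s) (frontier (B j)) = 0"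
      using elim(1) by (intro AE_ball_countable') auto
    have b1: "(\<lambda>s :: real. of_bool (0 \<le> s \<and> s < Y w 1) :: ennreal) \<in> borel_measurable borel" by measurable
    show ?case
      unfolding G_def
    proof (rule nn_integral_dominated_convergence[where w = "\<lambda>s. of_bool (0 \<le> s \<and> s < Y w 1) * ennreal (2 * b)"])
      show "(\<lambda>s. of_bool (0 \<le> s \<and> s < Y w 1) * H (\<lambda>j. Z t w j - s)) \<in> borel_measurable lborel" for t
        using borel_measurable_times_ennreal[OF b1 Ht] by simp
      show "(\<lambda>s. of_bool (0 \<le> s \<and> s < Y w 1) * H (\<lambda>j. Y w j - s)) \<in> borel_measurable lborel"
        using borel_measurable_times_ennreal[OF b1 Ht] by simp
      show "(\<lambda>s. of_bool (0 \<le> s \<and> s < Y w 1) * ennreal (2 * b)) \<in> borel_measurable lborel"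
        using borel_measurable_times_ennreal[OF b1 borel_measurable_const] by simp
      show "AE s in lborel. of_bool (0 \<le> s \<and> s < Y w 1) * H (\<lambda>j. Z t w j - s) \<le> of_bool (0 \<le> s \<and> s < Y w 1) * ennreal (2 * b)" for t
        by (intro AE_I2 mult_left_mono Hb) simp
      have "(\<integral>\<^sup>+s. of_bool (0 \<le> s \<and> s < Y w 1) * ennreal (2 * b) \<partial>lborel) = ennreal (Y w 1) * ennreal (2 * b)"
        using b1 by (subst nn_integral_multc) (simp_all add: cell_length)
      then show "(\<integral>\<^sup>+s. of_bool (0 \<le> s \<and> s < Y w 1) * ennreal (2 * b) \<partial>lborel) < \<infinity>"
        by (simp add: ennreal_mult_less_top)
      show "AE s in lborel. (\<lambda>t. of_bool (0 \<le> s \<and> s < Y w 1) * H (\<lambda>j. Z t w j - s)) \<longlonglongrightarrow> of_bool (0 \<le> s \<and> s < Y w 1) * H (\<lambda>j. Y w j - s)"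
        using good
      proof eventually_elim
        case (elim s)
        show ?case
        proof (cases "0 \<le> s \<and> s < Y w 1")
          case True
          have "eventually (\<lambda>t. counts k B (\<lambda>j. Z t w j - s) = counts k B (\<lambda>j. Y w j - s)) sequentially"
          proof (rule counts_eventually)
            show "(\<lambda>t. Z t w i - s) \<longlonglongrightarrow> Y w i - s" for i by (intro tendsto_diff lim tendsto_const)
            show "mono (\<lambda>j. Z t w j - s)" for t using two_sided_translate[OF Zt[of t], of s] by (simp add: two_sided_def)
            show "two_sided (\<lambda>j. Y w j - s)" by (rule two_sided_translate[OF Yt])
          qed (use B elim True in auto)
          then have "eventually (\<lambda>t. of_bool (0 \<le> s \<and> s < Y w 1) * H (\<lambda>j. Z t w j - s) = of_bool (0 \<le> s \<and> s < Y w 1) * H (\<lambda>j. Y w j - s)) sequentially"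
            by eventually_elim (simp add: H_def h_def)
          then show ?thesis by (rule tendsto_eventually)
        qed auto
      qed
    qed
  qed
  \<comment> \<open>First the points converge while the cell is that of the limit.\<close>
  have V: "(\<lambda>t. \<integral>\<^sup>+w. G (Y w) (Z t w) \<partial>?M) \<longlonglongrightarrow> (\<integral>\<^sup>+w. G (Y w) (Y w) \<partial>?M)"
  proof (rule nn_integral_dominated_convergence[where w = "\<lambda>w. ennreal (2 * b) * ennreal (Y w 1)"])
    show "(\<lambda>w. G (Y w) (Z t w)) \<in> borel_measurable ?M" for t by (rule Gm[OF Ym Zm])
    show "(\<lambda>w. G (Y w) (Y w)) \<in> borel_measurable ?M" by (rule Gm[OF Ym Ym])
    show "(\<lambda>w. ennreal (2 * b) * ennreal (Y w 1)) \<in> borel_measurable ?M" using Ym1 by measurable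
    have "(\<integral>\<^sup>+w. ennreal (2 * b) * ennreal (Y w 1) \<partial>?M) = ennreal (2 * b)"
      using nn_integral_cmult[OF Ym1, of "ennreal (2 * b)"] Y1 by simp
    then show "(\<integral>\<^sup>+w. ennreal (2 * b) * ennreal (Y w 1) \<partial>?M) < \<infinity>" by simp
  qed (use inner Gb in auto)
  have fin: "(\<integral>\<^sup>+w. G (Y w) (Y w) \<partial>?M) \<noteq> \<infinity>"
  proof -
    have "(\<integral>\<^sup>+w. G (Y w) (Y w) \<partial>?M) \<le> (\<integral>\<^sup>+w. ennreal (2 * b) * ennreal (Y w 1) \<partial>?M)" by (intro nn_integral_mono Gb)
    also have "\<dots> = ennreal (2 * b)" using nn_integral_cmult[OF Ym1, of "ennreal (2 * b)"] Y1 by simp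
    finally show ?thesis by (auto simp: top_unique)
  qed
  \<comment> \<open>Exchanging the cell of the limit for the cell at time \<open>t\<close> costs at most \<open>e t\<close>.\<close>
  define e where "e t = ennreal (2 * b) * ennreal ((K + 49) * (7 / 8) ^ t)" for t
  have e0: "e \<longlonglongrightarrow> 0"
  proof -
    have "(\<lambda>t. ennreal (2 * b * ((K + 49) * (7 / 8) ^ t))) \<longlonglongrightarrow> ennreal (2 * b * ((K + 49) * 0))"
      by (intro tendsto_ennrealI tendsto_mult tendsto_const LIMSEQ_realpow_zero) auto
    moreover have "ennreal (2 * b * ((K + 49) * (7 / 8) ^ t)) = e t" for t
      unfolding e_def using b0 K by (intro ennreal_mult) auto
    ultimately show ?thesis by simp
  qed
  have dist: "ennreal (2 * b) * (\<integral>\<^sup>+w. ennreal \<bar>Z t w 1 - Y w 1\<bar> \<partial>?M) \<le> e t" for t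
    unfolding e_def Z_def Y_def by (intro mult_left_mono start_first_gap_rate[OF st]) simp
  have cmp: "G x z \<le> G y z + ennreal (2 * b) * ennreal \<bar>x 1 - y 1\<bar>" for x y z
    unfolding G_def by (rule cell_compare[OF Hb Ht])
  have upper: "(\<integral>\<^sup>+w. G (Z t w) (Z t w) \<partial>?M) \<le> (\<integral>\<^sup>+w. G (Y w) (Z t w) \<partial>?M) + e t" for t
  proof -
    have "(\<integral>\<^sup>+w. G (Z t w) (Z t w) \<partial>?M) \<le> (\<integral>\<^sup>+w. G (Y w) (Z t w) + ennreal (2 * b) * ennreal \<bar>Z t w 1 - Y w 1\<bar> \<partial>?M)"
      by (intro nn_integral_mono cmp)
    also have "\<dots> = (\<integral>\<^sup>+w. G (Y w) (Z t w) \<partial>?M) + ennreal (2 * b) * (\<integral>\<^sup>+w. ennreal \<bar>Z t w 1 - Y w 1\<bar> \<partial>?M)"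
      using Zd[of t] Gm[OF Ym Zm, of t] by (subst nn_integral_add) (auto simp: nn_integral_cmult)
    also have "\<dots> \<le> (\<integral>\<^sup>+w. G (Y w) (Z t w) \<partial>?M) + e t" by (intro add_left_mono dist)
    finally show ?thesis .
  qed
  have lower: "(\<integral>\<^sup>+w. G (Y w) (Z t w) \<partial>?M) \<le> (\<integral>\<^sup>+w. G (Z t w) (Z t w) \<partial>?M) + e t" for t
  proof -
    have "(\<integral>\<^sup>+w. G (Y w) (Z t w) \<partial>?M) \<le> (\<integral>\<^sup>+w. G (Z t w) (Z t w) + ennreal (2 * b) * ennreal \<bar>Z t w 1 - Y w 1\<bar> \<partial>?M)"
      using cmp[of "Y _" "Z t _" "Z t _"] by (intro nn_integral_mono) (simp add: abs_minus_commute)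
    also have "\<dots> = (\<integral>\<^sup>+w. G (Z t w) (Z t w) \<partial>?M) + ennreal (2 * b) * (\<integral>\<^sup>+w. ennreal \<bar>Z t w 1 - Y w 1\<bar> \<partial>?M)"
      using Zd[of t] Gm[OF Zm Zm, of t t] by (subst nn_integral_add) (auto simp: nn_integral_cmult)
    also have "\<dots> \<le> (\<integral>\<^sup>+w. G (Z t w) (Z t w) \<partial>?M) + e t" by (intro add_left_mono dist)
    finally show ?thesis .
  qed
  have conv: "(\<lambda>t. \<integral>\<^sup>+x. H x \<partial>clustering_law P t) \<longlonglongrightarrow> (\<integral>\<^sup>+x. H x \<partial>limit_law)"
    unfolding start goal by (rule tendsto_ennreal_perturb[OF V fin e0 _ upper lower]) (simp add: e_def ennreal_mult_eq_top_iff)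
  have real: "(\<integral>\<^sup>+x. H x \<partial>R) = ennreal ((\<integral>x. h x \<partial>R) + b) \<and> 0 \<le> (\<integral>x. h x \<partial>R) + b"
    if "prob_space R" and R: "sets R = sets borel" for R
  proof -
    interpret R: prob_space R by fact
    have hR: "h \<in> borel_measurable R" using hm by (simp add: measurable_cong_sets[OF R refl])
    have ih: "integrable R h" by (rule R.integrable_const_bound[where B = b]) (use b hR in \<open>auto simp: h_def\<close>)
    have pos: "0 \<le> h x + b" for x using b[of "counts k B x"] unfolding h_def by linarith
    have "(\<integral>x. h x + b \<partial>R) = (\<integral>x. h x \<partial>R) + b" using ih by (simp add: R.prob_space)
    moreover have "(\<integral>\<^sup>+x. H x \<partial>R) = ennreal (\<integral>x. h x + b \<partial>R)"
      unfolding H_def using ih pos by (intro nn_integral_eq_integral) auto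
    moreover have "0 \<le> (\<integral>x. h x + b \<partial>R)" using pos by (intro integral_nonneg_AE) auto
    ultimately show ?thesis by simp
  qed
  note rc = real[OF prob_space_clustering_law[OF P] sets_clustering_law]
  note rl = real[OF prob_space_limit_law sets_limit_law]
  have "(\<lambda>t. (\<integral>x. h x \<partial>clustering_law P t) + b) \<longlonglongrightarrow> (\<integral>x. h x \<partial>limit_law) + b"
    using conv rc rl by (subst (asm) (1 2) conjunct1[OF rc] conjunct1[OF rl]) (auto simp: tendsto_ennreal_iff)
  from tendsto_diff[OF this tendsto_const[of b]]
  have "(\<lambda>t. \<integral>x. h x \<partial>clustering_law P t) \<longlonglongrightarrow> (\<integral>x. h x \<partial>limit_law)" by simp
  moreover have "(\<integral>v. f v \<partial>distr R borel (counts k B)) = (\<integral>x. h x \<partial>R)" if "sets R = sets borel" for R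
    unfolding h_def by (rule integral_distr) (use cm f in \<open>simp_all add: measurable_cong_sets[OF that refl]\<close>)
  ultimately show "(\<lambda>t. \<integral>v. f v \<partial>distr (clustering_law P t) borel (counts k B)) \<longlonglongrightarrow> (\<integral>v. f v \<partial>distr limit_law borel (counts k B))"
    by simp
qed

section \<open>The exponential tail and renewal starts\<close>

text \<open>
  Fatou's lemma and the uniform bound for the iterates of the lattice at the largest admissible
  exponent \<open>1 / 18\<close>, where \<open>1 + 18 l = 2\<close>.
\<close>

lemma limit_exp_moment: "(\<integral>\<^sup>+r. ennreal (exp (limit_points r 1 / 18)) \<partial>palm_coins) \<le> ennreal (exp (1 / 9))"
proof -
  have mc: "(\<lambda>r. ennreal (exp (coarsenings t r real_of_int 1 / 18))) \<in> borel_measurable palm_coins" for t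
    using measurable_compose[OF coarsenings_measurable measurable_coord[of 1]] by measurable
  have "(\<integral>\<^sup>+r. ennreal (exp (limit_points r 1 / 18)) \<partial>palm_coins) =
    (\<integral>\<^sup>+r. liminf (\<lambda>t. ennreal (exp (coarsenings t r real_of_int 1 / 18))) \<partial>palm_coins)"
  proof (rule nn_integral_cong_AE, use AE_limit_points in eventually_elim)
    fix r assume elim: "\<forall>k. (\<lambda>t. coarsenings t r real_of_int k) \<longlonglongrightarrow> limit_points r k"
    have "(\<lambda>t. ennreal (exp (coarsenings t r real_of_int 1 / 18))) \<longlonglongrightarrow> ennreal (exp (limit_points r 1 / 18))"
      using elim by (intro tendsto_ennrealI tendsto_exp tendsto_divide tendsto_const) auto
    then show "ennreal (exp (limit_points r 1 / 18)) = liminf (\<lambda>t. ennreal (exp (coarsenings t r real_of_int 1 / 18)))"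
      by (intro lim_imp_Liminf[symmetric]) auto
  qed
  also have "\<dots> \<le> liminf (\<lambda>t. \<integral>\<^sup>+r. ennreal (exp (coarsenings t r real_of_int 1 / 18)) \<partial>palm_coins)"
    by (rule nn_integral_liminf[OF mc])
  also have "\<dots> \<le> liminf (\<lambda>t. ennreal (exp (1 / 9)))"
  proof (rule Liminf_mono, rule always_eventually, rule allI)
    fix t
    show "(\<integral>\<^sup>+r. ennreal (exp (coarsenings t r real_of_int 1 / 18)) \<partial>palm_coins) \<le> ennreal (exp (1 / 9))"
      using lattice_exp_bound[OF unit_weights_1, of "1 / 18" 0 1 t] by (simp add: weighted_gaps_1 weight_1 coarsenings_0)
  qed
  also have "\<dots> = ennreal (exp (1 / 9))" by (rule Liminf_const) simp
  finally show ?thesis .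
qed

lemma limit_exp_tail: "exp_tail (gap_law limit_law)"
  unfolding exp_tail_def
proof (rule exI[of _ "exp (1 / 9)"], intro conjI, simp, rule exI[of _ "1 / 18"], intro conjI allI impI)
  interpret C: prob_space palm_coins by (rule prob_space_palm_coins)
  fix x :: real
  have pm: "palm limit_law = limit_palm"
    by (rule palm_eq[OF limit_palm_cycle_stationary limit_law_inverts]) simp
  have g: "(\<lambda>r. gap 0 (limit_points r)) \<in> borel_measurable palm_coins" by (rule measurable_compose[OF limit_points_measurable gap_measurable])
  have "gap_law limit_law = distr palm_coins borel (\<lambda>r. gap 0 (limit_points r))"
    unfolding gap_law_def pm unfolding limit_palm_def
    by (subst distr_distr) (auto simp: limit_points_measurable comp_def)
  then have "emeasure (gap_law limit_law) {x<..} = (\<integral>\<^sup>+r. indicator {x<..} (gap 0 (limit_points r)) \<partial>palm_coins)"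
    using g by (simp add: nn_integral_distr flip: nn_integral_indicator)
  \<comment> \<open>Markov's inequality for the exponential.\<close>
  also have "\<dots> \<le> (\<integral>\<^sup>+r. ennreal (exp (- x / 18)) * ennreal (exp (limit_points r 1 / 18)) \<partial>palm_coins)"
  proof (rule nn_integral_mono_AE, use AE_limit_points_two_sided in eventually_elim)
    case (elim r)
    have "1 \<le> exp (- x / 18 + limit_points r 1 / 18)" if "x < limit_points r 1" using that by simp
    then show ?case using elim
      by (auto simp: indicator_def gap_def exp_add[symmetric] simp flip: ennreal_mult ennreal_1 intro!: ennreal_leI)
  qed
  also have "\<dots> = ennreal (exp (- x / 18)) * (\<integral>\<^sup>+r. ennreal (exp (limit_points r 1 / 18)) \<partial>palm_coins)"
  proof (rule nn_integral_cmult)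
    show "(\<lambda>r. ennreal (exp (limit_points r 1 / 18))) \<in> borel_measurable palm_coins"
      using measurable_compose[OF limit_points_measurable measurable_coord[of 1]] by measurable
  qed
  also have "\<dots> \<le> ennreal (exp (- x / 18)) * ennreal (exp (1 / 9))" by (intro mult_left_mono limit_exp_moment) simp
  also have "\<dots> = ennreal (exp (1 / 9) * exp (- (1 / 18) * x))" by (simp add: ennreal_mult[symmetric] mult.commute)
  finally have "emeasure (gap_law limit_law) {x<..} \<le> ennreal (exp (1 / 9) * exp (- (1 / 18) * x))" .
  then show "measure (gap_law limit_law) {x<..} \<le> exp (1 / 9) * exp (- (1 / 18) * x)"
    unfolding measure_def by (intro enn2real_leI) auto
qed simp_all

text \<open>
  Independent gaps are uncorrelated and weights between \<open>0\<close> and \<open>1\<close> dominate their squares, so the constant is the variance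
  of the gap distribution. The mean gap is one by Palm inversion.
\<close>

lemma renewal_controlled_start:
  assumes rn: "renewal P" and inv: "inverts P (palm P)" and cs: "cycle_stationary (palm P)"
    and sq: "integrable (gap_law P) (\<lambda>g. g\<^sup>2)"
  shows "\<exists>K. controlled_start K (palm P)"
proof -
  interpret D: prob_space "palm P" using rn by (simp add: renewal_def)
  interpret P: prob_space P using rn by (simp add: renewal_def simple_process_def point_process_def)
  have gm [measurable]: "gap k \<in> borel_measurable (palm P)" for k
    using gap_measurable by (simp add: measurable_cong_sets[OF sets_palm refl])
  have law: "distr (palm P) borel (gap k) = gap_law P" for k using rn by (simp add: renewal_def)
  have sq': "integrable (palm P) (\<lambda>x. (gap k x)\<^sup>2)" for k
    using sq unfolding law[of k, symmetric] by (subst (asm) integrable_distr_eq) auto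
  have i1: "integrable (palm P) (gap k)" for k
    by (rule D.square_integrable_imp_integrable[OF gm sq'])
  have mean0: "(\<integral>x. gap 0 x \<partial>palm P) = 1"
  proof -
    have ae: "AE x in palm P. 0 \<le> gap 0 x \<and> gap 0 x = x 1"
      using cycle_stationary_zero[OF cs] cs[unfolded cycle_stationary_def, THEN conjunct2, THEN conjunct2, THEN conjunct1]
    proof eventually_elim
      case (elim x)
      have "x 0 \<le> x 1" using elim monoD[of x 0 1] by (simp add: two_sided_def)
      then show ?case using elim by (simp add: gap_def)
    qed
    have "(\<integral>\<^sup>+x. ennreal (gap 0 x) \<partial>palm P) = (\<integral>\<^sup>+x. ennreal (x 1) \<partial>palm P)"
      by (rule nn_integral_cong_AE) (use ae in eventually_elim, simp)
    also have "\<dots> = 1" using inverts_mass[OF inv] P.emeasure_space_1 by simp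
    finally have "ennreal (\<integral>x. gap 0 x \<partial>palm P) = 1"
      using ae i1[of 0] by (subst (asm) nn_integral_eq_integral) auto
    then show ?thesis by (simp add: ennreal_eq_1)
  qed
  have mean: "(\<integral>x. gap k x \<partial>palm P) = 1" for k
  proof -
    have "(\<integral>x. gap k x \<partial>palm P) = (\<integral>g. g \<partial>gap_law P)" for k
      unfolding law[of k, symmetric] by (rule integral_distr[symmetric]) auto
    then show ?thesis using mean0 by simp
  qed
  define X where "X k x = gap k x - 1" for k x
  have Xm [measurable]: "X k \<in> borel_measurable (palm P)" for k unfolding X_def by measurable
  have iX: "integrable (palm P) (X k)" for k unfolding X_def using i1 by simp
  have mX: "(\<integral>x. X k x \<partial>palm P) = 0" for k unfolding X_def using i1 mean by (simp add: D.prob_space)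
  have iX2: "integrable (palm P) (\<lambda>x. X k x * X k x)" for k
  proof -
    have "X k x * X k x = (gap k x)\<^sup>2 - 2 * gap k x + 1" for x by (simp add: X_def power2_eq_square algebra_simps)
    then show ?thesis using sq'[of k] i1[of k] by simp
  qed
  define K where "K = (\<integral>x. X 0 x * X 0 x \<partial>palm P)"
  have K: "0 \<le> K" unfolding K_def by (intro integral_nonneg_AE) auto
  have vX: "(\<integral>x. X k x * X k x \<partial>palm P) = K" for k
  proof -
    have "(\<integral>x. X k x * X k x \<partial>palm P) = (\<integral>g. (g - 1) * (g - 1) \<partial>gap_law P)" for k
      unfolding law[of k, symmetric] X_def by (rule integral_distr[symmetric]) auto
    then show ?thesis unfolding K_def by simp
  qed
  have ind: "D.indep_vars (\<lambda>_. borel) X UNIV"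
  proof -
    have "D.indep_vars (\<lambda>_. borel) gap UNIV" using rn by (simp add: renewal_def)
    from D.indep_vars_compose2[OF this, of "\<lambda>_ g. g - 1" "\<lambda>_. borel"] show ?thesis by (simp add: X_def[abs_def])
  qed
  have off: "integrable (palm P) (\<lambda>x. X k x * X l x) \<and> (\<integral>x. X k x * X l x \<partial>palm P) = 0" if "k \<noteq> l" for k l
  proof -
    have i: "D.indep_vars (\<lambda>_. borel) X {k, l}" by (rule D.indep_vars_subset[OF ind]) simp
    have "(\<Prod>i\<in>{k, l}. X i x) = X k x * X l x" for x using that by simp
    moreover have "(\<Prod>i\<in>{k, l}. \<integral>x. X i x \<partial>palm P) = 0" using mX that by simp
    ultimately show ?thesis
      using D.indep_vars_integrable[OF _ i] D.indep_vars_lebesgue_integral[OF _ i] iX by simp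
  qed
  have prod: "integrable (palm P) (\<lambda>x. X k x * X l x)" "(\<integral>x. X k x * X l x \<partial>palm P) = (if k = l then K else 0)" for k l
    using off[of k l] iX2[of k] vX[of k] by (cases "k = l"; simp)+
  have "controlled_start K (palm P)"
    unfolding controlled_start_def
  proof (intro conjI allI impI)
    show "prob_space (palm P)" by (rule D.prob_space_axioms)
    show "sets (palm P) = sets borel" by (rule sets_palm)
    show "0 \<le> K" by (rule K)
    show "AE x in palm P. x 0 = 0" by (rule cycle_stationary_zero[OF cs])
    fix m n and w :: "int \<Rightarrow> real" assume w: "unit_weights w"
    let ?J = "{m..<m + int n}"
    have expand: "(weighted_gaps m n w x - weight m n w)\<^sup>2 = (\<Sum>k\<in>?J. \<Sum>l\<in>?J. w k * w l * (X k x * X l x))" for x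
    proof -
      have "weighted_gaps m n w x - weight m n w = (\<Sum>k\<in>?J. w k * X k x)"
        by (simp add: weighted_gaps_def weight_def X_def sum_subtractf[symmetric] algebra_simps)
      then show ?thesis by (simp add: power2_eq_square sum_product algebra_simps)
    qed
    have int: "integrable (palm P) (\<lambda>x. (weighted_gaps m n w x - weight m n w)\<^sup>2)"
      unfolding expand by (intro Bochner_Integration.integrable_sum integrable_mult_right prod)
    have "(\<integral>x. (weighted_gaps m n w x - weight m n w)\<^sup>2 \<partial>palm P) = (\<Sum>k\<in>?J. \<Sum>l\<in>?J. w k * w l * (if k = l then K else 0))"
      unfolding expand
      by (subst Bochner_Integration.integral_sum, intro Bochner_Integration.integrable_sum integrable_mult_right prod,
          intro sum.cong refl, subst Bochner_Integration.integral_sum, intro integrable_mult_right prod,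
          intro sum.cong refl, simp only: integral_mult_right_zero prod(2))
    also have "\<dots> = K * (\<Sum>k\<in>?J. (w k)\<^sup>2)"
      by (simp add: if_distrib[of "\<lambda>v. _ * v"] sum.delta sum_distrib_left power2_eq_square mult.commute cong: if_cong)
    also have "\<dots> \<le> K * weight m n w" by (intro mult_left_mono sum_squares_le_weight w K)
    finally have "(\<integral>x. (weighted_gaps m n w x - weight m n w)\<^sup>2 \<partial>palm P) \<le> K * weight m n w" .
    then show "(\<integral>\<^sup>+x. ennreal ((weighted_gaps m n w x - weight m n w)\<^sup>2) \<partial>palm P) \<le> ennreal (K * weight m n w)"
      by (subst nn_integral_eq_integral[OF int]) (auto intro: ennreal_leI)
  qed
  then show ?thesis ..
qed

theorem theorem3p1:
  shows "\<exists>Q :: (int \<Rightarrow> real) measure.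
    point_process Q \<and> stationary Q \<and> has_intensity Q 1 \<and>
    (\<forall>P. renewal P \<longrightarrow> stationary P \<longrightarrow> has_intensity P 1 \<longrightarrow>
         integrable (gap_law P) (\<lambda>g. g\<^sup>2) \<longrightarrow>
         fdd_converges (clustering_law P) Q \<and>
         weakly_converges (\<lambda>t. palm (clustering_law P t)) (palm Q)) \<and>
    exp_tail (gap_law Q)"
proof (intro exI[of _ limit_law] conjI allI impI)
  note cl = limit_palm_cycle_stationary and il = limit_law_inverts
  show "point_process limit_law" by (rule limit_law_point_process)
  show "stationary limit_law" by (rule inverts_stationary[OF cl il sets_limit_law])
  show "has_intensity limit_law 1" by (rule inverts_has_intensity[OF cl il])
  show "exp_tail (gap_law limit_law)" by (rule limit_exp_tail)
  fix P :: "(int \<Rightarrow> real) measure"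
  assume rn: "renewal P" and st: "stationary P" and hi: "has_intensity P 1"
    and sq: "integrable (gap_law P) (\<lambda>g. g\<^sup>2)"
  have pp: "point_process P" and sp: "simple_process P" using rn by (simp_all add: renewal_def simple_process_def)
  have pr: "prob_space P" and s: "sets P = sets borel" using pp by (simp_all add: point_process_def)
  have ts: "AE x in P. two_sided x" by (rule stationary_two_sided[OF pp st hi])
  have inv: "inverts P (palm P)" by (rule palm_inverts[OF pr s st ts hi])
  have cs: "cycle_stationary (palm P)" by (rule renewal_cycle_stationary[OF rn ts])
  have sm: "AE x in palm P. strict_mono x" by (rule palm_strict_mono[OF sp])
  obtain K where K: "controlled_start K (palm P)" using renewal_controlled_start[OF rn inv cs sq] by blast
  show "fdd_converges (clustering_law P) limit_law"
    by (rule clustering_fdd_convergence[OF pr s inv cs sm K])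
  have "palm (clustering_law P t) = (palm_step_law ^^ t) (palm P)" for t
    using clustering_law_inverts[OF cs sm inv s, of t] by (intro palm_eq) auto
  moreover have "palm limit_law = limit_palm" by (rule palm_eq[OF cl il sets_limit_law])
  ultimately show "weakly_converges (\<lambda>t. palm (clustering_law P t)) (palm limit_law)"
    using palm_weak_convergence[OF K] by simp
qed

end
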